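(* Let $G=W(H_4)$, $S=\mathbb C[x,y,z,w]$, $T=S^G=\mathbb C[f_2,f_{12},f_{20},f_{30}]$, $I=(x,y,z)\subset S$, and let $$R=\bigoplus_{m\ge 0}\frac{T\cap I^m}{T\cap I^{m+1}},$$ bigraded so that $R_{d,m}=(T_d\cap I^m)/(T_d\cap I^{m+1})$ is the piece of bidegree $(d,m)$ (here $T_d$ is the space of elements of $T$ of degree $d$). Then: (1) The $\mathbb C$-algebra $R$ is finitely generated; it is generated by the classes $\overline f\in R_{d,m}$ of the following $12$ elements $f\in T_d\cap I^m$: - $(d,m)=(2,0)$: $f_2$ - $(12,2)$: $f_{12}$ - $(20,4)$: $f_{20}$ - $(24,6)$: $f_{12}^2-f_2^2f_{20}$ - $(30,6)$: $f_{30}$ - $(32,8)$: $f_{12}f_{20}-f_2f_{30}$ - $(36,10)$: $f_{12}^3-3f_2^2f_{12}f_{20}+2f_2^3f_{30}$ - $(42,10)$: $f_2f_{20}^2-f_{12}f_{30}$ - $(44,12)$: $f_{12}^2f_{20}+f_2^2f_{20}^2-2f_2f_{12}f_{30}$ - $(54,14)$: $2f_2f_{12}f_{20}^2-f_{12}^2f_{30}-f_2^2f_{20}f_{30}$ - $(60,16)$: $f_{20}^3-f_{30}^2$ - $(66,18)$: $3f_2f_{12}^2f_{20}^2-f_2^3f_{20}^3-f_{12}^3f_{30}-3f_2^2f_{12}f_{20}f_{30}+2f_2^3f_{30}^2$ (2) Among these generators, the one of bidegree $(36,10)$ has the smallest ratio $d/m$ (with $d/m=\infty$ when $m=0$). Therefore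 the Waldschmidt constant of the set $\mathcal H_4\subset\mathbb P^3$ of $60$ points is $$\widehat\alpha(\mathcal H_4)=\frac{36}{10}.$$ (3) The bigraded Hilbert series $HS(u,v)=\sum_{d,m}\dim_{\mathbb C}(R_{d,m})\,u^dv^m$ of $R$ equals $N(u,v)/D(u,v)$, where $$\begin{aligned}N(u,v)={}&1+u^{12}v^2+u^{24}v^6+u^{30}v^6+u^{32}v^8-u^{32}v^6+u^{42}v^{10}-u^{44}v^{10}+u^{54}v^{14}-u^{56}v^{14}\\&+u^{66}v^{18}-u^{66}v^{16}-u^{68}v^{18}-u^{74}v^{18}-u^{86}v^{22}-u^{98}v^{24},\\ D(u,v)={}&(1-u^{60}v^{16})(1-u^{44}v^{12})(1-u^{36}v^{10})(1-u^{20}v^4)(1-u^2).\end{aligned}$$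
   Context: Root system and group: let $\varphi=(1+\sqrt5)/2$. $H_4\subset\mathbb R^4$ is the set of $120$ vectors consisting of: the permutations of $(\pm1,0,0,0)$; the vectors $\frac12(\pm1,\pm1,\pm1,\pm1)$ with independent signs; and the even permutations of $\frac12(\pm\varphi,\pm1,\pm\varphi^{-1},0)$ with independent signs. $G=W(H_4)\subset GL(\mathbb R^4)$ is the group of order $14400$ generated by the reflections in the hyperplanes orthogonal to these vectors. $\mathcal H_4\subset\mathbb P^3$ is the set of $60$ points obtained by projectivizing $H_4$; it is a single $G$-orbit and contains the point $(0:0:0:1)$, whose homogeneous ideal is $I=(x,y,z)$. $G$ acts on $S=\mathbb C[x,y,z,w]$ by linear changes of variables. Invariants: the ring $T=S^G$ of invariants is a polynomial ring on four algebraically independent homogeneous generators $f_2,f_{12},f_{20},f_{30}$ of degrees $2,12,20,30$, chosen as follows. Write $\Delta=\partial_x^2+\partial_y^2+\partial_z^2+\partial_w^2$. - $f_2=x^2+y^2+z^2+w^2$. - $g_{12}$ is the scalar multiple of $\sum_{g\in G}g(x^{12})$ in which the coefficient of $x^{12}$ is $1$, and $f_{12}=\frac{19}{4}(f_2^6-g_{12})$. (It is the invariant of degree $12$ vanishing at $(0,0,0,1)$, scaled so that the coefficient of $x^2w^{10}$ is $1$.) - $g_{20}=\frac1{120}\Delta^2(f_{12}^2)$ and $f_{20}=\frac{5}{968}(-3f_2^{10}-224f_2^4f_{12}+3g_{20})$. (It is the invariant of degree $20$ vanishing to order $4$ at $(0,0,0,1)$, scaled so that the coefficient of $x^4w^{16}$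 is $1$.) - $g_{30}=\frac1{42}\Delta(f_{12}f_{20})$ and $f_{30}=\frac1{40}(-15f_2^5f_{20}-6f_2^3f_{12}^2+21g_{30})$. (It vanishes to order $6$ at $(0,0,0,1)$.) Waldschmidt constant: for a finite set $Z\subset\mathbb P^3$ with homogeneous ideal $J=\bigcap_{P\in Z}I(P)\subset S$, let $J^{(m)}=\bigcap_{P\in Z}I(P)^m$ and let $\alpha(J^{(m)})$ be the least degree of a nonzero homogeneous polynomial in $J^{(m)}$; then $\widehat\alpha(Z)=\inf_{m\ge1}\alpha(J^{(m)})/m$. *)

theory Defs
  imports
    "HOL-Analysis.Analysis"
    "HOL-Library.Poly_Mapping"
    "HOL-Library.Set_Algebras"
    "HOL-Computational_Algebra.Formal_Power_Series"
    "HOL-Algebra.Generated_Groups"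
    "HOL-Algebra.Module"
    "HOL-Algebra.Embedded_Algebras"
begin

section \<open>Polynomials\<close>

text \<open>
  The ring \<open>S = \<complex>[x, y, z, w]\<close> is the monoid algebra of the additive monoid of exponent vectors.
  The variables \<open>x, y, z, w\<close> have the indices \<open>1, 2, 3, 4\<close> of the four-element type \<open>4\<close>
  (in which the numeral \<open>4\<close> is the same element as \<open>0\<close>).
\<close>

type_synonym mon4 = "4 \<Rightarrow>\<^sub>0 nat"
type_synonym poly4 = "mon4 \<Rightarrow>\<^sub>0 complex"

definition Const :: "complex \<Rightarrow> poly4" where
  "Const c = Poly_Mapping.single 0 c"

definition Var :: "4 \<Rightarrow> poly4" where
  "Var i = Poly_Mapping.single (Poly_Mapping.single i 1) 1"

definition mdeg :: "mon4 \<Rightarrow> nat" where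
  "mdeg m = (\<Sum>i\<in>UNIV. Poly_Mapping.lookup m i)"

definition homogeneous :: "nat \<Rightarrow> poly4 \<Rightarrow> bool" where
  "homogeneous d f \<longleftrightarrow> (\<forall>m\<in>Poly_Mapping.keys f. mdeg m = d)"

definition eval_at :: "poly4 \<Rightarrow> complex ^ 4 \<Rightarrow> complex" where
  "eval_at f a = (\<Sum>m\<in>Poly_Mapping.keys f.
     Poly_Mapping.lookup f m * (\<Prod>i\<in>UNIV. (a $ i) ^ Poly_Mapping.lookup m i))"

definition subst :: "(4 \<Rightarrow> poly4) \<Rightarrow> poly4 \<Rightarrow> poly4" where
  "subst h f = (\<Sum>m\<in>Poly_Mapping.keys f.
     Const (Poly_Mapping.lookup f m) * (\<Prod>i\<in>UNIV. h i ^ Poly_Mapping.lookup m i))"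

text \<open>In \<open>partial\<close>, the truncated exponent \<open>0 - 1 = 0\<close> only occurs with the coefficient \<open>0\<close>.\<close>

definition partial :: "4 \<Rightarrow> poly4 \<Rightarrow> poly4" where
  "partial i f = (\<Sum>m\<in>Poly_Mapping.keys f.
     Poly_Mapping.single (m - Poly_Mapping.single i 1)
       (of_nat (Poly_Mapping.lookup m i) * Poly_Mapping.lookup f m))"

definition laplacian :: "poly4 \<Rightarrow> poly4" where
  "laplacian f = (\<Sum>i\<in>UNIV. partial i (partial i f))"

text \<open>An ideal generated by a set is its span in the ring as a module over itself.\<close>

definition ideal_gen :: "poly4 set \<Rightarrow> poly4 set" where
  "ideal_gen X = module.span ((*) :: poly4 \<Rightarrow> poly4 \<Rightarrow> poly4) X"

text \<open>
  Here \<open>J ^ m\<close> is the elementwise power of sets from \<open>Set_Algebras\<close>,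
  i.e. the set of all products of \<open>m\<close> elements of \<open>J\<close> (so \<open>J ^ 0 = {1}\<close>).
\<close>

definition ideal_power :: "poly4 set \<Rightarrow> nat \<Rightarrow> poly4 set" where
  "ideal_power J m = ideal_gen (J ^ m)"


section \<open>The root system and the reflection group\<close>

definition golden :: real where
  "golden = (1 + sqrt 5) / 2"

definition H4 :: "(real ^ 4) set" where
  "H4 =
     {s *\<^sub>R axis i 1 | s i. s \<in> {1, -1}} \<union>
     {v. \<forall>i. v $ i \<in> {1/2, -1/2}} \<union>
     {\<chi> i. s i * (vector [golden / 2, 1 / 2, inverse golden / 2, 0] :: real ^ 4) $ p i | s p.
        (\<forall>i. s i \<in> {1, -1}) \<and> p permutes UNIV \<and> evenperm p}"

definition reflection :: "real ^ 4 \<Rightarrow> real ^ 4 \<Rightarrow> real ^ 4" where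
  "reflection r v = v - (2 * (v \<bullet> r) / (r \<bullet> r)) *\<^sub>R r"

definition GL4 :: "(real ^ 4 \<Rightarrow> real ^ 4) monoid" where
  "GL4 = \<lparr>carrier = {g. linear g \<and> bij g}, mult = (\<circ>), one = id\<rparr>"

definition W_H4 :: "(real ^ 4 \<Rightarrow> real ^ 4) set" where
  "W_H4 = generate GL4 (reflection ` H4)"

text \<open>
  The variables are identified with the standard basis of \<open>\<real>\<^sup>4\<close> and \<open>g\<close> acts by
  \<open>x\<^sub>i \<mapsto> \<Sum>\<^sub>j g(e\<^sub>i)\<^sub>j x\<^sub>j\<close>. For orthogonal \<open>g\<close> this is \<open>f \<mapsto> f \<circ> g\<inverse>\<close>.
\<close>

definition act :: "(real ^ 4 \<Rightarrow> real ^ 4) \<Rightarrow> poly4 \<Rightarrow> poly4" where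
  "act g = subst (\<lambda>i. \<Sum>j\<in>UNIV. Const (complex_of_real (g (axis i 1) $ j)) * Var j)"

definition T_inv :: "poly4 set" where
  "T_inv = {f. \<forall>g\<in>W_H4. act g f = f}"

definition T_deg :: "nat \<Rightarrow> poly4 set" where
  "T_deg d = {f \<in> T_inv. homogeneous d f}"


section \<open>The basic invariants\<close>

definition f2 :: poly4 where
  "f2 = Var 1 ^ 2 + Var 2 ^ 2 + Var 3 ^ 2 + Var 4 ^ 2"

definition orbit_sum12 :: poly4 where
  "orbit_sum12 = (\<Sum>g\<in>W_H4. act g (Var 1 ^ 12))"

definition g12 :: poly4 where
  "g12 = Const (1 / Poly_Mapping.lookup orbit_sum12 (Poly_Mapping.single 1 12)) * orbit_sum12"

definition f12 :: poly4 where
  "f12 = Const (19 / 4) * (f2 ^ 6 - g12)"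

definition g20 :: poly4 where
  "g20 = Const (1 / 120) * laplacian (laplacian (f12 ^ 2))"

definition f20 :: poly4 where
  "f20 = Const (5 / 968) * (- 3 * f2 ^ 10 - 224 * f2 ^ 4 * f12 + 3 * g20)"

definition g30 :: poly4 where
  "g30 = Const (1 / 42) * laplacian (f12 * f20)"

definition f30 :: poly4 where
  "f30 = Const (1 / 40) * (- 15 * f2 ^ 5 * f20 - 6 * f2 ^ 3 * f12 ^ 2 + 21 * g30)"


section \<open>Associated graded algebras\<close>

definition complex_ring :: "complex ring" where
  "complex_ring = \<lparr>carrier = UNIV, mult = (*), one = 1, zero = 0, add = (+)\<rparr>"

text \<open>
  For a decreasing multiplicative filtration \<open>A 0 \<supseteq> A 1 \<supseteq> \<dots>\<close> of a subalgebra \<open>A 0\<close> of \<open>S\<close> by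
  subspaces, \<open>assoc_graded A\<close> is \<open>\<Oplus>\<^sub>k A k / A (k + 1)\<close>. Its elements are the
  families \<open>F\<close> of cosets \<open>F k = f + A (k + 1)\<close>, \<open>f \<in> A k\<close>, almost all of which are zero.
  The operations are elementwise operations on cosets; adding \<open>A (k + 1)\<close> completes a
  set of products of representatives to a full coset.
\<close>

definition assoc_graded :: "(nat \<Rightarrow> poly4 set) \<Rightarrow> (complex, nat \<Rightarrow> poly4 set) module" where
  "assoc_graded A =
     \<lparr>carrier = {F. (\<forall>k. \<exists>f\<in>A k. F k = f +o A (Suc k)) \<and> finite {k. F k \<noteq> A (Suc k)}},
      mult = (\<lambda>F G k. (\<Sum>i\<le>k. F i * G (k - i)) + A (Suc k)),
      one = (\<lambda>k. if k = 0 then 1 +o A 1 else A (Suc k)),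
      zero = (\<lambda>k. A (Suc k)),
      add = (\<lambda>F G k. F k + G k),
      smult = (\<lambda>c F k. Const c *o F k + A (Suc k))\<rparr>"

text \<open>The class of \<open>f \<in> A m\<close> in the \<open>m\<close>-th summand \<open>A m / A (m + 1)\<close>.\<close>

definition gr_class :: "(nat \<Rightarrow> poly4 set) \<Rightarrow> nat \<Rightarrow> poly4 \<Rightarrow> nat \<Rightarrow> poly4 set" where
  "gr_class A m f = (\<lambda>k. if k = m then f +o A (Suc m) else A (Suc k))"

definition generated_subalgebra ::
    "('a, 'm) ring_scheme \<Rightarrow> ('a, 'b, 'n) module_scheme \<Rightarrow> 'b set \<Rightarrow> 'b set" where
  "generated_subalgebra K B X =
     \<Inter> {H. subring H B \<and> (\<forall>c\<in>carrier K. \<forall>h\<in>H. c \<odot>\<^bsub>B\<^esub> h \<in> H) \<and> X \<subseteq> H}"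

definition finitely_generated_algebra ::
    "('a, 'm) ring_scheme \<Rightarrow> ('a, 'b, 'n) module_scheme \<Rightarrow> bool" where
  "finitely_generated_algebra K B \<longleftrightarrow> algebra K B \<and>
     (\<exists>X. finite X \<and> X \<subseteq> carrier B \<and> generated_subalgebra K B X = carrier B)"


section \<open>The bigraded algebra \<open>R\<close> and its Hilbert series\<close>

definition I_pt :: "poly4 set" where
  "I_pt = ideal_gen {Var 1, Var 2, Var 3}"

definition filt :: "nat \<Rightarrow> poly4 set" where
  "filt m = T_inv \<inter> ideal_power I_pt m"

definition R_alg :: "(complex, nat \<Rightarrow> poly4 set) module" where
  "R_alg = assoc_graded filt"

text \<open>
  The quotient \<open>(T\<^sub>d \<inter> I\<^sup>m) / (T\<^sub>d \<inter> I\<^sup>m\<^sup>+\<^sup>1)\<close> is realised as its image in the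
  summand \<open>(T \<inter> I\<^sup>m) / (T \<inter> I\<^sup>m\<^sup>+\<^sup>1)\<close> of \<open>R\<close>; see \<open>R_piece_class_eq_iff\<close> below.
\<close>

definition R_piece :: "nat \<Rightarrow> nat \<Rightarrow> (nat \<Rightarrow> poly4 set) set" where
  "R_piece d m = gr_class filt m ` (T_deg d \<inter> ideal_power I_pt m)"

text \<open>
  The dimension relation of \<open>Embedded_Algebras\<close> takes the field of scalars
  as a subset of the ring; here it is the copy of \<open>\<complex>\<close> in \<open>R\<close>.
\<close>

definition R_scalars :: "(nat \<Rightarrow> poly4 set) set" where
  "R_scalars = {c \<odot>\<^bsub>R_alg\<^esub> \<one>\<^bsub>R_alg\<^esub> | c. c \<in> carrier complex_ring}"

definition R_piece_has_dim :: "nat \<Rightarrow> nat \<Rightarrow> nat \<Rightarrow> bool" where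
  "R_piece_has_dim d m n \<longleftrightarrow> ring.dimension R_alg n R_scalars (R_piece d m)"

definition R_piece_dim :: "nat \<Rightarrow> nat \<Rightarrow> nat" where
  "R_piece_dim d m = (THE n. R_piece_has_dim d m n)"

text \<open>
  Power series in \<open>u, v\<close> are power series in \<open>u\<close> whose coefficients are power series in \<open>v\<close>.
\<close>

definition hs_u :: "rat fps fps" where
  "hs_u = fps_X"

definition hs_v :: "rat fps fps" where
  "hs_v = fps_const fps_X"

definition HS :: "rat fps fps" where
  "HS = Abs_fps (\<lambda>d. Abs_fps (\<lambda>m. of_nat (R_piece_dim d m)))"

definition HS_num :: "'a::comm_ring_1 \<Rightarrow> 'a \<Rightarrow> 'a" where
  "HS_num u v =
     1 + u^12 * v^2 + u^24 * v^6 + u^30 * v^6 + u^32 * v^8 - u^32 * v^6 + u^42 * v^10 - u^44 * v^10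
     + u^54 * v^14 - u^56 * v^14
     + u^66 * v^18 - u^66 * v^16 - u^68 * v^18 - u^74 * v^18 - u^86 * v^22 - u^98 * v^24"

definition HS_denom :: "'a::comm_ring_1 \<Rightarrow> 'a \<Rightarrow> 'a" where
  "HS_denom u v =
     (1 - u^60 * v^16) * (1 - u^44 * v^12) * (1 - u^36 * v^10) * (1 - u^20 * v^4) * (1 - u^2)"


section \<open>The twelve generators\<close>

text \<open>Each entry lists the bidegree \<open>(d, m)\<close> and the polynomial.\<close>

definition R_gens :: "(nat \<times> nat \<times> poly4) list" where
  "R_gens =
    [(2, 0, f2),
     (12, 2, f12),
     (20, 4, f20),
     (24, 6, f12^2 - f2^2 * f20),
     (30, 6, f30),
     (32, 8, f12 * f20 - f2 * f30),
     (36, 10, f12^3 - 3 * f2^2 * f12 * f20 + 2 * f2^3 * f30),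
     (42, 10, f2 * f20^2 - f12 * f30),
     (44, 12, f12^2 * f20 + f2^2 * f20^2 - 2 * f2 * f12 * f30),
     (54, 14, 2 * f2 * f12 * f20^2 - f12^2 * f30 - f2^2 * f20 * f30),
     (60, 16, f20^3 - f30^2),
     (66, 18, 3 * f2 * f12^2 * f20^2 - f2^3 * f20^3 - f12^3 * f30
              - 3 * f2^2 * f12 * f20 * f30 + 2 * f2^3 * f30^2)]"

definition slope :: "nat \<Rightarrow> nat \<Rightarrow> ereal" where
  "slope d m = (if m = 0 then \<infinity> else ereal (real d / real m))"


section \<open>The Waldschmidt constant\<close>

text \<open>Points of \<open>\<P>\<^sup>3\<close> are the one-dimensional subspaces of \<open>\<complex>\<^sup>4\<close>.\<close>

definition proj_point :: "complex ^ 4 \<Rightarrow> (complex ^ 4) set" where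
  "proj_point a = vec.span {a}"

definition H4_proj :: "(complex ^ 4) set set" where
  "H4_proj = (\<lambda>r. proj_point (\<chi> i. complex_of_real (r $ i))) ` H4"

definition point_ideal :: "(complex ^ 4) set \<Rightarrow> poly4 set" where
  "point_ideal P = ideal_gen {f. (\<exists>d. homogeneous d f) \<and> (\<forall>a\<in>P. eval_at f a = 0)}"

definition symbolic_power :: "(complex ^ 4) set set \<Rightarrow> nat \<Rightarrow> poly4 set" where
  "symbolic_power Z m = (\<Inter>P\<in>Z. ideal_power (point_ideal P) m)"

definition initial_degree :: "poly4 set \<Rightarrow> nat" where
  "initial_degree J = (LEAST d. \<exists>f\<in>J. f \<noteq> 0 \<and> homogeneous d f)"

definition waldschmidt :: "(complex ^ 4) set set \<Rightarrow> real" where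
  "waldschmidt Z = (INF m\<in>{1..}. real (initial_degree (symbolic_power Z m)) / real m)"


section \<open>Well-definedness of the constructions\<close>

text \<open>The denominator of the Hilbert series is a unit, so that the division is exact.\<close>

lemma HS_denom_unit: "f / HS_denom hs_u hs_v * HS_denom hs_u hs_v = f"
proof -
  let ?D = "HS_denom hs_u hs_v"
  have 0: "fps_nth ?D 0 = 1"
    by (simp add: HS_denom_def hs_u_def hs_v_def fps_X_power_iff)
  have s: "subdegree ?D = 0" using 0 by (simp add: subdegree_eq_0)
  have "?D * fps_right_inverse ?D 1 = 1" using 0 by (intro fps_right_inverse) simp
  moreover have "inverse (fps_nth ?D 0) = 1" unfolding 0 by (rule fps_inverse_one)
  ultimately have "inverse ?D * ?D = 1" unfolding fps_inverse_def by (simp only: mult.commute)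
  then show ?thesis 
    using s 0 by (simp add: fps_divide_def mult.assoc)
qed

lemma Const_simps: "Const (a + b) = Const a + Const b" "Const (a * b) = Const a * Const b"
  "Const 1 = 1"
  by (simp_all add: Const_def single_add mult_single single_one)

locale poly_filtration =
  fixes A :: "nat \<Rightarrow> poly4 set"
  assumes zero: "0 \<in> A k"
    and diff: "f \<in> A k \<Longrightarrow> g \<in> A k \<Longrightarrow> f - g \<in> A k"
    and scale: "f \<in> A k \<Longrightarrow> Const c * f \<in> A k"
    and mult: "f \<in> A i \<Longrightarrow> g \<in> A j \<Longrightarrow> f * g \<in> A (i + j)"
    and one: "1 \<in> A 0"
    and dec: "A (Suc k) \<subseteq> A k"
begin

lemma add: "f \<in> A k \<Longrightarrow> g \<in> A k \<Longrightarrow> f + g \<in> A k"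
  using diff[of f k "0 - g"] diff[OF zero, of g k] by simp

lemma sum: "(\<And>i. i \<in> J \<Longrightarrow> f i \<in> A k) \<Longrightarrow> (\<Sum>i\<in>J. f i) \<in> A k"
  by (induction J rule: infinite_finite_induct) (auto intro: zero add)

lemma antimono: "i \<le> j \<Longrightarrow> A j \<subseteq> A i"
  using lift_Suc_antimono_le[of A] dec by blast

lemma mem_coset: "x \<in> f +o A k \<longleftrightarrow> x - f \<in> A k"
  unfolding elt_set_plus_def by (auto intro: bexI[of _ "x - f"])

lemma coset_eq_iff: "f +o A k = g +o A k \<longleftrightarrow> f - g \<in> A k"
proof
  assume "f +o A k = g +o A k"
  moreover have "f \<in> f +o A k" using zero by (simp add: mem_coset)
  ultimately show "f - g \<in> A k" by (simp add: mem_coset)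
next
  assume d: "f - g \<in> A k"
  have "x - f \<in> A k \<longleftrightarrow> x - g \<in> A k" for x
    using add[OF _ d, of "x - f"] diff[OF _ d, of "x - g"] by (auto simp: algebra_simps)
  then show "f +o A k = g +o A k" by (auto simp: mem_coset)
qed

lemma coset_eq_zero_iff: "f +o A k = A k \<longleftrightarrow> f \<in> A k"
proof -
  have "0 +o A k = A k" by (auto simp: mem_coset)
  then show ?thesis using coset_eq_iff[of f k 0] by simp
qed

lemma gr_class_eq_iff: "gr_class A m f = gr_class A m g \<longleftrightarrow> f - g \<in> A (Suc m)"
  unfolding coset_eq_iff[symmetric] by (auto simp: gr_class_def fun_eq_iff)

definition cls :: "poly4 fps \<Rightarrow> nat \<Rightarrow> poly4 set" where
  "cls F = (\<lambda>k. fps_nth F k +o A (Suc k))"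

definition good :: "poly4 fps set" where
  "good = {F. (\<forall>k. fps_nth F k \<in> A k) \<and> finite {k. fps_nth F k \<noteq> 0}}"

lemma carrier_eq: "carrier (assoc_graded A) = cls ` good"
proof (intro equalityI subsetI)
  fix c assume "c \<in> carrier (assoc_graded A)"
  then have "\<forall>k. \<exists>f\<in>A k. c k = f +o A (Suc k)" and fin: "finite {k. c k \<noteq> A (Suc k)}"
    by (auto simp: assoc_graded_def)
  then obtain f where f: "f k \<in> A k" "c k = f k +o A (Suc k)" for k by metis
  define F where "F = Abs_fps (\<lambda>k. if c k = A (Suc k) then 0 else f k)"
  have "{k. fps_nth F k \<noteq> 0} \<subseteq> {k. c k \<noteq> A (Suc k)}" by (auto simp: F_def)
  then have "F \<in> good" using f(1) fin zero by (auto simp: good_def F_def intro: finite_subset)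
  moreover have "c = cls F"
    using f(2) coset_eq_zero_iff zero by (auto simp: cls_def F_def fun_eq_iff)
  ultimately show "c \<in> cls ` good" by blast
next
  fix c assume "c \<in> cls ` good"
  then obtain F where F: "F \<in> good" "c = cls F" by blast
  have "{k. c k \<noteq> A (Suc k)} \<subseteq> {k. fps_nth F k \<noteq> 0}"
    unfolding F(2) cls_def using coset_eq_zero_iff zero by auto
  then show "c \<in> carrier (assoc_graded A)"
    using F by (auto simp: assoc_graded_def good_def cls_def intro: finite_subset)
qed

lemma good_add: "F \<in> good \<Longrightarrow> G \<in> good \<Longrightarrow> F + G \<in> good"
proof -
  assume *: "F \<in> good" "G \<in> good"
  have "{k. fps_nth (F + G) k \<noteq> 0} \<subseteq> {k. fps_nth F k \<noteq> 0} \<union> {k. fps_nth G k \<noteq> 0}" by auto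
  with * show ?thesis unfolding good_def by (auto intro: add finite_subset)
qed

lemma good_uminus: "F \<in> good \<Longrightarrow> - F \<in> good"
  using diff[OF zero] unfolding good_def by fastforce

lemma good_zero: "0 \<in> good" and good_one: "1 \<in> good"
  using zero one by (auto simp: good_def fps_one_def)

lemma good_scale: "F \<in> good \<Longrightarrow> fps_const (Const c) * F \<in> good"
  using scale unfolding good_def by (auto elim!: rev_finite_subset)

lemma good_mult: assumes F: "F \<in> good" and G: "G \<in> good" shows "F * G \<in> good"
proof -
  have "fps_nth (F * G) k \<in> A k" for k
    unfolding fps_mult_nth
  proof (rule sum)
    fix i assume "i \<in> {0..k}"
    then show "fps_nth F i * fps_nth G (k - i) \<in> A k"
      using F G mult[of "fps_nth F i" i "fps_nth G (k - i)" "k - i"] by (simp add: good_def)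
  qed
  moreover have "{k. fps_nth (F * G) k \<noteq> 0}
      \<subseteq> (\<lambda>(i, j). i + j) ` ({k. fps_nth F k \<noteq> 0} \<times> {k. fps_nth G k \<noteq> 0})"
  proof
    fix k assume "k \<in> {k. fps_nth (F * G) k \<noteq> 0}"
    then have "(\<Sum>i=0..k. fps_nth F i * fps_nth G (k - i)) \<noteq> 0" by (simp add: fps_mult_nth)
    then obtain i where "i \<in> {0..k}" "fps_nth F i * fps_nth G (k - i) \<noteq> 0"
      by (rule sum.not_neutral_contains_not_neutral)
    then show "k \<in> (\<lambda>(i, j). i + j) ` ({k. fps_nth F k \<noteq> 0} \<times> {k. fps_nth G k \<noteq> 0})"
      by (intro image_eqI[of _ _ "(i, k - i)"]) auto
  qed
  ultimately show ?thesis
    using F G unfolding good_def by (auto elim!: finite_subset)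
qed

lemma add_cls: "cls F \<oplus>\<^bsub>assoc_graded A\<^esub> cls G = cls (F + G)"
proof -
  have "f +o A k + (g +o A k) = (f + g) +o A k" for f g k
  proof (intro equalityI subsetI)
    fix x assume "x \<in> f +o A k + (g +o A k)"
    then obtain a b where "x = a + b" "a - f \<in> A k" "b - g \<in> A k"
      by (auto simp: set_plus_def mem_coset)
    then show "x \<in> (f + g) +o A k"
      using add[of "a - f" k "b - g"] by (simp add: mem_coset algebra_simps)
  next
    fix x assume "x \<in> (f + g) +o A k"
    then have "x = f + (x - f)" "f \<in> f +o A k" "x - f \<in> g +o A k"
      using zero by (auto simp: mem_coset algebra_simps)
    then show "x \<in> f +o A k + (g +o A k)" unfolding set_plus_def by blast
  qed
  then show ?thesis by (simp add: assoc_graded_def cls_def)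
qed

lemma smult_cls: "c \<odot>\<^bsub>assoc_graded A\<^esub> cls F = cls (fps_const (Const c) * F)"
proof -
  have "Const c *o (f +o A k) + A k = (Const c * f) +o A k" for f k
  proof (intro equalityI subsetI)
    fix x assume "x \<in> Const c *o (f +o A k) + A k"
    then obtain a b where "x = Const c * a + b" "a - f \<in> A k" "b \<in> A k"
      by (auto simp: set_plus_def elt_set_times_def mem_coset)
    then show "x \<in> (Const c * f) +o A k"
      using add[OF scale[of "a - f" k c]] by (force simp: mem_coset algebra_simps)
  next
    fix x assume "x \<in> (Const c * f) +o A k"
    then have "x = Const c * f + (x - Const c * f)" "f \<in> f +o A k" "x - Const c * f \<in> A k"
      using zero by (auto simp: mem_coset)
    then show "x \<in> Const c *o (f +o A k) + A k"
      unfolding set_plus_def elt_set_times_def by blast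
  qed
  then show ?thesis by (simp add: assoc_graded_def cls_def)
qed

lemma set_sum_iff:
  "finite J \<Longrightarrow> x \<in> (\<Sum>i\<in>J. B i) \<longleftrightarrow> (\<exists>b. (\<forall>i\<in>J. b i \<in> B i) \<and> x = (\<Sum>i\<in>J. b i))"
  for B :: "'i \<Rightarrow> poly4 set"
proof (induction J arbitrary: x rule: finite_induct)
  case (insert j J)
  show ?case
  proof
    assume "x \<in> (\<Sum>i\<in>insert j J. B i)"
    then obtain y b where "y \<in> B j" "\<forall>i\<in>J. b i \<in> B i" "x = y + (\<Sum>i\<in>J. b i)"
      using insert by (auto simp: set_plus_def)
    then show "\<exists>b. (\<forall>i\<in>insert j J. b i \<in> B i) \<and> x = (\<Sum>i\<in>insert j J. b i)"
      using insert(1,2) by (intro exI[of _ "b(j := y)"]) (auto intro!: sum.cong)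
  qed (use insert in \<open>force simp: set_plus_def\<close>)
qed auto

lemma mult_cls:
  assumes F: "F \<in> good" and G: "G \<in> good"
  shows "cls F \<otimes>\<^bsub>assoc_graded A\<^esub> cls G = cls (F * G)"
proof -
  have "(\<Sum>i\<le>k. cls F i * cls G (k - i)) + A (Suc k) = cls (F * G) k" for k
  proof (intro equalityI subsetI)
    fix x assume "x \<in> (\<Sum>i\<le>k. cls F i * cls G (k - i)) + A (Suc k)"
    then obtain b y where b: "\<forall>i\<le>k. b i \<in> cls F i * cls G (k - i)" and y: "y \<in> A (Suc k)"
      and x: "x = (\<Sum>i\<le>k. b i) + y"
      by (fastforce simp: set_plus_def set_sum_iff)
    have "b i - fps_nth F i * fps_nth G (k - i) \<in> A (Suc k)" if i: "i \<le> k" for i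
    proof -
      obtain f g where fg: "b i = f * g" "f - fps_nth F i \<in> A (Suc i)"
          "g - fps_nth G (k - i) \<in> A (Suc (k - i))"
        using b i by (auto simp: set_times_def cls_def mem_coset)
      have "fps_nth G (k - i) + (g - fps_nth G (k - i)) \<in> A (k - i)"
        using G fg(3) dec by (intro add) (auto simp: good_def)
      then have "g \<in> A (k - i)" by simp
      then have "(f - fps_nth F i) * g \<in> A (Suc k)"
        using mult[OF fg(2), of g "k - i"] i by simp
      moreover have "fps_nth F i * (g - fps_nth G (k - i)) \<in> A (Suc k)"
        using mult[OF _ fg(3), of "fps_nth F i" i] i F by (simp add: good_def)
      ultimately show ?thesis using add unfolding fg(1) by (fastforce simp: algebra_simps)
    qed
    then have "(\<Sum>i\<le>k. b i - fps_nth F i * fps_nth G (k - i)) + y \<in> A (Suc k)"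
      by (intro add sum y) auto
    then show "x \<in> cls (F * G) k"
      by (simp add: x cls_def mem_coset fps_mult_nth sum_subtractf atLeast0AtMost algebra_simps)
  next
    fix x assume "x \<in> cls (F * G) k"
    then have "x - fps_nth (F * G) k \<in> A (Suc k)" by (simp add: cls_def mem_coset)
    moreover have "fps_nth H i \<in> cls H i" for H i
      using zero by (simp add: cls_def mem_coset)
    then have "fps_nth F i * fps_nth G j \<in> cls F i * cls G j" for i j
      unfolding set_times_def by blast
    then have "fps_nth (F * G) k \<in> (\<Sum>i\<le>k. cls F i * cls G (k - i))"
      by (auto simp: set_sum_iff fps_mult_nth atLeast0AtMost
          intro!: exI[of _ "\<lambda>i. fps_nth F i * fps_nth G (k - i)"])
    ultimately show "x \<in> (\<Sum>i\<le>k. cls F i * cls G (k - i)) + A (Suc k)"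
      unfolding set_plus_def by (force intro: exI[of _ "x - fps_nth (F * G) k"])
  qed
  then show ?thesis by (simp add: assoc_graded_def fun_eq_iff)
qed

lemma zero_cls: "\<zero>\<^bsub>assoc_graded A\<^esub> = cls 0" and one_cls: "\<one>\<^bsub>assoc_graded A\<^esub> = cls 1"
  using coset_eq_zero_iff zero by (auto simp: assoc_graded_def cls_def fun_eq_iff)

theorem algebra_assoc_graded: "algebra complex_ring (assoc_graded A)"
proof -
  note ops = add_cls mult_cls zero_cls one_cls smult_cls good_add good_mult good_zero good_one
    good_scale
  have K: "cring complex_ring"
  proof (rule cringI)
    show "abelian_group complex_ring"
      by (rule abelian_groupI) (auto simp: complex_ring_def algebra_simps intro: exI[of _ "- _"] right_minus left_minus)
    show "comm_monoid complex_ring"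
      by (rule comm_monoidI) (auto simp: complex_ring_def)
  qed (auto simp: complex_ring_def algebra_simps)
  have M: "cring (assoc_graded A)"
  proof (rule cringI)
    show "abelian_group (assoc_graded A)"
    proof (rule abelian_groupI)
      fix x assume "x \<in> carrier (assoc_graded A)"
      then obtain F where "F \<in> good" "x = cls F" by (auto simp: carrier_eq)
      then show "\<exists>y\<in>carrier (assoc_graded A). y \<oplus>\<^bsub>assoc_graded A\<^esub> x = \<zero>\<^bsub>assoc_graded A\<^esub>"
        by (intro bexI[of _ "cls (- F)"]) (auto simp: carrier_eq ops good_uminus)
    qed (auto simp: carrier_eq ops add_ac)
    show "comm_monoid (assoc_graded A)"
      by (rule comm_monoidI) (auto simp: carrier_eq ops mult_ac)
  qed (auto simp: carrier_eq ops algebra_simps)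
  show ?thesis
    by (rule algebraI[OF K M])
      (auto simp: carrier_eq ops Const_simps complex_ring_def mult.assoc ring_distribs
        simp flip: fps_const_add fps_const_mult)
qed

end



lemma subst_superset:
  assumes "finite K" "Poly_Mapping.keys f \<subseteq> K"
  shows "subst h f =
    (\<Sum>m\<in>K. Const (Poly_Mapping.lookup f m) * (\<Prod>i\<in>UNIV. h i ^ Poly_Mapping.lookup m i))"
  unfolding subst_def using assms
  by (intro sum.mono_neutral_left) (auto simp: in_keys_iff Const_def)

lemma subst_add: "subst h (f + g) = subst h f + subst h g"
proof -
  let ?K = "Poly_Mapping.keys f \<union> Poly_Mapping.keys g"
  have "Poly_Mapping.keys (f + g) \<subseteq> ?K" by (rule Poly_Mapping.keys_add)
  then show ?thesis
    by (simp add: subst_superset[of ?K] lookup_add Const_simps ring_distribs sum.distrib)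
qed

lemma subst_single:
  "subst h (Poly_Mapping.single m c) = Const c * (\<Prod>i\<in>UNIV. h i ^ Poly_Mapping.lookup m i)"
  by (subst subst_superset[of "{m}"]) auto

lemma subst_0: "subst h 0 = 0"
  by (simp add: subst_def)

lemma subst_sum: "subst h (sum f J) = (\<Sum>j\<in>J. subst h (f j))"
  by (induction J rule: infinite_finite_induct) (simp_all add: subst_0 subst_add)

lemma subst_mult: "subst h (f * g) = subst h f * subst h g"
proof -
  have f: "f = (\<Sum>m\<in>Poly_Mapping.keys f. Poly_Mapping.single m (Poly_Mapping.lookup f m))" for f :: poly4
    by (rule poly_mapping_eqI)
      (simp add: lookup_sum lookup_single when_def in_keys_iff sum.delta)
  have "subst h (Poly_Mapping.single m c * Poly_Mapping.single n d) =
      subst h (Poly_Mapping.single m c) * subst h (Poly_Mapping.single n d)" for m n c d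
    by (simp add: mult_single subst_single Const_simps lookup_add power_add prod.distrib mult_ac)
  then have "subst h ((\<Sum>m\<in>K. Poly_Mapping.single m (a m)) * (\<Sum>m\<in>L. Poly_Mapping.single m (b m))) =
      subst h (\<Sum>m\<in>K. Poly_Mapping.single m (a m)) * subst h (\<Sum>m\<in>L. Poly_Mapping.single m (b m))"
    for K L a b
    by (simp only: subst_sum sum_product)
  from this[of "Poly_Mapping.lookup f" "Poly_Mapping.keys f" "Poly_Mapping.lookup g" "Poly_Mapping.keys g"]
  show ?thesis by (simp only: f[symmetric])
qed

lemma subst_Const: "subst h (Const c) = Const c"
  using subst_single[of h 0 c] by (simp add: Const_def)

interpretation S_mod: Modules.module "(*) :: poly4 \<Rightarrow> poly4 \<Rightarrow> poly4"
  by standard (simp_all add: distrib_left distrib_right mult.assoc)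

lemma ideal_power_mult:
  assumes "f \<in> ideal_power J i" "g \<in> ideal_power J j"
  shows "f * g \<in> ideal_power J (i + j)"
proof -
  have 1: "a * g \<in> ideal_power J (i + j)" if "a \<in> J ^ i" for a
    using assms(2) unfolding ideal_power_def ideal_gen_def
  proof (induction rule: S_mod.span_induct_alt)
    case (step c x y)
    have "a * x \<in> J ^ (i + j)" using that step(1) by (auto simp: power_add set_times_def)
    then have "c * (a * x) + a * y \<in> S_mod.span (J ^ (i + j))"
      by (intro S_mod.span_add S_mod.span_scale S_mod.span_base step(2))
    moreover have "c * (a * x) + a * y = a * (c * x + y)"
      by (simp only: distrib_left mult.left_commute)
    ultimately show ?case by (simp only:)
  qed (simp add: S_mod.span_zero)
  from assms(1) show ?thesis unfolding ideal_power_def[of J i] ideal_gen_def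
  proof (induction rule: S_mod.span_induct_alt)
    case (step c x y)
    have "c * (x * g) + y * g \<in> ideal_power J (i + j)"
      using 1[OF step(1)] step(2) unfolding ideal_power_def ideal_gen_def
      by (intro S_mod.span_add S_mod.span_scale[of "x * g"])
    moreover have "c * (x * g) + y * g = (c * x + y) * g"
      by (simp only: distrib_right mult.assoc)
    ultimately show ?case by (simp only:)
  qed (simp add: ideal_power_def ideal_gen_def S_mod.span_zero)
qed

lemma ideal_power_Suc_subset: "ideal_power J (Suc k) \<subseteq> ideal_power J k"
proof -
  have "J ^ Suc k \<subseteq> S_mod.span (J ^ k)"
    by (auto simp: set_times_def intro: S_mod.span_scale S_mod.span_base)
  then show ?thesis unfolding ideal_power_def ideal_gen_def
    by (simp add: S_mod.span_minimal)
qed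

lemma poly_filtration_filt: "poly_filtration filt"
proof
  have act: "act g (f * f') = act g f * act g f'" "act g (f + f') = act g f + act g f'"
    "act g (Const c) = Const c" for g f f' c
    by (simp_all add: act_def subst_mult subst_add subst_Const)
  have actm: "act g (f - f') = act g f - act g f'" for g f f'
    using act(2)[of g "f - f'" f'] by (simp add: eq_diff_eq)
  have act0: "act g 0 = 0" for g by (simp add: act_def subst_0)
  fix k show "0 \<in> filt k"
    by (simp add: filt_def T_inv_def act0 ideal_power_def ideal_gen_def S_mod.span_zero)
  show "f - g \<in> filt k" if "f \<in> filt k" "g \<in> filt k" for f g
    using that by (simp add: filt_def T_inv_def actm ideal_power_def ideal_gen_def S_mod.span_diff)
  show "Const c * f \<in> filt k" if "f \<in> filt k" for f c
    using that by (simp add: filt_def T_inv_def act ideal_power_def ideal_gen_def S_mod.span_scale)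
  show "f * g \<in> filt (i + j)" if "f \<in> filt i" "g \<in> filt j" for f g i j
    using that by (simp add: filt_def T_inv_def act ideal_power_mult)
  show "1 \<in> filt 0"
    using act(3)[of _ 1] by (simp add: filt_def T_inv_def Const_simps ideal_power_def ideal_gen_def S_mod.span_base)
  show "filt (Suc k) \<subseteq> filt k"
    using ideal_power_Suc_subset by (auto simp: filt_def)
qed

lemma algebra_R_alg: "algebra complex_ring R_alg"
  unfolding R_alg_def by (rule poly_filtration.algebra_assoc_graded[OF poly_filtration_filt])

lemma R_piece_class_eq_iff:
  assumes "f \<in> T_deg d \<inter> ideal_power I_pt m" "g \<in> T_deg d \<inter> ideal_power I_pt m"
  shows "gr_class filt m f = gr_class filt m g \<longleftrightarrow> f - g \<in> T_deg d \<inter> ideal_power I_pt (Suc m)"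
proof -
  have "homogeneous d (f - g)"
    using assms keys_diff[of f g] by (auto simp: T_deg_def homogeneous_def)
  then show ?thesis using poly_filtration.gr_class_eq_iff[OF poly_filtration_filt, of m f g]
    by (auto simp: filt_def T_deg_def)
qed

end

theory Submission imports Defs begin

text \<open>
  Expanding \<open>f\<^sub>1\<^sub>2\<close>, \<open>f\<^sub>2\<^sub>0\<close>, \<open>f\<^sub>3\<^sub>0\<close> at \<open>(0:0:0:1)\<close> in powers of \<open>w\<close> shows that the initial forms
  of the twelve generators are, up to powers of \<open>w\<close>, polynomials in the three basic invariants
  \<open>P\<close>, \<open>Q\<close>, \<open>R\<close> of degrees \<open>2\<close>, \<open>6\<close>, \<open>10\<close> of the icosahedral group acting on \<open>(x, y, z)\<close>.
  Certain standard monomials in the generators have initial forms that span \<open>\<complex>[P, Q, R]\<close>; counting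
  shows that these initial forms are a basis. A second count, using that the invariants are
  generated by the four basic ones (Solomon's argument with the Jacobian determinant), shows that
  the products of the standard monomials with the powers of \<open>f\<^sub>2\<close> are a basis of the ring of invariants.
  As their initial forms are independent, this basis is adapted to the filtration by the powers of \<open>I\<close>,
  which gives the generators and the Hilbert series. The lower bound for the Waldschmidt constant follows
  by taking norms of forms over the group.
\<close>

section \<open>Polynomials in four variables\<close>

text \<open>The obstacle is that \<open>f2\<close>, \<open>f12\<close>, \<open>f20\<close>,
  \<open>f30\<close> have the initial forms 1, P, P^2, P^3 up to powers of w. As these are
  dependent, the order of a polynomial in the basic invariants cannot be read off from its
  monomials. The further generators are combinations in which such forms cancel; Q and R first
  appear in the bidegrees (24, 6) and (36, 10). Straightening shows only that the standard monomials
  span. Independence and completeness come from equalities of generating functions: with 1 / ((1 -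
  t^2) (1 - t^6) (1 - t^10)) when counting by order, and with 1 / ((1 - t^2) (1 - t^12) (1 - t^20)
  (1 - t^30)) when counting by degree. In Solomon's argument the decisive numerical fact is 1 + 11 +
  19 + 29 = 60, the number of mirrors. The bound behind the Waldschmidt constant is linear: 18 m
  \<le> 5 d holds for each of the twelve generators, with equality at (36, 10), and therefore for
  each element of the adapted basis.\<close>

lemma Const_0 [simp]: "Const 0 = 0"
  by (simp add: Const_def)

lemma Const_1 [simp]: "Const 1 = 1"
  by (simp add: Const_simps)

lemma Const_add: "Const (a + b) = Const a + Const b"
  and Const_mult: "Const (a * b) = Const a * Const b"
  by (simp_all add: Const_simps)

lemma Const_uminus: "Const (- a) = - Const a"
  by (simp add: Const_def single_uminus)

lemma Const_diff: "Const (a - b) = Const a - Const b"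
  by (simp add: Const_def single_diff)

lemma Const_of_nat [simp]: "Const (of_nat n) = of_nat n"
  by (induction n) (simp_all add: Const_add)

lemma Const_numeral [simp]: "Const (numeral n) = numeral n"
  using Const_of_nat[of "numeral n"] by (simp del: Const_of_nat)

lemma Const_power: "Const (a ^ n) = Const a ^ n"
  by (induction n) (simp_all add: Const_mult)

lemma Const_sum: "Const (sum f J) = (\<Sum>j\<in>J. Const (f j))"
  by (induction J rule: infinite_finite_induct) (simp_all add: Const_add)

lemma Const_eq_0_iff [simp]: "Const c = 0 \<longleftrightarrow> c = 0"
  by (auto simp: Const_def dest: arg_cong[of _ _ "\<lambda>f. Poly_Mapping.lookup f 0"])

lemma Const_eq_iff: "Const a = Const b \<longleftrightarrow> a = b"
  using Const_eq_0_iff[of "a - b"] by (simp add: Const_diff del: Const_eq_0_iff)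

lemma poly_sum_single:
  "(\<Sum>m\<in>Poly_Mapping.keys f. Poly_Mapping.single m (Poly_Mapping.lookup f m)) = f"
  for f :: poly4
  by (rule poly_mapping_eqI) (simp add: lookup_sum lookup_single when_def in_keys_iff sum.delta)

lemma poly_single_induct [case_names single add]:
  fixes f :: poly4
  assumes single: "\<And>m c. P (Poly_Mapping.single m c)"
    and add: "\<And>f g. P f \<Longrightarrow> P g \<Longrightarrow> P (f + g)"
  shows "P f"
proof -
  have 0: "P 0" using single[of 0 0] by simp
  have "P (\<Sum>m\<in>K. Poly_Mapping.single m (Poly_Mapping.lookup f m))" for K
    by (induction K rule: infinite_finite_induct) (simp_all add: 0 single add)
  from this[of "Poly_Mapping.keys f"] show ?thesis by (simp only: poly_sum_single)
qed

lemma lookup_Const_mult: "Poly_Mapping.lookup (Const c * f) m = c * Poly_Mapping.lookup f m"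
  by (induction f rule: poly_single_induct)
    (simp_all add: Const_def mult_single lookup_single when_def ring_distribs lookup_add)

lemma mon4_eqI:
  fixes m n :: mon4
  assumes "\<And>i. Poly_Mapping.lookup m i = Poly_Mapping.lookup n i"
  shows "m = n"
  by (rule poly_mapping_eqI) (rule assms)

lemma Var_power: "Var i ^ n = Poly_Mapping.single (Poly_Mapping.single i n) 1"
  by (induction n) (simp_all add: Var_def mult_single add.commute flip: single_add)

lemma single_eq_monomial:
  "Poly_Mapping.single m c = Const c * (\<Prod>i\<in>UNIV. Var i ^ Poly_Mapping.lookup m i)"
proof -
  have "m = (\<Sum>i\<in>UNIV. Poly_Mapping.single i (Poly_Mapping.lookup m i))"
    by (rule mon4_eqI) (simp add: lookup_sum lookup_single when_def sum.delta)
  moreover have "(\<Prod>i\<in>J. Poly_Mapping.single (f i) 1) = Poly_Mapping.single (\<Sum>i\<in>J. f i) (1 :: complex)"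
    for f :: "4 \<Rightarrow> mon4" and J
    by (induction J rule: infinite_finite_induct) (simp_all add: mult_single)
  ultimately show ?thesis
    by (simp add: Var_power Const_def mult_single)
qed

text \<open>Ring homomorphisms are determined by constants and variables, so identities between
  substitutions are proved with this rule; those about coefficients use
  \<open>poly_single_induct\<close>.\<close>

lemma poly4_induct [case_names Const Var add mult]:
  assumes Const: "\<And>c. P (Const c)" and Var: "\<And>i. P (Var i)"
    and add: "\<And>f g. P f \<Longrightarrow> P g \<Longrightarrow> P (f + g)"
    and mult: "\<And>f g. P f \<Longrightarrow> P g \<Longrightarrow> P (f * g)"
  shows "P f"
proof (induction f rule: poly_single_induct)
  case (single m c)
  have 1: "P 1" using Const[of 1] by simp
  have "P (Var i ^ n)" for i n by (induction n) (simp_all add: 1 mult Var)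
  then have "P (\<Prod>i\<in>J. Var i ^ Poly_Mapping.lookup m i)" for J
    by (induction J rule: infinite_finite_induct) (simp_all add: 1 mult)
  then show ?case by (simp add: single_eq_monomial mult Const)
qed (rule add)

lemma subst_Var [simp]: "subst h (Var i) = h i"
proof -
  have "(\<Prod>j\<in>UNIV. h j ^ Poly_Mapping.lookup (Poly_Mapping.single i 1) j) = (\<Prod>j\<in>UNIV. if j = i then h j else 1)"
    by (rule prod.cong) (simp_all add: lookup_single when_def)
  then show ?thesis by (simp add: Var_def subst_single)
qed

lemma subst_1 [simp]: "subst h 1 = 1"
  using subst_Const[of h 1] by simp

lemma subst_uminus: "subst h (- f) = - subst h f"
  using subst_add[of h f "- f"] by (simp add: subst_0 eq_neg_iff_add_eq_0 add.commute)

lemma subst_diff: "subst h (f - g) = subst h f - subst h g"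
  using subst_add[of h f "- g"] by (simp add: subst_uminus)

lemma subst_power: "subst h (f ^ n) = subst h f ^ n"
  by (induction n) (simp_all add: subst_mult)

lemma subst_prod: "subst h (prod f J) = (\<Prod>j\<in>J. subst h (f j))"
  by (induction J rule: infinite_finite_induct) (simp_all add: subst_mult)

lemma subst_numeral [simp]: "subst h (numeral n) = numeral n"
  using subst_Const[of h "numeral n"] by simp

lemma subst_subst: "subst h (subst k f) = subst (\<lambda>i. subst h (k i)) f"
  by (induction f rule: poly4_induct) (simp_all add: subst_Const subst_add subst_mult)

lemmas subst_hom = subst_0 subst_Const subst_add subst_mult subst_uminus subst_diff subst_power

section \<open>Gradings\<close>

text \<open>The weight is arbitrary because three are used: the total degree \<open>mdeg\<close>,
  the degree \<open>xdeg\<close> in x, y, z, and \<open>pdeg\<close> with weights 2, 6, 10.\<close>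

definition wpart :: "(mon4 \<Rightarrow> nat) \<Rightarrow> nat \<Rightarrow> poly4 \<Rightarrow> poly4" where
  "wpart \<omega> k f = (\<Sum>m\<in>{m \<in> Poly_Mapping.keys f. \<omega> m = k}. Poly_Mapping.single m (Poly_Mapping.lookup f m))"

lemma lookup_wpart:
  "Poly_Mapping.lookup (wpart \<omega> k f) m = (if \<omega> m = k then Poly_Mapping.lookup f m else 0)"
  unfolding wpart_def
  by (simp add: lookup_sum lookup_single when_def in_keys_iff sum.delta')

lemma wpart_add: "wpart \<omega> k (f + g) = wpart \<omega> k f + wpart \<omega> k g"
  by (rule poly_mapping_eqI) (simp add: lookup_wpart lookup_add)

lemma wpart_0 [simp]: "wpart \<omega> k 0 = 0"
  by (rule poly_mapping_eqI) (simp add: lookup_wpart)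

lemma wpart_uminus: "wpart \<omega> k (- f) = - wpart \<omega> k f"
  by (rule poly_mapping_eqI) (simp add: lookup_wpart)

lemma wpart_diff: "wpart \<omega> k (f - g) = wpart \<omega> k f - wpart \<omega> k g"
  by (rule poly_mapping_eqI) (simp add: lookup_wpart lookup_minus)

lemma wpart_sum: "wpart \<omega> k (sum f J) = (\<Sum>j\<in>J. wpart \<omega> k (f j))"
  by (induction J rule: infinite_finite_induct) (simp_all add: wpart_add)

lemma wpart_Const_mult: "wpart \<omega> k (Const c * f) = Const c * wpart \<omega> k f"
  by (rule poly_mapping_eqI) (simp add: lookup_wpart lookup_Const_mult)

lemma wpart_numeral_mult: "wpart \<omega> k (numeral n * f) = numeral n * wpart \<omega> k f"
  using wpart_Const_mult[of \<omega> k "numeral n" f] by simp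

lemma wpart_single:
  "wpart \<omega> k (Poly_Mapping.single m c) = (if \<omega> m = k then Poly_Mapping.single m c else 0)"
  by (rule poly_mapping_eqI) (simp add: lookup_wpart lookup_single when_def)

lemma wpart_wpart: "wpart \<omega> j (wpart \<omega> k f) = (if j = k then wpart \<omega> k f else 0)"
  by (rule poly_mapping_eqI) (simp add: lookup_wpart)

lemma sum_wpart:
  assumes "\<And>m. m \<in> Poly_Mapping.keys f \<Longrightarrow> \<omega> m \<le> N"
  shows "(\<Sum>k\<le>N. wpart \<omega> k f) = f"
  using assms by (intro poly_mapping_eqI) (auto simp: lookup_sum lookup_wpart in_keys_iff sum.delta)

lemma wpart_bounded: "\<exists>N. \<forall>m\<in>Poly_Mapping.keys f. \<omega> m \<le> (N :: nat)" for f :: poly4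
  by (rule exI[of _ "Max (\<omega> ` Poly_Mapping.keys f)"]) simp

lemma wpart_eq_0I: "(\<And>k. wpart \<omega> k f = 0) \<Longrightarrow> f = 0"
  using sum_wpart wpart_bounded by (metis sum.neutral)

text \<open>For \<open>xdeg\<close> this is membership in the k-th power of the ideal (x, y, z), by
  \<open>ideal_power_I_pt_iff\<close>; \<open>wpart xdeg k f\<close> is then the initial form of f
  if it is nonzero.\<close>

definition vanishes :: "(mon4 \<Rightarrow> nat) \<Rightarrow> nat \<Rightarrow> poly4 \<Rightarrow> bool" where
  "vanishes \<omega> k f \<longleftrightarrow> (\<forall>j<k. wpart \<omega> j f = 0)"

lemma vanishes_add: "vanishes \<omega> k f \<Longrightarrow> vanishes \<omega> k g \<Longrightarrow> vanishes \<omega> k (f + g)"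
  and vanishes_diff: "vanishes \<omega> k f \<Longrightarrow> vanishes \<omega> k g \<Longrightarrow> vanishes \<omega> k (f - g)"
  and vanishes_Const_mult: "vanishes \<omega> k f \<Longrightarrow> vanishes \<omega> k (Const c * f)"
  and vanishes_0 [simp]: "vanishes \<omega> k 0"
  and vanishes_le: "vanishes \<omega> k f \<Longrightarrow> l \<le> k \<Longrightarrow> vanishes \<omega> l f"
  by (simp_all add: vanishes_def wpart_add wpart_diff wpart_Const_mult)

lemma vanishes_iff_keys: "vanishes \<omega> k f \<longleftrightarrow> (\<forall>m\<in>Poly_Mapping.keys f. k \<le> \<omega> m)"
proof
  assume v: "vanishes \<omega> k f"
  show "\<forall>m\<in>Poly_Mapping.keys f. k \<le> \<omega> m"
  proof
    fix m assume "m \<in> Poly_Mapping.keys f"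
    then have "Poly_Mapping.lookup (wpart \<omega> (\<omega> m) f) m \<noteq> 0"
      by (simp add: lookup_wpart in_keys_iff)
    then show "k \<le> \<omega> m" using v unfolding vanishes_def by (metis linorder_not_le lookup_zero)
  qed
next
  assume "\<forall>m\<in>Poly_Mapping.keys f. k \<le> \<omega> m"
  then show "vanishes \<omega> k f"
    by (force simp: vanishes_def in_keys_iff lookup_wpart intro!: poly_mapping_eqI)
qed

lemma homogeneous_iff: "homogeneous d f \<longleftrightarrow> wpart mdeg d f = f"
proof
  assume "homogeneous d f"
  then show "wpart mdeg d f = f"
    by (intro poly_mapping_eqI) (auto simp: homogeneous_def lookup_wpart in_keys_iff)
next
  assume h: "wpart mdeg d f = f"
  show "homogeneous d f" unfolding homogeneous_def
  proof
    fix m assume "m \<in> Poly_Mapping.keys f"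
    then have "Poly_Mapping.lookup (wpart mdeg d f) m \<noteq> 0" by (simp add: h in_keys_iff)
    then show "mdeg m = d" by (auto simp: lookup_wpart split: if_splits)
  qed
qed

lemma homogeneous_wpart_mdeg: "homogeneous d (wpart mdeg d f)"
  by (simp add: homogeneous_iff wpart_wpart)

locale grading =
  fixes \<omega> :: "mon4 \<Rightarrow> nat"
  assumes plus: "\<omega> (m + n) = \<omega> m + \<omega> n"
begin

lemma zero: "\<omega> 0 = 0"
  using plus[of 0 0] by simp

lemma wpart_mult: "wpart \<omega> n (f * g) = (\<Sum>i\<le>n. wpart \<omega> i f * wpart \<omega> (n - i) g)"
proof (induction f rule: poly_single_induct)
  case (single m c)
  show ?case
  proof (induction g rule: poly_single_induct)
    case (single m' c')
    have "(\<Sum>i\<le>n. wpart \<omega> i (Poly_Mapping.single m c) * wpart \<omega> (n - i) (Poly_Mapping.single m' c')) =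
       (\<Sum>i\<le>n. if i = \<omega> m then (if \<omega> m' = n - i then Poly_Mapping.single (m + m') (c * c') else 0) else 0)"
      by (rule sum.cong) (auto simp: wpart_single mult_single)
    also have "\<dots> = wpart \<omega> n (Poly_Mapping.single m c * Poly_Mapping.single m' c')"
      by (auto simp: mult_single wpart_single plus)
    finally show ?case by simp
  qed (simp add: distrib_left wpart_add sum.distrib)
qed (simp add: distrib_right wpart_add sum.distrib)

text \<open>Initial forms multiply: in the convolution for weight a + b, every index other than a
  puts one of the two factors below its order.\<close>

lemma wpart_mult_lowest:
  assumes "vanishes \<omega> a f" "vanishes \<omega> b g"
  shows "wpart \<omega> (a + b) (f * g) = wpart \<omega> a f * wpart \<omega> b g"
proof -
  have "(\<Sum>i\<le>a + b. wpart \<omega> i f * wpart \<omega> (a + b - i) g) =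
      (\<Sum>i\<le>a + b. if i = a then wpart \<omega> a f * wpart \<omega> b g else 0)"
  proof (rule sum.cong)
    fix i assume "i \<in> {..a + b}"
    then show "wpart \<omega> i f * wpart \<omega> (a + b - i) g = (if i = a then wpart \<omega> a f * wpart \<omega> b g else 0)"
      using assms by (cases i a rule: linorder_cases) (auto simp: vanishes_def)
  qed simp
  then show ?thesis by (simp add: wpart_mult)
qed

lemma vanishes_mult:
  assumes "vanishes \<omega> a f" "vanishes \<omega> b g"
  shows "vanishes \<omega> (a + b) (f * g)"
  unfolding vanishes_def
proof (intro allI impI)
  fix j assume "j < a + b"
  then have "wpart \<omega> i f * wpart \<omega> (j - i) g = 0" if "i \<le> j" for i
    using assms that by (cases "i < a") (auto simp: vanishes_def)
  then show "wpart \<omega> j (f * g) = 0" unfolding wpart_mult by (intro sum.neutral) simp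
qed

lemma wpart_Const: "wpart \<omega> k (Const c) = (if k = 0 then Const c else 0)"
  by (simp add: Const_def wpart_single zero)

lemma wpart_1: "wpart \<omega> k 1 = (if k = 0 then 1 else 0)"
  using wpart_Const[of k 1] by simp

lemma wpart_pure_mult:
  assumes "wpart \<omega> a f = f" "wpart \<omega> b g = g"
  shows "wpart \<omega> (a + b) (f * g) = f * g"
proof -
  have "vanishes \<omega> k h" if "wpart \<omega> k h = h" for k h
    using wpart_wpart[of \<omega> _ k h] unfolding that by (simp add: vanishes_def)
  then show ?thesis using wpart_mult_lowest[of a f b g] assms by simp
qed

lemma wpart_pure_power: "wpart \<omega> a f = f \<Longrightarrow> wpart \<omega> (n * a) (f ^ n) = f ^ n"
  by (induction n) (simp_all add: wpart_1 wpart_pure_mult)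

lemma vanishes_any [simp]: "vanishes \<omega> 0 f"
  by (simp add: vanishes_def)

lemma vanishes_power: "vanishes \<omega> a f \<Longrightarrow> vanishes \<omega> (n * a) (f ^ n)"
  by (induction n) (simp_all add: vanishes_mult)

lemma wpart_power_lowest: "vanishes \<omega> a f \<Longrightarrow> wpart \<omega> (n * a) (f ^ n) = wpart \<omega> a f ^ n"
  by (induction n) (simp_all add: wpart_1 vanishes_power wpart_mult_lowest)

end

section \<open>Total degree, and order of vanishing at the base point\<close>

lemma mdeg_single: "mdeg (Poly_Mapping.single i n) = n"
  by (simp add: mdeg_def lookup_single when_def)

interpretation mdeg: grading mdeg
  by standard (simp add: mdeg_def lookup_add sum.distrib)

lemma homogeneous_Const: "homogeneous 0 (Const c)"
  by (simp add: homogeneous_iff mdeg.wpart_Const)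

lemma homogeneous_Var: "homogeneous 1 (Var i)"
  by (simp add: homogeneous_def Var_def mdeg_single)

lemma homogeneous_0 [simp]: "homogeneous d 0"
  by (simp add: homogeneous_def)

lemma homogeneous_add: "homogeneous d f \<Longrightarrow> homogeneous d g \<Longrightarrow> homogeneous d (f + g)"
  and homogeneous_diff: "homogeneous d f \<Longrightarrow> homogeneous d g \<Longrightarrow> homogeneous d (f - g)"
  and homogeneous_uminus: "homogeneous d f \<Longrightarrow> homogeneous d (- f)"
  and homogeneous_Const_mult: "homogeneous d f \<Longrightarrow> homogeneous d (Const c * f)"
  and homogeneous_numeral_mult: "homogeneous d f \<Longrightarrow> homogeneous d (numeral n * f)"
  by (simp_all add: homogeneous_iff wpart_add wpart_diff wpart_uminus wpart_Const_mult wpart_numeral_mult)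

lemma homogeneous_mult: "homogeneous d f \<Longrightarrow> homogeneous e g \<Longrightarrow> homogeneous (d + e) (f * g)"
  by (simp add: homogeneous_iff mdeg.wpart_pure_mult)

lemma homogeneous_power: "homogeneous d f \<Longrightarrow> homogeneous (n * d) (f ^ n)"
  by (simp add: homogeneous_iff mdeg.wpart_pure_power)

lemma homogeneous_sum: "(\<And>j. j \<in> J \<Longrightarrow> homogeneous d (f j)) \<Longrightarrow> homogeneous d (sum f J)"
  by (induction J rule: infinite_finite_induct) (simp_all add: homogeneous_add)

lemma wpart_mdeg_homogeneous: "homogeneous d f \<Longrightarrow> wpart mdeg k f = (if k = d then f else 0)"
  using wpart_wpart[of mdeg k d f] by (simp add: homogeneous_iff)

lemma homogeneous_0_iff: "homogeneous 0 f \<longleftrightarrow> (\<exists>c. f = Const c)"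
proof
  assume "homogeneous 0 f"
  then have "m = 0" if "m \<in> Poly_Mapping.keys f" for m
    using that by (intro mon4_eqI) (auto simp: homogeneous_def mdeg_def)
  then have "f = Const (Poly_Mapping.lookup f 0)"
    by (intro poly_mapping_eqI) (auto simp: Const_def lookup_single when_def in_keys_iff)
  then show "\<exists>c. f = Const c" ..
qed (auto simp: homogeneous_Const)

text \<open>\<open>Var 4\<close> is w, which does not vanish at the base point (0:0:0:1) and so has
  weight 0.\<close>

definition xdeg :: "mon4 \<Rightarrow> nat" where
  "xdeg m = Poly_Mapping.lookup m 1 + Poly_Mapping.lookup m 2 + Poly_Mapping.lookup m 3"

interpretation xdeg: grading xdeg
  by standard (simp add: xdeg_def lookup_add)

lemma xdeg_single: "xdeg (Poly_Mapping.single i n) = (if i = 4 then 0 else n)"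
  using exhaust_4[of i] by (auto simp: xdeg_def lookup_single when_def)

lemma wpart_xdeg_Var:
  "wpart xdeg k (Var i) = (if k = (if i = 4 then 0 else 1) then Var i else 0)"
  unfolding Var_def wpart_single by (auto simp: xdeg_single)

lemma Var_in_I_pt: "i \<noteq> 4 \<Longrightarrow> Var i \<in> I_pt"
  unfolding I_pt_def ideal_gen_def using exhaust_4[of i] by (intro S_mod.span_base) auto

lemma I_pt_vanishes: "f \<in> I_pt \<Longrightarrow> vanishes xdeg 1 f"
  unfolding I_pt_def ideal_gen_def
proof (induction rule: S_mod.span_induct_alt)
  case (step c x y)
  then have "vanishes xdeg (0 + 1) (c * x)"
    by (intro xdeg.vanishes_mult) (auto simp: vanishes_def wpart_xdeg_Var)
  then show ?case using step by (simp add: vanishes_add)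
qed simp

lemma ideal_power_subset: "J \<subseteq> ideal_power J 1"
  unfolding ideal_power_def ideal_gen_def power_one_right by (rule S_mod.span_superset)

lemma ideal_power_add: "f \<in> ideal_power J k \<Longrightarrow> g \<in> ideal_power J k \<Longrightarrow> f + g \<in> ideal_power J k"
  unfolding ideal_power_def ideal_gen_def by (rule S_mod.span_add)

lemma ideal_power_0 [simp]: "ideal_power J 0 = UNIV"
proof -
  have "f * 1 \<in> ideal_power J 0" for f
    unfolding ideal_power_def ideal_gen_def by (intro S_mod.span_scale S_mod.span_base) simp
  then show ?thesis by auto
qed

lemma ideal_power_zero: "0 \<in> ideal_power J k"
  unfolding ideal_power_def ideal_gen_def by (rule S_mod.span_zero)

lemma ideal_power_sum: "(\<And>j. j \<in> K \<Longrightarrow> f j \<in> ideal_power J k) \<Longrightarrow> sum f K \<in> ideal_power J k"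
  by (induction K rule: infinite_finite_induct) (simp_all add: ideal_power_zero ideal_power_add)

text \<open>Both sides are spanned by the monomials of degree at least k in x, y, z; such a monomial
  is written as a product of k variables and a rest by splitting off one of x, y, z at a
  time.\<close>

lemma ideal_power_I_pt_iff: "f \<in> ideal_power I_pt k \<longleftrightarrow> vanishes xdeg k f"
proof
  have J: "vanishes xdeg k x" if "x \<in> I_pt ^ k" for x
    using that
  proof (induction k arbitrary: x)
    case (Suc k)
    then obtain a b where "x = a * b" "a \<in> I_pt" "b \<in> I_pt ^ k"
      by (auto simp: set_times_def)
    then show ?case using xdeg.vanishes_mult[of 1 a k b] Suc.IH I_pt_vanishes by simp
  qed simp
  assume "f \<in> ideal_power I_pt k"
  then show "vanishes xdeg k f" unfolding ideal_power_def ideal_gen_def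
  proof (induction rule: S_mod.span_induct_alt)
    case (step c x y)
    then show ?case using xdeg.vanishes_mult[of 0 c k x] by (simp add: vanishes_add J)
  qed simp
next
  have mon: "Poly_Mapping.single m c \<in> ideal_power I_pt k" if "k \<le> xdeg m" for m c
    using that
  proof (induction k arbitrary: m)
    case (Suc k)
    have "Poly_Mapping.lookup m 1 \<noteq> 0 \<or> Poly_Mapping.lookup m 2 \<noteq> 0 \<or> Poly_Mapping.lookup m 3 \<noteq> 0"
      using Suc.prems unfolding xdeg_def by linarith
    moreover have "(1 :: 4) \<noteq> 4" "(2 :: 4) \<noteq> 4" "(3 :: 4) \<noteq> 4" by simp_all
    ultimately obtain i where i: "i \<noteq> 4" "Poly_Mapping.lookup m i \<noteq> 0"
      by metis
    define n where "n = m - Poly_Mapping.single i 1"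
    have m: "m = Poly_Mapping.single i 1 + n"
      using i(2) by (intro mon4_eqI) (auto simp: n_def lookup_add lookup_minus lookup_single when_def)
    have "xdeg (Poly_Mapping.single i 1) = 1"
      using i(1) by (simp add: xdeg_single)
    then have "k \<le> xdeg n" using Suc.prems unfolding m xdeg.plus by simp
    then have "Var i * Poly_Mapping.single n c \<in> ideal_power I_pt (1 + k)"
      using Var_in_I_pt[OF i(1)] ideal_power_subset by (intro ideal_power_mult Suc.IH) auto
    then show ?case by (simp add: Var_def mult_single m)
  qed simp
  assume "vanishes xdeg k f"
  then have "(\<Sum>m\<in>Poly_Mapping.keys f. Poly_Mapping.single m (Poly_Mapping.lookup f m)) \<in> ideal_power I_pt k"
    by (intro ideal_power_sum mon) (simp add: vanishes_iff_keys)
  then show "f \<in> ideal_power I_pt k" by (simp only: poly_sum_single)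
qed


section \<open>Derivatives\<close>

lemma partial_superset:
  assumes "finite K" "Poly_Mapping.keys f \<subseteq> K"
  shows "partial i f = (\<Sum>m\<in>K. Poly_Mapping.single (m - Poly_Mapping.single i 1)
       (of_nat (Poly_Mapping.lookup m i) * Poly_Mapping.lookup f m))"
  unfolding partial_def using assms
  by (intro sum.mono_neutral_left) (auto simp: in_keys_iff)

lemma partial_add: "partial i (f + g) = partial i f + partial i g"
proof -
  let ?K = "Poly_Mapping.keys f \<union> Poly_Mapping.keys g"
  have "Poly_Mapping.keys (f + g) \<subseteq> ?K" by (rule Poly_Mapping.keys_add)
  then show ?thesis
    by (simp add: partial_superset[of ?K] lookup_add ring_distribs single_add sum.distrib)
qed

lemma partial_single:
  "partial i (Poly_Mapping.single m c) =
    Poly_Mapping.single (m - Poly_Mapping.single i 1) (of_nat (Poly_Mapping.lookup m i) * c)"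
  by (subst partial_superset[of "{m}"]) auto

lemma partial_mult: "partial i (f * g) = partial i f * g + f * partial i g"
proof (induction f rule: poly_single_induct)
  case (single m c)
  show ?case
  proof (induction g rule: poly_single_induct)
    case (single n d)
    let ?e = "Poly_Mapping.single i (1 :: nat)"
    have *: "k + l - ?e = (k - ?e) + l" if "Poly_Mapping.lookup k i \<noteq> 0" for k l :: mon4
      using that by (intro mon4_eqI) (auto simp: lookup_add lookup_minus lookup_single when_def)
    show ?case
      using *[of m n] *[of n m]
      by (cases "Poly_Mapping.lookup m i = 0"; cases "Poly_Mapping.lookup n i = 0")
        (auto simp: mult_single partial_single lookup_add ring_distribs add.commute single_add ac_simps)
  qed (simp add: partial_add algebra_simps)
qed (simp add: partial_add algebra_simps)

lemma partial_Const [simp]: "partial i (Const c) = 0"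
  by (simp add: Const_def partial_single)

lemma partial_0 [simp]: "partial i 0 = 0"
  using partial_Const[of i 0] by simp

lemma partial_1 [simp]: "partial i 1 = 0"
  using partial_Const[of i 1] by simp

lemma partial_numeral [simp]: "partial i (numeral n) = 0"
  using partial_Const[of i "numeral n"] by simp

lemma partial_Var: "partial i (Var j) = (if i = j then 1 else 0)"
  unfolding Var_def partial_single by (auto simp: lookup_single when_def)

lemma partial_uminus: "partial i (- f) = - partial i f"
  using partial_add[of i f "- f"] by (simp add: eq_neg_iff_add_eq_0 add.commute)

lemma partial_diff: "partial i (f - g) = partial i f - partial i g"
  using partial_add[of i f "- g"] by (simp add: partial_uminus)

lemma partial_sum: "partial i (sum f J) = (\<Sum>j\<in>J. partial i (f j))"
  by (induction J rule: infinite_finite_induct) (simp_all add: partial_add)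

lemma partial_power: "partial i (f ^ n) = of_nat n * f ^ (n - 1) * partial i f"
proof (induction n)
  case (Suc n)
  have "partial i (f ^ Suc n) = partial i f * f ^ n + f * (of_nat n * f ^ (n - 1) * partial i f)"
    by (simp only: power_Suc partial_mult Suc)
  also have "f * (of_nat n * f ^ (n - 1) * partial i f) = of_nat n * f ^ n * partial i f"
  proof (cases n)
    case (Suc k)
    show ?thesis unfolding Suc by (simp only: diff_Suc_1 power_Suc mult_ac)
  qed simp
  also have "partial i f * f ^ n + of_nat n * f ^ n * partial i f = of_nat (Suc n) * f ^ (Suc n - 1) * partial i f"
    by (simp only: of_nat_Suc ring_distribs mult_1 mult_1_right diff_Suc_1 mult_ac add_ac)
  finally show ?case .
qed simp

lemma partial_Const_mult: "partial i (Const c * f) = Const c * partial i f"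
  by (simp add: partial_mult)

lemma partial_subst:
  "partial j (subst h f) = (\<Sum>i\<in>UNIV. subst h (partial i f) * partial j (h i))"
proof (induction f rule: poly4_induct)
  case (Var k)
  have "(\<Sum>i\<in>UNIV. subst h (partial i (Var k)) * partial j (h i)) = (\<Sum>i\<in>UNIV. if i = k then partial j (h i) else 0)"
    by (rule sum.cong) (auto simp: partial_Var subst_0)
  then show ?case by simp
next
  case (add f g)
  then show ?case by (simp add: subst_add partial_add distrib_right sum.distrib)
next
  case (mult f g)
  have "subst h (partial i (f * g)) * partial j (h i) =
      subst h g * (subst h (partial i f) * partial j (h i)) + subst h f * (subst h (partial i g) * partial j (h i))" for i
    unfolding subst_hom partial_mult by Groebner_Basis.algebra
  then have "(\<Sum>i\<in>UNIV. subst h (partial i (f * g)) * partial j (h i)) =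
      subst h g * partial j (subst h f) + subst h f * partial j (subst h g)"
    unfolding mult by (simp only: sum.distrib sum_distrib_left)
  then show ?case by (simp only: subst_mult partial_mult mult.commute add.commute)
qed (simp add: subst_Const subst_0)

lemma euler: "homogeneous d f \<Longrightarrow> (\<Sum>i\<in>UNIV. Var i * partial i f) = of_nat d * f"
proof -
  have mon: "(\<Sum>i\<in>UNIV. Var i * partial i (Poly_Mapping.single m c)) = of_nat (mdeg m) * Poly_Mapping.single m c" for m c
  proof -
    have "Var i * partial i (Poly_Mapping.single m c) = of_nat (Poly_Mapping.lookup m i) * Poly_Mapping.single m c" for i
    proof (cases "Poly_Mapping.lookup m i = 0")
      case False
      then have "Poly_Mapping.single i 1 + (m - Poly_Mapping.single i 1) = m"
        by (intro mon4_eqI) (auto simp: lookup_add lookup_minus lookup_single when_def)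
      moreover have "of_nat k * Poly_Mapping.single m c = Poly_Mapping.single m (of_nat k * c)" for k
        by (simp only: Const_of_nat[symmetric] Const_def mult_single add_0)
      ultimately show ?thesis
        unfolding Var_def partial_single mult_single mult_1 by simp
    qed (simp add: partial_single)
    then show ?thesis by (simp add: mdeg_def sum_distrib_right)
  qed
  assume "homogeneous d f"
  then have "(\<Sum>i\<in>UNIV. Var i * partial i (\<Sum>m\<in>K. Poly_Mapping.single m (Poly_Mapping.lookup f m))) =
      of_nat d * (\<Sum>m\<in>K. Poly_Mapping.single m (Poly_Mapping.lookup f m))"
    if "K \<subseteq> Poly_Mapping.keys f" for K
    using that mon
    by (induction K rule: infinite_finite_induct)
      (auto simp: partial_add distrib_left sum.distrib homogeneous_def)
  from this[of "Poly_Mapping.keys f"] show ?thesis by (simp only: poly_sum_single)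
qed

lemma homogeneous_partial: "homogeneous (Suc d) f \<Longrightarrow> homogeneous d (partial i f)"
  unfolding homogeneous_def
proof
  fix m assume h: "\<forall>m\<in>Poly_Mapping.keys f. mdeg m = Suc d" and m: "m \<in> Poly_Mapping.keys (partial i f)"
  have "Poly_Mapping.lookup (partial i f) m \<noteq> 0" using m by (simp add: in_keys_iff)
  then obtain n where n: "n \<in> Poly_Mapping.keys f"
     "Poly_Mapping.lookup (Poly_Mapping.single (n - Poly_Mapping.single i 1)
       (of_nat (Poly_Mapping.lookup n i) * Poly_Mapping.lookup f n)) m \<noteq> 0"
    unfolding partial_def lookup_sum by (rule sum.not_neutral_contains_not_neutral)
  then have "m = n - Poly_Mapping.single i 1" "Poly_Mapping.lookup n i \<noteq> 0"
    by (auto simp: lookup_single when_def split: if_splits)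
  then have "n = Poly_Mapping.single i 1 + m"
    by (intro mon4_eqI) (auto simp: lookup_add lookup_minus lookup_single when_def)
  moreover have "mdeg n = Suc d" using h n(1) by blast
  ultimately show "mdeg m = d" by (simp add: mdeg.plus mdeg_single)
qed

text \<open>Differentiation is compatible with taking components, so by Euler's identity k times the
  component of degree k is 0; in characteristic zero only degree 0 survives.\<close>

lemma poly_const_if_partial_0:
  assumes "\<And>i. partial i f = 0"
  shows "\<exists>c. f = Const c"
proof -
  have "wpart mdeg k f = 0" if "k \<noteq> 0" for k
  proof -
    have "partial i (wpart mdeg (Suc n) f) = wpart mdeg n (partial i f)" for i n
    proof (induction f rule: poly_single_induct)
      case (single m c)
      show ?case
      proof (cases "Poly_Mapping.lookup m i = 0")
        case False
        then have "m = Poly_Mapping.single i 1 + (m - Poly_Mapping.single i 1)"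
          by (intro mon4_eqI) (auto simp: lookup_add lookup_minus lookup_single when_def)
        then have "mdeg m = Suc (mdeg (m - Poly_Mapping.single i 1))"
          by (metis mdeg.plus mdeg_single plus_1_eq_Suc)
        then show ?thesis by (simp add: wpart_single partial_single)
      qed (auto simp add: wpart_single partial_single)
    qed (simp add: wpart_add partial_add)
    then have "partial i (wpart mdeg k f) = 0" for i
      using assms that by (cases k) auto
    then have "of_nat k * wpart mdeg k f = 0"
      using euler[OF homogeneous_wpart_mdeg, of k f] by simp
    then show ?thesis using that by simp
  qed
  then have "wpart mdeg k (f - wpart mdeg 0 f) = 0" for k
    by (simp add: wpart_diff wpart_wpart)
  then have "f = wpart mdeg 0 f" using wpart_eq_0I by (metis eq_iff_diff_eq_0)
  then show ?thesis using homogeneous_wpart_mdeg homogeneous_0_iff by metis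
qed

lemma homogeneous_laplacian: "homogeneous (Suc (Suc d)) f \<Longrightarrow> homogeneous d (laplacian f)"
  unfolding laplacian_def by (intro homogeneous_sum homogeneous_partial)

section \<open>The linear action on polynomials\<close>

lemma act_hom: "act g 0 = 0" "act g 1 = 1" "act g (Const c) = Const c" "act g (f + f') = act g f + act g f'"
  "act g (f * f') = act g f * act g f'" "act g (- f) = - act g f" "act g (f - f') = act g f - act g f'"
  "act g (f ^ n) = act g f ^ n" "act g (numeral k) = numeral k"
  by (simp_all add: act_def subst_hom)

lemma act_sum: "act g (sum f J) = (\<Sum>j\<in>J. act g (f j))"
  by (simp add: act_def subst_sum)

lemma act_prod: "act g (prod f J) = (\<Prod>j\<in>J. act g (f j))"
  by (simp add: act_def subst_prod)

lemma act_Var: "act g (Var i) = (\<Sum>j\<in>UNIV. Const (complex_of_real (g (axis i 1) $ j)) * Var j)"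
  by (simp add: act_def)

lemma partial_act:
  "partial j (act g f) = (\<Sum>i\<in>UNIV. Const (complex_of_real (g (axis i 1) $ j)) * act g (partial i f))"
proof -
  have "partial j (\<Sum>k\<in>UNIV. Const (complex_of_real (g (axis i 1) $ k)) * Var k) =
      Const (complex_of_real (g (axis i 1) $ j))" for i
  proof -
    have "partial j (\<Sum>k\<in>UNIV. Const (complex_of_real (g (axis i 1) $ k)) * Var k) =
      (\<Sum>k\<in>UNIV. if k = j then Const (complex_of_real (g (axis i 1) $ k)) else 0)"
      unfolding partial_sum by (rule sum.cong) (auto simp: partial_Const_mult partial_Var)
    then show ?thesis by simp
  qed
  then show ?thesis by (simp add: act_def partial_subst mult.commute)
qed

lemma homogeneous_act: "homogeneous d f \<Longrightarrow> homogeneous d (act g f)"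
proof -
  have V: "homogeneous 1 (act g (Var i))" for i
    unfolding act_Var by (intro homogeneous_sum homogeneous_Const_mult homogeneous_Var)
  have mon: "homogeneous (mdeg m) (act g (Poly_Mapping.single m c))" for m c
  proof -
    have "homogeneous (\<Sum>i\<in>J. Poly_Mapping.lookup m i * 1) (\<Prod>i\<in>J. act g (Var i) ^ Poly_Mapping.lookup m i)" for J
    proof (induction J rule: infinite_finite_induct)
      case (insert i J)
      then show ?case using homogeneous_mult[OF homogeneous_power[OF V]] by simp
    qed (use homogeneous_Const[of 1] in auto)
    from homogeneous_Const_mult[OF this[of UNIV]] show ?thesis
      by (simp add: single_eq_monomial act_hom act_prod mdeg_def)
  qed
  assume h: "homogeneous d f"
  have "homogeneous d (act g (\<Sum>m\<in>Poly_Mapping.keys f. Poly_Mapping.single m (Poly_Mapping.lookup f m)))"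
    unfolding act_sum using mon h by (intro homogeneous_sum) (metis homogeneous_def)
  then show ?thesis by (simp only: poly_sum_single)
qed

text \<open>Linear substitutions preserve degree. Hence the homogeneous components of an invariant
  are invariant, which \<open>generates\<close> needs for inhomogeneous elements of the
  filtration.\<close>

lemma wpart_mdeg_act: "wpart mdeg k (act g f) = act g (wpart mdeg k f)"
proof -
  obtain N where "\<forall>m\<in>Poly_Mapping.keys f. mdeg m \<le> N" using wpart_bounded by blast
  then have f: "(\<Sum>j\<le>N. wpart mdeg j f) = f" by (simp add: sum_wpart)
  have "wpart mdeg k (act g (wpart mdeg j f)) = act g (wpart mdeg k (wpart mdeg j f))" for j
    using wpart_mdeg_homogeneous[OF homogeneous_act[OF homogeneous_wpart_mdeg]]
    by (simp add: wpart_wpart act_hom)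
  then have "wpart mdeg k (act g (\<Sum>j\<le>N. wpart mdeg j f)) = act g (wpart mdeg k (\<Sum>j\<le>N. wpart mdeg j f))"
    by (simp only: act_sum wpart_sum)
  then show ?thesis by (simp only: f)
qed

section \<open>The root system and its reflection group\<close>

text \<open>
  The pair \<open>(a, b)\<close> of integers encodes the number \<open>a + b \<phi>\<close>; a root \<open>r\<close> is encoded by the
  coordinates of \<open>2 r\<close>, which are all of this form.
\<close>

type_synonym zphi = "int \<times> int"
type_synonym zvec = "zphi \<times> zphi \<times> zphi \<times> zphi"

definition zval :: "zphi \<Rightarrow> real" where
  "zval z = of_int (fst z) + of_int (snd z) * golden"

definition rvec :: "zvec \<Rightarrow> real ^ 4" where
  "rvec = (\<lambda>(a, b, c, d). \<chi> i. (if i = 1 then zval a else if i = 2 then zval b else if i = 3 then zval c else zval d) / 2)"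

text \<open>Multiplication in \<int>[\<phi>]: by \<phi>^2 = \<phi> + 1 the product of the
  \<phi>-parts contributes to both coordinates.\<close>

definition zmul :: "zphi \<Rightarrow> zphi \<Rightarrow> zphi" where
  "zmul = (\<lambda>(a, b) (c, d). (a * c + b * d, a * d + b * c + b * d))"

definition zadd :: "zphi \<Rightarrow> zphi \<Rightarrow> zphi" where
  "zadd = (\<lambda>(a, b) (c, d). (a + c, b + d))"

definition zneg :: "zphi \<Rightarrow> zphi" where
  "zneg = (\<lambda>(a, b). (- a, - b))"

definition zdot :: "zvec \<Rightarrow> zvec \<Rightarrow> zphi" where
  "zdot = (\<lambda>(a, b, c, d) (a', b', c', d'). zadd (zadd (zmul a a') (zmul b b')) (zadd (zmul c c') (zmul d d')))"

definition zhalf :: "zphi \<Rightarrow> zphi" where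
  "zhalf = (\<lambda>(a, b). (a div 2, b div 2))"

text \<open>As A and V encode 2 r and 2 v, \<open>zdot A V\<close> is 4 (v \<bullet> r), so the
  coefficient 2 (v \<bullet> r) of the reflection in a unit root r is half of it. The integer
  division in \<open>zhalf\<close> is exact under the parity conditions of
  \<open>refl_ok\<close>.\<close>

definition zrefl :: "zvec \<Rightarrow> zvec \<Rightarrow> zvec" where
  "zrefl A V = (let h = zneg (zhalf (zdot A V)) in
     case (A, V) of ((a, b, c, d), (a', b', c', d')) \<Rightarrow>
       (zadd a' (zmul h a), zadd b' (zmul h b), zadd c' (zmul h c), zadd d' (zmul h d)))"

text \<open>Zero is listed once, so that \<open>roots\<close> has no repetitions and sums over the
  list are sums over the set.\<close>

definition sgns :: "zphi \<Rightarrow> zphi list" where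
  "sgns z = (if z = (0, 0) then [z] else [z, zneg z])"

definition signed :: "zvec \<Rightarrow> zvec list" where
  "signed = (\<lambda>(a, b, c, d). [(a', b', c', d'). a' \<leftarrow> sgns a, b' \<leftarrow> sgns b, c' \<leftarrow> sgns c, d' \<leftarrow> sgns d])"

text \<open>One vector from each orbit of the sign changes; \<open>(-1, 1)\<close> encodes \<open>\<phi>\<inverse> = \<phi> - 1\<close>.\<close>

definition root_bases :: "zvec list" where
  "root_bases = (let z = (0, 0); i = (1, 0); j = (0, 1); k = (-1, 1); l = (2, 0) in
    [(l, z, z, z), (z, l, z, z), (z, z, l, z), (z, z, z, l), (i, i, i, i),
     (j, i, k, z), (j, k, z, i), (j, z, i, k), (i, j, z, k), (i, k, j, z), (i, z, k, j),
     (k, j, i, z), (k, i, z, j), (k, z, j, i), (z, j, k, i), (z, i, j, k), (z, k, i, j)])"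

definition roots :: "zvec list" where
  "roots = concat (map signed root_bases)"

text \<open>
  Together with the sign changes, the reflections in these three roots already act transitively
  on all roots, so it suffices to follow the vectors up to sign changes.
\<close>

definition gen_roots :: "zvec list" where
  "gen_roots = [((1, -1), (0, -1), (-1, 0), (0, 0)), ((0, -1), (0, 0), (-1, 0), (-1, 1)),
     ((1, 0), (1, 0), (-1, 0), (1, 0))]"

text \<open>The four listed values are -1, -\<phi>, -\<phi>^-1 and -2, the negatives of the nonzero
  coordinates in \<open>root_bases\<close>. What matters is equality up to sign,
  \<open>zabs_cases\<close>.\<close>

definition zabs :: "zphi \<Rightarrow> zphi" where
  "zabs z = (if List.member [(-1, 0), (0, -1), (1, -1), (-2, 0)] z then zneg z else z)"

definition vabs :: "zvec \<Rightarrow> zvec" where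
  "vabs = (\<lambda>(a, b, c, d). (zabs a, zabs b, zabs c, zabs d))"

text \<open>
  The auxiliary constants below replace abstractions, whose bodies the evaluation by rewriting
  would expand symbolically.
\<close>

definition unit_root :: "zvec \<Rightarrow> bool" where
  "unit_root A \<longleftrightarrow> zdot A A = (4, 0)"

definition refl_ok :: "zvec \<Rightarrow> zvec \<Rightarrow> bool" where
  "refl_ok A V \<longleftrightarrow> even (fst (zdot A V)) \<and> even (snd (zdot A V)) \<and> List.member root_bases (vabs (zrefl A V))"

definition gen_ok :: "zvec \<Rightarrow> bool" where
  "gen_ok A \<longleftrightarrow> List.member root_bases (vabs A) \<and> list_all (refl_ok A) roots"

definition refl_by :: "zvec \<Rightarrow> zvec \<Rightarrow> zvec" where
  "refl_by v A = vabs (zrefl A v)"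

definition neighbours :: "zvec \<Rightarrow> zvec list" where
  "neighbours v = map (refl_by v) gen_roots"

definition fresh :: "zvec list \<Rightarrow> zvec \<Rightarrow> bool" where
  "fresh seen v \<longleftrightarrow> \<not> List.member seen v"

definition next_layer :: "zvec list \<Rightarrow> zvec list \<Rightarrow> zvec list" where
  "next_layer seen new = remdups (filter (fresh seen) (concat (map neighbours new)))"

text \<open>Breadth-first search modulo signs with a bound on the number of layers; the first list
  collects everything seen, the second is the last layer.\<close>

fun orbit_steps :: "nat \<Rightarrow> zvec list \<times> zvec list \<Rightarrow> zvec list" where
  "orbit_steps 0 (seen, new) = seen"
| "orbit_steps (Suc n) (seen, new) = orbit_steps n (seen @ next_layer seen new, next_layer seen new)"

definition root_e1 :: zvec where
  "root_e1 = ((2, 0), (0, 0), (0, 0), (0, 0))"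

section \<open>Facts about the list of roots that are checked by evaluation\<close>

lemma distinct_roots: "distinct roots"
  by code_simp

lemma unit_roots: "list_all unit_root roots"
  by code_simp

text \<open>The first four entries of \<open>root_bases\<close> are the coordinate axes, whose
  reflections are the sign changes. Closure is checked for these and for the three generating roots;
  \<open>reflection_image\<close> transfers it to the other roots by conjugation.\<close>

lemma closed_roots: "list_all gen_ok (take 4 root_bases @ gen_roots)"
  by code_simp

lemma roots_orbit: "list_all (List.member (orbit_steps 5 ([root_e1], [root_e1]))) root_bases"
  by code_simp

section \<open>Arithmetic of the golden ratio, and the encoded list as the root system\<close>

lemma golden_square: "golden * golden = golden + 1"
proof -
  have "sqrt 5 * sqrt 5 = (5 :: real)" by simp
  then show ?thesis unfolding golden_def by (simp add: algebra_simps add_divide_distrib)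
qed

lemma inverse_golden: "inverse golden = golden - 1"
proof -
  have "golden * (golden - 1) = 1" using golden_square by (simp add: algebra_simps)
  then show ?thesis by (metis inverse_unique)
qed

text \<open>Makes the integer encoding injective: a + b \<phi> = 0 forces a = b = 0.\<close>

lemma golden_irrational: "golden \<notin> \<rat>"
proof
  assume "golden \<in> \<rat>"
  then have "2 * golden - 1 \<in> \<rat>" by simp
  moreover have "2 * golden - 1 = sqrt 5" by (simp add: golden_def field_simps)
  ultimately have "sqrt 5 \<in> \<rat>" by simp
  then obtain m n :: nat where mn: "n \<noteq> 0" "\<bar>sqrt 5\<bar> = real m / real n" "coprime m n"
    by (rule Rats_abs_nat_div_natE)
  have "real m = sqrt 5 * real n" using mn(1,2) by (simp add: field_simps)
  then have "real m ^ 2 = 5 * real n ^ 2" by (simp add: power_mult_distrib)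
  then have "real (m ^ 2) = real (5 * n ^ 2)" by simp
  then have eq: "m ^ 2 = 5 * n ^ 2" by (simp only: of_nat_eq_iff)
  have p: "prime (5 :: nat)" by simp
  have "5 dvd m ^ 2" using eq by simp
  then have m: "5 dvd m" using p prime_dvd_power by blast
  then obtain k where "m = 5 * k" by blast
  then have "n ^ 2 = 5 * k ^ 2" using eq by (simp add: power_mult_distrib)
  then have "5 dvd n ^ 2" by simp
  then have "5 dvd n" using p prime_dvd_power by blast
  then have "(5 :: nat) dvd 1" using m mn(3) by (meson coprime_common_divisor)
  then show False by simp
qed

lemma zval_eq_0: "zval z = 0 \<longleftrightarrow> z = (0, 0)"
proof
  assume z: "zval z = 0"
  obtain a b where ab: "z = (a, b)" by (cases z)
  have "b = 0"
  proof (rule ccontr)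
    assume "b \<noteq> 0"
    then have "golden = - of_int a / of_int b" using z by (simp add: zval_def ab field_simps)
    moreover have "- real_of_int a / of_int b \<in> \<rat>" by simp
    ultimately show False using golden_irrational by metis
  qed
  then show "z = (0, 0)" using z by (simp add: zval_def ab)
qed (simp add: zval_def)

lemma zval_hom: "zval (zadd x y) = zval x + zval y" "zval (zneg x) = - zval x" "zval (zmul x y) = zval x * zval y"
proof -
  have g: "golden * (golden * t) = golden * t + t" for t
    by (metis distrib_right golden_square mult.assoc mult_1)
  show "zval (zmul x y) = zval x * zval y"
    by (cases x; cases y) (simp add: zval_def zmul_def algebra_simps g golden_square)
qed (cases x; cases y; simp add: zval_def zadd_def zneg_def algebra_simps)+

lemma zval_inj: "zval x = zval y \<Longrightarrow> x = y"
  using zval_eq_0[of "zadd x (zneg y)"]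
  by (cases x; cases y) (simp add: zval_hom, simp add: zadd_def zneg_def)

lemma rvec_nth: "rvec (a, b, c, d) $ 1 = zval a / 2" "rvec (a, b, c, d) $ 2 = zval b / 2"
  "rvec (a, b, c, d) $ 3 = zval c / 2" "rvec (a, b, c, d) $ 4 = zval d / 2"
  by (simp_all add: rvec_def)

lemma vec4_eq_iff: "v = w \<longleftrightarrow> v $ 1 = w $ 1 \<and> v $ 2 = w $ 2 \<and> v $ 3 = w $ 3 \<and> v $ 4 = (w :: 'a ^ 4) $ 4"
  by (simp add: vec_eq_iff forall_4)

lemma inj_rvec: "inj rvec"
  by (rule injI) (auto simp: vec4_eq_iff rvec_nth dest: zval_inj)

lemma inner_rvec: "rvec A \<bullet> rvec V = zval (zdot A V) / 4"
  by (cases A; cases V) (simp add: inner_vec_def sum_4 rvec_nth zdot_def zval_hom)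

lemma reflection_rvec:
  assumes "zdot A A = (4, 0)" "even (fst (zdot A V))" "even (snd (zdot A V))"
  shows "reflection (rvec A) (rvec V) = rvec (zrefl A V)"
proof -
  have h: "zval (zhalf (zdot A V)) = zval (zdot A V) / 2"
    using assms(2,3) by (auto simp: zval_def zhalf_def split: prod.splits elim!: evenE)
  have u: "rvec A \<bullet> rvec A = 1"
    unfolding inner_rvec assms(1) by (simp add: zval_def)
  have "rvec V \<bullet> rvec A = zval (zdot A V) / 4"
    by (metis inner_commute inner_rvec)
  then have r: "reflection (rvec A) (rvec V) = rvec V - (zval (zdot A V) / 2) *\<^sub>R rvec A"
    by (simp add: reflection_def u)
  obtain a b c d where A: "A = (a, b, c, d)" by (cases A)
  obtain a' b' c' d' where V: "V = (a', b', c', d')" by (cases V)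
  show ?thesis
    unfolding r zrefl_def Let_def unfolding A V
    by (simp add: vec4_eq_iff rvec_nth zval_hom h[unfolded A V] field_simps)
qed

lemma set_signed:
  "v \<in> rvec ` set (signed (a, b, c, d)) \<longleftrightarrow>
    (v $ 1 = zval a / 2 \<or> v $ 1 = - zval a / 2) \<and> (v $ 2 = zval b / 2 \<or> v $ 2 = - zval b / 2) \<and>
    (v $ 3 = zval c / 2 \<or> v $ 3 = - zval c / 2) \<and> (v $ 4 = zval d / 2 \<or> v $ 4 = - zval d / 2)"
proof -
  have s: "(x = zval z / 2 \<or> x = - zval z / 2) \<longleftrightarrow> (\<exists>y\<in>set (sgns z). x = zval y / 2)" for x z
    by (cases "z = (0, 0)") (auto simp: sgns_def zval_hom zval_eq_0)
  have "set (signed (a, b, c, d)) = set (sgns a) \<times> set (sgns b) \<times> set (sgns c) \<times> set (sgns d)"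
    by (auto simp: signed_def)
  moreover have "v = rvec (a', b', c', d') \<longleftrightarrow>
      v $ 1 = zval a' / 2 \<and> v $ 2 = zval b' / 2 \<and> v $ 3 = zval c' / 2 \<and> v $ 4 = zval d' / 2" for a' b' c' d'
    by (simp add: vec4_eq_iff rvec_nth)
  ultimately show ?thesis unfolding s by (simp add: image_iff Bex_def) blast
qed

definition tup4 :: "4 \<Rightarrow> 4 \<Rightarrow> 4 \<Rightarrow> 4 \<Rightarrow> 4 \<Rightarrow> 4" where
  "tup4 a b c d = (\<lambda>i. if i = 1 then a else if i = 2 then b else if i = 3 then c else d)"

lemma tup4_simps [simp]: "tup4 a b c d 1 = a" "tup4 a b c d 2 = b" "tup4 a b c d 3 = c" "tup4 a b c d 4 = d"
  by (simp_all add: tup4_def)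

lemma tup4_eta: "tup4 (p 1) (p 2) (p 3) (p 4) = p"
  by (simp add: fun_eq_iff forall_4)

lemma bij_tup4: "distinct [a, b, c, d] \<Longrightarrow> bij (tup4 a b c d)"
proof -
  assume "distinct [a, b, c, d]"
  then have "x = y" if "tup4 a b c d x = tup4 a b c d y" for x y
    using that exhaust_4[of x] exhaust_4[of y] by auto
  then have "inj (tup4 a b c d)" by (rule injI)
  then show ?thesis by (simp add: bij_def finite_UNIV_inj_surj)
qed

lemma permutation_tup4: "distinct [a, b, c, d] \<Longrightarrow> permutation (tup4 a b c d)"
  by (simp add: permutation bij_tup4)

lemma tup4_swap:
  assumes "distinct [a, b, c, d]"
  shows "evenperm (tup4 b a c d) \<longleftrightarrow> \<not> evenperm (tup4 a b c d)"
    and "evenperm (tup4 a c b d) \<longleftrightarrow> \<not> evenperm (tup4 a b c d)"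
    and "evenperm (tup4 a b d c) \<longleftrightarrow> \<not> evenperm (tup4 a b c d)"
proof -
  have *: "evenperm (tup4 a b c d \<circ> Transposition.transpose i j) \<longleftrightarrow> \<not> evenperm (tup4 a b c d)" if "i \<noteq> j" for i j
    using that evenperm_comp[OF permutation_tup4[OF assms] permutation_swap_id] by (simp add: evenperm_swap)
  have "tup4 b a c d = tup4 a b c d \<circ> Transposition.transpose 1 2" "tup4 a c b d = tup4 a b c d \<circ> Transposition.transpose 2 3"
    "tup4 a b d c = tup4 a b c d \<circ> Transposition.transpose 3 4"
    by (simp_all add: fun_eq_iff forall_4 Transposition.transpose_def)
  then show "evenperm (tup4 b a c d) \<longleftrightarrow> \<not> evenperm (tup4 a b c d)"
    "evenperm (tup4 a c b d) \<longleftrightarrow> \<not> evenperm (tup4 a b c d)"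
    "evenperm (tup4 a b d c) \<longleftrightarrow> \<not> evenperm (tup4 a b c d)"
    by (simp_all add: *)
qed

lemma evenperm_tup4_id: "evenperm (tup4 1 2 3 4)"
proof -
  have "tup4 1 2 3 4 = id" by (simp add: fun_eq_iff forall_4)
  then show ?thesis by simp
qed

text \<open>Bubble sort: each rule moves a smaller entry to the left.\<close>

lemmas evenperm_sort =
  tup4_swap(1)[of 1 2] tup4_swap(1)[of 1 3] tup4_swap(1)[of 1 4] tup4_swap(1)[of 2 3] tup4_swap(1)[of 2 4] tup4_swap(1)[of 3 4]
  tup4_swap(2)[of _ 1 2] tup4_swap(2)[of _ 1 3] tup4_swap(2)[of _ 1 4] tup4_swap(2)[of _ 2 3] tup4_swap(2)[of _ 2 4] tup4_swap(2)[of _ 3 4]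
  tup4_swap(3)[of _ _ 1 2] tup4_swap(3)[of _ _ 1 3] tup4_swap(3)[of _ _ 1 4] tup4_swap(3)[of _ _ 2 3] tup4_swap(3)[of _ _ 2 4] tup4_swap(3)[of _ _ 3 4]
  evenperm_tup4_id

text \<open>Quantification over even permutations becomes twelve explicit cases, one for each of the
  last twelve vectors of \<open>root_bases\<close>.\<close>

lemma even_perm_ex:
  "(\<exists>p. p permutes (UNIV :: 4 set) \<and> evenperm p \<and> Q (p 1) (p 2) (p 3) (p 4)) \<longleftrightarrow>
    Q 1 2 3 4 \<or> Q 1 3 4 2 \<or> Q 1 4 2 3 \<or> Q 2 1 4 3 \<or> Q 2 3 1 4 \<or> Q 2 4 3 1 \<or>
    Q 3 1 2 4 \<or> Q 3 2 4 1 \<or> Q 3 4 1 2 \<or> Q 4 1 3 2 \<or> Q 4 2 1 3 \<or> Q 4 3 2 1" (is "?L \<longleftrightarrow> ?R")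
proof
  assume ?L
  then obtain p where p: "p permutes (UNIV :: 4 set)" "evenperm p" "Q (p 1) (p 2) (p 3) (p 4)" by blast
  have "inj p" using p(1) by (rule permutes_inj)
  then have d: "distinct [p 1, p 2, p 3, p 4]" by (simp add: inj_eq)
  have "evenperm (tup4 (p 1) (p 2) (p 3) (p 4))" using p(2) by (simp only: tup4_eta)
  \<comment> \<open>Of the 256 patterns of values, injectivity leaves the 24 permutations, and
    sorting by adjacent swaps discards the odd ones.\<close>
  then show ?R
    using d p(3) exhaust_4[of "p 1"] exhaust_4[of "p 2"] exhaust_4[of "p 3"] exhaust_4[of "p 4"]
    by (elim disjE; simp add: evenperm_sort)
next
  have "tup4 a b c d permutes UNIV" if "distinct [a, b, c, d]" for a b c d
    using bij_tup4[OF that] by (intro bij_imp_permutes) auto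
  then have *: ?L if "distinct [a, b, c, d]" "evenperm (tup4 a b c d)" "Q a b c d" for a b c d
    using that by (intro exI[of _ "tup4 a b c d"]) simp
  show "?R \<Longrightarrow> ?L"
    by (elim disjE; (rule *[rotated 2], assumption, simp, simp add: evenperm_sort))
qed

lemma H4_eq: "H4 = rvec ` set roots"
proof -
  have zv: "zval (0, 0) = 0" "zval (2, 0) = 2" "zval (1, 0) = 1" "zval (0, 1) = golden" "zval (-1, 1) = inverse golden"
    by (simp_all add: zval_def inverse_golden)
  have 1: "v \<in> {s *\<^sub>R axis i 1 | s i. s \<in> {1, -1}} \<longleftrightarrow>
      v \<in> rvec ` set (signed ((2, 0), (0, 0), (0, 0), (0, 0))) \<or> v \<in> rvec ` set (signed ((0, 0), (2, 0), (0, 0), (0, 0))) \<or>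
      v \<in> rvec ` set (signed ((0, 0), (0, 0), (2, 0), (0, 0))) \<or> v \<in> rvec ` set (signed ((0, 0), (0, 0), (0, 0), (2, 0)))"
    for v :: "real ^ 4"
  proof -
    have "(\<exists>i. P i) \<longleftrightarrow> P 1 \<or> P 2 \<or> P 3 \<or> P 4" for P :: "4 \<Rightarrow> bool"
      by (metis exhaust_4)
    then show ?thesis
      unfolding set_signed zv by (simp add: vec4_eq_iff axis_def) (auto; linarith?)
  qed
  have 2: "v \<in> {v. \<forall>i. v $ i \<in> {1/2, -1/2}} \<longleftrightarrow>
      v \<in> rvec ` set (signed ((1, 0), (1, 0), (1, 0), (1, 0)))" for v :: "real ^ 4"
    unfolding set_signed zv by (simp add: forall_4)
  define b :: "real ^ 4" where "b = vector [golden / 2, 1 / 2, inverse golden / 2, 0]"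
  have b: "b $ 1 = golden / 2" "b $ 2 = 1 / 2" "b $ 3 = inverse golden / 2" "b $ 4 = 0"
    by (simp_all add: b_def vector_def)
  have sign: "(\<exists>s. (\<forall>i. s i \<in> {1, -1}) \<and> v = (\<chi> i. s i * u i)) \<longleftrightarrow> (\<forall>i. v $ i = u i \<or> v $ i = - u i)"
    for v :: "real ^ 4" and u :: "4 \<Rightarrow> real"
  proof
    assume *: "\<forall>i. v $ i = u i \<or> v $ i = - u i"
    then show "\<exists>s. (\<forall>i. s i \<in> {1, -1}) \<and> v = (\<chi> i. s i * u i)"
      by (intro exI[of _ "\<lambda>i. if v $ i = u i then 1 else -1"]) (auto simp: vec_eq_iff)
  qed (force simp: vec_eq_iff)
  have 3: "v \<in> {\<chi> i. s i * b $ p i | s p. (\<forall>i. s i \<in> {1, -1}) \<and> p permutes UNIV \<and> evenperm p} \<longleftrightarrow>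
      (\<exists>B\<in>set (drop 5 root_bases). v \<in> rvec ` set (signed B))" for v
  proof -
    define Q where "Q i j k l \<longleftrightarrow>
         (v $ 1 = b $ i \<or> v $ 1 = - b $ i) \<and> (v $ 2 = b $ j \<or> v $ 2 = - b $ j) \<and>
         (v $ 3 = b $ k \<or> v $ 3 = - b $ k) \<and> (v $ 4 = b $ l \<or> v $ 4 = - b $ l)" for i j k l
    have "v \<in> {\<chi> i. s i * b $ p i | s p. (\<forall>i. s i \<in> {1, -1}) \<and> p permutes UNIV \<and> evenperm p} \<longleftrightarrow>
        (\<exists>p. p permutes UNIV \<and> evenperm p \<and> (\<forall>i. v $ i = b $ p i \<or> v $ i = - b $ p i))"
      unfolding sign[symmetric] by blast
    also have "\<dots> \<longleftrightarrow> (\<exists>p. p permutes UNIV \<and> evenperm p \<and> Q (p 1) (p 2) (p 3) (p 4))"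
      by (simp only: forall_4 Q_def)
    also have "\<dots> \<longleftrightarrow> (\<exists>B\<in>set (drop 5 root_bases). v \<in> rvec ` set (signed B))"
      unfolding even_perm_ex by (simp add: root_bases_def Let_def set_signed zv b Q_def)
    finally show ?thesis .
  qed
  have "H4 = (\<Union>B\<in>set root_bases. rvec ` set (signed B))"
    unfolding H4_def b_def[symmetric] set_eq_iff Un_iff 1 2 3
    by (simp add: root_bases_def Let_def)
  then show ?thesis by (simp add: roots_def image_UN)
qed

section \<open>Reflections, the group they generate, and its orbit of roots\<close>

lemma reflection_linear: "linear (reflection r)"
  by (rule linearI) (simp_all add: reflection_def inner_add_left algebra_simps add_divide_distrib)

lemma reflection_inner:
  assumes "r \<noteq> 0"
  shows "reflection r v \<bullet> reflection r w = v \<bullet> w"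
proof -
  have "r \<bullet> r \<noteq> 0" using assms by simp
  moreover have "r \<bullet> w = w \<bullet> r" by (rule inner_commute)
  ultimately show ?thesis
    unfolding reflection_def inner_diff_left inner_diff_right inner_scaleR_left inner_scaleR_right by simp
qed

lemma reflection_reflection:
  assumes "r \<noteq> 0"
  shows "reflection r (reflection r v) = v"
  using assms by (simp add: reflection_def inner_diff_left algebra_simps divide_simps)

text \<open>Conjugation: the reflection in s_a(r) is s_a s_r s_a. If s_a and s_r preserve the root
  system, so does this one, which is how closure spreads along the orbit.\<close>

lemma reflection_image:
  assumes "a \<noteq> 0"
  shows "reflection (reflection a r) v = reflection a (reflection r (reflection a v))"
proof -
  have "v \<bullet> reflection a r = reflection a v \<bullet> r"
    using reflection_inner[OF assms, of "reflection a v" r] by (simp add: reflection_reflection assms)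
  then have "reflection (reflection a r) v = v - (2 * (reflection a v \<bullet> r) / (r \<bullet> r)) *\<^sub>R reflection a r"
    by (simp add: reflection_def[of "reflection a r"] reflection_inner assms)
  also have "\<dots> = reflection a (reflection a v) - (2 * (reflection a v \<bullet> r) / (r \<bullet> r)) *\<^sub>R reflection a r"
    by (simp add: reflection_reflection assms)
  also have "\<dots> = reflection a (reflection r (reflection a v))"
    by (simp add: reflection_def[of r] linear_diff[OF reflection_linear] linear_scale[OF reflection_linear])
  finally show ?thesis .
qed

lemma H4_unit: "r \<in> H4 \<Longrightarrow> r \<bullet> r = 1"
  using unit_roots by (auto simp: H4_eq inner_rvec list_all_iff unit_root_def zval_def)

lemma H4_nonzero: "r \<in> H4 \<Longrightarrow> r \<noteq> 0"
  using H4_unit by force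

lemma finite_H4: "finite H4"
  by (simp add: H4_eq)

lemma axis_in_H4: "axis i 1 \<in> H4"
  unfolding H4_def by (intro UnI1) (force intro!: exI[of _ i] exI[of _ "1 :: real"])

lemma reflection_axis: "reflection (axis i 1) v $ j = (if i = j then - v $ j else v $ j)"
proof -
  have "v \<bullet> axis i 1 = v $ i" by (simp add: inner_axis)
  moreover have "axis i 1 \<bullet> axis i (1 :: real) = 1" by (simp add: inner_axis_axis)
  moreover have "axis i 1 $ j = (if i = j then 1 else (0 :: real))" by (simp add: axis_def)
  ultimately show ?thesis by (simp add: reflection_def)
qed

lemma zabs_cases: "zval (zabs z) = zval z \<or> zval (zabs z) = - zval z"
  by (simp add: zabs_def zval_hom)

lemma rvec_vabs: "rvec (vabs V) $ i = rvec V $ i \<or> rvec (vabs V) $ i = - rvec V $ i"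
proof -
  obtain a b c d where V: "V = (a, b, c, d)" by (cases V)
  show ?thesis using exhaust_4[of i] zabs_cases[of a] zabs_cases[of b] zabs_cases[of c] zabs_cases[of d]
    by (auto simp: V vabs_def rvec_nth)
qed

lemma H4_sign_change:
  assumes "v \<in> H4" "\<And>i. w $ i = v $ i \<or> w $ i = - v $ i"
  shows "w \<in> H4"
proof -
  obtain B where B: "B \<in> set root_bases" "v \<in> rvec ` set (signed B)"
    using assms(1) by (auto simp: H4_eq roots_def)
  obtain a b c d where "B = (a, b, c, d)" by (cases B)
  have aux: "y = u / 2 \<or> y = - u / 2" if "x = u / 2 \<or> x = - u / 2" "y = x \<or> y = - x" for x y u :: real
    using that by auto
  have "w \<in> rvec ` set (signed B)"
    using B(2) unfolding \<open>B = _\<close> set_signed by (elim conjE) (intro conjI; (erule aux, rule assms(2)))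
  then show ?thesis using B(1) by (auto simp: H4_eq roots_def)
qed

lemma base_in_H4: "B \<in> set root_bases \<Longrightarrow> rvec B \<in> H4"
proof -
  assume B: "B \<in> set root_bases"
  obtain a b c d where "B = (a, b, c, d)" by (cases B)
  then have "rvec B \<in> rvec ` set (signed B)" by (simp add: set_signed rvec_nth)
  then show ?thesis using B by (auto simp: H4_eq roots_def)
qed

lemma vabs_root: "vabs V \<in> set root_bases \<Longrightarrow> rvec V \<in> H4"
proof (rule H4_sign_change[OF base_in_H4])
  fix i show "rvec V $ i = rvec (vabs V) $ i \<or> rvec V $ i = - rvec (vabs V) $ i"
    using rvec_vabs[of V i] by auto
qed

lemma gen_root_facts:
  assumes "A \<in> set (take 4 root_bases @ gen_roots)"
  shows "rvec A \<in> H4" "V \<in> set roots \<Longrightarrow> reflection (rvec A) (rvec V) = rvec (zrefl A V)"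
    "V \<in> set roots \<Longrightarrow> rvec (zrefl A V) \<in> H4"
proof -
  have g: "gen_ok A" using closed_roots assms by (auto simp: list_all_iff)
  then show A: "rvec A \<in> H4" by (auto simp: gen_ok_def vabs_root List.member_iff)
  then have "A \<in> set roots" using inj_rvec by (auto simp: H4_eq inj_eq)
  then have u: "zdot A A = (4, 0)" using unit_roots by (auto simp: list_all_iff unit_root_def)
  assume "V \<in> set roots"
  then have "refl_ok A V" using g by (simp add: gen_ok_def list_all_iff)
  then show "reflection (rvec A) (rvec V) = rvec (zrefl A V)" "rvec (zrefl A V) \<in> H4"
    using reflection_rvec[OF u] by (simp_all add: refl_ok_def vabs_root List.member_iff)
qed

lemma gen_root_preserves:
  "A \<in> set (take 4 root_bases @ gen_roots) \<Longrightarrow> v \<in> H4 \<Longrightarrow> reflection (rvec A) v \<in> H4"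
  using gen_root_facts[of A] by (auto simp: H4_eq)

lemma reflection_in_W: "r \<in> H4 \<Longrightarrow> reflection r \<in> W_H4"
  unfolding W_H4_def by (rule generate.incl) simp

lemma id_in_W: "(\<lambda>v. v) \<in> W_H4"
  unfolding W_H4_def using generate.one[of GL4] by (simp add: GL4_def id_def)

lemma comp_in_W: "g \<in> W_H4 \<Longrightarrow> h \<in> W_H4 \<Longrightarrow> (\<lambda>v. g (h v)) \<in> W_H4"
  unfolding W_H4_def using generate.eng[of g GL4 _ h] by (simp add: GL4_def o_def)

text \<open>\<open>generate\<close> also adds the inverses of the generators; as reflections are
  involutions, these are reflections again, and \<open>W_induct\<close> has no case for
  inverses.\<close>

lemma inv_reflection: "r \<noteq> 0 \<Longrightarrow> m_inv GL4 (reflection r) = reflection r"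
proof -
  assume r: "r \<noteq> 0"
  have i: "reflection r \<circ> reflection r = id"
    unfolding fun_eq_iff o_apply id_apply using reflection_reflection[OF r] by blast
  then have b: "bij (reflection r)" by (rule o_bij[OF i])
  show ?thesis unfolding m_inv_def
  proof (rule the_equality)
    show "reflection r \<in> carrier GL4 \<and> reflection r \<otimes>\<^bsub>GL4\<^esub> reflection r = \<one>\<^bsub>GL4\<^esub> \<and>
        reflection r \<otimes>\<^bsub>GL4\<^esub> reflection r = \<one>\<^bsub>GL4\<^esub>"
      by (simp only: GL4_def monoid.select_convs partial_object.select_convs mem_Collect_eq i b reflection_linear simp_thms)
  next
    fix y assume "y \<in> carrier GL4 \<and> reflection r \<otimes>\<^bsub>GL4\<^esub> y = \<one>\<^bsub>GL4\<^esub> \<and> y \<otimes>\<^bsub>GL4\<^esub> reflection r = \<one>\<^bsub>GL4\<^esub>"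
    then have "reflection r \<circ> y = id" by (simp only: GL4_def monoid.select_convs)
    then have "reflection r (y v) = v" for v by (metis comp_apply id_apply)
    then show "y = reflection r" using reflection_reflection[OF r] by (intro ext) metis
  qed
qed

lemma W_induct [consumes 1, case_names id reflection comp]:
  assumes "g \<in> W_H4" "P (\<lambda>v. v)" "\<And>r. r \<in> H4 \<Longrightarrow> P (reflection r)"
    "\<And>g h. g \<in> W_H4 \<Longrightarrow> h \<in> W_H4 \<Longrightarrow> P g \<Longrightarrow> P h \<Longrightarrow> P (\<lambda>v. g (h v))"
  shows "P g"
  using assms(1) unfolding W_H4_def
proof (induction rule: generate.induct)
  case one
  then show ?case using assms(2) by (simp add: GL4_def id_def)
next
  case (incl h)
  then show ?case using assms(3) by auto
next
  case (inv h)
  then show ?case using assms(3) by (auto simp: inv_reflection H4_nonzero)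
next
  case (eng g h)
  then show ?case using assms(4)[of g h] by (simp add: W_H4_def GL4_def o_def)
qed

text \<open>Both claims are carried along the orbit search together, since a root inherits closure
  from the root before it by conjugation. As the search works modulo signs, each step is completed
  by axis reflections that restore the signs.\<close>

lemma reachable:
  assumes "r \<in> H4"
  shows "(\<forall>v\<in>H4. reflection r v \<in> H4) \<and> (\<exists>g\<in>W_H4. g (axis 1 1) = r)"
proof -
  define Q where "Q r \<longleftrightarrow> r \<in> H4 \<and> (\<forall>v\<in>H4. reflection r v \<in> H4) \<and> (\<exists>g\<in>W_H4. g (axis 1 1) = r)" for r
  have step: "Q (reflection a r)" if a: "a \<in> H4" "\<And>v. v \<in> H4 \<Longrightarrow> reflection a v \<in> H4" and r: "Q r" for a r
  proof -
    obtain g where g: "g \<in> W_H4" "g (axis 1 1) = r" using r by (auto simp: Q_def)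
    have "(\<lambda>v. reflection a (g v)) \<in> W_H4"
      by (rule comp_in_W[OF reflection_in_W[OF a(1)] g(1)])
    then have "\<exists>g\<in>W_H4. g (axis 1 1) = reflection a r"
      by (rule bexI[rotated]) (simp only: g(2))
    then show ?thesis using a r unfolding Q_def by (simp add: reflection_image H4_nonzero)
  qed
  have gstep: "Q (reflection (rvec A) r)" if "A \<in> set (take 4 root_bases @ gen_roots)" "Q r" for A r
    using that gen_root_facts(1) gen_root_preserves by (intro step) auto
  have axis: "\<exists>A\<in>set (take 4 root_bases @ gen_roots). rvec A = axis i 1" for i
    using exhaust_4[of i]
    by (auto simp: root_bases_def Let_def vec4_eq_iff rvec_nth axis_def zval_def)
  have flip: "Q (if b then reflection (axis i 1) r else r)" if "Q r" for b i r
  proof -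
    obtain A where "A \<in> set (take 4 root_bases @ gen_roots)" "rvec A = axis i 1" using axis by blast
    then show ?thesis using gstep[of A r] that by simp
  qed
  have signs: "Q w" if v: "Q v" and w: "\<And>i. w $ i = v $ i \<or> w $ i = - v $ i" for v w
  proof -
    \<comment> \<open>Flips coordinate i by an axis reflection exactly where v and w differ.\<close>
    define f where "f i r = (if w $ i \<noteq> v $ i then reflection (axis i 1) r else r)" for i r
    have "f i r $ j = (if i = j \<and> w $ i \<noteq> v $ i then - r $ j else r $ j)" for i r j
      by (auto simp: f_def reflection_axis)
    then have "w = f 1 (f 2 (f 3 (f 4 v)))"
      using w[of 1] w[of 2] w[of 3] w[of 4] by (auto simp: vec4_eq_iff)
    moreover have "Q (f 1 (f 2 (f 3 (f 4 v))))" unfolding f_def by (intro flip v)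
    ultimately show ?thesis by simp
  qed
  have e1: "Q (axis 1 1)"
  proof -
    have "\<forall>v\<in>H4. reflection (axis 1 1) v \<in> H4" using axis[of 1] gen_root_preserves by metis
    moreover have "\<exists>g\<in>W_H4. g (axis 1 1) = axis 1 1" by (rule bexI[OF _ id_in_W]) simp
    ultimately show ?thesis by (simp add: Q_def axis_in_H4)
  qed
  have layer: "Q (rvec w)" if new: "\<forall>v\<in>set new. Q (rvec v)" and w: "w \<in> set (next_layer seen new)" for seen new w
  proof -
    obtain v A where v: "v \<in> set new" "A \<in> set gen_roots" "w = vabs (zrefl A v)"
      using w by (auto simp: next_layer_def neighbours_def refl_by_def)
    then have Qv: "Q (rvec v)" using new by blast
    then have "v \<in> set roots" using inj_rvec by (auto simp: Q_def H4_eq inj_eq)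
    then have "Q (rvec (zrefl A v))" using gstep[of A "rvec v"] Qv gen_root_facts(2)[of A v] v(2) by simp
    then show ?thesis unfolding v(3) by (rule signs) (rule rvec_vabs)
  qed
  have orbit: "\<forall>v\<in>set (orbit_steps n (seen, new)). Q (rvec v)"
    if "\<forall>v\<in>set seen. Q (rvec v)" "\<forall>v\<in>set new. Q (rvec v)" for n seen new
    using that
  proof (induction n arbitrary: seen new)
    case (Suc n)
    have "\<forall>v\<in>set (seen @ next_layer seen new). Q (rvec v)" "\<forall>v\<in>set (next_layer seen new). Q (rvec v)"
      using Suc.prems layer by auto
    then show ?case unfolding orbit_steps.simps by (rule Suc.IH)
  qed simp
  have "rvec root_e1 = axis 1 1"
    by (simp add: root_e1_def vec4_eq_iff rvec_nth axis_def zval_def)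
  then have "\<forall>v\<in>set (orbit_steps 5 ([root_e1], [root_e1])). Q (rvec v)"
    using e1 by (intro orbit) auto
  then have bases: "Q (rvec B)" if "B \<in> set root_bases" for B
    using roots_orbit that by (auto simp: list_all_iff List.member_iff)
  obtain B where B: "B \<in> set root_bases" "r \<in> rvec ` set (signed B)"
    using assms by (auto simp: H4_eq roots_def)
  obtain a b c d where abcd: "B = (a, b, c, d)" by (cases B)
  have "Q r"
  proof (rule signs[OF bases[OF B(1)]])
    fix i show "r $ i = rvec B $ i \<or> r $ i = - rvec B $ i"
      using B(2) exhaust_4[of i] by (auto simp: abcd set_signed rvec_nth)
  qed
  then show ?thesis by (simp add: Q_def)
qed

lemma W_preserves_H4: "g \<in> W_H4 \<Longrightarrow> v \<in> H4 \<Longrightarrow> g v \<in> H4"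
  by (induction g arbitrary: v rule: W_induct) (auto simp: reachable)

lemma W_linear: "g \<in> W_H4 \<Longrightarrow> linear g"
  by (induction g rule: W_induct) (auto simp: reflection_linear linear_compose[unfolded o_def] linear_ident)

lemma W_inner: "g \<in> W_H4 \<Longrightarrow> g v \<bullet> g w = v \<bullet> w"
  by (induction g arbitrary: v w rule: W_induct) (auto simp: reflection_inner H4_nonzero)

lemma W_inverse: "g \<in> W_H4 \<Longrightarrow> \<exists>h\<in>W_H4. (\<forall>v. g (h v) = v) \<and> (\<forall>v. h (g v) = v)"
proof (induction g rule: W_induct)
  case (reflection r)
  then show ?case
    using reflection_in_W reflection_reflection[OF H4_nonzero] by blast
next
  case (comp g h)
  then obtain g' h' where "g' \<in> W_H4" "h' \<in> W_H4" "\<forall>v. g (g' v) = v" "\<forall>v. g' (g v) = v"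
    "\<forall>v. h (h' v) = v" "\<forall>v. h' (h v) = v"
    by blast
  then show ?case
    by (intro bexI[of _ "\<lambda>v. h' (g' v)"]) (simp_all add: comp_in_W)
qed (auto intro: id_in_W)

text \<open>An element is linear, hence determined by the images of the four basis vectors; these
  images are roots, and there are finitely many roots.\<close>

lemma finite_W: "finite W_H4"
proof (rule finite_imageD)
  show "inj_on (\<lambda>g i. g (axis i 1)) W_H4"
  proof (rule inj_onI)
    fix g h assume gh: "g \<in> W_H4" "h \<in> W_H4" and e: "(\<lambda>i. g (axis i 1)) = (\<lambda>i. h (axis i 1))"
    show "g = h"
    proof (rule linear_eq_stdbasis[OF W_linear W_linear])
      fix b :: "real ^ 4" assume "b \<in> Basis"
      then show "g b = h b" using e by (auto simp: Basis_vec_def fun_eq_iff)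
    qed (rule gh)+
  qed
  have "(\<lambda>g i. g (axis i 1)) ` W_H4 \<subseteq> PiE UNIV (\<lambda>_. H4)"
    using W_preserves_H4 axis_in_H4 by auto
  then show "finite ((\<lambda>g i. g (axis i 1)) ` W_H4)"
    by (rule finite_subset) (intro finite_PiE finite_H4 finite)
qed

text \<open>The elements sending the first basis vector to a given root form a coset of its
  stabiliser, so all fibres have the same size N. The value of N cancels in the normalisation of
  \<open>g12\<close>.\<close>

lemma sum_over_W:
  fixes F :: "real ^ 4 \<Rightarrow> poly4"
  obtains N where "N > 0" "(\<Sum>g\<in>W_H4. F (g (axis 1 1))) = of_nat N * (\<Sum>r\<in>H4. F r)"
proof -
  let ?S = "\<lambda>r. {g \<in> W_H4. g (axis 1 1) = r}"
  have card: "card (?S r) = card (?S (axis 1 1))" if r: "r \<in> H4" for r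
  proof -
    obtain h where h: "h \<in> W_H4" "h (axis 1 1) = r" using reachable[OF r] by blast
    obtain k where k: "k \<in> W_H4" "\<forall>v. h (k v) = v" "\<forall>v. k (h v) = v" using W_inverse[OF h(1)] by blast
    have kr: "k r = axis 1 1" using k(3) h(2) by metis
    have "bij_betw (\<lambda>g v. h (g v)) (?S (axis 1 1)) (?S r)"
    proof (rule bij_betw_byWitness[of _ "\<lambda>g v. k (g v)"])
      show "(\<lambda>g v. k (g v)) ` ?S r \<subseteq> ?S (axis 1 1)"
        by (intro image_subsetI CollectI conjI; elim CollectE conjE; simp add: comp_in_W[OF k(1)] kr)
      show "(\<lambda>g v. h (g v)) ` ?S (axis 1 1) \<subseteq> ?S r"
        by (intro image_subsetI CollectI conjI; elim CollectE conjE; simp add: comp_in_W[OF h(1)] h(2))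
    qed (simp_all add: k)
    then show ?thesis by (rule bij_betw_same_card[symmetric])
  qed
  have "(\<Sum>g\<in>W_H4. F (g (axis 1 1))) = (\<Sum>r\<in>H4. \<Sum>g\<in>?S r. F (g (axis 1 1)))"
    using W_preserves_H4[OF _ axis_in_H4]
    by (intro sum.group[OF finite_W finite_H4, symmetric] image_subsetI)
  also have "\<dots> = (\<Sum>r\<in>H4. of_nat (card (?S (axis 1 1))) * F r)"
    by (rule sum.cong) (auto simp: card)
  finally have "(\<Sum>g\<in>W_H4. F (g (axis 1 1))) = of_nat (card (?S (axis 1 1))) * (\<Sum>r\<in>H4. F r)"
    by (simp add: sum_distrib_left)
  moreover have "card (?S (axis 1 1)) > 0"
    using finite_W id_in_W by (subst card_gt_0_iff) auto
  ultimately show ?thesis using that by blast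
qed

lemma sum_over_H4: "(\<Sum>r\<in>H4. F r) = sum_list (map (\<lambda>v. F (rvec v)) roots)"
proof -
  have "(\<Sum>r\<in>H4. F r) = (\<Sum>v\<in>set roots. F (rvec v))"
    unfolding H4_eq by (rule sum.reindex_cong[OF inj_on_subset[OF inj_rvec]]) auto
  then show ?thesis by (simp add: sum_list_distinct_conv_sum_set distinct_roots)
qed

section \<open>The group acting on polynomials, and invariance of the basic forms\<close>

lemma vec4_expand: "(v :: real ^ 4) = (\<Sum>j\<in>UNIV. v $ j *\<^sub>R axis j 1)"
  by (simp add: vec_eq_iff axis_def if_distrib sum.delta cong: if_cong)

lemma act_comp: "linear g \<Longrightarrow> act g (act h f) = act (\<lambda>v. g (h v)) f"
proof (induction f rule: poly4_induct)
  case (Var i)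
  let ?C = "\<lambda>x. Const (complex_of_real x)"
  have "g (h (axis i 1)) = (\<Sum>j\<in>UNIV. h (axis i 1) $ j *\<^sub>R g (axis j 1))"
    by (subst vec4_expand[of "h (axis i 1)"]) (simp add: linear_sum[OF Var] linear_scale[OF Var])
  then have g: "g (h (axis i 1)) $ k = (\<Sum>j\<in>UNIV. h (axis i 1) $ j * g (axis j 1) $ k)" for k
    by simp
  have "act g (act h (Var i)) = (\<Sum>j\<in>UNIV. \<Sum>k\<in>UNIV. ?C (h (axis i 1) $ j * g (axis j 1) $ k) * Var k)"
    by (simp only: act_Var act_sum act_hom of_real_mult Const_mult sum_distrib_left mult.assoc)
  also have "\<dots> = (\<Sum>k\<in>UNIV. \<Sum>j\<in>UNIV. ?C (h (axis i 1) $ j * g (axis j 1) $ k) * Var k)"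
    by (rule sum.swap)
  also have "\<dots> = act (\<lambda>v. g (h v)) (Var i)"
    by (simp only: act_Var g of_real_sum Const_sum sum_distrib_right)
  finally show ?case .
qed (simp_all only: act_hom)

lemma act_id: "act (\<lambda>v. v) f = f"
proof (induction f rule: poly4_induct)
  case (Var i)
  have "(\<Sum>j\<in>UNIV. Const (complex_of_real (axis i 1 $ j)) * Var j) = (\<Sum>j\<in>UNIV. if j = i then Var j else 0)"
    by (rule sum.cong) (auto simp: axis_def)
  then show ?case by (simp add: act_Var)
qed (simp_all add: act_hom)

lemma T_inv_iff: "f \<in> T_inv \<longleftrightarrow> (\<forall>r\<in>H4. act (reflection r) f = f)"
proof
  assume *: "\<forall>r\<in>H4. act (reflection r) f = f"
  have "act g f = f" if "g \<in> W_H4" for g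
    using that
  proof (induction g rule: W_induct)
    case (comp g h)
    then show ?case using act_comp[OF W_linear[OF comp(1)], of h f] by metis
  qed (auto simp: act_id *)
  then show "f \<in> T_inv" by (simp add: T_inv_def)
qed (auto simp: T_inv_def reflection_in_W)

lemma T_inv_closed: "Const c \<in> T_inv" "numeral k \<in> T_inv" "0 \<in> T_inv" "1 \<in> T_inv"
  "f \<in> T_inv \<Longrightarrow> g \<in> T_inv \<Longrightarrow> f + g \<in> T_inv" "f \<in> T_inv \<Longrightarrow> g \<in> T_inv \<Longrightarrow> f - g \<in> T_inv"
  "f \<in> T_inv \<Longrightarrow> - f \<in> T_inv"
  "f \<in> T_inv \<Longrightarrow> g \<in> T_inv \<Longrightarrow> f * g \<in> T_inv" "f \<in> T_inv \<Longrightarrow> f ^ n \<in> T_inv"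
  by (simp_all add: T_inv_def act_hom)

lemma reflection_axis_nth:
  assumes "r \<in> H4"
  shows "reflection r (axis i 1) $ j = (if i = j then 1 else 0) - 2 * r $ i * r $ j"
proof -
  have "axis i 1 \<bullet> r = r $ i" by (simp add: inner_axis')
  moreover have "axis i 1 $ j = (if i = j then 1 else (0 :: real))" by (simp add: axis_def)
  ultimately show ?thesis by (simp add: reflection_def H4_unit[OF assms])
qed

lemma reflection_rows:
  assumes "r \<in> H4"
  shows "(\<Sum>j\<in>UNIV. reflection r (axis i 1) $ j * reflection r (axis k 1) $ j) = (if i = k then 1 else 0)"
  using reflection_inner[OF H4_nonzero[OF assms], of "axis i 1" "axis k 1"]
  by (simp add: inner_vec_def[of "reflection r _"] inner_axis_axis)

lemma reflection_columns:
  assumes "r \<in> H4"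
  shows "(\<Sum>j\<in>UNIV. reflection r (axis j 1) $ i * reflection r (axis j 1) $ k) = (if i = k then 1 else 0)"
proof -
  have "reflection r (axis j 1) $ i = reflection r (axis i 1) $ j" for i j
    using assms by (simp add: reflection_axis_nth)
  then show ?thesis using reflection_rows[OF assms, of i k] by simp
qed

lemma f2_sum: "f2 = (\<Sum>i\<in>UNIV. Var i * Var i)"
  by (simp add: f2_def sum_4 power2_eq_square)

lemma f2_T_inv: "f2 \<in> T_inv"
  unfolding T_inv_iff
proof
  fix r assume r: "r \<in> H4"
  let ?c = "\<lambda>i j. Const (complex_of_real (reflection r (axis i 1) $ j))"
  have "act (reflection r) f2 = (\<Sum>i\<in>UNIV. (\<Sum>j\<in>UNIV. ?c i j * Var j) * (\<Sum>k\<in>UNIV. ?c i k * Var k))"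
    by (simp add: f2_sum act_sum act_hom act_Var)
  also have "\<dots> = (\<Sum>i\<in>UNIV. \<Sum>j\<in>UNIV. \<Sum>k\<in>UNIV. (?c i j * ?c i k) * (Var j * Var k))"
    by (simp only: sum_product mult_ac)
  also have "\<dots> = (\<Sum>j\<in>UNIV. \<Sum>k\<in>UNIV. \<Sum>i\<in>UNIV. (?c i j * ?c i k) * (Var j * Var k))"
    by (subst sum.swap) (rule sum.cong[OF refl], rule sum.swap)
  also have "\<dots> = (\<Sum>j\<in>UNIV. \<Sum>k\<in>UNIV. Const (complex_of_real (\<Sum>i\<in>UNIV. reflection r (axis i 1) $ j * reflection r (axis i 1) $ k)) * (Var j * Var k))"
    by (simp add: sum_distrib_right Const_mult Const_sum)
  also have "\<dots> = (\<Sum>j\<in>UNIV. \<Sum>k\<in>UNIV. if j = k then Var j * Var k else 0)"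
    unfolding reflection_columns[OF r] by (intro sum.cong) auto
  finally show "act (reflection r) f2 = f2" by (simp add: f2_sum)
qed

text \<open>The chain rule produces the inner products of the rows of the matrix of the reflection,
  which are Kronecker deltas by orthogonality.\<close>

lemma laplacian_act: "r \<in> H4 \<Longrightarrow> laplacian (act (reflection r) f) = act (reflection r) (laplacian f)"
proof -
  assume r: "r \<in> H4"
  let ?c = "\<lambda>i j. Const (complex_of_real (reflection r (axis i 1) $ j))"
  let ?a = "act (reflection r)"
  have "laplacian (?a f) = (\<Sum>j\<in>UNIV. \<Sum>i\<in>UNIV. \<Sum>k\<in>UNIV. (?c i j * ?c k j) * ?a (partial k (partial i f)))"
    by (simp only: laplacian_def partial_act partial_sum partial_Const_mult sum_distrib_left mult.assoc)
  also have "\<dots> = (\<Sum>i\<in>UNIV. \<Sum>k\<in>UNIV. \<Sum>j\<in>UNIV. (?c i j * ?c k j) * ?a (partial k (partial i f)))"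
    by (subst sum.swap) (rule sum.cong[OF refl], rule sum.swap)
  also have "\<dots> = (\<Sum>i\<in>UNIV. \<Sum>k\<in>UNIV. Const (complex_of_real (\<Sum>j\<in>UNIV. reflection r (axis i 1) $ j * reflection r (axis k 1) $ j)) * ?a (partial k (partial i f)))"
    by (simp add: sum_distrib_right Const_mult Const_sum)
  also have "\<dots> = (\<Sum>i\<in>UNIV. \<Sum>k\<in>UNIV. if i = k then ?a (partial k (partial i f)) else 0)"
    unfolding reflection_rows[OF r] by (intro sum.cong) auto
  finally show ?thesis by (simp add: laplacian_def act_sum)
qed

lemma laplacian_T_inv: "f \<in> T_inv \<Longrightarrow> laplacian f \<in> T_inv"
  unfolding T_inv_iff using laplacian_act by metis

lemma orbit_sum12_T_inv: "orbit_sum12 \<in> T_inv"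
proof -
  have "act h orbit_sum12 = orbit_sum12" if h: "h \<in> W_H4" for h
  proof -
    obtain k where k: "k \<in> W_H4" "\<forall>v. h (k v) = v" "\<forall>v. k (h v) = v" using W_inverse[OF h] by blast
    have "bij_betw (\<lambda>g v. h (g v)) W_H4 W_H4"
      using comp_in_W[OF h] comp_in_W[OF k(1)]
      by (intro bij_betw_byWitness[of _ "\<lambda>g v. k (g v)"]) (auto simp: k)
    then have "(\<Sum>g\<in>W_H4. act (\<lambda>v. h (g v)) (Var 1 ^ 12)) = (\<Sum>g\<in>W_H4. act g (Var 1 ^ 12))"
      by (rule sum.reindex_bij_betw)
    then show ?thesis by (simp add: orbit_sum12_def act_sum act_comp W_linear h)
  qed
  then show ?thesis by (simp add: T_inv_def)
qed

lemma f12_T_inv: "f12 \<in> T_inv"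
  and f20_T_inv: "f20 \<in> T_inv"
  and f30_T_inv: "f30 \<in> T_inv"
proof -
  show 12: "f12 \<in> T_inv"
    unfolding f12_def g12_def by (intro T_inv_closed f2_T_inv orbit_sum12_T_inv)
  show 20: "f20 \<in> T_inv"
    unfolding f20_def g20_def by (intro T_inv_closed f2_T_inv 12 laplacian_T_inv)
  show "f30 \<in> T_inv"
    unfolding f30_def g30_def by (intro T_inv_closed f2_T_inv 12 20 laplacian_T_inv)
qed

section \<open>The invariant of degree 12\<close>

text \<open>The part of (a + b + c)^12 with all exponents even, in A = a^2, B = b^2, C = c^2; the
  coefficients are the multinomials 12! / ((2i)! (2j)! (2k)!).\<close>

definition even_trinomial :: "poly4 \<Rightarrow> poly4 \<Rightarrow> poly4 \<Rightarrow> poly4" where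
  "even_trinomial A B C = A ^ 6 + 66 * A ^ 5 * B + 66 * A ^ 5 * C + 495 * A ^ 4 * B ^ 2 + 2970 * A ^ 4 * B * C + 495 * A ^ 4 * C ^ 2 + 924 * A ^ 3 * B ^ 3 + 13860 * A ^ 3 * B ^ 2 * C + 13860 * A ^ 3 * B * C ^ 2 + 924 * A ^ 3 * C ^ 3 + 495 * A ^ 2 * B ^ 4 + 13860 * A ^ 2 * B ^ 3 * C + 34650 * A ^ 2 * B ^ 2 * C ^ 2 + 13860 * A ^ 2 * B * C ^ 3 + 495 * A ^ 2 * C ^ 4 + 66 * A * B ^ 5 + 2970 * A * B ^ 4 * C + 13860 * A * B ^ 3 * C ^ 2 + 13860 * A * B ^ 2 * C ^ 3 + 2970 * A * B * C ^ 4 + 66 * A * C ^ 5 + B ^ 6 + 66 * B ^ 5 * C + 495 * B ^ 4 * C ^ 2 + 924 * B ^ 3 * C ^ 3 + 495 * B ^ 2 * C ^ 4 + 66 * B * C ^ 5 + C ^ 6"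

lemma sum_signs_3:
  "(a + b + c) ^ 12 + (a + b - c) ^ 12 + (a - b + c) ^ 12 + (a - b - c) ^ 12 =
    4 * even_trinomial (a ^ 2) (b ^ 2) (c ^ 2)" for a b c :: poly4
  unfolding even_trinomial_def by Groebner_Basis.algebra

lemma sum_signs_4:
  "(a + b + c + d) ^ 12 + (a + b + c - d) ^ 12 + (a + b - c + d) ^ 12 + (a + b - c - d) ^ 12 +
   (a - b + c + d) ^ 12 + (a - b + c - d) ^ 12 + (a - b - c + d) ^ 12 + (a - b - c - d) ^ 12 =
    8 * (let A = a ^ 2; B = b ^ 2; C = c ^ 2; D = d ^ 2 in
      A ^ 6 + 66 * A ^ 5 * B + 66 * A ^ 5 * C + 66 * A ^ 5 * D + 495 * A ^ 4 * B ^ 2 + 2970 * A ^ 4 * B * C + 2970 * A ^ 4 * B * D + 495 * A ^ 4 * C ^ 2 + 2970 * A ^ 4 * C * D + 495 * A ^ 4 * D ^ 2 + 924 * A ^ 3 * B ^ 3 + 13860 * A ^ 3 * B ^ 2 * C + 13860 * A ^ 3 * B ^ 2 * D + 13860 * A ^ 3 * B * C ^ 2 + 83160 * A ^ 3 * B * C * D + 13860 * A ^ 3 * B * D ^ 2 + 924 * A ^ 3 * C ^ 3 + 13860 * A ^ 3 * C ^ 2 * D + 13860 * A ^ 3 * C * D ^ 2 + 924 * A ^ 3 * D ^ 3 + 495 * A ^ 2 * B ^ 4 + 13860 * A ^ 2 * B ^ 3 * C + 13860 * A ^ 2 * B ^ 3 * D + 34650 * A ^ 2 * B ^ 2 * C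 ^ 2 + 207900 * A ^ 2 * B ^ 2 * C * D + 34650 * A ^ 2 * B ^ 2 * D ^ 2 + 13860 * A ^ 2 * B * C ^ 3 + 207900 * A ^ 2 * B * C ^ 2 * D + 207900 * A ^ 2 * B * C * D ^ 2 + 13860 * A ^ 2 * B * D ^ 3 + 495 * A ^ 2 * C ^ 4 + 13860 * A ^ 2 * C ^ 3 * D + 34650 * A ^ 2 * C ^ 2 * D ^ 2 + 13860 * A ^ 2 * C * D ^ 3 + 495 * A ^ 2 * D ^ 4 + 66 * A * B ^ 5 + 2970 * A * B ^ 4 * C + 2970 * A * B ^ 4 * D + 13860 * A * B ^ 3 * C ^ 2 + 83160 * A * B ^ 3 * C * D + 13860 * A * B ^ 3 * D ^ 2 + 13860 * A * B ^ 2 * C ^ 3 + 207900 * A * B ^ 2 * C ^ 2 * D + 207900 * A * B ^ 2 * C * D ^ 2 + 13860 * A * B ^ 2 * D ^ 3 + 2970 * A * B * C ^ 4 + 83160 * A * B * C ^ 3 * D + 207900 * A * B * C ^ 2 * D ^ 2 + 83160 * A * B * C * D ^ 3 + 2970 * A * B * D ^ 4 + 66 * A * C ^ 5 + 2970 * A * C ^ 4 * D + 13860 * A * C ^ 3 * D ^ 2 + 13860 * A * C ^ 2 * D ^ 3 + 2970 * A * C * D ^ 4 + 66 * A * D ^ 5 + B ^ 6 + 66 * B ^ 5 * C + 66 * B ^ 5 * D + 495 * B ^ 4 * C ^ 2 + 2970 * B ^ 4 * C * D + 495 * B ^ 4 * D ^ 2 + 924 * B ^ 3 * C ^ 3 +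 13860 * B ^ 3 * C ^ 2 * D + 13860 * B ^ 3 * C * D ^ 2 + 924 * B ^ 3 * D ^ 3 + 495 * B ^ 2 * C ^ 4 + 13860 * B ^ 2 * C ^ 3 * D + 34650 * B ^ 2 * C ^ 2 * D ^ 2 + 13860 * B ^ 2 * C * D ^ 3 + 495 * B ^ 2 * D ^ 4 + 66 * B * C ^ 5 + 2970 * B * C ^ 4 * D + 13860 * B * C ^ 3 * D ^ 2 + 13860 * B * C ^ 2 * D ^ 3 + 2970 * B * C * D ^ 4 + 66 * B * D ^ 5 + C ^ 6 + 66 * C ^ 5 * D + 495 * C ^ 4 * D ^ 2 + 924 * C ^ 3 * D ^ 3 + 495 * C ^ 2 * D ^ 4 + 66 * C * D ^ 5 + D ^ 6)" for a b c d :: poly4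
  unfolding Let_def by Groebner_Basis.algebra

text \<open>For h = \<phi> this is \<open>even_trinomial\<close> at (\<phi>^2 A, B, \<phi>^-2 C),
  with every power of \<phi> reduced to a linear expression in h; hence the Fibonacci
  numbers.\<close>

definition golden_trinomial :: "poly4 \<Rightarrow> poly4 \<Rightarrow> poly4 \<Rightarrow> poly4 \<Rightarrow> poly4" where
  "golden_trinomial h A B C = (144 * h + 89) * A ^ 6 + 66 * (55 * h + 34) * A ^ 5 * B + 66 * (21 * h + 13) * A ^ 5 * C + 495 * (21 * h + 13) * A ^ 4 * B ^ 2 + 2970 * (8 * h + 5) * A ^ 4 * B * C + 495 * (3 * h + 2) * A ^ 4 * C ^ 2 + 924 * (8 * h + 5) * A ^ 3 * B ^ 3 + 13860 * (3 * h + 2) * A ^ 3 * B ^ 2 * C + 13860 * (h + 1) * A ^ 3 * B * C ^ 2 + 924 * A ^ 3 * C ^ 3 + 495 * (3 * h + 2) * A ^ 2 * B ^ 4 + 13860 * (h + 1) * A ^ 2 * B ^ 3 * C + 34650 * A ^ 2 * B ^ 2 * C ^ 2 + 13860 * (2 - h) * A ^ 2 * B * C ^ 3 + 495 * (5 - 3 * h) * A ^ 2 * C ^ 4 + 66 * (h + 1) * A * B ^ 5 + 2970 * A * B ^ 4 * C + 13860 * (2 - h) * A * B ^ 3 * C ^ 2 + 13860 * (5 - 3 * h) * A * B ^ 2 * C ^ 3 + 2970 * (13 - 8 * h) * A * B * C ^ 4 + 66 * (34 - 21 * h) * A * C ^ 5 + B ^ 6 + 66 * (2 - h) * B ^ 5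 * C + 495 * (5 - 3 * h) * B ^ 4 * C ^ 2 + 924 * (13 - 8 * h) * B ^ 3 * C ^ 3 + 495 * (34 - 21 * h) * B ^ 2 * C ^ 4 + 66 * (89 - 55 * h) * B * C ^ 5 + (233 - 144 * h) * C ^ 6"

lemma even_trinomial_golden:
  fixes h :: poly4
  assumes h: "h ^ 2 = h + 1"
  shows "even_trinomial ((h + 1) * A) B ((2 - h) * C) = golden_trinomial h A B C"
proof -
  \<comment> \<open>With independent u and v the expansion is a plain polynomial identity; the
    relation h^2 = h + 1 then enters only through the table of the values u^i v^j for u = h + 1 and
    v = 2 - h.\<close>
  have expand: "even_trinomial (u * A) B (v * C) = (u ^ 6) * A ^ 6 + 66 * (u ^ 5) * A ^ 5 * B + 66 * (u ^ 5 * v) * A ^ 5 * C + 495 * (u ^ 4) * A ^ 4 * B ^ 2 + 2970 * (u ^ 4 * v) * A ^ 4 * B * C + 495 * (u ^ 4 * v ^ 2) * A ^ 4 * C ^ 2 + 924 * (u ^ 3) * A ^ 3 * B ^ 3 + 13860 * (u ^ 3 * v) * A ^ 3 * B ^ 2 * C + 13860 * (u ^ 3 * v ^ 2) * A ^ 3 * B * C ^ 2 + 924 * (u ^ 3 * v ^ 3) * A ^ 3 * C ^ 3 + 495 * (u ^ 2) * A ^ 2 * B ^ 4 + 13860 * (u ^ 2 * v) * A ^ 2 * B ^ 3 * C + 34650 * (u ^ 2 * v ^ 2) * A ^ 2 * B ^ 2 * C ^ 2 + 13860 * (u ^ 2 * v ^ 3) * A ^ 2 * B * C ^ 3 + 495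 * (u ^ 2 * v ^ 4) * A ^ 2 * C ^ 4 + 66 * u * A * B ^ 5 + 2970 * (u * v) * A * B ^ 4 * C + 13860 * (u * v ^ 2) * A * B ^ 3 * C ^ 2 + 13860 * (u * v ^ 3) * A * B ^ 2 * C ^ 3 + 2970 * (u * v ^ 4) * A * B * C ^ 4 + 66 * (u * v ^ 5) * A * C ^ 5 + B ^ 6 + 66 * v * B ^ 5 * C + 495 * (v ^ 2) * B ^ 4 * C ^ 2 + 924 * (v ^ 3) * B ^ 3 * C ^ 3 + 495 * (v ^ 4) * B ^ 2 * C ^ 4 + 66 * (v ^ 5) * B * C ^ 5 + (v ^ 6) * C ^ 6" for u v
    unfolding even_trinomial_def by (simp only: power_mult_distrib mult_ac)
  have 1: "(h + 1) * (2 - h) = 1" using h by Groebner_Basis.algebra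
  have p2: "(h + 1) ^ 2 = 3 * h + 2" using h by Groebner_Basis.algebra
  have q2: "(2 - h) ^ 2 = 5 - 3 * h" using h by Groebner_Basis.algebra
  have p3: "(h + 1) ^ 3 = 8 * h + 5" using h by Groebner_Basis.algebra
  have q3: "(2 - h) ^ 3 = 13 - 8 * h" using h by Groebner_Basis.algebra
  have p4: "(h + 1) ^ 4 = 21 * h + 13" using h by Groebner_Basis.algebra
  have q4: "(2 - h) ^ 4 = 34 - 21 * h" using h by Groebner_Basis.algebra
  have p5: "(h + 1) ^ 5 = 55 * h + 34" using h by Groebner_Basis.algebra
  have q5: "(2 - h) ^ 5 = 89 - 55 * h" using h by Groebner_Basis.algebra
  have p6: "(h + 1) ^ 6 = 144 * h + 89" using h by Groebner_Basis.algebra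
  have q6: "(2 - h) ^ 6 = 233 - 144 * h" using h by Groebner_Basis.algebra
  have m12: "(h + 1) * (2 - h) ^ 2 = 2 - h" using h by Groebner_Basis.algebra
  have m13: "(h + 1) * (2 - h) ^ 3 = 5 - 3 * h" using h by Groebner_Basis.algebra
  have m14: "(h + 1) * (2 - h) ^ 4 = 13 - 8 * h" using h by Groebner_Basis.algebra
  have m15: "(h + 1) * (2 - h) ^ 5 = 34 - 21 * h" using h by Groebner_Basis.algebra
  have m21: "(h + 1) ^ 2 * (2 - h) = h + 1" using h by Groebner_Basis.algebra
  have m22: "(h + 1) ^ 2 * (2 - h) ^ 2 = 1" using h by Groebner_Basis.algebra
  have m23: "(h + 1) ^ 2 * (2 - h) ^ 3 = 2 - h" using h by Groebner_Basis.algebra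
  have m24: "(h + 1) ^ 2 * (2 - h) ^ 4 = 5 - 3 * h" using h by Groebner_Basis.algebra
  have m31: "(h + 1) ^ 3 * (2 - h) = 3 * h + 2" using h by Groebner_Basis.algebra
  have m32: "(h + 1) ^ 3 * (2 - h) ^ 2 = h + 1" using h by Groebner_Basis.algebra
  have m33: "(h + 1) ^ 3 * (2 - h) ^ 3 = 1" using h by Groebner_Basis.algebra
  have m41: "(h + 1) ^ 4 * (2 - h) = 8 * h + 5" using h by Groebner_Basis.algebra
  have m42: "(h + 1) ^ 4 * (2 - h) ^ 2 = 3 * h + 2" using h by Groebner_Basis.algebra
  have m51: "(h + 1) ^ 5 * (2 - h) = 21 * h + 13" using h by Groebner_Basis.algebra
  show ?thesis unfolding expand golden_trinomial_def
    by (simp only: 1 m12 m13 m14 m15 m21 m22 m23 m24 m31 m32 m33 m41 m42 m51) (simp only: p2 q2 p3 q3 p4 q4 p5 q5 p6 q6 mult_1_right mult_1_left)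
qed

text \<open>For h = \<phi> this is \<phi>^-3 (\<phi>^2 A - C) (\<phi>^2 B - A) (\<phi>^2 C - B): in
  squares of coordinates, and up to a scalar, the product of the six linear forms given by the
  fivefold axes of an icosahedron.\<close>

definition inv6 :: "poly4 \<Rightarrow> poly4 \<Rightarrow> poly4 \<Rightarrow> poly4 \<Rightarrow> poly4" where
  "inv6 h A B C = (h - 1) * (A ^ 2 * B + B ^ 2 * C + C ^ 2 * A) - h * (A ^ 2 * C + B ^ 2 * A + C ^ 2 * B) + 4 * A * B * C"

definition inv10 :: "poly4 \<Rightarrow> poly4 \<Rightarrow> poly4 \<Rightarrow> poly4 \<Rightarrow> poly4" where
  "inv10 h A B C = - (A ^ 4 * B + B ^ 4 * C + C ^ 4 * A) - (A ^ 4 * C + B ^ 4 * A + C ^ 4 * B)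
     + (3 * h - 2) * (A ^ 3 * B ^ 2 + B ^ 3 * C ^ 2 + C ^ 3 * A ^ 2)
     + (1 - 3 * h) * (A ^ 2 * B ^ 3 + B ^ 2 * C ^ 3 + C ^ 2 * A ^ 3)
     + 14 * (A ^ 3 * B * C + A * B ^ 3 * C + A * B * C ^ 3)
     - 15 * (A ^ 2 * B ^ 2 * C + A * B ^ 2 * C ^ 2 + A ^ 2 * B * C ^ 2)"

text \<open>The expansion of \<open>f12\<close> in powers of D = w^2. Its coefficients are
  invariants of the stabiliser of the base point, so they are polynomials in s and in forms p, t of
  degrees 6 and 10; \<open>inv6\<close> and \<open>inv10\<close> are normalised by the coefficients
  of D^3 and D.\<close>

definition inv12 :: "poly4 \<Rightarrow> poly4 \<Rightarrow> poly4 \<Rightarrow> poly4 \<Rightarrow> poly4" where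
  "inv12 s p t D = s * D ^ 5 - 3 * s ^ 2 * D ^ 4 + (7 * s ^ 3 + 33 * p) * D ^ 3 - (3 * s ^ 4 + 33 * s * p) * D ^ 2
     + (s ^ 5 + 11 * t) * D - (s * t + 3 * p ^ 2)"

text \<open>The left side is the sum of the twelfth powers of the 120 doubled roots as linear forms,
  grouped by sign changes, in squared coordinates. Its coefficient of A^6 is 2 * 4096 + 16 + 8 * 969
  = 15960, and 3360 = 15960 * 4 / 19 comes from the scaling of \<open>f12\<close>.\<close>

lemma power_sum_identity:
  fixes A B C D h :: poly4
  assumes h: "h ^ 2 = h + 1"
  shows "2 * 4096 * (A ^ 6 + B ^ 6 + C ^ 6 + D ^ 6) + 16 * (A ^ 6 + 66 * A ^ 5 * B + 66 * A ^ 5 * C + 66 * A ^ 5 * D + 495 * A ^ 4 * B ^ 2 + 2970 * A ^ 4 * B * C + 2970 * A ^ 4 * B * D + 495 * A ^ 4 * C ^ 2 + 2970 * A ^ 4 * C * D + 495 * A ^ 4 * D ^ 2 + 924 * A ^ 3 * B ^ 3 + 13860 * A ^ 3 * B ^ 2 * C + 13860 * A ^ 3 * B ^ 2 * D + 13860 * A ^ 3 * B * C ^ 2 + 83160 * A ^ 3 * B * C * D + 13860 * A ^ 3 * B * D ^ 2 + 924 * A ^ 3 * C ^ 3 + 13860 * A ^ 3 * C ^ 2 * D + 13860 * A ^ 3 * C * D ^ 2 + 924 * A ^ 3 * D ^ 3 + 495 * A ^ 2 * B ^ 4 + 13860 * A ^ 2 * B ^ 3 * C + 13860 * A ^ 2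 * B ^ 3 * D + 34650 * A ^ 2 * B ^ 2 * C ^ 2 + 207900 * A ^ 2 * B ^ 2 * C * D + 34650 * A ^ 2 * B ^ 2 * D ^ 2 + 13860 * A ^ 2 * B * C ^ 3 + 207900 * A ^ 2 * B * C ^ 2 * D + 207900 * A ^ 2 * B * C * D ^ 2 + 13860 * A ^ 2 * B * D ^ 3 + 495 * A ^ 2 * C ^ 4 + 13860 * A ^ 2 * C ^ 3 * D + 34650 * A ^ 2 * C ^ 2 * D ^ 2 + 13860 * A ^ 2 * C * D ^ 3 + 495 * A ^ 2 * D ^ 4 + 66 * A * B ^ 5 + 2970 * A * B ^ 4 * C + 2970 * A * B ^ 4 * D + 13860 * A * B ^ 3 * C ^ 2 + 83160 * A * B ^ 3 * C * D + 13860 * A * B ^ 3 * D ^ 2 + 13860 * A * B ^ 2 * C ^ 3 + 207900 * A * B ^ 2 * C ^ 2 * D + 207900 * A * B ^ 2 * C * D ^ 2 + 13860 * A * B ^ 2 * D ^ 3 + 2970 * A * B * C ^ 4 + 83160 * A * B * C ^ 3 * D + 207900 * A * B * C ^ 2 * D ^ 2 + 83160 * A * B * C * D ^ 3 + 2970 * A * B * D ^ 4 + 66 * A * C ^ 5 + 2970 * A * C ^ 4 * D + 13860 * A * C ^ 3 * D ^ 2 + 13860 * A * C ^ 2 * D ^ 3 + 2970 * A * C * D ^ 4 + 66 * A * D ^ 5 + B ^ 6 + 66 * B ^ 5 * C + 66 * B ^ 5 * D + 495 * B ^ 4 * C ^ 2 + 2970 * B ^ 4 * C * D + 495 * B ^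 4 * D ^ 2 + 924 * B ^ 3 * C ^ 3 + 13860 * B ^ 3 * C ^ 2 * D + 13860 * B ^ 3 * C * D ^ 2 + 924 * B ^ 3 * D ^ 3 + 495 * B ^ 2 * C ^ 4 + 13860 * B ^ 2 * C ^ 3 * D + 34650 * B ^ 2 * C ^ 2 * D ^ 2 + 13860 * B ^ 2 * C * D ^ 3 + 495 * B ^ 2 * D ^ 4 + 66 * B * C ^ 5 + 2970 * B * C ^ 4 * D + 13860 * B * C ^ 3 * D ^ 2 + 13860 * B * C ^ 2 * D ^ 3 + 2970 * B * C * D ^ 4 + 66 * B * D ^ 5 + C ^ 6 + 66 * C ^ 5 * D + 495 * C ^ 4 * D ^ 2 + 924 * C ^ 3 * D ^ 3 + 495 * C ^ 2 * D ^ 4 + 66 * C * D ^ 5 + D ^ 6)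
    + 8 * (golden_trinomial h A B C + golden_trinomial h A D B + golden_trinomial h A C D + golden_trinomial h B A D + golden_trinomial h C A B + golden_trinomial h D A C + golden_trinomial h B C A + golden_trinomial h D B A + golden_trinomial h C D A + golden_trinomial h B D C + golden_trinomial h C B D + golden_trinomial h D C B)
    = 15960 * (A + B + C + D) ^ 6 - 3360 * inv12 (A + B + C) (inv6 h A B C) (inv10 h A B C) D"
proof -
  \<comment> \<open>The only term nonlinear in h is the square of \<open>inv6\<close>. Splitting
    \<open>inv6\<close> into parts free of h lets this square be reduced first; what remains is
    linear in h.\<close>
  define p0 where "p0 = 4 * A * B * C - (A ^ 2 * B + B ^ 2 * C + C ^ 2 * A)"
  define p1 where "p1 = (A ^ 2 * B + B ^ 2 * C + C ^ 2 * A) - (A ^ 2 * C + B ^ 2 * A + C ^ 2 * B)"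
  have "inv6 h A B C = p0 + h * p1"
    unfolding inv6_def p0_def p1_def by Groebner_Basis.algebra
  then have sq: "inv6 h A B C ^ 2 = p0 ^ 2 + p1 ^ 2 + h * (p1 ^ 2 + 2 * p0 * p1)"
    using h by Groebner_Basis.algebra
  show ?thesis
    unfolding inv12_def sq unfolding p0_def p1_def inv6_def inv10_def golden_trinomial_def
    by Groebner_Basis.algebra
qed

section \<open>Summation over the list of roots\<close>

definition gold :: poly4 where
  "gold = Const (complex_of_real golden)"

lemma gold_square: "gold ^ 2 = gold + 1"
proof -
  have "complex_of_real golden ^ 2 = complex_of_real golden + 1"
    by (simp add: power2_eq_square golden_square flip: of_real_mult)
  then show ?thesis by (simp add: gold_def Const_add flip: Const_power)
qed

definition zpoly :: "zphi \<Rightarrow> poly4" where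
  "zpoly z = of_int (fst z) + of_int (snd z) * gold"

lemma Const_of_int: "Const (of_int k) = of_int k"
  by (cases k rule: int_cases2) (simp_all add: Const_uminus)

lemma zpoly_zval: "zpoly z = Const (complex_of_real (zval z))"
  by (simp add: zpoly_def zval_def gold_def Const_add Const_mult Const_of_int)

lemma zpoly_neg: "zpoly (zneg z) = - zpoly z"
  by (simp add: zpoly_zval zval_hom Const_uminus)

lemma zpoly_zero: "zpoly (0, 0) = 0"
  by (simp add: zpoly_def)

lemma zpoly_values: "zpoly (1, 0) = 1" "zpoly (0, 1) = gold" "zpoly (-1, 1) = gold - 1" "zpoly (2, 0) = 2"
  by (simp_all add: zpoly_def)

lemma zphi_nonzero: "(1, 0) \<noteq> ((0, 0) :: zphi)" "(0, 1) \<noteq> ((0, 0) :: zphi)" "(-1, 1) \<noteq> ((0, 0) :: zphi)"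
  by simp_all

definition lform :: "zvec \<Rightarrow> poly4" where
  "lform = (\<lambda>(a, b, c, d). zpoly a * Var 1 + zpoly b * Var 2 + zpoly c * Var 3 + zpoly d * Var 4)"

lemma lform_rvec: "(\<Sum>j\<in>UNIV. Const (complex_of_real (rvec v $ j)) * Var j) = Const (1 / 2) * lform v"
proof -
  obtain a b c d where v: "v = (a, b, c, d)" by (cases v)
  have "Const (complex_of_real (x / 2)) = Const (1 / 2) * Const (complex_of_real x)" for x
    by (simp flip: Const_mult)
  then show ?thesis
    by (simp only: v sum_4 rvec_nth lform_def prod.case zpoly_zval distrib_left mult.assoc)
qed

lemma neg_power_12: "(- x) ^ 12 = x ^ 12" for x :: poly4
  by simp

text \<open>The right-nested shape with a final 0 is what \<open>sum_list\<close> over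
  \<open>signed\<close> unfolds to. Terms differing by an overall sign agree, so the eight terms are
  twice the four of \<open>sum_signs_3\<close>.\<close>

lemma sum_signs_8:
  "(a + b + c) ^ 12 + ((a + b + - c) ^ 12 + ((a + - b + c) ^ 12 + ((a + - b + - c) ^ 12 +
   ((- a + b + c) ^ 12 + ((- a + b + - c) ^ 12 + ((- a + - b + c) ^ 12 + ((- a + - b + - c) ^ 12 + 0))))))) =
    8 * even_trinomial (a ^ 2) (b ^ 2) (c ^ 2)" for a b c :: poly4
proof -
  have "- a + b + c = - (a + - b + - c)" "- a + b + - c = - (a + - b + c)"
    "- a + - b + c = - (a + b + - c)" "- a + - b + - c = - (a + b + c)" by simp_all
  then show ?thesis
    using sum_signs_3[of a b c] by (simp only: neg_power_12) (simp add: algebra_simps)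
qed

lemma double_sum_8:
  fixes x1 x2 x3 x4 x5 x6 x7 x8 y :: poly4
  assumes "x1 + x2 + x3 + x4 + x5 + x6 + x7 + x8 = 8 * y"
  shows "x1 + (x2 + (x3 + (x4 + (x5 + (x6 + (x7 + (x8 +
    (x8 + (x7 + (x6 + (x5 + (x4 + (x3 + (x2 + (x1 + 0))))))))))))))) = 16 * y"
  using assms by Groebner_Basis.algebra

lemma sum_signs_16:
  "(a + b + c + d) ^ 12 + ((a + b + c + - d) ^ 12 + ((a + b + - c + d) ^ 12 + ((a + b + - c + - d) ^ 12 + ((a + - b + c + d) ^ 12 + ((a + - b + c + - d) ^ 12 + ((a + - b + - c + d) ^ 12 + ((a + - b + - c + - d) ^ 12 + ((- a + b + c + d) ^ 12 + ((- a + b + c + - d) ^ 12 + ((- a + b + - c + d) ^ 12 + ((- a + b + - c + - d) ^ 12 + ((- a + - b + c + d) ^ 12 + ((- a + - b + c + - d) ^ 12 + ((- a + - b + - c + d) ^ 12 + ((- a + - b + - c + - d) ^ 12 + 0))))))))))))))) =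
    16 * (let A = a ^ 2; B = b ^ 2; C = c ^ 2; D = d ^ 2 in
      A ^ 6 + 66 * A ^ 5 * B + 66 * A ^ 5 * C + 66 * A ^ 5 * D + 495 * A ^ 4 * B ^ 2 + 2970 * A ^ 4 * B * C + 2970 * A ^ 4 * B * D + 495 * A ^ 4 * C ^ 2 + 2970 * A ^ 4 * C * D + 495 * A ^ 4 * D ^ 2 + 924 * A ^ 3 * B ^ 3 + 13860 * A ^ 3 * B ^ 2 * C + 13860 * A ^ 3 * B ^ 2 * D + 13860 * A ^ 3 * B * C ^ 2 + 83160 * A ^ 3 * B * C * D + 13860 * A ^ 3 * B * D ^ 2 + 924 * A ^ 3 * C ^ 3 + 13860 * A ^ 3 * C ^ 2 * D + 13860 * A ^ 3 * C * D ^ 2 + 924 * A ^ 3 * D ^ 3 + 495 * A ^ 2 * B ^ 4 + 13860 * A ^ 2 * B ^ 3 * C + 13860 * A ^ 2 * B ^ 3 * D + 34650 * A ^ 2 * B ^ 2 * C ^ 2 + 207900 * A ^ 2 * B ^ 2 * C * D + 34650 * A ^ 2 * B ^ 2 * D ^ 2 + 13860 * A ^ 2 * B * C ^ 3 + 207900 * A ^ 2 * B * C ^ 2 * D + 207900 * A ^ 2 * B * C * D ^ 2 + 13860 * A ^ 2 * B * D ^ 3 + 495 * A ^ 2 * C ^ 4 + 13860 * A ^ 2 * C ^ 3 * D + 34650 * A ^ 2 * C ^ 2 * D ^ 2 + 13860 * A ^ 2 * C * D ^ 3 + 495 * A ^ 2 * D ^ 4 + 66 * A * B ^ 5 + 2970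 * A * B ^ 4 * C + 2970 * A * B ^ 4 * D + 13860 * A * B ^ 3 * C ^ 2 + 83160 * A * B ^ 3 * C * D + 13860 * A * B ^ 3 * D ^ 2 + 13860 * A * B ^ 2 * C ^ 3 + 207900 * A * B ^ 2 * C ^ 2 * D + 207900 * A * B ^ 2 * C * D ^ 2 + 13860 * A * B ^ 2 * D ^ 3 + 2970 * A * B * C ^ 4 + 83160 * A * B * C ^ 3 * D + 207900 * A * B * C ^ 2 * D ^ 2 + 83160 * A * B * C * D ^ 3 + 2970 * A * B * D ^ 4 + 66 * A * C ^ 5 + 2970 * A * C ^ 4 * D + 13860 * A * C ^ 3 * D ^ 2 + 13860 * A * C ^ 2 * D ^ 3 + 2970 * A * C * D ^ 4 + 66 * A * D ^ 5 + B ^ 6 + 66 * B ^ 5 * C + 66 * B ^ 5 * D + 495 * B ^ 4 * C ^ 2 + 2970 * B ^ 4 * C * D + 495 * B ^ 4 * D ^ 2 + 924 * B ^ 3 * C ^ 3 + 13860 * B ^ 3 * C ^ 2 * D + 13860 * B ^ 3 * C * D ^ 2 + 924 * B ^ 3 * D ^ 3 + 495 * B ^ 2 * C ^ 4 + 13860 * B ^ 2 * C ^ 3 * D + 34650 * B ^ 2 * C ^ 2 * D ^ 2 + 13860 * B ^ 2 * C * D ^ 3 + 495 * B ^ 2 * D ^ 4 + 66 * B * C ^ 5 + 2970 * B * C ^ 4 * D + 13860 * B * C ^ 3 * D ^ 2 + 13860 * B * C ^ 2 * D ^ 3 + 2970 * B * C * D ^ 4 + 66 * B * D ^ 5 + C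 ^ 6 + 66 * C ^ 5 * D + 495 * C ^ 4 * D ^ 2 + 924 * C ^ 3 * D ^ 3 + 495 * C ^ 2 * D ^ 4 + 66 * C * D ^ 5 + D ^ 6)" for a b c d :: poly4
proof -
  have "- a + b + c + d = - (a + - b + - c + - d)" "- a + b + c + - d = - (a + - b + - c + d)" "- a + b + - c + d = - (a + - b + c + - d)" "- a + b + - c + - d = - (a + - b + c + d)" "- a + - b + c + d = - (a + b + - c + - d)" "- a + - b + c + - d = - (a + b + - c + d)" "- a + - b + - c + d = - (a + b + c + - d)" "- a + - b + - c + - d = - (a + b + c + d)" by simp_all
  then show ?thesis
    by (simp only: neg_power_12) (rule double_sum_8[OF sum_signs_4[unfolded diff_conv_add_uminus]])
qed

lemma signed_sum_zero1:
  assumes "b \<noteq> (0, 0)" "c \<noteq> (0, 0)" "d \<noteq> (0, 0)"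
  shows "(\<Sum>v\<leftarrow>signed ((0, 0), b, c, d). lform v ^ 12) =
    8 * even_trinomial ((zpoly b * Var 2) ^ 2) ((zpoly c * Var 3) ^ 2) ((zpoly d * Var 4) ^ 2)"
proof -
  have s: "signed ((0, 0), b, c, d) = [((0, 0), b, c, d), ((0, 0), b, c, zneg d), ((0, 0), b, zneg c, d), ((0, 0), b, zneg c, zneg d), ((0, 0), zneg b, c, d), ((0, 0), zneg b, c, zneg d), ((0, 0), zneg b, zneg c, d), ((0, 0), zneg b, zneg c, zneg d)]"
    by (simp add: signed_def sgns_def assms)
  show ?thesis
    unfolding s sum_signs_8[symmetric]
    by (simp only: list.map sum_list.Cons sum_list.Nil lform_def prod.case zpoly_neg zpoly_zero
        mult_zero_left add_0_left add_0_right mult_minus_left)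
qed

lemma signed_sum_zero2:
  assumes "a \<noteq> (0, 0)" "c \<noteq> (0, 0)" "d \<noteq> (0, 0)"
  shows "(\<Sum>v\<leftarrow>signed (a, (0, 0), c, d). lform v ^ 12) =
    8 * even_trinomial ((zpoly a * Var 1) ^ 2) ((zpoly c * Var 3) ^ 2) ((zpoly d * Var 4) ^ 2)"
proof -
  have s: "signed (a, (0, 0), c, d) = [(a, (0, 0), c, d), (a, (0, 0), c, zneg d), (a, (0, 0), zneg c, d), (a, (0, 0), zneg c, zneg d), (zneg a, (0, 0), c, d), (zneg a, (0, 0), c, zneg d), (zneg a, (0, 0), zneg c, d), (zneg a, (0, 0), zneg c, zneg d)]"
    by (simp add: signed_def sgns_def assms)
  show ?thesis
    unfolding s sum_signs_8[symmetric]
    by (simp only: list.map sum_list.Cons sum_list.Nil lform_def prod.case zpoly_neg zpoly_zero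
        mult_zero_left add_0_left add_0_right mult_minus_left)
qed

lemma signed_sum_zero3:
  assumes "a \<noteq> (0, 0)" "b \<noteq> (0, 0)" "d \<noteq> (0, 0)"
  shows "(\<Sum>v\<leftarrow>signed (a, b, (0, 0), d). lform v ^ 12) =
    8 * even_trinomial ((zpoly a * Var 1) ^ 2) ((zpoly b * Var 2) ^ 2) ((zpoly d * Var 4) ^ 2)"
proof -
  have s: "signed (a, b, (0, 0), d) = [(a, b, (0, 0), d), (a, b, (0, 0), zneg d), (a, zneg b, (0, 0), d), (a, zneg b, (0, 0), zneg d), (zneg a, b, (0, 0), d), (zneg a, b, (0, 0), zneg d), (zneg a, zneg b, (0, 0), d), (zneg a, zneg b, (0, 0), zneg d)]"
    by (simp add: signed_def sgns_def assms)
  show ?thesis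
    unfolding s sum_signs_8[symmetric]
    by (simp only: list.map sum_list.Cons sum_list.Nil lform_def prod.case zpoly_neg zpoly_zero
        mult_zero_left add_0_left add_0_right mult_minus_left)
qed

lemma signed_sum_zero4:
  assumes "a \<noteq> (0, 0)" "b \<noteq> (0, 0)" "c \<noteq> (0, 0)"
  shows "(\<Sum>v\<leftarrow>signed (a, b, c, (0, 0)). lform v ^ 12) =
    8 * even_trinomial ((zpoly a * Var 1) ^ 2) ((zpoly b * Var 2) ^ 2) ((zpoly c * Var 3) ^ 2)"
proof -
  have s: "signed (a, b, c, (0, 0)) = [(a, b, c, (0, 0)), (a, b, zneg c, (0, 0)), (a, zneg b, c, (0, 0)), (a, zneg b, zneg c, (0, 0)), (zneg a, b, c, (0, 0)), (zneg a, b, zneg c, (0, 0)), (zneg a, zneg b, c, (0, 0)), (zneg a, zneg b, zneg c, (0, 0))]"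
    by (simp add: signed_def sgns_def assms)
  show ?thesis
    unfolding s sum_signs_8[symmetric]
    by (simp only: list.map sum_list.Cons sum_list.Nil lform_def prod.case zpoly_neg zpoly_zero
        mult_zero_left add_0_left add_0_right mult_minus_left)
qed

lemma signed_sum_ones:
  "(\<Sum>v\<leftarrow>signed ((1, 0), (1, 0), (1, 0), (1, 0)). lform v ^ 12) =
    16 * (let A = Var 1 ^ 2; B = Var 2 ^ 2; C = Var 3 ^ 2; D = Var 4 ^ 2 in
      A ^ 6 + 66 * A ^ 5 * B + 66 * A ^ 5 * C + 66 * A ^ 5 * D + 495 * A ^ 4 * B ^ 2 + 2970 * A ^ 4 * B * C + 2970 * A ^ 4 * B * D + 495 * A ^ 4 * C ^ 2 + 2970 * A ^ 4 * C * D + 495 * A ^ 4 * D ^ 2 + 924 * A ^ 3 * B ^ 3 + 13860 * A ^ 3 * B ^ 2 * C + 13860 * A ^ 3 * B ^ 2 * D + 13860 * A ^ 3 * B * C ^ 2 + 83160 * A ^ 3 * B * C * D + 13860 * A ^ 3 * B * D ^ 2 + 924 * A ^ 3 * C ^ 3 + 13860 * A ^ 3 * C ^ 2 * D + 13860 * A ^ 3 * C * D ^ 2 + 924 * A ^ 3 * D ^ 3 + 495 * A ^ 2 * B ^ 4 + 13860 * A ^ 2 * B ^ 3 * C + 13860 * A ^ 2 * B ^ 3 * D + 34650 * A ^ 2 * B ^ 2 * C ^ 2 + 207900 * A ^ 2 * B ^ 2 * C * D + 34650 * A ^ 2 * B ^ 2 * D ^ 2 + 13860 * A ^ 2 * B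 * C ^ 3 + 207900 * A ^ 2 * B * C ^ 2 * D + 207900 * A ^ 2 * B * C * D ^ 2 + 13860 * A ^ 2 * B * D ^ 3 + 495 * A ^ 2 * C ^ 4 + 13860 * A ^ 2 * C ^ 3 * D + 34650 * A ^ 2 * C ^ 2 * D ^ 2 + 13860 * A ^ 2 * C * D ^ 3 + 495 * A ^ 2 * D ^ 4 + 66 * A * B ^ 5 + 2970 * A * B ^ 4 * C + 2970 * A * B ^ 4 * D + 13860 * A * B ^ 3 * C ^ 2 + 83160 * A * B ^ 3 * C * D + 13860 * A * B ^ 3 * D ^ 2 + 13860 * A * B ^ 2 * C ^ 3 + 207900 * A * B ^ 2 * C ^ 2 * D + 207900 * A * B ^ 2 * C * D ^ 2 + 13860 * A * B ^ 2 * D ^ 3 + 2970 * A * B * C ^ 4 + 83160 * A * B * C ^ 3 * D + 207900 * A * B * C ^ 2 * D ^ 2 + 83160 * A * B * C * D ^ 3 + 2970 * A * B * D ^ 4 + 66 * A * C ^ 5 + 2970 * A * C ^ 4 * D + 13860 * A * C ^ 3 * D ^ 2 + 13860 * A * C ^ 2 * D ^ 3 + 2970 * A * C * D ^ 4 + 66 * A * D ^ 5 + B ^ 6 + 66 * B ^ 5 * C + 66 * B ^ 5 * D + 495 * B ^ 4 * C ^ 2 + 2970 * B ^ 4 * C * D + 495 * B ^ 4 * D ^ 2 + 924 * B ^ 3 * C ^ 3 + 13860 * B ^ 3 * C ^ 2 * D + 13860 * B ^ 3 * C * D ^ 2 + 924 * B ^ 3 * D ^ 3 + 495 * B ^ 2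 * C ^ 4 + 13860 * B ^ 2 * C ^ 3 * D + 34650 * B ^ 2 * C ^ 2 * D ^ 2 + 13860 * B ^ 2 * C * D ^ 3 + 495 * B ^ 2 * D ^ 4 + 66 * B * C ^ 5 + 2970 * B * C ^ 4 * D + 13860 * B * C ^ 3 * D ^ 2 + 13860 * B * C ^ 2 * D ^ 3 + 2970 * B * C * D ^ 4 + 66 * B * D ^ 5 + C ^ 6 + 66 * C ^ 5 * D + 495 * C ^ 4 * D ^ 2 + 924 * C ^ 3 * D ^ 3 + 495 * C ^ 2 * D ^ 4 + 66 * C * D ^ 5 + D ^ 6)"
proof -
  have s: "signed ((1, 0), (1, 0), (1, 0), (1, 0)) = [((1, 0), (1, 0), (1, 0), (1, 0)), ((1, 0), (1, 0), (1, 0), zneg (1, 0)), ((1, 0), (1, 0), zneg (1, 0), (1, 0)), ((1, 0), (1, 0), zneg (1, 0), zneg (1, 0)), ((1, 0), zneg (1, 0), (1, 0), (1, 0)), ((1, 0), zneg (1, 0), (1, 0), zneg (1, 0)), ((1, 0), zneg (1, 0), zneg (1, 0), (1, 0)), ((1, 0), zneg (1, 0), zneg (1, 0), zneg (1, 0)), (zneg (1, 0), (1, 0), (1, 0), (1, 0)), (zneg (1, 0), (1, 0), (1, 0), zneg (1, 0)), (zneg (1, 0), (1, 0), zneg (1, 0), (1, 0)), (zneg (1, 0), (1, 0), zneg (1, 0), zneg (1, 0)), (zneg (1, 0), zneg (1, 0), (1, 0), (1, 0)), (zneg (1, 0), zneg (1, 0), (1, 0), zneg (1, 0)), (zneg (1,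 0), zneg (1, 0), zneg (1, 0), (1, 0)), (zneg (1, 0), zneg (1, 0), zneg (1, 0), zneg (1, 0))]"
    by (simp only: signed_def prod.case sgns_def zphi_nonzero if_False list.map concat.simps append.simps)
  show ?thesis
    unfolding s sum_signs_16[symmetric]
    by (simp only: list.map sum_list.Cons sum_list.Nil lform_def prod.case zpoly_neg zpoly_values
        mult_minus_left mult_1_left)
qed

lemma signed_sum_axis:
  "(\<Sum>v\<leftarrow>signed ((2, 0), (0, 0), (0, 0), (0, 0)). lform v ^ 12) = 2 * 4096 * (Var 1 ^ 2) ^ 6"
  "(\<Sum>v\<leftarrow>signed ((0, 0), (2, 0), (0, 0), (0, 0)). lform v ^ 12) = 2 * 4096 * (Var 2 ^ 2) ^ 6"
  "(\<Sum>v\<leftarrow>signed ((0, 0), (0, 0), (2, 0), (0, 0)). lform v ^ 12) = 2 * 4096 * (Var 3 ^ 2) ^ 6"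
  "(\<Sum>v\<leftarrow>signed ((0, 0), (0, 0), (0, 0), (2, 0)). lform v ^ 12) = 2 * 4096 * (Var 4 ^ 2) ^ 6"
  by (simp_all add: signed_def sgns_def lform_def zpoly_neg zpoly_zero)
    (simp_all add: zpoly_def power_mult_distrib)

lemma even_trinomial_swap:
  "even_trinomial A B C = even_trinomial B A C" "even_trinomial A B C = even_trinomial A C B"
  unfolding even_trinomial_def by Groebner_Basis.algebra+

lemma golden_sums:
  "even_trinomial ((zpoly (0, 1) * x) ^ 2) ((zpoly (1, 0) * y) ^ 2) ((zpoly (-1, 1) * z) ^ 2) = golden_trinomial gold (x ^ 2) (y ^ 2) (z ^ 2)"
  "even_trinomial ((zpoly (0, 1) * x) ^ 2) ((zpoly (-1, 1) * z) ^ 2) ((zpoly (1, 0) * y) ^ 2) = golden_trinomial gold (x ^ 2) (y ^ 2) (z ^ 2)"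
  "even_trinomial ((zpoly (1, 0) * y) ^ 2) ((zpoly (0, 1) * x) ^ 2) ((zpoly (-1, 1) * z) ^ 2) = golden_trinomial gold (x ^ 2) (y ^ 2) (z ^ 2)"
  "even_trinomial ((zpoly (-1, 1) * z) ^ 2) ((zpoly (0, 1) * x) ^ 2) ((zpoly (1, 0) * y) ^ 2) = golden_trinomial gold (x ^ 2) (y ^ 2) (z ^ 2)"
  "even_trinomial ((zpoly (1, 0) * y) ^ 2) ((zpoly (-1, 1) * z) ^ 2) ((zpoly (0, 1) * x) ^ 2) = golden_trinomial gold (x ^ 2) (y ^ 2) (z ^ 2)"
  "even_trinomial ((zpoly (-1, 1) * z) ^ 2) ((zpoly (1, 0) * y) ^ 2) ((zpoly (0, 1) * x) ^ 2) = golden_trinomial gold (x ^ 2) (y ^ 2) (z ^ 2)"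
proof -
  have x: "(zpoly (0, 1) * x) ^ 2 = (gold + 1) * x ^ 2"
    by (simp add: zpoly_def power_mult_distrib gold_square)
  have y: "(zpoly (1, 0) * y) ^ 2 = y ^ 2"
    by (simp add: zpoly_def)
  have "(gold - 1) ^ 2 = 2 - gold" using gold_square by Groebner_Basis.algebra
  then have z: "(zpoly (-1, 1) * z) ^ 2 = (2 - gold) * z ^ 2"
    by (simp add: zpoly_def power_mult_distrib)
  show "even_trinomial ((zpoly (0, 1) * x) ^ 2) ((zpoly (1, 0) * y) ^ 2) ((zpoly (-1, 1) * z) ^ 2) = golden_trinomial gold (x ^ 2) (y ^ 2) (z ^ 2)"
    unfolding x y z by (rule even_trinomial_golden[OF gold_square])
  then show "even_trinomial ((zpoly (0, 1) * x) ^ 2) ((zpoly (-1, 1) * z) ^ 2) ((zpoly (1, 0) * y) ^ 2) = golden_trinomial gold (x ^ 2) (y ^ 2) (z ^ 2)"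
    "even_trinomial ((zpoly (1, 0) * y) ^ 2) ((zpoly (0, 1) * x) ^ 2) ((zpoly (-1, 1) * z) ^ 2) = golden_trinomial gold (x ^ 2) (y ^ 2) (z ^ 2)"
    "even_trinomial ((zpoly (-1, 1) * z) ^ 2) ((zpoly (0, 1) * x) ^ 2) ((zpoly (1, 0) * y) ^ 2) = golden_trinomial gold (x ^ 2) (y ^ 2) (z ^ 2)"
    "even_trinomial ((zpoly (1, 0) * y) ^ 2) ((zpoly (-1, 1) * z) ^ 2) ((zpoly (0, 1) * x) ^ 2) = golden_trinomial gold (x ^ 2) (y ^ 2) (z ^ 2)"
    "even_trinomial ((zpoly (-1, 1) * z) ^ 2) ((zpoly (1, 0) * y) ^ 2) ((zpoly (0, 1) * x) ^ 2) = golden_trinomial gold (x ^ 2) (y ^ 2) (z ^ 2)"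
    by (metis even_trinomial_swap)+
qed

abbreviation sx :: poly4 where "sx \<equiv> Var 1 ^ 2 + Var 2 ^ 2 + Var 3 ^ 2"

text \<open>\<open>sx\<close>, \<open>px\<close> and \<open>tx\<close> are basic invariants, of
  degrees 2, 6 and 10, of the icosahedral reflection group that fixes the base point.\<close>

definition px :: poly4 where "px = inv6 gold (Var 1 ^ 2) (Var 2 ^ 2) (Var 3 ^ 2)"

definition tx :: poly4 where "tx = inv10 gold (Var 1 ^ 2) (Var 2 ^ 2) (Var 3 ^ 2)"

lemma sum_roots: "(\<Sum>v\<leftarrow>roots. lform v ^ 12) = 15960 * f2 ^ 6 - 3360 * inv12 sx px tx (Var 4 ^ 2)"
proof -
  have concat: "(\<Sum>v\<leftarrow>concat (map signed Bs). F v) = (\<Sum>B\<leftarrow>Bs. \<Sum>v\<leftarrow>signed B. F v)"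
    for Bs and F :: "zvec \<Rightarrow> poly4"
    by (induction Bs) simp_all
  show ?thesis
    unfolding roots_def concat f2_def px_def tx_def power_sum_identity[OF gold_square, symmetric]
    unfolding root_bases_def Let_def list.map sum_list.Cons sum_list.Nil signed_sum_axis signed_sum_ones
    unfolding Let_def
    by (simp only: signed_sum_zero1 signed_sum_zero2 signed_sum_zero3 signed_sum_zero4 zphi_nonzero
        not_False_eq_True golden_sums, simp only: zpoly_zero add_0_right add_0_left) Groebner_Basis.algebra
qed

text \<open>Restriction to the x-axis keeps the coefficient of x^n, which yields the normalising
  coefficient of the orbit sum without expanding it.\<close>

lemma lookup_axis:
  "Poly_Mapping.lookup (subst (\<lambda>i. if i = 1 then Var 1 else 0) f) (Poly_Mapping.single 1 n) =
    Poly_Mapping.lookup f (Poly_Mapping.single 1 n)"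
proof (induction f rule: poly_single_induct)
  case (single m c)
  let ?l = "Poly_Mapping.lookup m"
  have prod4: "(\<Prod>i\<in>UNIV. F i) = F 1 * (F 2 * (F 3 * F 4))" for F :: "4 \<Rightarrow> poly4"
    unfolding UNIV_4 by simp
  have neq: "(2 :: 4) \<noteq> 1" "(3 :: 4) \<noteq> 1" "(4 :: 4) \<noteq> 1" by simp_all
  have s: "subst (\<lambda>i. if i = 1 then Var 1 else 0) (Poly_Mapping.single m c) =
      Const c * (Var 1 ^ ?l 1 * (0 ^ ?l 2 * (0 ^ ?l 3 * 0 ^ ?l 4)))"
    unfolding subst_single prod4 by (simp only: neq if_True if_False refl)
  show ?case
  proof (cases "?l 2 = 0 \<and> ?l 3 = 0 \<and> ?l 4 = 0")
    case True
    then have "m = Poly_Mapping.single 1 (?l 1)"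
      by (intro mon4_eqI) (use exhaust_4 in \<open>force simp: lookup_single when_def\<close>)
    moreover have "Poly_Mapping.lookup (Const c * Var 1 ^ ?l 1) k = Poly_Mapping.lookup (Poly_Mapping.single (Poly_Mapping.single 1 (?l 1)) c) k" for k
      by (simp add: Var_power Const_def mult_single)
    ultimately show ?thesis unfolding s using True by simp
  next
    case False
    then have "m \<noteq> Poly_Mapping.single 1 n" by (auto simp: lookup_single)
    moreover have "0 ^ ?l 2 * (0 ^ ?l 3 * 0 ^ ?l 4) = (0 :: poly4)" using False by (auto simp: power_0_left)
    ultimately show ?thesis
      unfolding s by (simp only: lookup_single when_def mult_zero_right lookup_zero if_False)
  qed
qed (simp add: subst_add lookup_add)

text \<open>The orbit of x consists of the linear forms of the roots, so the orbit sum is a multiple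
  of their twelfth power sum; dividing by the coefficient of x^12 removes the unknown multiplicity
  N.\<close>

lemma f12_eq: "f12 = inv12 sx px tx (Var 4 ^ 2)"
proof -
  let ?F = "inv12 sx px tx (Var 4 ^ 2)"
  obtain N where N: "N > 0" and sum: "orbit_sum12 =
      of_nat N * (\<Sum>r\<in>H4. (\<Sum>j\<in>UNIV. Const (complex_of_real (r $ j)) * Var j) ^ 12)"
    using sum_over_W[of "\<lambda>v. (\<Sum>j\<in>UNIV. Const (complex_of_real (v $ j)) * Var j) ^ 12"]
    by (auto simp: orbit_sum12_def act_hom act_Var)
  \<comment> \<open>The factor is 2^-12, since \<open>lform\<close> uses the doubled
    coordinates.\<close>
  have "(\<Sum>r\<in>H4. (\<Sum>j\<in>UNIV. Const (complex_of_real (r $ j)) * Var j) ^ 12) =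
      Const (1 / 4096) * (\<Sum>v\<leftarrow>roots. lform v ^ 12)"
    unfolding sum_over_H4 lform_rvec power_mult_distrib
    by (simp add: sum_list_const_mult flip: Const_power) (simp add: power_divide)
  then have O: "orbit_sum12 = Const (of_nat N / 4096) * (15960 * f2 ^ 6 - 3360 * ?F)"
  proof -
    have "Const (of_nat N / 4096) = of_nat N * Const (1 / 4096)"
      by (simp flip: Const_of_nat Const_mult)
    then show ?thesis
      using \<open>_ = Const (1 / 4096) * _\<close> by (simp only: sum sum_roots mult.assoc)
  qed
  \<comment> \<open>Every term of \<open>inv12\<close> contains p, t or D, so only the multiple of
    \<open>f2 ^ 6\<close> survives on the x-axis.\<close>
  let ?e = "subst (\<lambda>i. if i = 1 then Var 1 else 0)"
  have neq: "(2 :: 4) \<noteq> 1" "(3 :: 4) \<noteq> 1" "(4 :: 4) \<noteq> 1" by simp_all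
  have e: "?e (Var 1) = Var 1" "?e (Var 2) = 0" "?e (Var 3) = 0" "?e (Var 4) = 0"
    by (simp_all only: subst_Var neq if_True if_False refl)
  have z: "(0 :: poly4) ^ 2 = 0" by simp
  have f2': "?e f2 = Var 1 ^ 2"
    by (simp only: f2_def subst_hom e z add_0_right)
  have "?e px = inv6 gold (Var 1 ^ 2) 0 0"
    by (simp only: px_def inv6_def subst_hom subst_numeral subst_1 e z gold_def)
  then have px': "?e px = 0" by (simp add: inv6_def)
  have "?e tx = inv10 gold (Var 1 ^ 2) 0 0"
    by (simp only: tx_def inv10_def subst_hom subst_numeral subst_1 e z gold_def)
  then have tx': "?e tx = 0" by (simp add: inv10_def)
  have "?e ?F = inv12 (Var 1 ^ 2) 0 0 0"
    by (simp only: inv12_def subst_hom subst_numeral px' tx' e z add_0_right)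
  then have F': "?e ?F = 0" by (simp add: inv12_def)
  have "?e orbit_sum12 = Const (of_nat N / 4096) * (15960 * (Var 1 ^ 2) ^ 6)"
    by (simp only: O subst_hom subst_numeral f2' F' mult_zero_right diff_zero)
  also have "\<dots> = Const (of_nat N / 4096 * 15960) * Var 1 ^ 12"
    by (simp only: Const_mult Const_numeral mult.assoc power_mult[symmetric]) simp
  finally have "Poly_Mapping.lookup (?e orbit_sum12) (Poly_Mapping.single 1 12) = of_nat N / 4096 * 15960"
    by (simp only: lookup_Const_mult Var_power) simp
  then have "Poly_Mapping.lookup orbit_sum12 (Poly_Mapping.single 1 12) = of_nat N / 4096 * 15960"
    by (simp only: lookup_axis)
  then have "g12 = Const (1 / (of_nat N / 4096 * 15960)) * Const (of_nat N / 4096) * (15960 * f2 ^ 6 - 3360 * ?F)"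
    unfolding g12_def by (simp only: O mult.assoc)
  also have "Const (1 / (of_nat N / 4096 * 15960)) * Const (of_nat N / 4096) = Const (1 / 15960)"
    using N by (simp flip: Const_mult)
  finally have "15960 * g12 = (Const 15960 * Const (1 / 15960)) * (15960 * f2 ^ 6 - 3360 * ?F)"
    by (simp only: Const_numeral mult.assoc)
  also have "Const 15960 * Const (1 / 15960) = 1" by (simp flip: Const_mult del: Const_numeral)
  finally have "15960 * g12 = 15960 * f2 ^ 6 - 3360 * ?F" by simp
  moreover have "4 * f12 = 19 * (f2 ^ 6 - g12)"
  proof -
    have "Const 4 * Const (19 / 4) = Const 19" by (simp flip: Const_mult del: Const_numeral)
    then show ?thesis unfolding f12_def by (simp add: mult.assoc[symmetric])
  qed
  ultimately show ?thesis by Groebner_Basis.algebra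
qed

section \<open>Standard monomials in the generators\<close>

text \<open>
  The generators are indexed by their position in \<open>R_gens\<close>. A standard monomial is
  \<open>g\<^sub>8\<^sup>i g\<^sub>1\<^sub>0\<^sup>j\<close> times an element of one of twelve families: four heads times powers of
  \<open>g\<^sub>2\<close>, six heads times powers of \<open>g\<^sub>6\<close>, and the two single elements \<open>g\<^sub>7\<close> and \<open>g\<^sub>9\<close>.
  They are the monomials avoiding the leading monomials of a quadratic Groebner basis of the
  relations modulo \<open>f\<^sub>2\<close>.
\<close>

definition shead :: "(nat \<Rightarrow> 'a::comm_monoid_mult) \<Rightarrow> nat \<Rightarrow> 'a" where
  "shead g \<beta> = [1, g 4, g 5, g 4 * g 5, g 6, g 1, g 3, g 11, g 1 * g 11, g 3 * g 11, g 7, g 9] ! \<beta>"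

definition sstep :: "(nat \<Rightarrow> 'a) \<Rightarrow> nat \<Rightarrow> 'a" where
  "sstep g \<beta> = (if \<beta> < 4 then g 2 else g 6)"

definition smon :: "(nat \<Rightarrow> 'a::comm_monoid_mult) \<Rightarrow> ((nat \<times> nat) \<times> nat) \<times> nat \<Rightarrow> 'a" where
  "smon g = (\<lambda>(((\<beta>, i), j), m). g 8 ^ i * g 10 ^ j * (shead g \<beta> * sstep g \<beta> ^ m))"

text \<open>The additive counterpart of \<open>smon\<close>: the exponent of t when generator i is
  replaced by t^(w i), as in \<open>smon_power\<close>.\<close>

definition sweight :: "(nat \<Rightarrow> nat) \<Rightarrow> ((nat \<times> nat) \<times> nat) \<times> nat \<Rightarrow> nat" where
  "sweight w = (\<lambda>(((\<beta>, i), j), m). i * w 8 + j * w 10 +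
     ([0, w 4, w 5, w 4 + w 5, w 6, w 1, w 3, w 11, w 1 + w 11, w 3 + w 11, w 7, w 9] ! \<beta> + m * sstep w \<beta>))"

definition sidx :: "(((nat \<times> nat) \<times> nat) \<times> nat) set" where
  "sidx = {(((\<beta>, i), j), m). \<beta> < 12 \<and> (10 \<le> \<beta> \<longrightarrow> m = 0)}"

lemma less_12: "\<beta> < 12 \<longleftrightarrow> \<beta> \<in> {0, 1, 2, 3, 4, 5, 6, 7, 8, 9, 10, 11 :: nat}"
  unfolding insert_iff empty_iff by presburger

lemma (in grading) smon_weight:
  assumes g: "\<And>i. i < 12 \<Longrightarrow> wpart \<omega> (w i) (g i) = g i" and x: "x \<in> sidx"
  shows "wpart \<omega> (sweight w x) (smon g x) = smon g x"
proof -
  obtain \<beta> i j m where x': "x = (((\<beta>, i), j), m)" by (metis surj_pair)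
  have 1: "wpart \<omega> 0 1 = 1" by (simp add: wpart_1)
  have "wpart \<omega> ([0, w 4, w 5, w 4 + w 5, w 6, w 1, w 3, w 11, w 1 + w 11, w 3 + w 11, w 7, w 9] ! \<beta>) (shead g \<beta>) = shead g \<beta>"
    using x unfolding x' sidx_def less_12 by (auto simp: shead_def 1 intro!: wpart_pure_mult g)
  moreover have "wpart \<omega> (sstep w \<beta>) (sstep g \<beta>) = sstep g \<beta>"
    by (simp add: sstep_def g)
  ultimately show ?thesis
    unfolding x' smon_def sweight_def prod.case
    by (intro wpart_pure_mult wpart_pure_power g) simp_all
qed

lemma (in grading) smon_lowest:
  assumes g: "\<And>i. i < 12 \<Longrightarrow> vanishes \<omega> (w i) (g i) \<and> wpart \<omega> (w i) (g i) = g' i" and x: "x \<in> sidx"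
  shows "vanishes \<omega> (sweight w x) (smon g x) \<and> wpart \<omega> (sweight w x) (smon g x) = smon g' x"
proof -
  define L where "L k f f' \<longleftrightarrow> vanishes \<omega> k f \<and> wpart \<omega> k f = f'" for k f f'
  have mult: "L (k + l) (f * h) (f' * h')" if "L k f f'" "L l h h'" for k l f f' h h'
    using that unfolding L_def by (auto simp: vanishes_mult wpart_mult_lowest)
  have pow: "L (n * k) (f ^ n) (f' ^ n)" if "L k f f'" for n k f f'
    using that unfolding L_def by (auto simp: vanishes_power wpart_power_lowest)
  have 1: "L 0 1 1" by (simp add: L_def wpart_1)
  have g: "L (w i) (g i) (g' i)" if "i < 12" for i using g[OF that] by (simp add: L_def)
  obtain \<beta> i j m where x': "x = (((\<beta>, i), j), m)" by (metis surj_pair)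
  have "L ([0, w 4, w 5, w 4 + w 5, w 6, w 1, w 3, w 11, w 1 + w 11, w 3 + w 11, w 7, w 9] ! \<beta>) (shead g \<beta>) (shead g' \<beta>)"
    using x unfolding x' sidx_def less_12 by (auto simp: shead_def 1 intro!: mult g)
  moreover have "L (sstep w \<beta>) (sstep g \<beta>) (sstep g' \<beta>)"
    by (simp add: sstep_def g)
  ultimately show ?thesis
    unfolding L_def[symmetric] x' smon_def sweight_def prod.case
    by (intro mult pow g) simp_all
qed

lemma smon_hom:
  assumes "\<And>a b. \<phi> (a * b) = \<phi> a * \<phi> b" "\<phi> 1 = 1" and x: "x \<in> sidx"
  shows "\<phi> (smon g x) = smon (\<lambda>i. \<phi> (g i)) x"
proof -
  have p: "\<phi> (a ^ n) = \<phi> a ^ n" for a n by (induction n) (simp_all add: assms)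
  obtain \<beta> i j m where x': "x = (((\<beta>, i), j), m)" by (metis surj_pair)
  have "\<phi> (shead g \<beta>) = shead (\<lambda>i. \<phi> (g i)) \<beta>"
    using x unfolding x' sidx_def less_12 by (auto simp: shead_def assms)
  then show ?thesis by (simp add: x' smon_def sstep_def assms p)
qed

lemma smon_mult:
  assumes x: "x \<in> sidx"
  shows "smon (\<lambda>i. g i * h i) x = smon g x * smon h x"
proof -
  obtain \<beta> i j m where x': "x = (((\<beta>, i), j), m)" by (metis surj_pair)
  have "shead (\<lambda>i. g i * h i) \<beta> = shead g \<beta> * shead h \<beta>"
    using x unfolding x' sidx_def less_12 by (auto simp: shead_def mult_ac)
  moreover have "sstep (\<lambda>i. g i * h i) \<beta> = sstep g \<beta> * sstep h \<beta>" by (simp add: sstep_def)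
  ultimately show ?thesis by (simp add: x' smon_def power_mult_distrib mult_ac)
qed

lemma smon_closed:
  assumes x: "x \<in> sidx" and "P 1" "\<And>a b. P a \<Longrightarrow> P b \<Longrightarrow> P (a * b)" "\<And>i. 0 < i \<Longrightarrow> i < 12 \<Longrightarrow> P (g i)"
  shows "P (smon g x)"
proof -
  have p: "P (a ^ n)" if "P a" for a n using that by (induction n) (simp_all add: assms)
  obtain \<beta> i j m where x': "x = (((\<beta>, i), j), m)" by (metis surj_pair)
  have "P (shead g \<beta>)"
    using x unfolding x' sidx_def less_12 by (auto simp: shead_def assms)
  then show ?thesis by (simp add: x' smon_def sstep_def assms p)
qed

text \<open>The leading forms of the generators, up to scalar factors, as polynomials in three of them.\<close>

definition lead :: "nat \<Rightarrow> poly4" where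
  "lead i = (let P = Var 1; Q = Var 2; R = Var 3 in
    [1, P, P ^ 2, Q, P ^ 3, P * Q, R, P ^ 2 * Q, Q ^ 2 - P * R, P * Q ^ 2 - 2 * P ^ 2 * R,
     3 * P ^ 2 * Q ^ 2 - 4 * P ^ 3 * R, 2 * Q ^ 3 - 3 * P * Q * R] ! i)"

interpretation Sv: vector_space "\<lambda>c f. Const c * f :: poly4"
  by standard (simp_all only: Const_add Const_mult Const_1 distrib_left distrib_right mult.assoc mult_1_left)

definition svec :: "poly4 set" where
  "svec = Sv.span (smon lead ` sidx)"

abbreviation "PP \<equiv> Var 1 :: poly4"
abbreviation "QQ \<equiv> Var 2 :: poly4"
abbreviation "RR \<equiv> Var 3 :: poly4"
abbreviation "kk \<equiv> QQ ^ 2 - PP * RR"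
abbreviation "nn \<equiv> PP * QQ ^ 2 - 2 * PP ^ 2 * RR"
abbreviation "zz \<equiv> 3 * PP ^ 2 * QQ ^ 2 - 4 * PP ^ 3 * RR"
abbreviation "yy \<equiv> 2 * QQ ^ 3 - 3 * PP * QQ * RR"

lemma lead_simps: "lead 1 = PP" "lead (Suc 0) = PP" "lead 2 = PP ^ 2" "lead 3 = QQ" "lead 4 = PP ^ 3" "lead 5 = PP * QQ" "lead 6 = RR"
  "lead 7 = PP ^ 2 * QQ" "lead 8 = kk" "lead 9 = nn" "lead 10 = zz" "lead 11 = yy"
  by (simp_all add: lead_def Let_def)

section \<open>Straightening: the span of the standard monomials in P, Q, R\<close>

lemma svec_add: "f \<in> svec \<Longrightarrow> g \<in> svec \<Longrightarrow> f + g \<in> svec"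
  and svec_diff: "f \<in> svec \<Longrightarrow> g \<in> svec \<Longrightarrow> f - g \<in> svec"
  and svec_scale: "f \<in> svec \<Longrightarrow> Const c * f \<in> svec"
  unfolding svec_def by (rule Sv.span_add Sv.span_diff Sv.span_scale; assumption)+

lemma svec_numeral: "f \<in> svec \<Longrightarrow> numeral n * f \<in> svec"
  using svec_scale[of f "numeral n"] by simp

text \<open>\<open>lead 8\<close> and \<open>lead 10\<close> occur in standard monomials with
  arbitrary exponents, so multiplication by them only raises an exponent; straightening then has to
  deal with the twelve families alone.\<close>

lemma svec_kz:
  assumes "f \<in> svec"
  shows "kk * f \<in> svec" "zz * f \<in> svec"
proof -
  have base: "kk * f \<in> svec \<and> zz * f \<in> svec" if f: "f \<in> smon lead ` sidx" for f
  proof -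
    obtain \<beta> i j m where x: "f = smon lead (((\<beta>, i), j), m)" "(((\<beta>, i), j), m) \<in> sidx" using f by auto
    then have "kk * f = smon lead (((\<beta>, Suc i), j), m)" "zz * f = smon lead (((\<beta>, i), Suc j), m)"
      by (simp_all only: smon_def prod.case lead_simps power_Suc mult_ac)
    moreover have "(((\<beta>, Suc i), j), m) \<in> sidx" "(((\<beta>, i), Suc j), m) \<in> sidx"
      using x(2) by (simp_all add: sidx_def)
    ultimately show ?thesis unfolding svec_def by (metis Sv.span_base imageI)
  qed
  have "f \<in> Sv.span (smon lead ` sidx)" using assms by (simp only: svec_def)
  then have "kk * f \<in> svec \<and> zz * f \<in> svec"
  proof (induction rule: Sv.span_induct_alt)
    case base
    show ?case by (simp only: mult_zero_right svec_def Sv.span_zero simp_thms)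
  next
    case (step c x y)
    have "t * (Const c * x + y) = Const c * (t * x) + t * y" for t
      by (simp only: distrib_left mult.left_commute)
    then show ?case using step base[OF step(1)] by (simp only:) (blast intro: svec_add svec_scale)
  qed
  then show "kk * f \<in> svec" "zz * f \<in> svec" by blast+
qed

lemma svec_family:
  assumes "\<beta> < 12" "10 \<le> \<beta> \<longrightarrow> m = 0"
  shows "shead lead \<beta> * sstep lead \<beta> ^ m \<in> svec"
proof -
  have "smon lead (((\<beta>, 0), 0), m) \<in> svec"
    unfolding svec_def using assms by (intro Sv.span_base imageI) (simp add: sidx_def)
  then show ?thesis by (simp add: smon_def)
qed

lemma svec_b: "(PP ^ 2) ^ m \<in> svec" "PP ^ 3 * (PP ^ 2) ^ m \<in> svec" "PP * QQ * (PP ^ 2) ^ m \<in> svec"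
    "PP ^ 3 * (PP * QQ) * (PP ^ 2) ^ m \<in> svec"
  using svec_family[of 0 m] svec_family[of 1 m] svec_family[of 2 m] svec_family[of 3 m]
  by (simp_all add: shead_def sstep_def lead_simps)

lemma svec_r': "RR * RR ^ m \<in> svec" "PP * RR ^ m \<in> svec" "QQ * RR ^ m \<in> svec" "yy * RR ^ m \<in> svec"
    "PP * yy * RR ^ m \<in> svec" "QQ * yy * RR ^ m \<in> svec"
  using svec_family[of 4 m] svec_family[of 5 m] svec_family[of 6 m] svec_family[of 7 m]
    svec_family[of 8 m] svec_family[of 9 m]
  by (simp_all add: shead_def sstep_def lead_simps)

lemma svec_hn: "PP ^ 2 * QQ \<in> svec" "nn \<in> svec"
  using svec_family[of 10 0] svec_family[of 11 0] by (simp_all add: shead_def sstep_def lead_simps)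

lemma svec_rpow: "RR ^ m \<in> svec"
  using svec_r'(1) svec_b(1)[of 0] by (cases m) auto

lemmas svec_intros = svec_add svec_diff svec_numeral svec_kz svec_b svec_r' svec_hn svec_rpow

text \<open>Each straightening lemma shows that a standard combination lies in the span and then
  identifies it with the wanted product as a polynomial. Writing k, z, n, y for \<open>kk\<close>,
  \<open>zz\<close>, \<open>nn\<close>, \<open>yy\<close>, the basic rewritings are PQR = 2kQ - y,
  P^2 R = kP - n, nR = Qy - 2k^2, P^3 Q^2 = 4kP^3 - zP, P^4 R = 3kP^3 - zP and PQy = 2kn +
  zR.\<close>

lemma svec_eqI: "g \<in> svec \<Longrightarrow> f = g \<Longrightarrow> f \<in> svec"
  by simp

lemma svec_nrpow: "nn * RR ^ m \<in> svec"
proof (cases m)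
  case (Suc m')
  have "QQ * yy * RR ^ m' - 2 * (kk * (kk * RR ^ m')) \<in> svec" by (intro svec_intros)
  then show ?thesis by (rule svec_eqI) (simp only: Suc power_Suc, Groebner_Basis.algebra)
qed (simp add: svec_hn)

lemma svec_erpow: "PP * QQ * RR ^ m \<in> svec"
proof (cases m)
  case (Suc m')
  have "2 * (kk * (QQ * RR ^ m')) - yy * RR ^ m' \<in> svec" by (intro svec_intros)
  then show ?thesis by (rule svec_eqI) (simp only: Suc power_Suc, Groebner_Basis.algebra)
next
  case 0
  then show ?thesis using svec_b(3)[of 0] by simp
qed

lemma svec_hrpow: "PP ^ 2 * QQ * RR ^ m \<in> svec"
proof (cases m)
  case (Suc m')
  have "2 * (kk * (PP * QQ * RR ^ m')) - PP * yy * RR ^ m' \<in> svec" by (intro svec_intros svec_erpow)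
  then show ?thesis by (rule svec_eqI) (simp only: Suc power_Suc, Groebner_Basis.algebra)
qed (simp add: svec_hn)

lemma svec_Pb: "PP * (PP ^ 2) ^ m \<in> svec"
proof (cases m)
  case (Suc m')
  have "PP ^ 3 * (PP ^ 2) ^ m' \<in> svec" by (intro svec_intros)
  then show ?thesis by (rule svec_eqI) (simp only: Suc power_Suc, Groebner_Basis.algebra)
next
  case 0
  then show ?thesis using svec_r'(2)[of 0] by simp
qed

lemma svec_Qb: "QQ * (PP ^ 2) ^ m \<in> svec"
proof (cases m)
  case 0
  then show ?thesis using svec_r'(3)[of 0] by simp
next
  case 1: (Suc m')
  show ?thesis
  proof (cases m')
    case 0
    show ?thesis using svec_hn(1) by (rule svec_eqI) (simp add: 1 0 mult.commute)
  next
    case (Suc m'')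
    have "PP ^ 3 * (PP * QQ) * (PP ^ 2) ^ m'' \<in> svec" by (intro svec_intros)
    then show ?thesis by (rule svec_eqI) (simp only: 1 Suc power_Suc, Groebner_Basis.algebra)
  qed
qed

lemma svec_P3Q2b: "PP ^ 3 * QQ ^ 2 * (PP ^ 2) ^ m \<in> svec"
proof -
  have "4 * (kk * (PP ^ 3 * (PP ^ 2) ^ m)) - zz * (PP * (PP ^ 2) ^ m) \<in> svec" by (intro svec_intros svec_Pb)
  then show ?thesis by (rule svec_eqI) Groebner_Basis.algebra
qed

lemma svec_P2rpow: "PP ^ 2 * RR ^ m \<in> svec"
proof (cases m)
  case 0
  then show ?thesis using svec_b(1)[of 1] by simp
next
  case (Suc m')
  have "kk * (PP * RR ^ m') - nn * RR ^ m' \<in> svec" by (intro svec_intros svec_nrpow)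
  then show ?thesis by (rule svec_eqI) (simp only: Suc power_Suc, Groebner_Basis.algebra)
qed

lemma svec_Rb: "RR * (PP ^ 2) ^ m \<in> svec"
proof (cases m)
  case 0
  then show ?thesis using svec_r'(1)[of 0] by simp
next
  case 1: (Suc m')
  show ?thesis
  proof (cases m')
    case 0
    show ?thesis using svec_P2rpow[of 1] by (rule svec_eqI) (simp add: 1 0 mult.commute)
  next
    case (Suc m'')
    have "3 * (kk * (PP ^ 3 * (PP ^ 2) ^ m'')) - zz * (PP * (PP ^ 2) ^ m'') \<in> svec" by (intro svec_intros svec_Pb)
    then show ?thesis by (rule svec_eqI) (simp only: 1 Suc power_Suc, Groebner_Basis.algebra)
  qed
qed

lemma svec_PQyr: "PP * (QQ * yy * RR ^ m) \<in> svec"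
proof -
  have "2 * (kk * (nn * RR ^ m)) + zz * (RR * RR ^ m) \<in> svec" by (intro svec_intros svec_nrpow)
  then show ?thesis by (rule svec_eqI) Groebner_Basis.algebra
qed

text \<open>The facts \<open>b0\<close> to \<open>b11\<close> treat the families with heads 0 to 11.
  As 1 is standard, closure under P, Q and R will put all monomials into the span.\<close>

lemma svec_families_PQR:
  assumes "\<beta> < 12" "10 \<le> \<beta> \<longrightarrow> m = 0"
  shows "PP * (shead lead \<beta> * sstep lead \<beta> ^ m) \<in> svec \<and> QQ * (shead lead \<beta> * sstep lead \<beta> ^ m) \<in> svec \<and>
    RR * (shead lead \<beta> * sstep lead \<beta> ^ m) \<in> svec"
proof -
  have b0: "PP * (PP ^ 2) ^ m \<in> svec \<and> QQ * (PP ^ 2) ^ m \<in> svec \<and> RR * (PP ^ 2) ^ m \<in> svec"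
    by (simp add: svec_Pb svec_Qb svec_Rb)
  have b1: "PP * (PP ^ 3 * (PP ^ 2) ^ m) \<in> svec \<and> QQ * (PP ^ 3 * (PP ^ 2) ^ m) \<in> svec \<and> RR * (PP ^ 3 * (PP ^ 2) ^ m) \<in> svec"
  proof (intro conjI)
    show "PP * (PP ^ 3 * (PP ^ 2) ^ m) \<in> svec"
      using svec_b(1)[of "Suc (Suc m)"] by (rule svec_eqI) (simp only: power_Suc, Groebner_Basis.algebra)
    show "QQ * (PP ^ 3 * (PP ^ 2) ^ m) \<in> svec"
      using svec_b(3)[of "Suc m"] by (rule svec_eqI) (simp only: power_Suc, Groebner_Basis.algebra)
    have "3 * (kk * (PP ^ 2) ^ Suc m) - zz * (PP ^ 2) ^ m \<in> svec" by (intro svec_intros)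
    then show "RR * (PP ^ 3 * (PP ^ 2) ^ m) \<in> svec"
      by (rule svec_eqI) (simp only: power_Suc, Groebner_Basis.algebra)
  qed
  have b2: "PP * (PP * QQ * (PP ^ 2) ^ m) \<in> svec \<and> QQ * (PP * QQ * (PP ^ 2) ^ m) \<in> svec \<and> RR * (PP * QQ * (PP ^ 2) ^ m) \<in> svec"
  proof (intro conjI)
    show "PP * (PP * QQ * (PP ^ 2) ^ m) \<in> svec"
      using svec_Qb[of "Suc m"] by (rule svec_eqI) (simp only: power_Suc, Groebner_Basis.algebra)
    show "QQ * (PP * QQ * (PP ^ 2) ^ m) \<in> svec"
    proof (cases m)
      case 0
      have "2 * (kk * (PP * RR ^ 0)) - nn \<in> svec" by (intro svec_intros)
      then show ?thesis by (rule svec_eqI) (simp only: 0 power_0, Groebner_Basis.algebra)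
    next
      case (Suc m')
      show ?thesis using svec_P3Q2b[of m'] by (rule svec_eqI) (simp only: Suc power_Suc, Groebner_Basis.algebra)
    qed
    show "RR * (PP * QQ * (PP ^ 2) ^ m) \<in> svec"
    proof (cases m)
      case 0
      show ?thesis using svec_erpow[of 1] by (rule svec_eqI) (simp only: 0 power_0 power_one_right, Groebner_Basis.algebra)
    next
      case (Suc m')
      have "3 * (kk * (QQ * (PP ^ 2) ^ Suc m')) - zz * (QQ * (PP ^ 2) ^ m') \<in> svec" by (intro svec_intros svec_Qb)
      then show ?thesis by (rule svec_eqI) (simp only: Suc power_Suc, Groebner_Basis.algebra)
    qed
  qed
  have b3: "PP * (PP ^ 3 * (PP * QQ) * (PP ^ 2) ^ m) \<in> svec \<and> QQ * (PP ^ 3 * (PP * QQ) * (PP ^ 2) ^ m) \<in> svec \<and>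
      RR * (PP ^ 3 * (PP * QQ) * (PP ^ 2) ^ m) \<in> svec"
  proof (intro conjI)
    show "PP * (PP ^ 3 * (PP * QQ) * (PP ^ 2) ^ m) \<in> svec"
      using svec_b(3)[of "Suc (Suc m)"] by (rule svec_eqI) (simp only: power_Suc, Groebner_Basis.algebra)
    have "4 * (kk * (PP ^ 2) ^ Suc (Suc m)) - zz * (PP ^ 2) ^ Suc m \<in> svec" by (intro svec_intros)
    then show "QQ * (PP ^ 3 * (PP * QQ) * (PP ^ 2) ^ m) \<in> svec"
      by (rule svec_eqI) (simp only: power_Suc, Groebner_Basis.algebra)
    have "3 * (kk * (PP * QQ * (PP ^ 2) ^ Suc m)) - zz * (PP * QQ * (PP ^ 2) ^ m) \<in> svec" by (intro svec_intros)
    then show "RR * (PP ^ 3 * (PP * QQ) * (PP ^ 2) ^ m) \<in> svec"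
      by (rule svec_eqI) (simp only: power_Suc, Groebner_Basis.algebra)
  qed
  have b4: "PP * (RR * RR ^ m) \<in> svec \<and> QQ * (RR * RR ^ m) \<in> svec \<and> RR * (RR * RR ^ m) \<in> svec"
    using svec_r'(1,2,3)[of "Suc m"] by simp
  have b5: "PP * (PP * RR ^ m) \<in> svec \<and> QQ * (PP * RR ^ m) \<in> svec \<and> RR * (PP * RR ^ m) \<in> svec"
    using svec_P2rpow[of m] svec_erpow[of m] svec_r'(2)[of "Suc m"] by (simp only: power2_eq_square power_Suc mult_ac simp_thms)
  have b6: "PP * (QQ * RR ^ m) \<in> svec \<and> QQ * (QQ * RR ^ m) \<in> svec \<and> RR * (QQ * RR ^ m) \<in> svec"
  proof (intro conjI)
    have "kk * RR ^ m + PP * RR ^ Suc m \<in> svec" by (intro svec_intros)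
    then show "QQ * (QQ * RR ^ m) \<in> svec" by (rule svec_eqI) (simp only: power_Suc, Groebner_Basis.algebra)
  qed (use svec_erpow[of m] svec_r'(3)[of "Suc m"] in \<open>simp_all only: power_Suc mult_ac\<close>)
  have b7: "PP * (yy * RR ^ m) \<in> svec \<and> QQ * (yy * RR ^ m) \<in> svec \<and> RR * (yy * RR ^ m) \<in> svec"
    using svec_r'(5,6)[of m] svec_r'(4)[of "Suc m"] by (simp only: power_Suc mult_ac simp_thms)
  have b8: "PP * (PP * yy * RR ^ m) \<in> svec \<and> QQ * (PP * yy * RR ^ m) \<in> svec \<and> RR * (PP * yy * RR ^ m) \<in> svec"
  proof (intro conjI)
    have "zz * (QQ * RR ^ m) - kk * (PP ^ 2 * QQ * RR ^ m) \<in> svec" by (intro svec_intros svec_hrpow)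
    then show "PP * (PP * yy * RR ^ m) \<in> svec" by (rule svec_eqI) Groebner_Basis.algebra
    show "QQ * (PP * yy * RR ^ m) \<in> svec"
      using svec_PQyr[of m] by (rule svec_eqI) Groebner_Basis.algebra
    show "RR * (PP * yy * RR ^ m) \<in> svec"
      using svec_r'(5)[of "Suc m"] by (rule svec_eqI) (simp only: power_Suc, Groebner_Basis.algebra)
  qed
  have b9: "PP * (QQ * yy * RR ^ m) \<in> svec \<and> QQ * (QQ * yy * RR ^ m) \<in> svec \<and> RR * (QQ * yy * RR ^ m) \<in> svec"
  proof (intro conjI)
    show "PP * (QQ * yy * RR ^ m) \<in> svec" by (rule svec_PQyr)
    have "kk * (yy * RR ^ m) + PP * yy * RR ^ Suc m \<in> svec" by (intro svec_intros)
    then show "QQ * (QQ * yy * RR ^ m) \<in> svec" by (rule svec_eqI) (simp only: power_Suc, Groebner_Basis.algebra)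
    show "RR * (QQ * yy * RR ^ m) \<in> svec"
      using svec_r'(6)[of "Suc m"] by (rule svec_eqI) (simp only: power_Suc, Groebner_Basis.algebra)
  qed
  have b10: "PP * (PP ^ 2 * QQ) \<in> svec \<and> QQ * (PP ^ 2 * QQ) \<in> svec \<and> RR * (PP ^ 2 * QQ) \<in> svec"
  proof (intro conjI)
    show "PP * (PP ^ 2 * QQ) \<in> svec"
      using svec_b(3)[of 1] by (rule svec_eqI) (simp only: power_one_right, Groebner_Basis.algebra)
    have "4 * (kk * (PP ^ 2) ^ 1) - zz * (PP ^ 2) ^ 0 \<in> svec" by (intro svec_intros)
    then show "QQ * (PP ^ 2 * QQ) \<in> svec"
      by (rule svec_eqI) (simp only: power_one_right power_0, Groebner_Basis.algebra)
    show "RR * (PP ^ 2 * QQ) \<in> svec" using svec_hrpow[of 1] by (simp only: power_one_right mult_ac)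
  qed
  have b11: "PP * nn \<in> svec \<and> QQ * nn \<in> svec \<and> RR * nn \<in> svec"
  proof (intro conjI)
    have "zz * (PP ^ 2) ^ 0 - 2 * (kk * (PP ^ 2) ^ 1) \<in> svec" by (intro svec_intros)
    then show "PP * nn \<in> svec" by (rule svec_eqI) (simp only: power_one_right power_0, Groebner_Basis.algebra)
    have "PP * yy * RR ^ 0 - kk * (PP * QQ * (PP ^ 2) ^ 0) \<in> svec" by (intro svec_intros)
    then show "QQ * nn \<in> svec" by (rule svec_eqI) (simp only: power_0, Groebner_Basis.algebra)
    show "RR * nn \<in> svec"
      using svec_nrpow[of 1] by (rule svec_eqI) (simp only: power_one_right mult.commute)
  qed
  have c: "\<beta> \<in> {0, 1, 2, 3, 4, 5, 6, 7, 8, 9, 10, 11}" using assms(1) by (simp add: less_12)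
  then show ?thesis
    using assms(2) b0 b1 b2 b3 b4 b5 b6 b7 b8 b9 b10 b11
    by (elim insertE emptyE) (simp_all only: shead_def sstep_def nth_Cons_0 nth_Cons_Suc nth_Cons_numeral
      nth_Cons' lead_simps if_True if_False mult_1_left mult_1_right power_0 simp_thms, simp_all)
qed

lemma svec_PQR: 
  assumes "f \<in> svec" "t \<in> {PP, QQ, RR}"
  shows "t * f \<in> svec"
proof -
  have pow: "u ^ j * f \<in> svec" if u: "\<And>f. f \<in> svec \<Longrightarrow> u * f \<in> svec" and f: "f \<in> svec" for u f j
  proof (induction j)
    case (Suc j)
    show ?case using u[OF Suc] by (simp only: power_Suc mult.assoc)
  qed (simp add: f)
  have kzpow: "kk ^ i * zz ^ j * f \<in> svec" if "f \<in> svec" for i j f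
    unfolding mult.assoc[of "kk ^ i"] by (intro pow svec_kz that)
  have base: "t * f \<in> svec" if f: "f \<in> smon lead ` sidx" for f
  proof -
    obtain \<beta> i j m where x: "f = smon lead (((\<beta>, i), j), m)" "(((\<beta>, i), j), m) \<in> sidx" using f by auto
    have "t * (shead lead \<beta> * sstep lead \<beta> ^ m) \<in> svec"
      using svec_families_PQR[of \<beta> m] x(2) assms(2) by (auto simp: sidx_def)
    from kzpow[OF this, of i j] show ?thesis
      by (rule svec_eqI) (simp only: x smon_def prod.case lead_simps mult_ac)
  qed
  show ?thesis using assms(1) unfolding svec_def
  proof (induction rule: Sv.span_induct_alt)
    case base
    then show ?case by (simp add: Sv.span_zero)
  next
    case (step c x y)
    have "t * (Const c * x + y) = Const c * (t * x) + t * y"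
      by (simp only: distrib_left mult.left_commute)
    then show ?case using step base[OF step(1)] by (simp only: svec_def Sv.span_add Sv.span_scale)
  qed
qed

lemma monomial_in_svec: "PP ^ i * QQ ^ j * RR ^ l \<in> svec"
proof -
  have PQ: "PP * f \<in> svec" "QQ * f \<in> svec" if "f \<in> svec" for f
    using that by (rule svec_PQR; simp)+
  have "RR ^ l \<in> svec" by (rule svec_rpow)
  then have "QQ ^ j * RR ^ l \<in> svec"
    by (induction j) (simp_all only: power_0 mult_1_left power_Suc mult.assoc PQ)
  then have "PP ^ i * (QQ ^ j * RR ^ l) \<in> svec"
    by (induction i) (simp_all only: power_0 mult_1_left power_Suc mult.assoc PQ)
  then show ?thesis by (simp only: mult.assoc)
qed

section \<open>Expansion of the invariants at the base point\<close>

abbreviation dd :: poly4 where "dd \<equiv> Var 4 ^ 2"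

lemma f12_explicit: "f12 = sx * dd ^ 5 - 3 * sx ^ 2 * dd ^ 4 + (7 * sx ^ 3 + 33 * px) * dd ^ 3 - (3 * sx ^ 4 + 33 * sx * px) * dd ^ 2
     + (sx ^ 5 + 11 * tx) * dd - (sx * tx + 3 * px ^ 2)"
  unfolding f12_eq inv12_def ..

text \<open>All polynomials expanded below are even in \<open>(x, y, z)\<close>, so only the even parts are recorded.\<close>

definition co :: "nat \<Rightarrow> poly4 \<Rightarrow> poly4" where
  "co n f = wpart xdeg (2 * n) f"

definition evenx :: "poly4 \<Rightarrow> bool" where
  "evenx f \<longleftrightarrow> (\<forall>k. odd k \<longrightarrow> wpart xdeg k f = 0)"

lemma co_linear: "co n (f + g) = co n f + co n g" "co n (f - g) = co n f - co n g"
  "co n (numeral k * f) = numeral k * co n f"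
  by (simp_all add: co_def wpart_add wpart_diff wpart_numeral_mult)

lemma evenx_mult: assumes "evenx f" "evenx g" shows "evenx (f * g)"
  unfolding evenx_def
proof (intro allI impI)
  fix k :: nat assume k: "odd k"
  have "wpart xdeg i f * wpart xdeg (k - i) g = 0" if "i \<le> k" for i
    using assms k that by (cases "odd i") (auto simp: evenx_def)
  then show "wpart xdeg k (f * g) = 0" unfolding xdeg.wpart_mult by (intro sum.neutral) simp
qed

lemma co_mult: assumes "evenx f" shows "co n (f * g) = (\<Sum>i\<le>n. co i f * co (n - i) g)"
proof -
  have "co n (f * g) = (\<Sum>i\<in>{..2 * n}. wpart xdeg i f * wpart xdeg (2 * n - i) g)"
    by (simp add: co_def xdeg.wpart_mult)
  also have "\<dots> = (\<Sum>i\<in>(\<lambda>i. 2 * i) ` {..n}. wpart xdeg i f * wpart xdeg (2 * n - i) g)"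
  proof (rule sum.mono_neutral_right)
    show "\<forall>i\<in>{..2 * n} - (\<lambda>i. 2 * i) ` {..n}. wpart xdeg i f * wpart xdeg (2 * n - i) g = 0"
    proof
      fix i assume i: "i \<in> {..2 * n} - (\<lambda>i. 2 * i) ` {..n}"
      have "odd i"
      proof
        assume "even i"
        then obtain j where "i = 2 * j" by (elim evenE)
        then show False using i by auto
      qed
      then show "wpart xdeg i f * wpart xdeg (2 * n - i) g = 0" using assms by (simp add: evenx_def)
    qed
  qed auto
  also have "\<dots> = (\<Sum>i\<le>n. co i f * co (n - i) g)"
    by (subst sum.reindex) (auto simp: inj_on_def co_def diff_mult_distrib2)
  finally show ?thesis .
qed

definition purex :: "nat \<Rightarrow> poly4 \<Rightarrow> bool" where
  "purex k f \<longleftrightarrow> wpart xdeg k f = f"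

lemma purex_mult: "purex a f \<Longrightarrow> purex b g \<Longrightarrow> a + b = k \<Longrightarrow> purex k (f * g)"
  and purex_power: "purex a f \<Longrightarrow> n * a = k \<Longrightarrow> purex k (f ^ n)"
  and purex_add: "purex k f \<Longrightarrow> purex k g \<Longrightarrow> purex k (f + g)"
  and purex_diff: "purex k f \<Longrightarrow> purex k g \<Longrightarrow> purex k (f - g)"
  and purex_uminus: "purex k f \<Longrightarrow> purex k (- f)"
  and purex_numeral: "purex k f \<Longrightarrow> purex k (numeral j * f)"
  and purex_Const_mult: "purex k f \<Longrightarrow> purex k (Const c * f)"
  and purex_Var: "i \<noteq> 4 \<Longrightarrow> purex 1 (Var i)" and purex_W: "purex 0 (Var 4)"
  and purex_0: "purex k 0"
  using xdeg.wpart_pure_mult[of a f b g] xdeg.wpart_pure_power[of a f n]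
  by (auto simp: purex_def wpart_add wpart_diff wpart_uminus wpart_numeral_mult wpart_Const_mult wpart_xdeg_Var)

lemma purex_part: "purex k f \<Longrightarrow> wpart xdeg j f = (if j = k then f else 0)"
  unfolding purex_def using wpart_wpart[of xdeg j k f] by simp

lemma purex_gold_mult: "purex k f \<Longrightarrow> purex k ((gold - 1) * f)" "purex k f \<Longrightarrow> purex k (gold * f)"
  "purex k f \<Longrightarrow> purex k ((3 * gold - 2) * f)" "purex k f \<Longrightarrow> purex k ((1 - 3 * gold) * f)"
proof -
  have "gold - 1 = Const (complex_of_real golden - 1)" "3 * gold - 2 = Const (3 * complex_of_real golden - 2)"
    "1 - 3 * gold = Const (1 - 3 * complex_of_real golden)"
    by (simp_all add: gold_def Const_diff Const_mult)
  moreover have "gold = Const (complex_of_real golden)" by (rule gold_def)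
  moreover assume "purex k f"
  ultimately show "purex k ((gold - 1) * f)" "purex k (gold * f)"
    "purex k ((3 * gold - 2) * f)" "purex k ((1 - 3 * gold) * f)"
    using purex_Const_mult by metis+
qed

lemma purex_sq: "purex 2 (Var 1 ^ 2)" "purex 2 (Var 2 ^ 2)" "purex 2 (Var 3 ^ 2)" "purex 0 dd"
  by (rule purex_power[OF purex_Var] purex_power[OF purex_W]; simp)+

lemma purex_sx: "purex 2 sx"
  by (intro purex_add purex_sq)

lemma purex_px: "purex 6 px"
proof -
  have 1: "purex 6 (a ^ 2 * b)" if "purex 2 a" "purex 2 b" for a b
    using that by (auto intro!: purex_mult purex_power)
  have 2: "purex 6 (a * b * c)" if "purex 2 a" "purex 2 b" "purex 2 c" for a b c
    using that by (auto intro!: purex_mult)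
  show ?thesis unfolding px_def inv6_def mult.assoc[of 4]
    by (intro purex_add purex_diff purex_gold_mult purex_numeral 1 2 purex_sq)
qed

lemma purex_tx: "purex 10 tx"
proof -
  have 1: "purex 10 (a ^ 4 * b)" "purex 10 (a ^ 3 * b ^ 2)" "purex 10 (a ^ 2 * b ^ 3)" if "purex 2 a" "purex 2 b" for a b
    using that by (auto intro!: purex_mult purex_power)
  have 2: "purex 10 (a ^ 3 * b * c)" "purex 10 (a * b ^ 3 * c)" "purex 10 (a * b * c ^ 3)"
    "purex 10 (a ^ 2 * b ^ 2 * c)" "purex 10 (a * b ^ 2 * c ^ 2)" "purex 10 (a ^ 2 * b * c ^ 2)"
    if "purex 2 a" "purex 2 b" "purex 2 c" for a b c
    using that by (auto intro!: purex_mult purex_power)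
  show ?thesis unfolding tx_def inv10_def
    by (intro purex_add purex_diff purex_uminus purex_gold_mult purex_numeral 1 2 purex_sq)
qed

lemma purex_1: "purex 0 1"
  by (simp add: purex_def xdeg.wpart_1)

lemmas purex_rules = purex_add purex_diff purex_numeral purex_sx purex_px purex_tx purex_sq(4) purex_1 purex_0
  purex_mult purex_power

lemma graded_parts:
  assumes f: "f = (\<Sum>n\<le>N. g n)" and g: "\<And>n. n \<le> N \<Longrightarrow> purex (2 * n) (g n)"
  shows "evenx f" "co n f = (if n \<le> N then g n else 0)"
proof -
  have part: "wpart xdeg k (g n) = (if k = 2 * n then g n else 0)" if "n \<le> N" for k n
    using g[OF that] by (rule purex_part)
  show "evenx f" unfolding evenx_def f wpart_sum
    by (auto intro!: sum.neutral simp: part)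
  have "co n f = (\<Sum>i\<le>N. if i = n then g n else 0)"
    unfolding co_def f wpart_sum by (rule sum.cong) (auto simp: part)
  then show "co n f = (if n \<le> N then g n else 0)" by simp
qed

definition f2_part :: "nat \<Rightarrow> poly4" where
  "f2_part n = [dd, sx] ! n"

definition f12_part :: "nat \<Rightarrow> poly4" where
  "f12_part n = [0, sx * dd ^ 5, - (3 * (sx ^ 2 * dd ^ 4)), (7 * sx ^ 3 + 33 * px) * dd ^ 3,
     - ((3 * sx ^ 4 + 33 * (sx * px)) * dd ^ 2), (sx ^ 5 + 11 * tx) * dd, - (sx * tx + 3 * px ^ 2)] ! n"

lemma f2_parts: "evenx f2" "co n f2 = (if n \<le> 1 then f2_part n else 0)"
proof -
  have s: "f2 = (\<Sum>n\<le>1. f2_part n)" by (simp add: f2_def f2_part_def)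
  have p: "purex (2 * n) (f2_part n)" if "n \<le> 1" for n
  proof -
    have "n = 0 \<or> n = 1" using that by auto
    then show ?thesis by (auto simp: f2_part_def purex_sx purex_sq)
  qed
  show "evenx f2" "co n f2 = (if n \<le> 1 then f2_part n else 0)"
    by (rule graded_parts[OF s p]; simp)+
qed

lemma f12_part_simps: "f12_part 0 = 0" "f12_part 1 = sx * dd ^ 5" "f12_part 2 = - (3 * (sx ^ 2 * dd ^ 4))"
    "f12_part 3 = (7 * sx ^ 3 + 33 * px) * dd ^ 3" "f12_part 4 = - ((3 * sx ^ 4 + 33 * (sx * px)) * dd ^ 2)"
    "f12_part 5 = (sx ^ 5 + 11 * tx) * dd" "f12_part 6 = - (sx * tx + 3 * px ^ 2)"
  by (simp_all add: f12_part_def)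

lemma f12_parts: "evenx f12" "co n f12 = (if n \<le> 6 then f12_part n else 0)"
proof -
  have e: "(\<Sum>n\<le>6. f12_part n) = 0 + sx * dd ^ 5 + - (3 * (sx ^ 2 * dd ^ 4)) + (7 * sx ^ 3 + 33 * px) * dd ^ 3 +
     - ((3 * sx ^ 4 + 33 * (sx * px)) * dd ^ 2) + (sx ^ 5 + 11 * tx) * dd + - (sx * tx + 3 * px ^ 2)"
    by (simp add: numeral_eq_Suc f12_part_def)
  have s: "f12 = (\<Sum>n\<le>6. f12_part n)"
    unfolding f12_explicit e by Groebner_Basis.algebra
  have p: "purex (2 * n) (f12_part n)" if "n \<le> 6" for n
  proof -
    have q: "purex (2 * 1) (sx * dd ^ 5)" "purex (2 * 2) (- (3 * (sx ^ 2 * dd ^ 4)))" "purex (2 * 3) ((7 * sx ^ 3 + 33 * px) * dd ^ 3)"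
      "purex (2 * 4) (- ((3 * sx ^ 4 + 33 * (sx * px)) * dd ^ 2))" "purex (2 * 5) ((sx ^ 5 + 11 * tx) * dd)"
      "purex (2 * 6) (- (sx * tx + 3 * px ^ 2))"
      by (rule purex_uminus purex_rules | simp)+
    have "n \<in> {0, 1, 2, 3, 4, 5, 6}" using that by auto
    then show ?thesis by (elim insertE emptyE) (simp_all only: f12_part_simps q purex_0)
  qed
  show "evenx f12" "co n f12 = (if n \<le> 6 then f12_part n else 0)"
    by (rule graded_parts[OF s p]; simp)+
qed

text \<open>Terms keep the shape coefficient times form times power of \<open>dd\<close>, even with
  coefficient 1 or exponent 0, so that rules such as \<open>lap3_dd\<close> and
  \<open>partial4_monomials\<close> match the expansions literally.\<close>

lemma co_f2_aux:
  "co 0 f2 = 1 * (1) * dd ^ 1" "co 1 f2 = 1 * (sx) * dd ^ 0" "co 2 f2 = 0" "co 3 f2 = 0" "co 4 f2 = 0" "co 5 f2 = 0" "co 6 f2 = 0" "co 7 f2 = 0"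
  by (simp_all add: f2_parts f2_part_def)

lemma co_f12_aux:
  "co 0 f12 = 0" "co 1 f12 = 1 * (sx) * dd ^ 5" "co 2 f12 = - (3 * (sx ^ 2) * dd ^ 4)" "co 3 f12 = 7 * (sx ^ 3) * dd ^ 3 + 33 * (px) * dd ^ 3" "co 4 f12 = - (3 * (sx ^ 4) * dd ^ 2) - 33 * (sx * px) * dd ^ 2" "co 5 f12 = 1 * (sx ^ 5) * dd ^ 1 + 11 * (tx) * dd ^ 1" "co 6 f12 = - (1 * (sx * tx) * dd ^ 0) - 3 * (px ^ 2) * dd ^ 0" "co 7 f12 = 0"
proof -
  have le: "(0 :: nat) \<le> 6" "(1 :: nat) \<le> 6" "(2 :: nat) \<le> 6" "(3 :: nat) \<le> 6" "(4 :: nat) \<le> 6"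
    "(5 :: nat) \<le> 6" "(6 :: nat) \<le> 6" "\<not> (7 :: nat) \<le> 6"
    by simp_all
  show "co 0 f12 = 0" "co 7 f12 = 0"
    by (simp_all only: f12_parts le if_True if_False f12_part_simps)
  show "co 1 f12 = 1 * (sx) * dd ^ 5" "co 2 f12 = - (3 * (sx ^ 2) * dd ^ 4)"
    "co 3 f12 = 7 * (sx ^ 3) * dd ^ 3 + 33 * (px) * dd ^ 3"
    "co 4 f12 = - (3 * (sx ^ 4) * dd ^ 2) - 33 * (sx * px) * dd ^ 2"
    "co 5 f12 = 1 * (sx ^ 5) * dd ^ 1 + 11 * (tx) * dd ^ 1"
    "co 6 f12 = - (1 * (sx * tx) * dd ^ 0) - 3 * (px ^ 2) * dd ^ 0"
    by (simp only: f12_parts le if_True if_False f12_part_simps; Groebner_Basis.algebra)+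
qed

lemma evenx_f2: "evenx f2" and evenx_f12: "evenx f12"
  by (rule f2_parts f12_parts)+

section \<open>The Laplacian on the coefficients at the base point\<close>

lemma wpart_xdeg_partial:
  "wpart xdeg k (partial i f) = (if i = 4 then partial i (wpart xdeg k f) else partial i (wpart xdeg (Suc k) f))"
proof (induction f rule: poly_single_induct)
  case (single m c)
  show ?case
  proof (cases "Poly_Mapping.lookup m i = 0")
    case False
    then have "m = Poly_Mapping.single i 1 + (m - Poly_Mapping.single i 1)"
      by (intro mon4_eqI) (auto simp: lookup_add lookup_minus lookup_single when_def)
    then have "xdeg m = xdeg (Poly_Mapping.single i 1 + (m - Poly_Mapping.single i 1))" by (rule arg_cong)
    then have "xdeg m = (if i = 4 then 0 else 1) + xdeg (m - Poly_Mapping.single i 1)"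
      by (simp only: xdeg.plus xdeg_single)
    then show ?thesis by (simp add: wpart_single partial_single)
  qed (auto simp add: wpart_single partial_single)
qed (simp add: wpart_add partial_add)

definition lap3 :: "poly4 \<Rightarrow> poly4" where
  "lap3 f = partial 1 (partial 1 f) + partial 2 (partial 2 f) + partial 3 (partial 3 f)"

text \<open>The inner product of the gradients in x, y, z; twice this is the defect of
  \<open>lap3\<close> from being a derivation, see \<open>lap3_mult\<close>.\<close>

definition gam3 :: "poly4 \<Rightarrow> poly4 \<Rightarrow> poly4" where
  "gam3 f g = partial 1 f * partial 1 g + partial 2 f * partial 2 g + partial 3 f * partial 3 g"

lemma evenx_laplacian: "evenx f \<Longrightarrow> evenx (laplacian f)"
  unfolding evenx_def laplacian_def sum_4 wpart_add wpart_xdeg_partial by simp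

text \<open>Second derivatives in x, y, z lower the order by two, hence the index of
  \<open>co\<close> by one, and those in w keep it. So each Laplacian costs one coefficient: indices
  up to 7 for the square of \<open>f12\<close> yield those up to 5 for \<open>f20\<close>.\<close>

lemma co_laplacian: "co n (laplacian f) = lap3 (co (Suc n) f) + partial 4 (partial 4 (co n f))"
  by (simp add: co_def laplacian_def sum_4 wpart_add wpart_xdeg_partial lap3_def)

lemma evenx_linear: "evenx f \<Longrightarrow> evenx g \<Longrightarrow> evenx (f + g)" "evenx f \<Longrightarrow> evenx g \<Longrightarrow> evenx (f - g)"
  "evenx f \<Longrightarrow> evenx (Const c * f)" "evenx f \<Longrightarrow> evenx (numeral k * f)" "evenx f \<Longrightarrow> evenx (- f)"
  by (simp_all add: evenx_def wpart_add wpart_diff wpart_Const_mult wpart_numeral_mult wpart_uminus)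

lemma evenx_power: "evenx f \<Longrightarrow> evenx (f ^ n)"
proof (induction n)
  case 0
  show ?case by (auto simp: evenx_def xdeg.wpart_1)
qed (simp add: evenx_mult)

lemma evenx_f20: "evenx f20"
  unfolding f20_def g20_def mult_minus_left
  by (intro evenx_linear evenx_mult evenx_power evenx_laplacian evenx_f2 evenx_f12)

lemma evenx_f2_2: "evenx (f2 * f2)" and evenx_f2_3: "evenx (f2 * (f2 * f2))"
  and evenx_f2_4: "evenx ((f2 * f2) * (f2 * f2))" and evenx_f2_5: "evenx (f2 * ((f2 * f2) * (f2 * f2)))"
  and evenx_sq: "evenx (f12 * f12)" and evenx_l1: "evenx (laplacian (f12 * f12))"
  and evenx_pr: "evenx (f12 * f20)"
  by (intro evenx_mult evenx_laplacian evenx_f2 evenx_f12 evenx_f20)+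

lemma evenx_f30: "evenx f30"
  unfolding f30_def g30_def mult_minus_left
  by (intro evenx_linear evenx_mult evenx_power evenx_laplacian evenx_f2 evenx_f12 evenx_f20)

lemma partial_gold: "partial i gold = 0"
  by (simp add: gold_def)

lemma partial_sq: "partial 1 (Var 1 ^ 2) = 2 * Var 1" "partial 1 (Var 2 ^ 2) = 0" "partial 1 (Var 3 ^ 2) = 0"
  "partial 2 (Var 1 ^ 2) = 0" "partial 2 (Var 2 ^ 2) = 2 * Var 2" "partial 2 (Var 3 ^ 2) = 0"
  "partial 3 (Var 1 ^ 2) = 0" "partial 3 (Var 2 ^ 2) = 0" "partial 3 (Var 3 ^ 2) = 2 * Var 3"
  "partial 4 (Var 1 ^ 2) = 0" "partial 4 (Var 2 ^ 2) = 0" "partial 4 (Var 3 ^ 2) = 0"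
  "partial 1 dd = 0" "partial 2 dd = 0" "partial 3 dd = 0" "partial 4 dd = 2 * Var 4"
  by (simp_all add: power2_eq_square partial_mult partial_Var)

text \<open>Partial derivatives of \<open>inv6\<close> and \<open>inv10\<close> with respect to their first argument; the others follow by cyclic symmetry.\<close>

definition inv6' :: "poly4 \<Rightarrow> poly4 \<Rightarrow> poly4 \<Rightarrow> poly4 \<Rightarrow> poly4" where
  "inv6' h A B C = (h - 1) * (2 * A * B + C ^ 2) - h * (2 * A * C + B ^ 2) + 4 * B * C"

definition inv10' :: "poly4 \<Rightarrow> poly4 \<Rightarrow> poly4 \<Rightarrow> poly4 \<Rightarrow> poly4" where
  "inv10' h A B C = - (4 * A ^ 3 * B + C ^ 4) - (4 * A ^ 3 * C + B ^ 4)
     + (3 * h - 2) * (3 * A ^ 2 * B ^ 2 + 2 * C ^ 3 * A) + (1 - 3 * h) * (2 * A * B ^ 3 + 3 * C ^ 2 * A ^ 2)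
     + 14 * (3 * A ^ 2 * B * C + B ^ 3 * C + B * C ^ 3)
     - 15 * (2 * A * B ^ 2 * C + B ^ 2 * C ^ 2 + 2 * A * B * C ^ 2)"

definition inv6'' :: "poly4 \<Rightarrow> poly4 \<Rightarrow> poly4 \<Rightarrow> poly4 \<Rightarrow> poly4" where
  "inv6'' h A B C = (h - 1) * (2 * B) - h * (2 * C)"

definition inv10'' :: "poly4 \<Rightarrow> poly4 \<Rightarrow> poly4 \<Rightarrow> poly4 \<Rightarrow> poly4" where
  "inv10'' h A B C = - (12 * A ^ 2 * B) - (12 * A ^ 2 * C)
     + (3 * h - 2) * (6 * A * B ^ 2 + 2 * C ^ 3) + (1 - 3 * h) * (2 * B ^ 3 + 6 * C ^ 2 * A)
     + 14 * (6 * A * B * C) - 15 * (2 * B ^ 2 * C + 2 * B * C ^ 2)"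

lemma inv_cyclic: "inv6 h A B C = inv6 h B C A" "inv10 h A B C = inv10 h B C A"
  by (unfold inv6_def inv10_def, Groebner_Basis.algebra+)

lemma partial_inv:
  assumes "partial i B = 0" "partial i C = 0"
  shows "partial i (inv6 gold A B C) = inv6' gold A B C * partial i A"
    "partial i (inv10 gold A B C) = inv10' gold A B C * partial i A"
    "partial i (inv6' gold A B C) = inv6'' gold A B C * partial i A"
    "partial i (inv10' gold A B C) = inv10'' gold A B C * partial i A"
proof -
  note d = partial_add partial_diff partial_uminus partial_mult partial_power partial_gold partial_numeral partial_1
    assms mult_zero_left mult_zero_right
  have n: "of_nat 2 = (2 :: poly4)" "of_nat 3 = (3 :: poly4)" "of_nat 4 = (4 :: poly4)" "(2 :: nat) - 1 = 1" "(3 :: nat) - 1 = 2" "(4 :: nat) - 1 = 3"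
    by simp_all
  show "partial i (inv6 gold A B C) = inv6' gold A B C * partial i A"
    unfolding inv6_def inv6'_def d n by Groebner_Basis.algebra
  show "partial i (inv10 gold A B C) = inv10' gold A B C * partial i A"
    unfolding inv10_def inv10'_def d n by Groebner_Basis.algebra
  show "partial i (inv6' gold A B C) = inv6'' gold A B C * partial i A"
    unfolding inv6'_def inv6''_def d n by Groebner_Basis.algebra
  show "partial i (inv10' gold A B C) = inv10'' gold A B C * partial i A"
    unfolding inv10'_def inv10''_def d n by Groebner_Basis.algebra
qed

abbreviation "xx \<equiv> Var 1 ^ 2 :: poly4"
abbreviation "yx \<equiv> Var 2 ^ 2 :: poly4"
abbreviation "zx \<equiv> Var 3 ^ 2 :: poly4"

lemma partial_sx: "partial 1 sx = 2 * Var 1" "partial 2 sx = 2 * Var 2" "partial 3 sx = 2 * Var 3" "partial 4 sx = 0"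
  by (simp_all only: partial_add partial_sq add_0_left add_0_right)

lemma partial_px: "partial 1 px = inv6' gold xx yx zx * (2 * Var 1)" "partial 2 px = inv6' gold yx zx xx * (2 * Var 2)"
  "partial 3 px = inv6' gold zx xx yx * (2 * Var 3)" "partial 4 px = 0"
proof -
  have c: "px = inv6 gold yx zx xx" "px = inv6 gold zx xx yx" unfolding px_def using inv_cyclic by metis+
  show "partial 1 px = inv6' gold xx yx zx * (2 * Var 1)"
    unfolding px_def by (simp only: partial_inv partial_sq)
  show "partial 2 px = inv6' gold yx zx xx * (2 * Var 2)"
    unfolding c(1) by (simp only: partial_inv partial_sq)
  show "partial 3 px = inv6' gold zx xx yx * (2 * Var 3)"
    unfolding c(2) by (simp only: partial_inv partial_sq)
  show "partial 4 px = 0" unfolding px_def by (simp only: partial_inv partial_sq mult_zero_right)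
qed

lemma partial_tx: "partial 1 tx = inv10' gold xx yx zx * (2 * Var 1)" "partial 2 tx = inv10' gold yx zx xx * (2 * Var 2)"
  "partial 3 tx = inv10' gold zx xx yx * (2 * Var 3)" "partial 4 tx = 0"
proof -
  have c: "tx = inv10 gold yx zx xx" "tx = inv10 gold zx xx yx" unfolding tx_def using inv_cyclic by metis+
  show "partial 1 tx = inv10' gold xx yx zx * (2 * Var 1)"
    unfolding tx_def by (simp only: partial_inv partial_sq)
  show "partial 2 tx = inv10' gold yx zx xx * (2 * Var 2)"
    unfolding c(1) by (simp only: partial_inv partial_sq)
  show "partial 3 tx = inv10' gold zx xx yx * (2 * Var 3)"
    unfolding c(2) by (simp only: partial_inv partial_sq)
  show "partial 4 tx = 0" unfolding tx_def by (simp only: partial_inv partial_sq mult_zero_right)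
qed

lemma partial_Var_num: "partial i (2 * Var i) = 2"
  by (simp add: partial_mult partial_Var)

text \<open>The Laplacian in x, y, z commutes with the icosahedral group, so it maps polynomials in
  \<open>sx\<close>, \<open>px\<close>, \<open>tx\<close> to such polynomials. These values and a
  few products \<open>gam3\<close> determine it on all forms that occur.\<close>

lemma lap3_base: "lap3 sx = 6" "lap3 px = - 2 * sx ^ 2" "lap3 tx = - 4 * sx ^ 4 + 36 * sx * px"
proof -
  show "lap3 sx = 6" unfolding lap3_def partial_sx partial_Var_num by simp
  show "lap3 px = - 2 * sx ^ 2"
    unfolding lap3_def partial_px partial_mult[of _ "inv6' _ _ _ _"] partial_Var_num
    by (simp only: partial_inv partial_sq) (unfold inv6'_def inv6''_def, Groebner_Basis.algebra)
  show "lap3 tx = - 4 * sx ^ 4 + 36 * sx * px"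
    unfolding lap3_def partial_tx partial_mult[of _ "inv10' _ _ _ _"] partial_Var_num
    by (simp only: partial_inv partial_sq) (unfold inv10'_def inv10''_def px_def inv6_def, Groebner_Basis.algebra)
qed

lemma gam3_pp: "gam3 px px = - 4 * sx ^ 2 * px - 4 * tx"
  unfolding gam3_def partial_px using gold_square
  by (unfold px_def inv6_def tx_def inv10_def inv6'_def) Groebner_Basis.algebra

text \<open>Half the gradient of \<open>sx\<close> is the radial field, so this is Euler's identity:
  \<open>gam3 sx f\<close> is f times twice its degree.\<close>

lemma gam3_sx:
  "gam3 sx px = 12 * px" "gam3 sx tx = 20 * tx" "gam3 sx sx = 4 * sx"
  unfolding gam3_def partial_sx partial_px partial_tx
  by (unfold px_def tx_def inv6_def inv10_def inv6'_def inv10'_def, Groebner_Basis.algebra+)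

lemma lap3_mult: "lap3 (f * g) = lap3 f * g + f * lap3 g + 2 * gam3 f g"
  unfolding lap3_def gam3_def partial_mult partial_add by Groebner_Basis.algebra

lemma gam3_mult: "gam3 f (g * h) = gam3 f g * h + g * gam3 f h"
  unfolding gam3_def partial_mult by Groebner_Basis.algebra

lemma lap3_linear: "lap3 (f + g) = lap3 f + lap3 g" "lap3 (f - g) = lap3 f - lap3 g" "lap3 (- f) = - lap3 f"
  "lap3 (numeral k * f) = numeral k * lap3 f" "lap3 0 = 0" "lap3 (1 * f) = lap3 f"
  by (simp_all add: lap3_def partial_add partial_diff partial_uminus partial_mult algebra_simps)

lemma lap3_dd: "lap3 (f * dd ^ l) = lap3 f * dd ^ l"
proof -
  have "partial i (dd ^ l) = 0" if "i \<noteq> 4" for i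
    using that by (simp add: partial_power partial_Var)
  then have "partial 1 (dd ^ l) = 0" "partial 2 (dd ^ l) = 0" "partial 3 (dd ^ l) = 0" by simp_all
  then show ?thesis by (simp only: lap3_def partial_mult mult_zero_right add_0_right distrib_right)
qed

lemma lap3_1: "lap3 1 = 0" by (simp add: lap3_def)

lemma lap3_step: "lap3 (sx * f) = 6 * f + sx * lap3 f + 2 * gam3 sx f"
  "gam3 sx (sx * f) = 4 * sx * f + sx * gam3 sx f"
  unfolding lap3_mult gam3_mult gam3_sx lap3_base by (rule refl)+

lemma px2_step: "lap3 (px * px) = - 12 * (sx ^ 2 * px) - 8 * tx" "gam3 sx (px * px) = 24 * (px * px)"
  unfolding lap3_mult gam3_mult gam3_pp gam3_sx lap3_base by Groebner_Basis.algebra+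

lemma lap3_monomials:
  "lap3 (sx) = 6 * (1)"
  "lap3 (sx ^ 2) = 20 * (sx)"
  "lap3 (sx ^ 3) = 42 * (sx ^ 2)"
  "lap3 (sx ^ 4) = 72 * (sx ^ 3)"
  "lap3 (sx ^ 5) = 110 * (sx ^ 4)"
  "lap3 (sx ^ 6) = 156 * (sx ^ 5)"
  "lap3 (sx ^ 7) = 210 * (sx ^ 6)"
  "lap3 (px) = - (2 * (sx ^ 2))"
  "lap3 (sx * px) = - (2 * (sx ^ 3)) + 30 * (px)"
  "lap3 (sx ^ 2 * px) = - (2 * (sx ^ 4)) + 68 * (sx * px)"
  "lap3 (sx ^ 3 * px) = - (2 * (sx ^ 5)) + 114 * (sx ^ 2 * px)"
  "lap3 (sx ^ 4 * px) = - (2 * (sx ^ 6)) + 168 * (sx ^ 3 * px)"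
  "lap3 (tx) = - (4 * (sx ^ 4)) + 36 * (sx * px)"
  "lap3 (sx * tx) = - (4 * (sx ^ 5)) + 36 * (sx ^ 2 * px) + 46 * (tx)"
  "lap3 (sx ^ 2 * tx) = - (4 * (sx ^ 6)) + 36 * (sx ^ 3 * px) + 100 * (sx * tx)"
  "lap3 (px ^ 2) = - (12 * (sx ^ 2 * px)) - 8 * (tx)"
  "lap3 (sx * px ^ 2) = - (12 * (sx ^ 3 * px)) - 8 * (sx * tx) + 54 * (px ^ 2)"
proof -
  show "lap3 (sx) = 6 * (1)"
    unfolding lap3_base by Groebner_Basis.algebra
  show "lap3 (sx ^ 2) = 20 * (sx)"
    unfolding power2_eq_square[of sx] lap3_step gam3_sx lap3_base by Groebner_Basis.algebra
  have e1: "sx ^ 3 = sx * (sx * sx)" by Groebner_Basis.algebra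
  show "lap3 (sx ^ 3) = 42 * (sx ^ 2)"
    unfolding e1 lap3_step gam3_sx px2_step lap3_base by Groebner_Basis.algebra
  have e2: "sx ^ 4 = sx * (sx * (sx * sx))" by Groebner_Basis.algebra
  show "lap3 (sx ^ 4) = 72 * (sx ^ 3)"
    unfolding e2 lap3_step gam3_sx px2_step lap3_base by Groebner_Basis.algebra
  have e3: "sx ^ 5 = sx * (sx * (sx * (sx * sx)))" by Groebner_Basis.algebra
  show "lap3 (sx ^ 5) = 110 * (sx ^ 4)"
    unfolding e3 lap3_step gam3_sx px2_step lap3_base by Groebner_Basis.algebra
  have e4: "sx ^ 6 = sx * (sx * (sx * (sx * (sx * sx))))" by Groebner_Basis.algebra
  show "lap3 (sx ^ 6) = 156 * (sx ^ 5)"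
    unfolding e4 lap3_step gam3_sx px2_step lap3_base by Groebner_Basis.algebra
  have e5: "sx ^ 7 = sx * (sx * (sx * (sx * (sx * (sx * sx)))))" by Groebner_Basis.algebra
  show "lap3 (sx ^ 7) = 210 * (sx ^ 6)"
    unfolding e5 lap3_step gam3_sx px2_step lap3_base by Groebner_Basis.algebra
  show "lap3 (px) = - (2 * (sx ^ 2))"
    unfolding lap3_base by Groebner_Basis.algebra
  show "lap3 (sx * px) = - (2 * (sx ^ 3)) + 30 * (px)"
    unfolding lap3_step gam3_sx px2_step lap3_base by Groebner_Basis.algebra
  have e7: "sx ^ 2 * px = sx * (sx * px)" by Groebner_Basis.algebra
  show "lap3 (sx ^ 2 * px) = - (2 * (sx ^ 4)) + 68 * (sx * px)"
    unfolding e7 lap3_step gam3_sx px2_step lap3_base by Groebner_Basis.algebra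
  have e8: "sx ^ 3 * px = sx * (sx * (sx * px))" by Groebner_Basis.algebra
  show "lap3 (sx ^ 3 * px) = - (2 * (sx ^ 5)) + 114 * (sx ^ 2 * px)"
    unfolding e8 lap3_step gam3_sx px2_step lap3_base by Groebner_Basis.algebra
  have e9: "sx ^ 4 * px = sx * (sx * (sx * (sx * px)))" by Groebner_Basis.algebra
  show "lap3 (sx ^ 4 * px) = - (2 * (sx ^ 6)) + 168 * (sx ^ 3 * px)"
    unfolding e9 lap3_step gam3_sx px2_step lap3_base by Groebner_Basis.algebra
  show "lap3 (tx) = - (4 * (sx ^ 4)) + 36 * (sx * px)"
    unfolding lap3_base by Groebner_Basis.algebra
  show "lap3 (sx * tx) = - (4 * (sx ^ 5)) + 36 * (sx ^ 2 * px) + 46 * (tx)"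
    unfolding lap3_step gam3_sx px2_step lap3_base by Groebner_Basis.algebra
  have e11: "sx ^ 2 * tx = sx * (sx * tx)" by Groebner_Basis.algebra
  show "lap3 (sx ^ 2 * tx) = - (4 * (sx ^ 6)) + 36 * (sx ^ 3 * px) + 100 * (sx * tx)"
    unfolding e11 lap3_step gam3_sx px2_step lap3_base by Groebner_Basis.algebra
  show "lap3 (px ^ 2) = - (12 * (sx ^ 2 * px)) - 8 * (tx)"
    unfolding power2_eq_square[of px] px2_step by Groebner_Basis.algebra
  have e12: "sx * px ^ 2 = sx * (px * px)" by Groebner_Basis.algebra
  show "lap3 (sx * px ^ 2) = - (12 * (sx ^ 3 * px)) - 8 * (sx * tx) + 54 * (px ^ 2)"
    unfolding e12 lap3_step gam3_sx px2_step lap3_base by Groebner_Basis.algebra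
qed

text \<open>For l = 0 the truncated exponent l - 1 is harmless because the coefficient is 0.\<close>

lemma partial4_dd: 
  assumes "partial 4 G = 0"
  shows "partial 4 (partial 4 (G * dd ^ l)) = of_nat (2 * l * (2 * l - 1)) * G * dd ^ (l - 1)"
proof -
  have 1: "partial 4 (dd ^ l) = of_nat (2 * l) * Var 4 * dd ^ (l - 1)" for l
    unfolding partial_power[of 4 dd l] partial_sq of_nat_mult of_nat_numeral by (simp only: mult_ac)
  have z: "partial 4 (of_nat (2 * l) * G) = 0"
    unfolding Const_of_nat[symmetric] by (simp only: partial_Const_mult assms mult_zero_right)
  have e: "G * (n * v * d) = n * G * (v * d)" "Var 4 * (n * Var 4 * d) = n * (dd * d)"
    "n * G * (d + c * d) = n * (c + 1) * G * d" for n v d c :: poly4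
    by Groebner_Basis.algebra+
  have "partial 4 (G * dd ^ l) = (of_nat (2 * l) * G) * (Var 4 * dd ^ (l - 1))"
    by (simp only: partial_mult[of 4 G] assms mult_zero_left add_0_left 1 e(1))
  then have "partial 4 (partial 4 (G * dd ^ l)) = of_nat (2 * l) * G * partial 4 (Var 4 * dd ^ (l - 1))"
    by (simp only: partial_mult[of 4 "of_nat (2 * l) * G"] z mult_zero_left add_0_left)
  also have "partial 4 (Var 4 * dd ^ (l - 1)) = dd ^ (l - 1) + of_nat (2 * (l - 1)) * (dd * dd ^ (l - 1 - 1))"
    by (simp only: partial_mult[of 4 "Var 4"] partial_Var refl if_True 1 mult_1_left e(2))
  also have "of_nat (2 * (l - 1)) * (dd * dd ^ (l - 1 - 1)) = of_nat (2 * (l - 1)) * dd ^ (l - 1)"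
    by (cases "l - 1") simp_all
  also have "of_nat (2 * l) * G * (dd ^ (l - 1) + of_nat (2 * (l - 1)) * dd ^ (l - 1)) =
      of_nat (2 * l) * (of_nat (2 * (l - 1)) + 1) * G * dd ^ (l - 1)"
    by (rule e(3))
  also have "of_nat (2 * l) * (of_nat (2 * (l - 1)) + 1) = (of_nat (2 * l * (2 * (l - 1) + 1)) :: poly4)"
    by (simp only: of_nat_mult of_nat_add of_nat_1)
  also have "2 * l * (2 * (l - 1) + 1) = 2 * l * (2 * l - 1)" by (cases l) simp_all
  finally show ?thesis .
qed

lemma partial4_monomial:
  assumes "partial 4 G = 0" "of_nat (2 * l * (2 * l - 1)) = c" "l - 1 = k"
  shows "partial 4 (partial 4 (G * dd ^ l)) = c * G * dd ^ k"
  unfolding partial4_dd[OF assms(1)] assms(2,3) ..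

lemma co_suc: "Suc 0 = 1" "Suc 1 = 2" "Suc 2 = 3" "Suc 3 = 4" "Suc 4 = 5" "Suc 5 = 6" "Suc 6 = 7"
  by simp_all

lemma partial4_linear: "partial 4 (partial 4 (f + g)) = partial 4 (partial 4 f) + partial 4 (partial 4 g)"
  "partial 4 (partial 4 (f - g)) = partial 4 (partial 4 f) - partial 4 (partial 4 g)"
  "partial 4 (partial 4 (- f)) = - partial 4 (partial 4 f)" "partial 4 (partial 4 0) = 0"
  by (simp_all add: partial_add partial_diff partial_uminus)

text \<open>The instances cover the terms of \<open>co_sq\<close>, \<open>co_l1\<close> and
  \<open>co_pr\<close> with their numerical coefficients, to serve as literal rewrite rules.\<close>

lemma partial4_monomials:
  "partial 4 (partial 4 (7700 * (tx) * dd ^ 6)) = 132 * (7700 * (tx)) * dd ^ 5"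
  "partial 4 (partial 4 (1980 * (px) * dd ^ 8)) = 240 * (1980 * (px)) * dd ^ 7"
  "partial 4 (partial 4 (495 * (px ^ 2) * dd ^ 10)) = 380 * (495 * (px ^ 2)) * dd ^ 9"
  "partial 4 (partial 4 (1089 * (px ^ 2) * dd ^ 6)) = 132 * (1089 * (px ^ 2)) * dd ^ 5"
  "partial 4 (partial 4 (25812 * (px ^ 2) * dd ^ 5)) = 90 * (25812 * (px ^ 2)) * dd ^ 4"
  "partial 4 (partial 4 (20 * (sx) * dd ^ 10)) = 380 * (20 * (sx)) * dd ^ 9"
  "partial 4 (partial 4 (22 * (sx * tx) * dd ^ 6)) = 132 * (22 * (sx * tx)) * dd ^ 5"
  "partial 4 (partial 4 (90 * (sx * tx) * dd ^ 10)) = 380 * (90 * (sx * tx)) * dd ^ 9"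
  "partial 4 (partial 4 (13576 * (sx * tx) * dd ^ 5)) = 90 * (13576 * (sx * tx)) * dd ^ 4"
  "partial 4 (partial 4 (15 * (sx * px) * dd ^ 12)) = 552 * (15 * (sx * px)) * dd ^ 11"
  "partial 4 (partial 4 (66 * (sx * px) * dd ^ 8)) = 240 * (66 * (sx * px)) * dd ^ 7"
  "partial 4 (partial 4 (2112 * (sx * px) * dd ^ 7)) = 182 * (2112 * (sx * px)) * dd ^ 6"
  "partial 4 (partial 4 (2184 * (sx * px ^ 2) * dd ^ 5)) = 90 * (2184 * (sx * px ^ 2)) * dd ^ 4"
  "partial 4 (partial 4 (1 * (sx ^ 2) * dd ^ 10)) = 380 * (1 * (sx ^ 2)) * dd ^ 9"
  "partial 4 (partial 4 (128 * (sx ^ 2) * dd ^ 9)) = 306 * (128 * (sx ^ 2)) * dd ^ 8"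
  "partial 4 (partial 4 (68 * (sx ^ 2 * tx) * dd ^ 5)) = 90 * (68 * (sx ^ 2 * tx)) * dd ^ 4"
  "partial 4 (partial 4 (81 * (sx ^ 2 * px) * dd ^ 11)) = 462 * (81 * (sx ^ 2 * px)) * dd ^ 10"
  "partial 4 (partial 4 (264 * (sx ^ 2 * px) * dd ^ 7)) = 182 * (264 * (sx ^ 2 * px)) * dd ^ 6"
  "partial 4 (partial 4 (14916 * (sx ^ 2 * px) * dd ^ 6)) = 132 * (14916 * (sx ^ 2 * px)) * dd ^ 5"
  "partial 4 (partial 4 (1 * (sx ^ 3) * dd ^ 13)) = 650 * (1 * (sx ^ 3)) * dd ^ 12"
  "partial 4 (partial 4 (6 * (sx ^ 3) * dd ^ 9)) = 306 * (6 * (sx ^ 3)) * dd ^ 8"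
  "partial 4 (partial 4 (312 * (sx ^ 3) * dd ^ 8)) = 240 * (312 * (sx ^ 3)) * dd ^ 7"
  "partial 4 (partial 4 (315 * (sx ^ 3 * px) * dd ^ 10)) = 380 * (315 * (sx ^ 3 * px)) * dd ^ 9"
  "partial 4 (partial 4 (660 * (sx ^ 3 * px) * dd ^ 6)) = 132 * (660 * (sx ^ 3 * px)) * dd ^ 5"
  "partial 4 (partial 4 (8 * (sx ^ 4) * dd ^ 12)) = 552 * (8 * (sx ^ 4)) * dd ^ 11"
  "partial 4 (partial 4 (23 * (sx ^ 4) * dd ^ 8)) = 240 * (23 * (sx ^ 4)) * dd ^ 7"
  "partial 4 (partial 4 (768 * (sx ^ 4) * dd ^ 7)) = 182 * (768 * (sx ^ 4)) * dd ^ 6"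
  "partial 4 (partial 4 (660 * (sx ^ 4 * px) * dd ^ 5)) = 90 * (660 * (sx ^ 4 * px)) * dd ^ 4"
  "partial 4 (partial 4 (33 * (sx ^ 5) * dd ^ 11)) = 462 * (33 * (sx ^ 5)) * dd ^ 10"
  "partial 4 (partial 4 (48 * (sx ^ 5) * dd ^ 7)) = 182 * (48 * (sx ^ 5)) * dd ^ 6"
  "partial 4 (partial 4 (620 * (sx ^ 5) * dd ^ 6)) = 132 * (620 * (sx ^ 5)) * dd ^ 5"
  "partial 4 (partial 4 (69 * (sx ^ 6) * dd ^ 6)) = 132 * (69 * (sx ^ 6)) * dd ^ 5"
  "partial 4 (partial 4 (82 * (sx ^ 6) * dd ^ 10)) = 380 * (82 * (sx ^ 6)) * dd ^ 9"
  "partial 4 (partial 4 (620 * (sx ^ 6) * dd ^ 5)) = 90 * (620 * (sx ^ 6)) * dd ^ 4"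
  "partial 4 (partial 4 (48 * (sx ^ 7) * dd ^ 5)) = 90 * (48 * (sx ^ 7)) * dd ^ 4"
  by (rule partial4_monomial, (simp only: partial_mult partial_power partial_sx partial_px partial_tx partial_numeral partial_1
    mult_zero_left mult_zero_right add_0_left)[1], simp, simp)+

lemma lap3_squares: "lap3 (Var 1 ^ 2) = 2" "lap3 (Var 2 ^ 2) = 2" "lap3 (Var 3 ^ 2) = 2"
  by (simp_all only: lap3_def partial_sq partial_Var_num partial_0 add_0_left add_0_right)

lemmas diff3_rules = lap3_squares lap3_linear lap3_dd lap3_1 lap3_monomials partial4_linear partial4_monomials


section \<open>The coefficients from which the initial forms are read off\<close>

lemma co_mult_0: "co 0 (f * g) = co 0 f * co 0 g" if "evenx f"
  using co_mult[OF that, of 0 g] by (simp add: numeral_eq_Suc atMost_Suc add.commute)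

lemma co_mult_1: "co 1 (f * g) = co 0 f * co 1 g + co 1 f * co 0 g" if "evenx f"
  using co_mult[OF that, of 1 g] by (simp add: numeral_eq_Suc atMost_Suc add.commute)

lemma co_mult_2: "co 2 (f * g) = co 0 f * co 2 g + co 1 f * co 1 g + co 2 f * co 0 g" if "evenx f"
  using co_mult[OF that, of 2 g] by (simp add: numeral_eq_Suc atMost_Suc add.commute)

lemma co_mult_3: "co 3 (f * g) = co 0 f * co 3 g + co 1 f * co 2 g + co 2 f * co 1 g + co 3 f * co 0 g" if "evenx f"
  using co_mult[OF that, of 3 g] by (simp add: numeral_eq_Suc atMost_Suc add.commute)

lemma co_mult_4: "co 4 (f * g) = co 0 f * co 4 g + co 1 f * co 3 g + co 2 f * co 2 g + co 3 f * co 1 g + co 4 f * co 0 g" if "evenx f"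
  using co_mult[OF that, of 4 g] by (simp add: numeral_eq_Suc atMost_Suc add.commute)

lemma co_mult_5: "co 5 (f * g) = co 0 f * co 5 g + co 1 f * co 4 g + co 2 f * co 3 g + co 3 f * co 2 g + co 4 f * co 1 g + co 5 f * co 0 g" if "evenx f"
  using co_mult[OF that, of 5 g] by (simp add: numeral_eq_Suc atMost_Suc add.commute)

lemma co_mult_6: "co 6 (f * g) = co 0 f * co 6 g + co 1 f * co 5 g + co 2 f * co 4 g + co 3 f * co 3 g + co 4 f * co 2 g + co 5 f * co 1 g + co 6 f * co 0 g" if "evenx f"
  using co_mult[OF that, of 6 g] by (simp add: numeral_eq_Suc atMost_Suc add.commute)

lemma co_mult_7: "co 7 (f * g) = co 0 f * co 7 g + co 1 f * co 6 g + co 2 f * co 5 g + co 3 f * co 4 g + co 4 f * co 3 g + co 5 f * co 2 g + co 6 f * co 1 g + co 7 f * co 0 g" if "evenx f"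
  using co_mult[OF that, of 7 g] by (simp add: numeral_eq_Suc atMost_Suc add.commute)

lemma co_f2:
  "co 0 (f2) = 1 * (1) * dd ^ 1"
  "co 1 (f2) = 1 * (sx) * dd ^ 0"
  "co 2 (f2) = 0"
  "co 3 (f2) = 0"
  "co 4 (f2) = 0"
  "co 5 (f2) = 0"
  "co 6 (f2) = 0"
  "co 7 (f2) = 0"
  by (rule co_f2_aux)+
lemma co_f12:
  "co 0 (f12) = 0"
  "co 1 (f12) = 1 * (sx) * dd ^ 5"
  "co 2 (f12) = - (3 * (sx ^ 2) * dd ^ 4)"
  "co 3 (f12) = 7 * (sx ^ 3) * dd ^ 3 + 33 * (px) * dd ^ 3"
  "co 4 (f12) = - (3 * (sx ^ 4) * dd ^ 2) - 33 * (sx * px) * dd ^ 2"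
  "co 5 (f12) = 1 * (sx ^ 5) * dd ^ 1 + 11 * (tx) * dd ^ 1"
  "co 6 (f12) = - (1 * (sx * tx) * dd ^ 0) - 3 * (px ^ 2) * dd ^ 0"
  "co 7 (f12) = 0"
  by (rule co_f12_aux)+
lemma co_f2_2:
  "co 0 (f2 * f2) = 1 * (1) * dd ^ 2"
  "co 1 (f2 * f2) = 2 * (sx) * dd ^ 1"
  "co 2 (f2 * f2) = 1 * (sx ^ 2) * dd ^ 0"
  "co 3 (f2 * f2) = 0"
  "co 4 (f2 * f2) = 0"
  "co 5 (f2 * f2) = 0"
  by (simp only: co_mult_0[OF evenx_f2] co_mult_1[OF evenx_f2] co_mult_2[OF evenx_f2] co_mult_3[OF evenx_f2] co_mult_4[OF evenx_f2] co_mult_5[OF evenx_f2] co_f2; Groebner_Basis.algebra)+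

lemma co_f2_3:
  "co 0 (f2 * (f2 * f2)) = 1 * (1) * dd ^ 3"
  "co 1 (f2 * (f2 * f2)) = 3 * (sx) * dd ^ 2"
  "co 2 (f2 * (f2 * f2)) = 3 * (sx ^ 2) * dd ^ 1"
  "co 3 (f2 * (f2 * f2)) = 1 * (sx ^ 3) * dd ^ 0"
  "co 4 (f2 * (f2 * f2)) = 0"
  "co 5 (f2 * (f2 * f2)) = 0"
  by (simp only: co_mult_0[OF evenx_f2] co_mult_1[OF evenx_f2] co_mult_2[OF evenx_f2] co_mult_3[OF evenx_f2] co_mult_4[OF evenx_f2] co_mult_5[OF evenx_f2] co_f2 co_f2_2; Groebner_Basis.algebra)+

lemma co_f2_4:
  "co 0 ((f2 * f2) * (f2 * f2)) = 1 * (1) * dd ^ 4"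
  "co 1 ((f2 * f2) * (f2 * f2)) = 4 * (sx) * dd ^ 3"
  "co 2 ((f2 * f2) * (f2 * f2)) = 6 * (sx ^ 2) * dd ^ 2"
  "co 3 ((f2 * f2) * (f2 * f2)) = 4 * (sx ^ 3) * dd ^ 1"
  "co 4 ((f2 * f2) * (f2 * f2)) = 1 * (sx ^ 4) * dd ^ 0"
  "co 5 ((f2 * f2) * (f2 * f2)) = 0"
  by (simp only: co_mult_0[OF evenx_f2_2] co_mult_1[OF evenx_f2_2] co_mult_2[OF evenx_f2_2] co_mult_3[OF evenx_f2_2] co_mult_4[OF evenx_f2_2] co_mult_5[OF evenx_f2_2] co_f2_2; Groebner_Basis.algebra)+

lemma co_f2_5:
  "co 0 (f2 * ((f2 * f2) * (f2 * f2))) = 1 * (1) * dd ^ 5"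
  "co 1 (f2 * ((f2 * f2) * (f2 * f2))) = 5 * (sx) * dd ^ 4"
  "co 2 (f2 * ((f2 * f2) * (f2 * f2))) = 10 * (sx ^ 2) * dd ^ 3"
  "co 3 (f2 * ((f2 * f2) * (f2 * f2))) = 10 * (sx ^ 3) * dd ^ 2"
  "co 4 (f2 * ((f2 * f2) * (f2 * f2))) = 5 * (sx ^ 4) * dd ^ 1"
  "co 5 (f2 * ((f2 * f2) * (f2 * f2))) = 1 * (sx ^ 5) * dd ^ 0"
  by (simp only: co_mult_0[OF evenx_f2] co_mult_1[OF evenx_f2] co_mult_2[OF evenx_f2] co_mult_3[OF evenx_f2] co_mult_4[OF evenx_f2] co_mult_5[OF evenx_f2] co_f2 co_f2_4; Groebner_Basis.algebra)+

lemma co_f2_10: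
  "co 0 ((f2 * ((f2 * f2) * (f2 * f2))) * (f2 * ((f2 * f2) * (f2 * f2)))) = 1 * (1) * dd ^ 10"
  "co 1 ((f2 * ((f2 * f2) * (f2 * f2))) * (f2 * ((f2 * f2) * (f2 * f2)))) = 10 * (sx) * dd ^ 9"
  "co 2 ((f2 * ((f2 * f2) * (f2 * f2))) * (f2 * ((f2 * f2) * (f2 * f2)))) = 45 * (sx ^ 2) * dd ^ 8"
  "co 3 ((f2 * ((f2 * f2) * (f2 * f2))) * (f2 * ((f2 * f2) * (f2 * f2)))) = 120 * (sx ^ 3) * dd ^ 7"
  "co 4 ((f2 * ((f2 * f2) * (f2 * f2))) * (f2 * ((f2 * f2) * (f2 * f2)))) = 210 * (sx ^ 4) * dd ^ 6"
  "co 5 ((f2 * ((f2 * f2) * (f2 * f2))) * (f2 * ((f2 * f2) * (f2 * f2)))) = 252 * (sx ^ 5) * dd ^ 5"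
  by (simp only: co_mult_0[OF evenx_f2_5] co_mult_1[OF evenx_f2_5] co_mult_2[OF evenx_f2_5] co_mult_3[OF evenx_f2_5] co_mult_4[OF evenx_f2_5] co_mult_5[OF evenx_f2_5] co_f2_5; Groebner_Basis.algebra)+

lemma co_sq:
  "co 0 (f12 * f12) = 0"
  "co 1 (f12 * f12) = 0"
  "co 2 (f12 * f12) = 1 * (sx ^ 2) * dd ^ 10"
  "co 3 (f12 * f12) = - (6 * (sx ^ 3) * dd ^ 9)"
  "co 4 (f12 * f12) = 23 * (sx ^ 4) * dd ^ 8 + 66 * (sx * px) * dd ^ 8"
  "co 5 (f12 * f12) = - (48 * (sx ^ 5) * dd ^ 7) - 264 * (sx ^ 2 * px) * dd ^ 7"
  "co 6 (f12 * f12) = 69 * (sx ^ 6) * dd ^ 6 + 660 * (sx ^ 3 * px) * dd ^ 6 + 22 * (sx * tx) * dd ^ 6 + 1089 * (px ^ 2) * dd ^ 6"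
  "co 7 (f12 * f12) = - (48 * (sx ^ 7) * dd ^ 5) - 660 * (sx ^ 4 * px) * dd ^ 5 - 68 * (sx ^ 2 * tx) * dd ^ 5 - 2184 * (sx * px ^ 2) * dd ^ 5"
  by (simp only: co_mult_0[OF evenx_f12] co_mult_1[OF evenx_f12] co_mult_2[OF evenx_f12] co_mult_3[OF evenx_f12] co_mult_4[OF evenx_f12] co_mult_5[OF evenx_f12] co_mult_6[OF evenx_f12] co_mult_7[OF evenx_f12] co_f12; Groebner_Basis.algebra)+

lemma co_l1:
  "co 0 (laplacian (f12 * f12)) = 0"
  "co 1 (laplacian (f12 * f12)) = 20 * (sx) * dd ^ 10"
  "co 2 (laplacian (f12 * f12)) = 128 * (sx ^ 2) * dd ^ 9"
  "co 3 (laplacian (f12 * f12)) = - (312 * (sx ^ 3) * dd ^ 8) + 1980 * (px) * dd ^ 8"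
  "co 4 (laplacian (f12 * f12)) = 768 * (sx ^ 4) * dd ^ 7 - 2112 * (sx * px) * dd ^ 7"
  "co 5 (laplacian (f12 * f12)) = 620 * (sx ^ 5) * dd ^ 6 + 14916 * (sx ^ 2 * px) * dd ^ 6 - 7700 * (tx) * dd ^ 6"
  "co 6 (laplacian (f12 * f12)) = 620 * (sx ^ 6) * dd ^ 5 + 13576 * (sx * tx) * dd ^ 5 + 25812 * (px ^ 2) * dd ^ 5"
  by (simp only: co_laplacian co_suc co_sq diff3_rules; Groebner_Basis.algebra)+

lemma co_l2:
  "co 0 (laplacian (laplacian (f12 * f12))) = 120 * (1) * dd ^ 10"
  "co 1 (laplacian (laplacian (f12 * f12))) = 10160 * (sx) * dd ^ 9"
  "co 2 (laplacian (laplacian (f12 * f12))) = 22104 * (sx ^ 2) * dd ^ 8"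
  "co 3 (laplacian (laplacian (f12 * f12))) = - (15360 * (sx ^ 3) * dd ^ 7) + 411840 * (px) * dd ^ 7"
  "co 4 (laplacian (laplacian (f12 * f12))) = 208944 * (sx ^ 4) * dd ^ 6 + 352704 * (sx * px) * dd ^ 6"
  "co 5 (laplacian (laplacian (f12 * f12))) = 124256 * (sx ^ 5) * dd ^ 5 + 2147904 * (sx ^ 2 * px) * dd ^ 5 - 598400 * (tx) * dd ^ 5"
proof -
  show "co 0 (laplacian (laplacian (f12 * f12))) = 120 * (1) * dd ^ 10"
    by (simp only: co_laplacian[of _ "laplacian (f12 * f12)"] co_suc co_l1 diff3_rules; Groebner_Basis.algebra)
  show "co 1 (laplacian (laplacian (f12 * f12))) = 10160 * (sx) * dd ^ 9"
    by (simp only: co_laplacian[of _ "laplacian (f12 * f12)"] co_suc co_l1 diff3_rules; Groebner_Basis.algebra)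
  show "co 2 (laplacian (laplacian (f12 * f12))) = 22104 * (sx ^ 2) * dd ^ 8"
    by (simp only: co_laplacian[of _ "laplacian (f12 * f12)"] co_suc co_l1 diff3_rules; Groebner_Basis.algebra)
  show "co 3 (laplacian (laplacian (f12 * f12))) = - (15360 * (sx ^ 3) * dd ^ 7) + 411840 * (px) * dd ^ 7"
    by (simp only: co_laplacian[of _ "laplacian (f12 * f12)"] co_suc co_l1 diff3_rules; Groebner_Basis.algebra)
  show "co 4 (laplacian (laplacian (f12 * f12))) = 208944 * (sx ^ 4) * dd ^ 6 + 352704 * (sx * px) * dd ^ 6"
    by (simp only: co_laplacian[of _ "laplacian (f12 * f12)"] co_suc co_l1 diff3_rules; Groebner_Basis.algebra)
  show "co 5 (laplacian (laplacian (f12 * f12))) = 124256 * (sx ^ 5) * dd ^ 5 + 2147904 * (sx ^ 2 * px) * dd ^ 5 - 598400 * (tx) * dd ^ 5"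
    by (simp only: co_laplacian[of _ "laplacian (f12 * f12)"] co_suc co_l1 diff3_rules; Groebner_Basis.algebra)
qed

lemma co_f2_4_f12:
  "co 0 (((f2 * f2) * (f2 * f2)) * f12) = 0"
  "co 1 (((f2 * f2) * (f2 * f2)) * f12) = 1 * (sx) * dd ^ 9"
  "co 2 (((f2 * f2) * (f2 * f2)) * f12) = 1 * (sx ^ 2) * dd ^ 8"
  "co 3 (((f2 * f2) * (f2 * f2)) * f12) = 1 * (sx ^ 3) * dd ^ 7 + 33 * (px) * dd ^ 7"
  "co 4 (((f2 * f2) * (f2 * f2)) * f12) = 11 * (sx ^ 4) * dd ^ 6 + 99 * (sx * px) * dd ^ 6"
  "co 5 (((f2 * f2) * (f2 * f2)) * f12) = 20 * (sx ^ 5) * dd ^ 5 + 66 * (sx ^ 2 * px) * dd ^ 5 + 11 * (tx) * dd ^ 5"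
  by (simp only: co_mult_0[OF evenx_f2_4] co_mult_1[OF evenx_f2_4] co_mult_2[OF evenx_f2_4] co_mult_3[OF evenx_f2_4] co_mult_4[OF evenx_f2_4] co_mult_5[OF evenx_f2_4] co_f2_4 co_f12; Groebner_Basis.algebra)+

text \<open>Denominators are cleared, 116160 = 968 * 120, and powers are bracketed as the products
  whose coefficients are computed above.\<close>

lemma f20_scaled: "116160 * f20 = 5 * (3 * laplacian (laplacian (f12 * f12)) -
    360 * ((f2 * ((f2 * f2) * (f2 * f2))) * (f2 * ((f2 * f2) * (f2 * f2)))) - 26880 * (((f2 * f2) * (f2 * f2)) * f12))"
proof -
  have "Const 968 * Const (5 / 968) = Const 5" "Const 120 * Const (1 / 120) = Const 1"
    by (simp_all flip: Const_mult del: Const_numeral)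
  then have "968 * f20 = 5 * (- 3 * f2 ^ 10 - 224 * f2 ^ 4 * f12 + 3 * g20)" "120 * g20 = laplacian (laplacian (f12 ^ 2))"
    by (simp_all only: f20_def g20_def mult.assoc[symmetric] Const_numeral Const_1 mult_1_left)
  then show ?thesis by (simp only: power2_eq_square) Groebner_Basis.algebra
qed

lemma co_f20_scaled: "116160 * co n f20 = 5 * (3 * co n (laplacian (laplacian (f12 * f12))) -
    360 * co n ((f2 * ((f2 * f2) * (f2 * f2))) * (f2 * ((f2 * f2) * (f2 * f2)))) - 26880 * co n (((f2 * f2) * (f2 * f2)) * f12))"
  using arg_cong[OF f20_scaled, of "co n"] by (simp only: co_linear)

lemma co_f20:
  "co 0 (f20) = 0"
  "co 1 (f20) = 0"
  "co 2 (f20) = 1 * (sx ^ 2) * dd ^ 8"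
  "co 3 (f20) = - (5 * (sx ^ 3) * dd ^ 7) + 15 * (px) * dd ^ 7"
  "co 4 (f20) = 11 * (sx ^ 4) * dd ^ 6 - 69 * (sx * px) * dd ^ 6"
  "co 5 (f20) = - (11 * (sx ^ 5) * dd ^ 5) + 201 * (sx ^ 2 * px) * dd ^ 5 - 90 * (tx) * dd ^ 5"
proof -
  show "co 0 (f20) = 0"
    using co_f20_scaled[of 0] unfolding co_l2 co_f2_10 co_f2_4_f12 by Groebner_Basis.algebra
  show "co 1 (f20) = 0"
    using co_f20_scaled[of 1] unfolding co_l2 co_f2_10 co_f2_4_f12 by Groebner_Basis.algebra
  show "co 2 (f20) = 1 * (sx ^ 2) * dd ^ 8"
    using co_f20_scaled[of 2] unfolding co_l2 co_f2_10 co_f2_4_f12 by Groebner_Basis.algebra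
  show "co 3 (f20) = - (5 * (sx ^ 3) * dd ^ 7) + 15 * (px) * dd ^ 7"
    using co_f20_scaled[of 3] unfolding co_l2 co_f2_10 co_f2_4_f12 by Groebner_Basis.algebra
  show "co 4 (f20) = 11 * (sx ^ 4) * dd ^ 6 - 69 * (sx * px) * dd ^ 6"
    using co_f20_scaled[of 4] unfolding co_l2 co_f2_10 co_f2_4_f12 by Groebner_Basis.algebra
  show "co 5 (f20) = - (11 * (sx ^ 5) * dd ^ 5) + 201 * (sx ^ 2 * px) * dd ^ 5 - 90 * (tx) * dd ^ 5"
    using co_f20_scaled[of 5] unfolding co_l2 co_f2_10 co_f2_4_f12 by Groebner_Basis.algebra
qed

lemma co_pr:
  "co 0 (f12 * f20) = 0"
  "co 1 (f12 * f20) = 0"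
  "co 2 (f12 * f20) = 0"
  "co 3 (f12 * f20) = 1 * (sx ^ 3) * dd ^ 13"
  "co 4 (f12 * f20) = - (8 * (sx ^ 4) * dd ^ 12) + 15 * (sx * px) * dd ^ 12"
  "co 5 (f12 * f20) = 33 * (sx ^ 5) * dd ^ 11 - 81 * (sx ^ 2 * px) * dd ^ 11"
  "co 6 (f12 * f20) = - (82 * (sx ^ 6) * dd ^ 10) + 315 * (sx ^ 3 * px) * dd ^ 10 - 90 * (sx * tx) * dd ^ 10 + 495 * (px ^ 2) * dd ^ 10"
  by (simp only: co_mult_0[OF evenx_f12] co_mult_1[OF evenx_f12] co_mult_2[OF evenx_f12] co_mult_3[OF evenx_f12] co_mult_4[OF evenx_f12] co_mult_5[OF evenx_f12] co_mult_6[OF evenx_f12] co_f12 co_f20; Groebner_Basis.algebra)+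

lemma co_l3:
  "co 0 (laplacian (f12 * f20)) = 0"
  "co 1 (laplacian (f12 * f20)) = 0"
  "co 2 (laplacian (f12 * f20)) = 42 * (sx ^ 2) * dd ^ 13"
  "co 3 (laplacian (f12 * f20)) = 44 * (sx ^ 3) * dd ^ 12 + 450 * (px) * dd ^ 12"
  "co 4 (laplacian (f12 * f20)) = - (624 * (sx ^ 4) * dd ^ 11) + 2772 * (sx * px) * dd ^ 11"
  "co 5 (laplacian (f12 * f20)) = 2184 * (sx ^ 5) * dd ^ 10 - 10692 * (sx ^ 2 * px) * dd ^ 10 - 8100 * (tx) * dd ^ 10"
  by (simp only: co_laplacian co_suc co_pr diff3_rules; Groebner_Basis.algebra)+

lemma co_f2_5_f20:
  "co 0 ((f2 * ((f2 * f2) * (f2 * f2))) * f20) = 0"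
  "co 1 ((f2 * ((f2 * f2) * (f2 * f2))) * f20) = 0"
  "co 2 ((f2 * ((f2 * f2) * (f2 * f2))) * f20) = 1 * (sx ^ 2) * dd ^ 13"
  "co 3 ((f2 * ((f2 * f2) * (f2 * f2))) * f20) = 15 * (px) * dd ^ 12"
  "co 4 ((f2 * ((f2 * f2) * (f2 * f2))) * f20) = - (4 * (sx ^ 4) * dd ^ 11) + 6 * (sx * px) * dd ^ 11"
  "co 5 ((f2 * ((f2 * f2) * (f2 * f2))) * f20) = 4 * (sx ^ 5) * dd ^ 10 + 6 * (sx ^ 2 * px) * dd ^ 10 - 90 * (tx) * dd ^ 10"
  by (simp only: co_mult_0[OF evenx_f2_5] co_mult_1[OF evenx_f2_5] co_mult_2[OF evenx_f2_5] co_mult_3[OF evenx_f2_5] co_mult_4[OF evenx_f2_5] co_mult_5[OF evenx_f2_5] co_f2_5 co_f20; Groebner_Basis.algebra)+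

lemma co_f2_3_sq:
  "co 0 ((f2 * (f2 * f2)) * (f12 * f12)) = 0"
  "co 1 ((f2 * (f2 * f2)) * (f12 * f12)) = 0"
  "co 2 ((f2 * (f2 * f2)) * (f12 * f12)) = 1 * (sx ^ 2) * dd ^ 13"
  "co 3 ((f2 * (f2 * f2)) * (f12 * f12)) = - (3 * (sx ^ 3) * dd ^ 12)"
  "co 4 ((f2 * (f2 * f2)) * (f12 * f12)) = 8 * (sx ^ 4) * dd ^ 11 + 66 * (sx * px) * dd ^ 11"
  "co 5 ((f2 * (f2 * f2)) * (f12 * f12)) = 4 * (sx ^ 5) * dd ^ 10 - 66 * (sx ^ 2 * px) * dd ^ 10"
  by (simp only: co_mult_0[OF evenx_f2_3] co_mult_1[OF evenx_f2_3] co_mult_2[OF evenx_f2_3] co_mult_3[OF evenx_f2_3] co_mult_4[OF evenx_f2_3] co_mult_5[OF evenx_f2_3] co_f2_3 co_sq; Groebner_Basis.algebra)+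

text \<open>The factor is 80 = 40 * 42 / 21. The coefficients of \<open>f30\<close> still have
  denominators, which is why \<open>co_f30\<close> is stated for ten times them.\<close>

lemma f30_scaled: "80 * f30 = laplacian (f12 * f20) - 30 * ((f2 * ((f2 * f2) * (f2 * f2))) * f20) -
    12 * ((f2 * (f2 * f2)) * (f12 * f12))"
proof -
  have "Const 40 * Const (1 / 40) = Const 1" "Const 42 * Const (1 / 42) = Const 1"
    by (simp_all flip: Const_mult del: Const_numeral)
  then have "40 * f30 = - 15 * f2 ^ 5 * f20 - 6 * f2 ^ 3 * f12 ^ 2 + 21 * g30" "42 * g30 = laplacian (f12 * f20)"
    by (simp_all only: f30_def g30_def mult.assoc[symmetric] Const_numeral Const_1 mult_1_left)
  then show ?thesis by Groebner_Basis.algebra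
qed

lemma co_f30_scaled: "80 * co n f30 = co n (laplacian (f12 * f20)) - 30 * co n ((f2 * ((f2 * f2) * (f2 * f2))) * f20) -
    12 * co n ((f2 * (f2 * f2)) * (f12 * f12))"
  using arg_cong[OF f30_scaled, of "co n"] by (simp only: co_linear)

lemma co_f30:
  "10 * co 0 f30 = 0"
  "10 * co 1 f30 = 0"
  "10 * co 2 f30 = 0"
  "10 * co 3 f30 = 10 * (sx ^ 3) * dd ^ 12"
  "10 * co 4 f30 = - (75 * (sx ^ 4) * dd ^ 11) + 225 * (sx * px) * dd ^ 11"
  "10 * co 5 f30 = 252 * (sx ^ 5) * dd ^ 10 - 1260 * (sx ^ 2 * px) * dd ^ 10 - 675 * (tx) * dd ^ 10"
proof -
  show "10 * co 0 f30 = 0"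
    using co_f30_scaled[of 0] unfolding co_l3 co_f2_5_f20 co_f2_3_sq by Groebner_Basis.algebra
  show "10 * co 1 f30 = 0"
    using co_f30_scaled[of 1] unfolding co_l3 co_f2_5_f20 co_f2_3_sq by Groebner_Basis.algebra
  show "10 * co 2 f30 = 0"
    using co_f30_scaled[of 2] unfolding co_l3 co_f2_5_f20 co_f2_3_sq by Groebner_Basis.algebra
  show "10 * co 3 f30 = 10 * (sx ^ 3) * dd ^ 12"
    using co_f30_scaled[of 3] unfolding co_l3 co_f2_5_f20 co_f2_3_sq by Groebner_Basis.algebra
  show "10 * co 4 f30 = - (75 * (sx ^ 4) * dd ^ 11) + 225 * (sx * px) * dd ^ 11"
    using co_f30_scaled[of 4] unfolding co_l3 co_f2_5_f20 co_f2_3_sq by Groebner_Basis.algebra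
  show "10 * co 5 f30 = 252 * (sx ^ 5) * dd ^ 10 - 1260 * (sx ^ 2 * px) * dd ^ 10 - 675 * (tx) * dd ^ 10"
    using co_f30_scaled[of 5] unfolding co_l3 co_f2_5_f20 co_f2_3_sq by Groebner_Basis.algebra
qed

lemma co_f2_2_f20:
  "co 0 ((f2 * f2) * f20) = 0"
  "co 1 ((f2 * f2) * f20) = 0"
  "co 2 ((f2 * f2) * f20) = 1 * (sx ^ 2) * dd ^ 10"
  "co 3 ((f2 * f2) * f20) = - (3 * (sx ^ 3) * dd ^ 9) + 15 * (px) * dd ^ 9"
  "co 4 ((f2 * f2) * f20) = 2 * (sx ^ 4) * dd ^ 8 - 39 * (sx * px) * dd ^ 8"
  "co 5 ((f2 * f2) * f20) = 6 * (sx ^ 5) * dd ^ 7 + 78 * (sx ^ 2 * px) * dd ^ 7 - 90 * (tx) * dd ^ 7"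
  by (simp only: co_mult_0[OF evenx_f2_2] co_mult_1[OF evenx_f2_2] co_mult_2[OF evenx_f2_2] co_mult_3[OF evenx_f2_2] co_mult_4[OF evenx_f2_2] co_mult_5[OF evenx_f2_2] co_f2_2 co_f20; Groebner_Basis.algebra)+

lemma co_f2_2_pr:
  "co 0 ((f2 * f2) * (f12 * f20)) = 0"
  "co 1 ((f2 * f2) * (f12 * f20)) = 0"
  "co 2 ((f2 * f2) * (f12 * f20)) = 0"
  "co 3 ((f2 * f2) * (f12 * f20)) = 1 * (sx ^ 3) * dd ^ 15"
  "co 4 ((f2 * f2) * (f12 * f20)) = - (6 * (sx ^ 4) * dd ^ 14) + 15 * (sx * px) * dd ^ 14"
  "co 5 ((f2 * f2) * (f12 * f20)) = 18 * (sx ^ 5) * dd ^ 13 - 51 * (sx ^ 2 * px) * dd ^ 13"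
  by (simp only: co_mult_0[OF evenx_f2_2] co_mult_1[OF evenx_f2_2] co_mult_2[OF evenx_f2_2] co_mult_3[OF evenx_f2_2] co_mult_4[OF evenx_f2_2] co_mult_5[OF evenx_f2_2] co_f2_2 co_pr; Groebner_Basis.algebra)+

lemma co_cube:
  "co 0 (f12 * (f12 * f12)) = 0"
  "co 1 (f12 * (f12 * f12)) = 0"
  "co 2 (f12 * (f12 * f12)) = 0"
  "co 3 (f12 * (f12 * f12)) = 1 * (sx ^ 3) * dd ^ 15"
  "co 4 (f12 * (f12 * f12)) = - (9 * (sx ^ 4) * dd ^ 14)"
  "co 5 (f12 * (f12 * f12)) = 48 * (sx ^ 5) * dd ^ 13 + 99 * (sx ^ 2 * px) * dd ^ 13"
  by (simp only: co_mult_0[OF evenx_f12] co_mult_1[OF evenx_f12] co_mult_2[OF evenx_f12] co_mult_3[OF evenx_f12] co_mult_4[OF evenx_f12] co_mult_5[OF evenx_f12] co_f12 co_sq; Groebner_Basis.algebra)+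

lemma co_10f30:
  "co 0 (10 * f30) = 0"
  "co 1 (10 * f30) = 0"
  "co 2 (10 * f30) = 0"
  "co 3 (10 * f30) = 10 * (sx ^ 3) * dd ^ 12"
  "co 4 (10 * f30) = - (75 * (sx ^ 4) * dd ^ 11) + 225 * (sx * px) * dd ^ 11"
  "co 5 (10 * f30) = 252 * (sx ^ 5) * dd ^ 10 - 1260 * (sx ^ 2 * px) * dd ^ 10 - 675 * (tx) * dd ^ 10"
  by (simp_all only: co_linear co_f30)

lemma co_f2_3_f30:
  "co 0 ((f2 * (f2 * f2)) * (10 * f30)) = 0"
  "co 1 ((f2 * (f2 * f2)) * (10 * f30)) = 0"
  "co 2 ((f2 * (f2 * f2)) * (10 * f30)) = 0"
  "co 3 ((f2 * (f2 * f2)) * (10 * f30)) = 10 * (sx ^ 3) * dd ^ 15"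
  "co 4 ((f2 * (f2 * f2)) * (10 * f30)) = - (45 * (sx ^ 4) * dd ^ 14) + 225 * (sx * px) * dd ^ 14"
  "co 5 ((f2 * (f2 * f2)) * (10 * f30)) = 57 * (sx ^ 5) * dd ^ 13 - 585 * (sx ^ 2 * px) * dd ^ 13 - 675 * (tx) * dd ^ 13"
  by (simp only: co_mult_0[OF evenx_f2_3] co_mult_1[OF evenx_f2_3] co_mult_2[OF evenx_f2_3] co_mult_3[OF evenx_f2_3] co_mult_4[OF evenx_f2_3] co_mult_5[OF evenx_f2_3] co_f2_3 co_10f30; Groebner_Basis.algebra)+

section \<open>The invariants form a polynomial ring\<close>

text \<open>
  For an invariant \<open>h\<close>, the gradient of \<open>h\<close> is a combination of the gradients of the four basic
  invariants with coefficients \<open>J\<^sub>i / J\<close>. Every invariant has a derivative in the direction of a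
  root \<open>r\<close> that changes sign under the reflection in \<open>r\<close>, so that all the determinants are
  divisible by the linear form of \<open>r\<close>. As \<open>J\<close> has degree \<open>60\<close>, it is a multiple of the product of the
  sixty linear forms, so the quotients are polynomials. Euler's identity and averaging over the group
  express \<open>h\<close> by invariants of smaller degree.
\<close>

definition grad :: "poly4 \<Rightarrow> 4 \<Rightarrow> poly4" where
  "grad f i = partial i f"

definition det3 :: "'a::comm_ring_1 \<Rightarrow> 'a \<Rightarrow> 'a \<Rightarrow> 'a \<Rightarrow> 'a \<Rightarrow> 'a \<Rightarrow> 'a \<Rightarrow> 'a \<Rightarrow> 'a \<Rightarrow> 'a" where
  "det3 a1 a2 a3 b1 b2 b3 c1 c2 c3 = a1 * (b2 * c3 - b3 * c2) - a2 * (b1 * c3 - b3 * c1) + a3 * (b1 * c2 - b2 * c1)"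

text \<open>Written out, so that Cramer's rule and the row and column operations below are plain
  polynomial identities.\<close>

definition det4 :: "(4 \<Rightarrow> 'a::comm_ring_1) \<Rightarrow> (4 \<Rightarrow> 'a) \<Rightarrow> (4 \<Rightarrow> 'a) \<Rightarrow> (4 \<Rightarrow> 'a) \<Rightarrow> 'a" where
  "det4 a b c d =
     a 1 * det3 (b 2) (b 3) (b 4) (c 2) (c 3) (c 4) (d 2) (d 3) (d 4)
   - a 2 * det3 (b 1) (b 3) (b 4) (c 1) (c 3) (c 4) (d 1) (d 3) (d 4)
   + a 3 * det3 (b 1) (b 2) (b 4) (c 1) (c 2) (c 4) (d 1) (d 2) (d 4)
   - a 4 * det3 (b 1) (b 2) (b 3) (c 1) (c 2) (c 3) (d 1) (d 2) (d 3)"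

lemma det4_cramer:
  fixes a b c d v :: "4 \<Rightarrow> poly4"
  shows "det4 a b c d * v j = det4 v b c d * a j + det4 a v c d * b j + det4 a b v d * c j + det4 a b c v * d j"
proof -
  have "\<forall>j. det4 a b c d * v j = det4 v b c d * a j + det4 a v c d * b j + det4 a b v d * c j + det4 a b c v * d j"
    unfolding forall_4 det4_def det3_def by (intro conjI; Groebner_Basis.algebra)
  then show ?thesis by blast
qed

lemma four_neq: "(1 :: 4) \<noteq> 2" "(1 :: 4) \<noteq> 3" "(1 :: 4) \<noteq> 4" "(2 :: 4) \<noteq> 1" "(2 :: 4) \<noteq> 3" "(2 :: 4) \<noteq> 4"
  "(3 :: 4) \<noteq> 1" "(3 :: 4) \<noteq> 2" "(3 :: 4) \<noteq> 4" "(4 :: 4) \<noteq> 1" "(4 :: 4) \<noteq> 2" "(4 :: 4) \<noteq> 3"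
  by simp_all

text \<open>Replacing column j by the combination of all columns with coefficients x multiplies the
  determinant by x j, and every entry of the new column is divisible by l.\<close>

lemma det4_column:
  fixes a b c d x :: "4 \<Rightarrow> poly4"
  assumes "l dvd (\<Sum>i\<in>UNIV. x i * a i)" "l dvd (\<Sum>i\<in>UNIV. x i * b i)"
    "l dvd (\<Sum>i\<in>UNIV. x i * c i)" "l dvd (\<Sum>i\<in>UNIV. x i * d i)"
  shows "l dvd x j * det4 a b c d"
proof -
  obtain p q r s where *: "x 1 * a 1 + x 2 * a 2 + x 3 * a 3 + x 4 * a 4 = l * p"
    "x 1 * b 1 + x 2 * b 2 + x 3 * b 3 + x 4 * b 4 = l * q"
    "x 1 * c 1 + x 2 * c 2 + x 3 * c 3 + x 4 * c 4 = l * r"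
    "x 1 * d 1 + x 2 * d 2 + x 3 * d 3 + x 4 * d 4 = l * s"
    using assms unfolding sum_4 dvd_def by blast
  define up where "up f e i = (if i = j then e else f i)" for f :: "4 \<Rightarrow> poly4" and e and i :: 4
  have "x j * det4 a b c d = det4 (up a (l * p)) (up b (l * q)) (up c (l * r)) (up d (l * s))"
  proof -
    have "\<forall>j. x j * det4 a b c d =
      det4 (\<lambda>i. if i = j then x 1 * a 1 + x 2 * a 2 + x 3 * a 3 + x 4 * a 4 else a i)
        (\<lambda>i. if i = j then x 1 * b 1 + x 2 * b 2 + x 3 * b 3 + x 4 * b 4 else b i)
        (\<lambda>i. if i = j then x 1 * c 1 + x 2 * c 2 + x 3 * c 3 + x 4 * c 4 else c i)
        (\<lambda>i. if i = j then x 1 * d 1 + x 2 * d 2 + x 3 * d 3 + x 4 * d 4 else d i)"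
      unfolding forall_4 det4_def det3_def by (simp only: four_neq if_True if_False refl) (intro conjI; Groebner_Basis.algebra)
    then show ?thesis unfolding *[symmetric] up_def by blast
  qed
  also have "\<dots> = l * det4 (up a p) (up b q) (up c r) (up d s)"
  proof -
    have "\<forall>j. det4 (\<lambda>i. if i = j then l * p else a i) (\<lambda>i. if i = j then l * q else b i)
        (\<lambda>i. if i = j then l * r else c i) (\<lambda>i. if i = j then l * s else d i) =
      l * det4 (\<lambda>i. if i = j then p else a i) (\<lambda>i. if i = j then q else b i)
        (\<lambda>i. if i = j then r else c i) (\<lambda>i. if i = j then s else d i)"
      unfolding forall_4 det4_def det3_def by (simp only: four_neq if_True if_False refl) (intro conjI; Groebner_Basis.algebra)
    then show ?thesis unfolding up_def by blast
  qed
  finally show ?thesis by simp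
qed

subsection \<open>Divisibility by the linear forms of the roots\<close>

definition root_form :: "real ^ 4 \<Rightarrow> poly4" where
  "root_form r = (\<Sum>i\<in>UNIV. Const (complex_of_real (r $ i)) * Var i)"

lemma act_reflection_Var:
  assumes "r \<in> H4"
  shows "act (reflection r) (Var i) = Var i - Const (complex_of_real (2 * r $ i)) * root_form r"
proof -
  have "act (reflection r) (Var i) =
      (\<Sum>j\<in>UNIV. (if j = i then Var j else 0) - Const (complex_of_real (2 * r $ i)) * (Const (complex_of_real (r $ j)) * Var j))"
    unfolding act_Var reflection_axis_nth[OF assms]
    by (rule sum.cong) (auto simp only: of_real_diff of_real_mult of_real_1 of_real_0 Const_diff Const_mult Const_1 Const_0
      left_diff_distrib mult_1_left mult_zero_left mult.assoc if_True if_False split: if_splits)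
  then show ?thesis by (simp add: sum_subtractf root_form_def sum_distrib_left)
qed

text \<open>A polynomial and its reflection agree on the mirror. The divisibility passes to sums and
  products, so it comes down to the case of a variable.\<close>

lemma dvd_act_reflection:
  assumes "r \<in> H4"
  shows "root_form r dvd f - act (reflection r) f"
proof (induction f rule: poly4_induct)
  case (Var i)
  then show ?case by (simp add: act_reflection_Var[OF assms])
next
  case (add f g)
  have "f + g - act (reflection r) (f + g) = (f - act (reflection r) f) + (g - act (reflection r) g)"
    by (simp add: act_hom)
  then show ?case using add by (simp only: dvd_add)
next
  case (mult f g)
  have "f * g - act (reflection r) (f * g) = (f - act (reflection r) f) * g + act (reflection r) f * (g - act (reflection r) g)"
    by (simp add: act_hom algebra_simps)
  then show ?case using mult by (simp only: dvd_add dvd_mult dvd_mult2)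
qed (simp add: act_hom)

lemma dvd_if_skew:
  assumes "r \<in> H4" "act (reflection r) f = - f"
  shows "root_form r dvd f"
proof -
  have "root_form r dvd 2 * f" using dvd_act_reflection[OF assms(1), of f] by (simp add: assms(2))
  then have "root_form r dvd Const (1 / 2) * (2 * f)" by (rule dvd_mult)
  moreover have "Const (1 / 2) * 2 = 1"
    unfolding Const_numeral[symmetric] Const_mult[symmetric] by (simp add: Const_1)
  ultimately show ?thesis by (simp only: mult.assoc[symmetric] mult_1_left)
qed

lemma root_form_dvd_derivative:
  assumes r: "r \<in> H4" and f: "f \<in> T_inv"
  shows "root_form r dvd (\<Sum>i\<in>UNIV. Const (complex_of_real (r $ i)) * grad f i)"
proof (rule dvd_if_skew[OF r])
  let ?C = "\<lambda>x. Const (complex_of_real x)"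
  let ?a = "act (reflection r)"
  have fa: "?a f = f" using f r by (simp add: T_inv_iff)
  have u: "(\<Sum>j\<in>UNIV. r $ j * r $ j) = 1" using H4_unit[OF r] by (simp add: inner_vec_def)
  \<comment> \<open>The reflection is symmetric and sends r to -r.\<close>
  have row: "(\<Sum>j\<in>UNIV. r $ j * reflection r (axis i 1) $ j) = - r $ i" for i
  proof -
    have "(\<Sum>j\<in>UNIV. r $ j * reflection r (axis i 1) $ j) = (\<Sum>j\<in>UNIV. (if j = i then r $ j else 0) - 2 * r $ i * (r $ j * r $ j))"
      unfolding reflection_axis_nth[OF r] by (rule sum.cong) (auto simp: algebra_simps)
    also have "\<dots> = r $ i - 2 * r $ i * 1" by (simp add: sum_subtractf u flip: sum_distrib_left)
    finally show ?thesis by simp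
  qed
  have "(\<Sum>j\<in>UNIV. ?C (r $ j) * grad f j) = (\<Sum>j\<in>UNIV. ?C (r $ j) * partial j (?a f))"
    by (simp add: grad_def fa)
  also have "\<dots> = (\<Sum>j\<in>UNIV. \<Sum>i\<in>UNIV. ?C (r $ j * reflection r (axis i 1) $ j) * ?a (grad f i))"
    by (simp only: partial_act grad_def sum_distrib_left of_real_mult Const_mult mult.assoc)
  also have "\<dots> = (\<Sum>i\<in>UNIV. \<Sum>j\<in>UNIV. ?C (r $ j * reflection r (axis i 1) $ j) * ?a (grad f i))"
    by (rule sum.swap)
  also have "\<dots> = (\<Sum>i\<in>UNIV. ?C (- r $ i) * ?a (grad f i))"
    by (simp only: sum_distrib_right[symmetric] Const_sum[symmetric] of_real_sum[symmetric] row)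
  also have "\<dots> = - ?a (\<Sum>i\<in>UNIV. ?C (r $ i) * grad f i)"
    by (simp add: act_sum act_hom Const_uminus sum_negf)
  finally have "(\<Sum>i\<in>UNIV. ?C (r $ i) * grad f i) = - ?a (\<Sum>i\<in>UNIV. ?C (r $ i) * grad f i)" .
  from minus_equation_iff[THEN iffD1, OF this[symmetric]]
  show "?a (\<Sum>i\<in>UNIV. ?C (r $ i) * grad f i) = - (\<Sum>i\<in>UNIV. ?C (r $ i) * grad f i)" by (rule sym)
qed

text \<open>In \<open>det4_column\<close> the coefficients x are the coordinates of r, so the new
  column consists of derivatives in the direction of r; some coordinate of r is nonzero and can be
  divided out.\<close>

lemma root_form_dvd_det4:
  assumes r: "r \<in> H4" and "k1 \<in> T_inv" "k2 \<in> T_inv" "k3 \<in> T_inv" "k4 \<in> T_inv"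
  shows "root_form r dvd det4 (grad k1) (grad k2) (grad k3) (grad k4)"
proof -
  obtain j where j: "r $ j \<noteq> 0" using H4_nonzero[OF r] by (auto simp: vec_eq_iff)
  let ?C = "\<lambda>x. Const (complex_of_real x)"
  let ?d = "det4 (grad k1) (grad k2) (grad k3) (grad k4)"
  have "root_form r dvd ?C (r $ j) * ?d"
    using assms by (intro det4_column root_form_dvd_derivative)
  then have "root_form r dvd ?C (1 / r $ j) * (?C (r $ j) * ?d)" by (rule dvd_mult)
  moreover have "?C (1 / r $ j) * ?C (r $ j) = 1" using j by (simp flip: Const_mult)
  ultimately show ?thesis by (simp only: mult.assoc[symmetric] mult_1_left)
qed

text \<open>For a unit vector r this is composition with the orthogonal projection onto the mirror.
  It is a ring homomorphism that kills \<open>root_form r\<close> and changes a polynomial by a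
  multiple of it, so its kernel is generated by \<open>root_form r\<close>; as it maps into a
  domain, \<open>root_form r\<close> is prime.\<close>

definition proj_root :: "real ^ 4 \<Rightarrow> poly4 \<Rightarrow> poly4" where
  "proj_root r = subst (\<lambda>i. Var i - Const (complex_of_real (r $ i)) * root_form r)"

lemma proj_root_dvd: "root_form r dvd f - proj_root r f"
proof (induction f rule: poly4_induct)
  case (add f g)
  have "f + g - proj_root r (f + g) = (f - proj_root r f) + (g - proj_root r g)"
    by (simp add: proj_root_def subst_hom)
  then show ?case using add by (simp only: dvd_add)
next
  case (mult f g)
  have "f * g - proj_root r (f * g) = (f - proj_root r f) * g + proj_root r f * (g - proj_root r g)"
    by (simp add: proj_root_def subst_hom algebra_simps)
  then show ?case using mult by (simp only: dvd_add dvd_mult dvd_mult2)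
qed (simp_all add: proj_root_def subst_hom)

lemma proj_root_form: "proj_root r (root_form s) = root_form s - Const (complex_of_real (r \<bullet> s)) * root_form r"
proof -
  have "proj_root r (root_form s) = (\<Sum>i\<in>UNIV. Const (complex_of_real (s $ i)) * Var i - Const (complex_of_real (r $ i * s $ i)) * root_form r)"
    by (simp only: proj_root_def root_form_def[of s] subst_sum subst_hom subst_Var right_diff_distrib Const_mult of_real_mult)
      (simp only: mult.assoc mult.left_commute)
  then show ?thesis
    by (simp add: sum_subtractf root_form_def inner_vec_def Const_sum sum_distrib_right)
qed

lemma root_form_prime:
  assumes r: "r \<in> H4" and s: "s \<in> H4" "s \<noteq> r" "s \<noteq> - r" and d: "root_form r dvd root_form s * f"
  shows "root_form r dvd f"
proof -
  have hom: "proj_root r (a * b) = proj_root r a * proj_root r b" for a b by (simp add: proj_root_def subst_hom)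
  have "proj_root r (root_form r) = 0" unfolding proj_root_form by (simp add: H4_unit[OF r])
  moreover obtain k where "root_form s * f = root_form r * k" using d by (elim dvdE)
  ultimately have "proj_root r (root_form s * f) = 0" by (simp only: hom mult_zero_left)
  then have "proj_root r (root_form s) = 0 \<or> proj_root r f = 0" by (simp add: hom)
  moreover have "proj_root r (root_form s) \<noteq> 0"
  proof
    assume "proj_root r (root_form s) = 0"
    then have "(\<Sum>i\<in>UNIV. Const (complex_of_real (s $ i - (r \<bullet> s) * r $ i)) * Var i) = 0"
      unfolding proj_root_form by (simp only: root_form_def sum_distrib_left of_real_diff of_real_mult
        Const_diff Const_mult left_diff_distrib sum_subtractf mult.assoc)
    then have p: "partial j (\<Sum>i\<in>UNIV. Const (complex_of_real (s $ i - (r \<bullet> s) * r $ i)) * Var i) = 0" for j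
      by simp
    have "s $ j - (r \<bullet> s) * r $ j = 0" for j
    proof -
      have e: "partial j (\<Sum>i\<in>UNIV. Const (complex_of_real (s $ i - (r \<bullet> s) * r $ i)) * Var i) =
          (\<Sum>i\<in>UNIV. if i = j then Const (complex_of_real (s $ i - (r \<bullet> s) * r $ i)) else 0)"
        unfolding partial_sum by (rule sum.cong) (auto simp: partial_Const_mult partial_Var)
      from p[of j] show ?thesis
        by (simp only: e sum.delta[OF finite] UNIV_I if_True Const_eq_0_iff of_real_eq_0_iff)
    qed
    then have sr: "s = (r \<bullet> s) *\<^sub>R r" by (simp add: vec_eq_iff)
    have "s \<bullet> s = (r \<bullet> s) * (r \<bullet> s)" by (subst (1) sr) simp
    then have "(r \<bullet> s) * (r \<bullet> s) = 1" using H4_unit[OF s(1)] by simp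
    then have "r \<bullet> s = 1 \<or> r \<bullet> s = -1" by (simp add: square_eq_1_iff)
    then show False using sr s(2,3) by (metis scaleR_minus1_left scaleR_one)
  qed
  ultimately have "proj_root r f = 0" by blast
  then show ?thesis using proj_root_dvd[of r f] by simp
qed

text \<open>One root from each pair r, -r, the one whose first nonzero coordinate is positive: these
  represent the mirrors.\<close>

definition pos_roots :: "(real ^ 4) set" where
  "pos_roots = {r \<in> H4. r $ 1 > 0 \<or> r $ 1 = 0 \<and> (r $ 2 > 0 \<or> r $ 2 = 0 \<and> (r $ 3 > 0 \<or> r $ 3 = 0 \<and> r $ 4 > 0))}"

lemma H4_uminus: "r \<in> H4 \<Longrightarrow> - r \<in> H4"
  by (rule H4_sign_change) auto

lemma card_pos_roots: "card pos_roots = 60"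
proof -
  have "r \<in> pos_roots \<or> - r \<in> pos_roots" if "r \<in> H4" for r
  proof -
    have "\<not> (r $ 1 = 0 \<and> r $ 2 = 0 \<and> r $ 3 = 0 \<and> r $ 4 = 0)"
      using H4_nonzero[OF that] by (simp add: vec4_eq_iff)
    then show ?thesis using that H4_uminus[OF that] unfolding pos_roots_def by simp linarith
  qed
  then have u: "H4 = pos_roots \<union> uminus ` pos_roots"
  proof (intro equalityI subsetI)
    fix r assume "r \<in> H4"
    then show "r \<in> pos_roots \<union> uminus ` pos_roots"
      using \<open>\<And>r. r \<in> H4 \<Longrightarrow> r \<in> pos_roots \<or> - r \<in> pos_roots\<close> by (metis UnI1 UnI2 image_eqI minus_minus)
  qed (auto simp: pos_roots_def dest: H4_uminus)
  have disj: "pos_roots \<inter> uminus ` pos_roots = {}"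
    by (auto simp: pos_roots_def)
  have fin: "finite pos_roots" using finite_H4 by (simp add: pos_roots_def)
  have "card H4 = card (set roots)"
    unfolding H4_eq by (rule card_image) (rule inj_on_subset[OF inj_rvec], simp)
  also have "\<dots> = length roots" by (rule distinct_card[OF distinct_roots])
  also have "\<dots> = 120" by (simp add: roots_def root_bases_def Let_def signed_def sgns_def)
  finally have "120 = card pos_roots + card (uminus ` pos_roots)"
    using fin disj unfolding u by (simp add: card_Un_disjoint)
  moreover have "card (uminus ` pos_roots) = card pos_roots" by (rule card_image) simp
  ultimately show ?thesis by simp
qed

definition root_prod :: poly4 where
  "root_prod = (\<Prod>r\<in>pos_roots. root_form r)"

text \<open>The forms are prime and pairwise non-proportional, so they can be split off one after
  the other.\<close>

lemma root_prod_dvd: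
  assumes "\<And>r. r \<in> H4 \<Longrightarrow> root_form r dvd f"
  shows "root_prod dvd f"
proof -
  have fin: "finite pos_roots" using finite_H4 by (simp add: pos_roots_def)
  have "(\<Prod>r\<in>R. root_form r) dvd f" if "finite R" "R \<subseteq> pos_roots" for R
    using that
  proof (induction R rule: finite_induct)
    case (insert r R)
    then obtain g where g: "f = (\<Prod>r\<in>R. root_form r) * g" by (auto elim: dvdE)
    have r: "r \<in> H4" using insert by (auto simp: pos_roots_def)
    have ne: "s \<noteq> r \<and> s \<noteq> - r \<and> s \<in> H4" if "s \<in> R" for s
    proof -
      have "s \<in> pos_roots" "r \<in> pos_roots" "s \<noteq> r" using insert that by auto
      then show ?thesis by (auto simp: pos_roots_def)
    qed
    \<comment> \<open>Strips the factors already split off, one at a time, from the divisibility by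
      the new form.\<close>
    have "root_form r dvd (\<Prod>r\<in>R'. root_form r) * g \<Longrightarrow> root_form r dvd g" if "finite R'" "R' \<subseteq> R" for R'
      using that
    proof (induction R' rule: finite_induct)
      case (insert s R')
      have "root_form r dvd root_form s * ((\<Prod>r\<in>R'. root_form r) * g)"
        using insert.prems(1) unfolding prod.insert[OF insert.hyps(1,2)] mult.assoc .
      then have "root_form r dvd (\<Prod>r\<in>R'. root_form r) * g"
        using root_form_prime[OF r, of s] ne[of s] insert.prems by blast
      then show ?case using insert.IH insert.prems by blast
    qed simp
    from this[OF insert(1) subset_refl] have "root_form r dvd g"
      using assms[OF r] g by simp
    then show ?case unfolding g using insert by (simp add: mult.commute mult_dvd_mono)
  qed simp
  then show ?thesis using fin by (simp add: root_prod_def)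
qed

lemma homogeneous_root_form: "homogeneous 1 (root_form r)"
  unfolding root_form_def by (intro homogeneous_sum homogeneous_Const_mult homogeneous_Var)

lemma homogeneous_root_prod: "homogeneous 60 root_prod"
proof -
  have "homogeneous (card R) (\<Prod>r\<in>R. root_form r)" for R
  proof (induction R rule: infinite_finite_induct)
    case (insert r R)
    then show ?case using homogeneous_mult[OF homogeneous_root_form[of r], of "card R"] by simp
  qed (use homogeneous_Const[of 1] in simp_all)
  then show ?thesis unfolding root_prod_def card_pos_roots[symmetric] .
qed

text \<open>Comparing components of degree d replaces g by its constant term. This makes the
  Jacobian determinant a scalar multiple of \<open>root_prod\<close>.\<close>

lemma homogeneous_dvd_same_degree:
  assumes "homogeneous d f" "homogeneous d (f * g)" "f * g \<noteq> 0"
  shows "\<exists>c. c \<noteq> 0 \<and> f * g = Const c * f"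
proof -
  have f: "vanishes mdeg d f" using assms(1) wpart_mdeg_homogeneous[OF assms(1)] by (simp add: vanishes_def)
  have "f * g = wpart mdeg (d + 0) (f * g)" using assms(2) by (simp add: homogeneous_iff)
  also have "\<dots> = wpart mdeg d f * wpart mdeg 0 g"
    by (rule mdeg.wpart_mult_lowest) (simp_all add: f)
  also have "wpart mdeg d f = f" using assms(1) by (simp add: homogeneous_iff)
  finally have *: "f * g = f * wpart mdeg 0 g" .
  obtain c where "wpart mdeg 0 g = Const c" using homogeneous_wpart_mdeg[of 0 g] by (auto simp: homogeneous_0_iff)
  then have "f * g = Const c * f" using * by (simp add: mult.commute)
  then show ?thesis using assms(3) by (intro exI[of _ c]) auto
qed

section \<open>Averaging over the group, and generation of the invariants\<close>

definition average :: "poly4 \<Rightarrow> poly4" where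
  "average f = Const (1 / of_nat (card W_H4)) * (\<Sum>g\<in>W_H4. act g f)"

lemma card_W: "card W_H4 \<noteq> 0"
  using finite_W id_in_W by auto

lemma average_inv: "f \<in> T_inv \<Longrightarrow> average (f * g) = f * average g"
proof -
  assume f: "f \<in> T_inv"
  have "(\<Sum>h\<in>W_H4. act h (f * g)) = f * (\<Sum>h\<in>W_H4. act h g)"
    using f by (simp add: act_hom T_inv_def sum_distrib_left)
  then show ?thesis by (simp only: average_def mult.left_commute)
qed

lemma average_1: "average 1 = 1"
  using card_W by (simp add: average_def act_hom flip: Const_of_nat Const_mult)

lemma average_T_inv: "average f \<in> T_inv"
proof -
  have "act h (\<Sum>g\<in>W_H4. act g f) = (\<Sum>g\<in>W_H4. act g f)" if h: "h \<in> W_H4" for h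
  proof -
    obtain k where k: "k \<in> W_H4" "\<forall>v. h (k v) = v" "\<forall>v. k (h v) = v" using W_inverse[OF h] by blast
    have "bij_betw (\<lambda>g v. h (g v)) W_H4 W_H4"
      using comp_in_W[OF h] comp_in_W[OF k(1)]
      by (intro bij_betw_byWitness[of _ "\<lambda>g v. k (g v)"]) (auto simp: k)
    then have "(\<Sum>g\<in>W_H4. act (\<lambda>v. h (g v)) f) = (\<Sum>g\<in>W_H4. act g f)"
      by (rule sum.reindex_bij_betw)
    then show ?thesis by (simp add: act_sum act_comp W_linear h)
  qed
  then show ?thesis by (simp add: average_def T_inv_def act_hom)
qed

lemma average_add: "average (f + g) = average f + average g"
  by (simp add: average_def act_hom sum.distrib distrib_left)

lemma homogeneous_average: "homogeneous d f \<Longrightarrow> homogeneous d (average f)"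
  unfolding average_def by (intro homogeneous_Const_mult homogeneous_sum homogeneous_act)

lemma homogeneous_det4:
  assumes "\<And>i. homogeneous p (a i)" "\<And>i. homogeneous q (b i)" "\<And>i. homogeneous r (c i)" "\<And>i. homogeneous s (d i)"
  shows "homogeneous (p + (q + (r + s))) (det4 a b c d)"
  unfolding det4_def det3_def
  by (intro homogeneous_add homogeneous_diff homogeneous_mult assms)

text \<open>The predicate A stands for membership in the subalgebra generated by h1, ..., h4. The
  degrees lowered by one sum to the number of mirrors, so the Jacobian determinant and the product
  of the linear forms agree up to a scalar.\<close>

theorem invariants_generated:
  assumes inv: "h1 \<in> T_inv" "h2 \<in> T_inv" "h3 \<in> T_inv" "h4 \<in> T_inv"
    and hom: "homogeneous (Suc d1) h1" "homogeneous (Suc d2) h2" "homogeneous (Suc d3) h3" "homogeneous (Suc d4) h4"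
    and deg: "d1 + d2 + d3 + d4 = 60"
    and J: "det4 (grad h1) (grad h2) (grad h3) (grad h4) \<noteq> 0"
    and A: "\<And>c. A (Const c)" "\<And>f g. A f \<Longrightarrow> A g \<Longrightarrow> A (f + g)" "\<And>f g. A f \<Longrightarrow> A g \<Longrightarrow> A (f * g)"
      "A h1" "A h2" "A h3" "A h4"
    and f: "f \<in> T_inv" "homogeneous d f"
  shows "A f"
proof -
  let ?J = "det4 (grad h1) (grad h2) (grad h3) (grad h4)"
  have hg: "homogeneous d (grad k i)" if "homogeneous (Suc d) k" for d k i
    using homogeneous_partial[OF that] by (simp add: grad_def)
  have "root_prod dvd ?J" by (rule root_prod_dvd, rule root_form_dvd_det4[OF _ inv], assumption)
  then obtain g where g: "?J = root_prod * g" by (auto elim: dvdE)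
  have "homogeneous 60 ?J" using homogeneous_det4[OF hg[OF hom(1)] hg[OF hom(2)] hg[OF hom(3)] hg[OF hom(4)]] deg
    by (simp add: add.assoc)
  then obtain c where c: "c \<noteq> 0" "?J = Const c * root_prod"
    using homogeneous_dvd_same_degree[OF homogeneous_root_prod] J unfolding g by blast
  have rp: "root_prod \<noteq> 0" using c J by auto
  show ?thesis using f
  proof (induction d arbitrary: f rule: less_induct)
    case (less d)
    show ?case
    proof (cases d)
      case 0
      then show ?thesis using less.prems A(1) by (auto simp: homogeneous_0_iff)
    next
      case (Suc e)
      have dvd: "root_prod dvd det4 (grad f) (grad h2) (grad h3) (grad h4)"
        "root_prod dvd det4 (grad h1) (grad f) (grad h3) (grad h4)"
        "root_prod dvd det4 (grad h1) (grad h2) (grad f) (grad h4)"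
        "root_prod dvd det4 (grad h1) (grad h2) (grad h3) (grad f)"
        by (intro root_prod_dvd root_form_dvd_det4 inv less.prems; assumption)+
      then obtain a1 a2 a3 a4 where a: "det4 (grad f) (grad h2) (grad h3) (grad h4) = root_prod * a1"
        "det4 (grad h1) (grad f) (grad h3) (grad h4) = root_prod * a2"
        "det4 (grad h1) (grad h2) (grad f) (grad h4) = root_prod * a3"
        "det4 (grad h1) (grad h2) (grad h3) (grad f) = root_prod * a4"
        by (auto elim!: dvdE)
      \<comment> \<open>Cramer's rule with all determinants divided by \<open>root_prod\<close>: the
        gradient of f becomes a polynomial combination of the four gradients.\<close>
      have "root_prod * (Const c * grad f i) = root_prod * (a1 * grad h1 i + a2 * grad h2 i + a3 * grad h3 i + a4 * grad h4 i)" for i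
        using det4_cramer[of "grad h1" "grad h2" "grad h3" "grad h4" "grad f" i] unfolding a c(2)
        by (simp only: distrib_left mult_ac)
      then have gr: "Const c * grad f i = a1 * grad h1 i + a2 * grad h2 i + a3 * grad h3 i + a4 * grad h4 i" for i
        using rp by simp
      have "Const c * (of_nat d * f) = (\<Sum>i\<in>UNIV. Var i * (Const c * grad f i))"
        unfolding euler[OF less.prems(2), symmetric] by (simp only: grad_def sum_distrib_left mult.left_commute)
      also have "\<dots> = a1 * (\<Sum>i\<in>UNIV. Var i * grad h1 i) + a2 * (\<Sum>i\<in>UNIV. Var i * grad h2 i) +
          a3 * (\<Sum>i\<in>UNIV. Var i * grad h3 i) + a4 * (\<Sum>i\<in>UNIV. Var i * grad h4 i)"
        unfolding gr by (simp only: distrib_left sum.distrib sum_distrib_left mult.left_commute)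
      also have "\<dots> = h1 * (of_nat (Suc d1) * a1) + h2 * (of_nat (Suc d2) * a2) + h3 * (of_nat (Suc d3) * a3) + h4 * (of_nat (Suc d4) * a4)"
        unfolding grad_def euler[OF hom(1)] euler[OF hom(2)] euler[OF hom(3)] euler[OF hom(4)] by (simp only: mult_ac)
      finally have eq: "Const (c * of_nat d) * f = h1 * (of_nat (Suc d1) * a1) + h2 * (of_nat (Suc d2) * a2) +
          h3 * (of_nat (Suc d3) * a3) + h4 * (of_nat (Suc d4) * a4)"
        by (simp only: Const_mult Const_of_nat mult.assoc)
      define k where "k = 1 / (c * of_nat d)"
      have "of_nat d \<noteq> (0 :: complex)" using Suc by (subst of_nat_eq_0_iff) simp
      then have kc: "Const k * Const (c * of_nat d) = 1" using c(1) \<open>of_nat d \<noteq> 0\<close> unfolding Const_mult[symmetric] k_def by simp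
      define b where "b h a n = Const k * (of_nat (Suc n) * a)" for h a :: poly4 and n :: nat
      have "f = Const k * (Const (c * of_nat d) * f)" by (simp only: mult.assoc[symmetric] kc mult_1_left)
      also have "\<dots> = h1 * b h1 a1 d1 + h2 * b h2 a2 d2 + h3 * b h3 a3 d3 + h4 * b h4 a4 d4"
        unfolding eq b_def by (simp only: distrib_left mult.left_commute)
      finally have feq: "f = h1 * b h1 a1 d1 + h2 * b h2 a2 d2 + h3 * b h3 a3 d3 + h4 * b h4 a4 d4" .
      \<comment> \<open>The quotients may be inhomogeneous; only their components of complementary
        degree contribute to degree d.\<close>
      have red: "wpart mdeg d (h * w) = h * (if Suc n \<le> d then wpart mdeg (d - Suc n) w else 0)" if "homogeneous (Suc n) h" for h w n
      proof -
        have "wpart mdeg d (h * w) = (\<Sum>i\<le>d. if i = Suc n then h * wpart mdeg (d - Suc n) w else 0)"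
          unfolding mdeg.wpart_mult by (rule sum.cong) (auto simp: wpart_mdeg_homogeneous[OF that])
        then show ?thesis by simp
      qed
      \<comment> \<open>As f and the four forms are invariant, the coefficients may be averaged.
        They become invariants of smaller degree, to which the induction applies.\<close>
      define B where "B w n = average (if Suc n \<le> d then wpart mdeg (d - Suc n) w else 0)" for w n
      have "f = average (f * 1)" using average_inv[OF less.prems(1), of 1] by (simp add: average_1)
      also have "f * 1 = wpart mdeg d f" using less.prems(2) by (simp add: homogeneous_iff)
      also have "\<dots> = wpart mdeg d (h1 * b h1 a1 d1 + h2 * b h2 a2 d2 + h3 * b h3 a3 d3 + h4 * b h4 a4 d4)"
        using feq by simp
      also have "average \<dots> = h1 * B (b h1 a1 d1) d1 + h2 * B (b h2 a2 d2) d2 + h3 * B (b h3 a3 d3) d3 + h4 * B (b h4 a4 d4) d4"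
        by (simp only: wpart_add red[OF hom(1)] red[OF hom(2)] red[OF hom(3)] red[OF hom(4)] average_add
            average_inv inv B_def)
      finally have final: "f = h1 * B (b h1 a1 d1) d1 + h2 * B (b h2 a2 d2) d2 + h3 * B (b h3 a3 d3) d3 + h4 * B (b h4 a4 d4) d4" .
      have AB: "A (B w n)" for w n
      proof (cases "Suc n \<le> d")
        case True
        have "homogeneous (d - Suc n) (B w n)"
          unfolding B_def using True by (auto intro!: homogeneous_average homogeneous_wpart_mdeg)
        moreover have "B w n \<in> T_inv" unfolding B_def by (rule average_T_inv)
        ultimately show ?thesis using less.IH[of "d - Suc n" "B w n"] True by simp
      next
        case False
        then have "B w n = 0" by (simp add: B_def average_def act_hom)
        then show ?thesis using A(1)[of 0] by simp
      qed
      show ?thesis by (subst final) (intro A AB)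
    qed
  qed
qed

section \<open>Counting standard monomials\<close>

definition gens :: "nat \<Rightarrow> poly4" where "gens i = snd (snd (R_gens ! i))"
definition wd :: "nat \<Rightarrow> nat" where "wd i = fst (R_gens ! i)"
definition wm :: "nat \<Rightarrow> nat" where "wm i = fst (snd (R_gens ! i))"

lemma wd_simps: "wd 0 = 2" "wd 1 = 12" "wd (Suc 0) = 12" "wd 2 = 20" "wd 3 = 24" "wd 4 = 30" "wd 5 = 32" "wd 6 = 36" "wd 7 = 42"
  "wd 8 = 44" "wd 9 = 54" "wd 10 = 60" "wd 11 = 66"
  by (simp_all add: wd_def R_gens_def)

lemma wm_simps: "wm 0 = 0" "wm 1 = 2" "wm (Suc 0) = 2" "wm 2 = 4" "wm 3 = 6" "wm 4 = 6" "wm 5 = 8" "wm 6 = 10" "wm 7 = 10"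
  "wm 8 = 12" "wm 9 = 14" "wm 10 = 16" "wm 11 = 18"
  by (simp_all add: wm_def R_gens_def)

section \<open>Generating functions of weighted sets\<close>

definition bmon :: "nat \<times> nat \<Rightarrow> rat fps fps" where
  "bmon p = fps_X ^ fst p * fps_const (fps_X ^ snd p)"

lemma bmon_0: "bmon (0, 0) = 1"
  by (simp add: bmon_def)

lemma bmon_add: "bmon (a + c, b + d) = bmon (a, b) * bmon (c, d)"
  by (simp add: bmon_def power_add mult_ac flip: fps_const_mult)

lemma nth_bmon_mult:
  "fps_nth (fps_nth (bmon (a, b) * F) d) m = (if a \<le> d \<and> b \<le> m then fps_nth (fps_nth F (d - a)) (m - b) else 0)"
  by (simp add: bmon_def mult.assoc fps_X_power_mult_nth not_less)

definition wgf :: "'i set \<Rightarrow> ('i \<Rightarrow> nat \<times> nat) \<Rightarrow> rat fps fps" where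
  "wgf S w = Abs_fps (\<lambda>d. Abs_fps (\<lambda>m. of_nat (card {x \<in> S. w x = (d, m)})))"

text \<open>\<open>card\<close> is 0 on infinite sets, so this condition is what makes the counts
  additive.\<close>

definition finite_fibres :: "'i set \<Rightarrow> ('i \<Rightarrow> nat \<times> nat) \<Rightarrow> bool" where
  "finite_fibres S w \<longleftrightarrow> (\<forall>e. finite {x \<in> S. w x = e})"

lemma wgf_cong: "(\<And>x. x \<in> S \<Longrightarrow> w x = w' x) \<Longrightarrow> wgf S w = wgf S w'"
proof -
  assume *: "\<And>x. x \<in> S \<Longrightarrow> w x = w' x"
  have "{x \<in> S. w x = e} = {x \<in> S. w' x = e}" for e using * by auto
  then show ?thesis by (simp only: wgf_def)
qed

lemma finite_fibres_cong: "(\<And>x. x \<in> S \<Longrightarrow> w x = w' x) \<Longrightarrow> finite_fibres S w = finite_fibres S w'"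
proof -
  assume *: "\<And>x. x \<in> S \<Longrightarrow> w x = w' x"
  have "{x \<in> S. w x = e} = {x \<in> S. w' x = e}" for e using * by auto
  then show ?thesis by (simp only: finite_fibres_def)
qed

lemma finite_fibresD: "finite_fibres S w \<Longrightarrow> finite {x \<in> S. w x = e}"
  by (simp only: finite_fibres_def)

lemma wgf_Un:
  assumes "finite_fibres S w" "finite_fibres T w" "S \<inter> T = {}"
  shows "wgf (S \<union> T) w = wgf S w + wgf T w"
proof -
  have "card {x \<in> S \<union> T. w x = e} = card {x \<in> S. w x = e} + card {x \<in> T. w x = e}" for e
  proof -
    have "{x \<in> S \<union> T. w x = e} = {x \<in> S. w x = e} \<union> {x \<in> T. w x = e}" by auto
    then show ?thesis using assms by (auto intro!: card_Un_disjoint dest: finite_fibresD)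
  qed
  then show ?thesis by (simp add: wgf_def fps_eq_iff)
qed

lemma finite_fibres_Un: "finite_fibres S w \<Longrightarrow> finite_fibres T w \<Longrightarrow> finite_fibres (S \<union> T) w"
proof -
  assume *: "finite_fibres S w" "finite_fibres T w"
  have "{x \<in> S \<union> T. w x = e} = {x \<in> S. w x = e} \<union> {x \<in> T. w x = e}" for e by auto
  with * show ?thesis unfolding finite_fibres_def by (simp only: finite_Un simp_thms)
qed

lemma finite_fibres_finite: "finite S \<Longrightarrow> finite_fibres S w"
  by (simp add: finite_fibres_def)

lemma wgf_single: "wgf {x} w = bmon (w x)"
proof -
  have "card {y. y = x \<and> w y = e} = (if w x = e then 1 else 0)" for e
  proof -
    have "{y. y = x \<and> w y = e} = (if w x = e then {x} else {})" by auto
    then show ?thesis by simp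
  qed
  moreover have "fps_nth (fps_nth (bmon p) d) m = (if p = (d, m) then 1 else 0)" for p d m
    using nth_bmon_mult[of "fst p" "snd p" 1 d m]
    by (cases p) (simp only: fst_conv snd_conv mult_1_right fps_one_nth, auto)
  ultimately show ?thesis by (simp add: wgf_def fps_eq_iff)
qed

lemma wgf_finite:
  assumes "finite S"
  shows "wgf S w = (\<Sum>x\<in>S. bmon (w x))"
  using assms
proof (induction S rule: finite_induct)
  case empty
  show ?case by (simp add: wgf_def fps_eq_iff)
next
  case (insert x S)
  have "wgf ({x} \<union> S) w = wgf {x} w + wgf S w"
    using insert by (intro wgf_Un finite_fibres_finite) auto
  then show ?case using insert by (simp add: wgf_single)
qed

text \<open>The weight on pairs (x, n) in which n counts the powers of a further factor of weight
  a.\<close>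

definition shiftw :: "('i \<Rightarrow> nat \<times> nat) \<Rightarrow> nat \<times> nat \<Rightarrow> 'i \<times> nat \<Rightarrow> nat \<times> nat" where
  "shiftw w a = (\<lambda>(x, n). (fst (w x) + n * fst a, snd (w x) + n * snd a))"

lemma finite_fibres_shift:
  assumes "finite_fibres S w" "a \<noteq> (0, 0)"
  shows "finite_fibres (S \<times> UNIV) (shiftw w a)"
  unfolding finite_fibres_def
proof
  fix e :: "nat \<times> nat"
  have "{y \<in> S \<times> UNIV. shiftw w a y = e} \<subseteq>
    (\<Union>n\<in>{..fst e + snd e}. (\<lambda>x. (x, n)) ` {x \<in> S. w x = (fst e - n * fst a, snd e - n * snd a)})"
  proof
    fix y assume y: "y \<in> {y \<in> S \<times> UNIV. shiftw w a y = e}"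
    obtain x n where xn: "y = (x, n)" "x \<in> S" using y by auto
    have e: "fst (w x) + n * fst a = fst e" "snd (w x) + n * snd a = snd e"
      using y by (auto simp: xn shiftw_def)
    have "n \<le> n * fst a + n * snd a" using assms(2) by (cases a) (auto simp: trans_le_add1 trans_le_add2)
    then have "n \<le> fst e + snd e" using e by linarith
    moreover have "w x = (fst e - n * fst a, snd e - n * snd a)"
      unfolding e[symmetric] by simp
    ultimately show "y \<in> (\<Union>n\<in>{..fst e + snd e}. (\<lambda>x. (x, n)) ` {x \<in> S. w x = (fst e - n * fst a, snd e - n * snd a)})"
      using xn by auto
  qed
  then show "finite {y \<in> S \<times> UNIV. shiftw w a y = e}"
    by (rule finite_subset) (intro finite_UN_I finite_imageI finite_fibresD[OF assms(1)] finite_atMost)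
qed

text \<open>Geometric series: the pairs with n > 0 are the shift by a of all pairs, and those with n
  = 0 form a copy of S.\<close>

lemma wgf_shift:
  assumes "finite_fibres S w" "a \<noteq> (0, 0)"
  shows "wgf (S \<times> UNIV) (shiftw w a) * (1 - bmon a) = wgf S w"
proof -
  let ?A = "\<lambda>e. {y \<in> S \<times> UNIV. shiftw w a y = e}"
  obtain b c where a: "a = (b, c)" by (cases a)
  have fin: "finite (?A e)" for e using finite_fibres_shift[OF assms] by (rule finite_fibresD)
  have c: "card (?A (d, m)) = (if b \<le> d \<and> c \<le> m then card (?A (d - b, m - c)) else 0) + card {x \<in> S. w x = (d, m)}" for d m
  proof -
    let ?B = "if b \<le> d \<and> c \<le> m then (\<lambda>(x, n). (x, Suc n)) ` ?A (d - b, m - c) else {}"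
    let ?C = "(\<lambda>x. (x, 0 :: nat)) ` {x \<in> S. w x = (d, m)}"
    have "?A (d, m) = ?B \<union> ?C"
    proof (intro equalityI subsetI)
      fix y assume y: "y \<in> ?A (d, m)"
      obtain x n where xn: "y = (x, n)" by (cases y)
      show "y \<in> ?B \<union> ?C"
      proof (cases n)
        case 0
        then show ?thesis using y by (auto simp: xn shiftw_def prod_eq_iff)
      next
        case (Suc k)
        have e: "x \<in> S" "fst (w x) + k * b + b = d" "snd (w x) + k * c + c = m"
          using y by (auto simp: xn shiftw_def Suc a)
        then have "(x, k) \<in> ?A (d - b, m - c)" "b \<le> d" "c \<le> m" by (auto simp: shiftw_def a)
        then show ?thesis unfolding xn Suc by (auto intro!: rev_image_eqI[of "(x, k)"])
      qed
    next
      fix y assume "y \<in> ?B \<union> ?C"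
      then show "y \<in> ?A (d, m)"
        by (auto simp: shiftw_def a prod_eq_iff split: if_splits)
    qed
    moreover have "?B \<inter> ?C = {}" by auto
    moreover have "card ?B = (if b \<le> d \<and> c \<le> m then card (?A (d - b, m - c)) else 0)"
      by (auto intro!: card_image inj_onI)
    moreover have "card ?C = card {x \<in> S. w x = (d, m)}" by (intro card_image inj_onI) auto
    moreover have "finite ?B" "finite ?C" using fin finite_fibresD[OF assms(1)] by auto
    ultimately show ?thesis by (simp only: card_Un_disjoint)
  qed
  have "wgf (S \<times> UNIV) (shiftw w a) = bmon (b, c) * wgf (S \<times> UNIV) (shiftw w a) + wgf S w"
  proof (intro fps_ext)
    fix d m
    have 1: "fps_nth (fps_nth (wgf (S \<times> UNIV) (shiftw w a)) d) m = of_nat (card (?A (d, m)))" for d m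
      by (simp add: wgf_def)
    have 2: "fps_nth (fps_nth (wgf S w) d) m = of_nat (card {x \<in> S. w x = (d, m)})"
      by (simp add: wgf_def)
    show "fps_nth (fps_nth (wgf (S \<times> UNIV) (shiftw w a)) d) m =
        fps_nth (fps_nth (bmon (b, c) * wgf (S \<times> UNIV) (shiftw w a) + wgf S w) d) m"
      unfolding fps_add_nth nth_bmon_mult 1 2 c[of d m] by (simp split: if_splits)
  qed
  then have "wgf (S \<times> UNIV) (shiftw w a) = bmon a * wgf (S \<times> UNIV) (shiftw w a) + wgf S w"
    by (simp only: a)
  then show ?thesis by Groebner_Basis.algebra
qed

lemma wgf_image:
  assumes "inj_on \<phi> S" "\<And>x. x \<in> S \<Longrightarrow> w' (\<phi> x) = w x"
  shows "wgf (\<phi> ` S) w' = wgf S w"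
proof -
  have "card {y \<in> \<phi> ` S. w' y = e} = card {x \<in> S. w x = e}" for e
  proof -
    have "{y \<in> \<phi> ` S. w' y = e} = \<phi> ` {x \<in> S. w x = e}" using assms(2) by auto
    moreover have "inj_on \<phi> {x \<in> S. w x = e}" using assms(1) by (rule inj_on_subset) auto
    ultimately show ?thesis by (simp add: card_image)
  qed
  then show ?thesis by (simp add: wgf_def)
qed

lemma finite_fibres_image:
  assumes "finite_fibres S w" "\<And>x. x \<in> S \<Longrightarrow> w' (\<phi> x) = w x"
  shows "finite_fibres (\<phi> ` S) w'"
  unfolding finite_fibres_def
proof
  fix e
  have "{y \<in> \<phi> ` S. w' y = e} = \<phi> ` {x \<in> S. w x = e}" using assms(2) by auto
  then show "finite {y \<in> \<phi> ` S. w' y = e}" using finite_fibresD[OF assms(1)] by simp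
qed

definition headw :: "(nat \<Rightarrow> nat) \<Rightarrow> nat \<Rightarrow> nat" where
  "headw w \<beta> = [0, w 4, w 5, w 4 + w 5, w 6, w 1, w 3, w 11, w 1 + w 11, w 3 + w 11, w 7, w 9] ! \<beta>"

definition sw :: "(nat \<Rightarrow> nat \<times> nat) \<Rightarrow> ((nat \<times> nat) \<times> nat) \<times> nat \<Rightarrow> nat \<times> nat" where
  "sw v x = (sweight (\<lambda>i. fst (v i)) x, sweight (\<lambda>i. snd (v i)) x)"

text \<open>The three summands are the families with powers of generator 2, those with powers of
  generator 6, and the two single elements; generators 8 and 10 contribute common geometric series.
  The weight v is left open because three gradings are counted: by order, by degree and by
  both.\<close>

lemma wgf_sidx:
  assumes v: "v 2 \<noteq> (0, 0)" "v 6 \<noteq> (0, 0)" "v 8 \<noteq> (0, 0)" "v 10 \<noteq> (0, 0)"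
  shows "finite_fibres sidx (sw v)"
    "wgf sidx (sw v) * ((1 - bmon (v 8)) * (1 - bmon (v 10)) * (1 - bmon (v 2)) * (1 - bmon (v 6))) =
      (1 + bmon (v 4) + bmon (v 5) + bmon (v 4) * bmon (v 5)) * (1 - bmon (v 6))
      + (bmon (v 6) + bmon (v 1) + bmon (v 3) + bmon (v 11) + bmon (v 1) * bmon (v 11) + bmon (v 3) * bmon (v 11)) * (1 - bmon (v 2))
      + (bmon (v 7) + bmon (v 9)) * ((1 - bmon (v 2)) * (1 - bmon (v 6)))"
proof -
  let ?h = "\<lambda>\<beta>. (headw (\<lambda>i. fst (v i)) \<beta>, headw (\<lambda>i. snd (v i)) \<beta>)"
  let ?w8 = "shiftw ?h (v 8)"
  let ?w = "shiftw ?w8 (v 10)"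
  have f8: "finite_fibres (H \<times> UNIV) ?w8" if "finite H" for H
    by (rule finite_fibres_shift[OF finite_fibres_finite[OF that] v(3)])
  have f10: "finite_fibres ((H \<times> UNIV) \<times> UNIV) ?w" if "finite H" for H
    by (rule finite_fibres_shift[OF f8[OF that] v(4)])
  have base: "wgf ((H \<times> UNIV) \<times> UNIV) ?w * ((1 - bmon (v 8)) * (1 - bmon (v 10))) = (\<Sum>\<beta>\<in>H. bmon (?h \<beta>))"
    if "finite H" for H
  proof -
    have "wgf ((H \<times> UNIV) \<times> UNIV) ?w * (1 - bmon (v 10)) = wgf (H \<times> UNIV) ?w8"
      by (rule wgf_shift[OF f8[OF that] v(4)])
    moreover have "wgf (H \<times> UNIV) ?w8 * (1 - bmon (v 8)) = wgf H ?h"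
      by (rule wgf_shift[OF finite_fibres_finite[OF that] v(3)])
    moreover have "G * (k * z) = B" if "G * z = G'" "G' * k = B" for G G' B k z :: "rat fps fps"
      unfolding that[symmetric] by (simp only: mult_ac)
    ultimately show ?thesis unfolding wgf_finite[OF that, symmetric] by blast
  qed
  let ?S1 = "(({0, 1, 2, 3 :: nat} \<times> (UNIV :: nat set)) \<times> (UNIV :: nat set)) \<times> (UNIV :: nat set)"
  let ?S2 = "(({4, 5, 6, 7, 8, 9 :: nat} \<times> (UNIV :: nat set)) \<times> (UNIV :: nat set)) \<times> (UNIV :: nat set)"
  let ?S3 = "(\<lambda>y. (y, 0 :: nat)) ` (({10, 11 :: nat} \<times> (UNIV :: nat set)) \<times> (UNIV :: nat set))"
  have sidx: "sidx = ?S1 \<union> (?S2 \<union> ?S3)"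
  proof (intro equalityI subsetI)
    fix x assume x: "x \<in> sidx"
    obtain \<beta> i j m where x': "x = (((\<beta>, i), j), m)" by (metis surj_pair)
    have "\<beta> \<in> {0, 1, 2, 3, 4, 5, 6, 7, 8, 9, 10, 11}" "10 \<le> \<beta> \<longrightarrow> m = 0"
      using x by (auto simp: sidx_def x' less_12)
    then show "x \<in> ?S1 \<union> (?S2 \<union> ?S3)" unfolding x' by auto
  qed (auto simp: sidx_def)
  have w1: "sw v x = shiftw ?w (v 2) x" if "x \<in> ?S1" for x
    using that by (auto simp: sw_def sweight_def shiftw_def headw_def sstep_def)
  have w2: "sw v x = shiftw ?w (v 6) x" if "x \<in> ?S2" for x
    using that by (auto simp: sw_def sweight_def shiftw_def headw_def sstep_def)
  have w3: "sw v (y, 0) = ?w y" for y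
    by (cases y; cases "fst y") (auto simp: sw_def sweight_def shiftw_def headw_def)
  have F1: "finite_fibres ?S1 (sw v)"
  proof -
    have "finite_fibres ?S1 (shiftw ?w (v 2))" by (rule finite_fibres_shift[OF f10 v(1)]) simp
    then show ?thesis by (simp only: finite_fibres_cong[of ?S1 "sw v" "shiftw ?w (v 2)", OF w1])
  qed
  have F2: "finite_fibres ?S2 (sw v)"
  proof -
    have "finite_fibres ?S2 (shiftw ?w (v 6))" by (rule finite_fibres_shift[OF f10 v(2)]) simp
    then show ?thesis by (simp only: finite_fibres_cong[of ?S2 "sw v" "shiftw ?w (v 6)", OF w2])
  qed
  have F3: "finite_fibres ?S3 (sw v)"
    by (rule finite_fibres_image[of "({10, 11} \<times> UNIV) \<times> UNIV" ?w "sw v" "\<lambda>y. (y, 0)"]) (simp_all only: f10 w3 finite.emptyI finite_insert)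
  show "finite_fibres sidx (sw v)"
    unfolding sidx by (intro finite_fibres_Un F1 F2 F3)
  have "wgf sidx (sw v) = wgf ?S1 (sw v) + (wgf ?S2 (sw v) + wgf ?S3 (sw v))"
    unfolding sidx by (subst wgf_Un[OF F1 finite_fibres_Un[OF F2 F3]], force, subst wgf_Un[OF F2 F3], force, rule refl)
  moreover have "wgf ?S1 (sw v) * (1 - bmon (v 2)) = wgf (({0, 1, 2, 3} \<times> UNIV) \<times> UNIV) ?w"
  proof -
    have "wgf ?S1 (sw v) = wgf ?S1 (shiftw ?w (v 2))" by (rule wgf_cong, rule w1)
    then show ?thesis using wgf_shift[OF f10 v(1), of "{0, 1, 2, 3}"] by (simp only: finite.emptyI finite_insert simp_thms)
  qed
  moreover have "wgf ?S2 (sw v) * (1 - bmon (v 6)) = wgf (({4, 5, 6, 7, 8, 9} \<times> UNIV) \<times> UNIV) ?w"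
  proof -
    have "wgf ?S2 (sw v) = wgf ?S2 (shiftw ?w (v 6))" by (rule wgf_cong, rule w2)
    then show ?thesis using wgf_shift[OF f10 v(2), of "{4, 5, 6, 7, 8, 9}"] by (simp only: finite.emptyI finite_insert simp_thms)
  qed
  moreover have "wgf ?S3 (sw v) = wgf (({10, 11} \<times> UNIV) \<times> UNIV) ?w"
    by (rule wgf_image[of "\<lambda>y. (y, 0)" _ "sw v" ?w]) (simp_all only: inj_on_def w3 prod.inject simp_thms, simp)
  moreover note base[of "{0, 1, 2, 3}"] base[of "{4, 5, 6, 7, 8, 9}"] base[of "{10, 11}"]
  moreover have "(\<Sum>\<beta>\<in>{0, 1, 2, 3}. bmon (?h \<beta>)) = 1 + bmon (v 4) + bmon (v 5) + bmon (v 4) * bmon (v 5)"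
    by (simp add: headw_def bmon_0 bmon_add add.assoc)
  moreover have "(\<Sum>\<beta>\<in>{4, 5, 6, 7, 8, 9}. bmon (?h \<beta>)) =
      bmon (v 6) + bmon (v 1) + bmon (v 3) + bmon (v 11) + bmon (v 1) * bmon (v 11) + bmon (v 3) * bmon (v 11)"
    by (simp add: headw_def bmon_0 bmon_add add.assoc)
  moreover have "(\<Sum>\<beta>\<in>{10, 11}. bmon (?h \<beta>)) = bmon (v 7) + bmon (v 9)"
    by (simp add: headw_def)
  moreover have "(G1 + (G2 + G3)) * (k * z * b * r) = B1 * r + B2 * b + B3 * (b * r)"
    if "G1 * b = W1" "G2 * r = W2" "G3 = W3" "W1 * (k * z) = B1" "W2 * (k * z) = B2" "W3 * (k * z) = B3"
    for G1 G2 G3 k z b r W1 W2 W3 B1 B2 B3 :: "rat fps fps"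
    unfolding that(4-6)[symmetric] that(1-3)[symmetric] by (simp only: distrib_left distrib_right mult_ac add_ac)
  ultimately show "wgf sidx (sw v) * ((1 - bmon (v 8)) * (1 - bmon (v 10)) * (1 - bmon (v 2)) * (1 - bmon (v 6))) =
      (1 + bmon (v 4) + bmon (v 5) + bmon (v 4) * bmon (v 5)) * (1 - bmon (v 6))
      + (bmon (v 6) + bmon (v 1) + bmon (v 3) + bmon (v 11) + bmon (v 1) * bmon (v 11) + bmon (v 3) * bmon (v 11)) * (1 - bmon (v 2))
      + (bmon (v 7) + bmon (v 9)) * ((1 - bmon (v 2)) * (1 - bmon (v 6)))"
    by (simp only: finite.emptyI finite_insert simp_thms)
qed

text \<open>Exponent triples as iterated pairs over a one-point set, so that
  \<open>wgf_shift\<close> applies three times.\<close>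

definition pidx :: "(((unit \<times> nat) \<times> nat) \<times> nat) set" where
  "pidx = (({()} \<times> UNIV) \<times> UNIV) \<times> UNIV"

definition pw :: "nat \<times> nat \<Rightarrow> nat \<times> nat \<Rightarrow> nat \<times> nat \<Rightarrow> ((unit \<times> nat) \<times> nat) \<times> nat \<Rightarrow> nat \<times> nat" where
  "pw a b c = shiftw (shiftw (shiftw (\<lambda>_. (0, 0)) a) b) c"

lemma wgf_pidx:
  assumes "a \<noteq> (0, 0)" "b \<noteq> (0, 0)" "c \<noteq> (0, 0)"
  shows "finite_fibres pidx (pw a b c)"
    "wgf pidx (pw a b c) * ((1 - bmon a) * (1 - bmon b) * (1 - bmon c)) = 1"
proof -
  have f: "finite_fibres {()} (\<lambda>_. (0, 0))" by (simp add: finite_fibres_finite)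
  show "finite_fibres pidx (pw a b c)"
    unfolding pidx_def pw_def by (intro finite_fibres_shift f assms)
  have "wgf pidx (pw a b c) * (1 - bmon c) * (1 - bmon b) * (1 - bmon a) = wgf {()} (\<lambda>_. (0, 0))"
    unfolding pidx_def pw_def wgf_shift[OF finite_fibres_shift[OF finite_fibres_shift[OF f assms(1)] assms(2)] assms(3)]
      wgf_shift[OF finite_fibres_shift[OF f assms(1)] assms(2)] wgf_shift[OF f assms(1)] ..
  then show "wgf pidx (pw a b c) * ((1 - bmon a) * (1 - bmon b) * (1 - bmon c)) = 1"
    by (simp add: wgf_single bmon_0 mult_ac)
qed

lemma card_eq_if_wgf_eq: "wgf S w = wgf T w' \<Longrightarrow> card {x \<in> S. w x = (d, m)} = card {x \<in> T. w' x = (d, m)}"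
proof -
  assume "wgf S w = wgf T w'"
  then have "fps_nth (fps_nth (wgf S w) d) m = fps_nth (fps_nth (wgf T w') d) m" by simp
  then show ?thesis by (simp add: wgf_def)
qed

lemma bmon_X: "bmon (n, 0) = fps_X ^ n"
  by (simp add: bmon_def)

lemma one_minus_X_power: "0 < n \<Longrightarrow> 1 - fps_X ^ n \<noteq> (0 :: rat fps fps)"
proof
  assume n: "0 < n" and e: "1 - fps_X ^ n = (0 :: rat fps fps)"
  show False using arg_cong[OF e, of "\<lambda>F. fps_nth F 0"] n by (simp add: fps_X_power_iff)
qed

text \<open>Counted by order, the standard monomials have the series 1 / ((1 - t^2) (1 - t^6) (1 -
  t^10)), which is that of the monomials in P, Q, R.\<close>

lemma card_weight:
  "card {x \<in> sidx. sweight wm x = n} = card {y \<in> pidx. pw (2, 0) (6, 0) (10, 0) y = (n, 0)}"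
proof -
  let ?v = "\<lambda>i. (wm i, 0 :: nat)"
  let ?X = "fps_X :: rat fps fps"
  have v: "?v 2 \<noteq> (0, 0)" "?v 6 \<noteq> (0, 0)" "?v 8 \<noteq> (0, 0)" "?v 10 \<noteq> (0, 0)" by (simp_all add: wm_simps)
  have a: "(2, 0) \<noteq> (0 :: nat, 0 :: nat)" "(6, 0) \<noteq> (0 :: nat, 0 :: nat)" "(10, 0) \<noteq> (0 :: nat, 0 :: nat)" by simp_all
  note s = wgf_sidx(2)[of ?v, OF v, unfolded wm_simps bmon_X]
  note p = wgf_pidx(2)[OF a, unfolded bmon_X]
  let ?D = "(1 - ?X ^ 12) * (1 - ?X ^ 16) * (1 - ?X ^ 4) * (1 - ?X ^ 10)"
  let ?E = "(1 - ?X ^ 2) * (1 - ?X ^ 6) * (1 - ?X ^ 10)"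
  have "wgf sidx (sw ?v) * ?D * ?E = wgf pidx (pw (2, 0) (6, 0) (10, 0)) * ?E * ?D"
    unfolding s p by Groebner_Basis.algebra
  then have "wgf sidx (sw ?v) * (?D * ?E) = wgf pidx (pw (2, 0) (6, 0) (10, 0)) * (?D * ?E)"
    by (simp only: mult_ac)
  moreover have "?D * ?E \<noteq> 0" by (simp add: one_minus_X_power del: right_minus_eq)
  ultimately have "wgf sidx (sw ?v) = wgf pidx (pw (2, 0) (6, 0) (10, 0))"
    using mult_right_cancel[of "?D * ?E"] by blast
  then have "card {x \<in> sidx. sw ?v x = (n, 0)} = card {y \<in> pidx. pw (2, 0) (6, 0) (10, 0) y = (n, 0)}"
    by (rule card_eq_if_wgf_eq)
  moreover have "sweight (\<lambda>i. 0) x = 0" if "x \<in> sidx" for x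
    using that unfolding sidx_def sweight_def less_12 by (auto simp: sstep_def)
  then have "{x \<in> sidx. sw ?v x = (n, 0)} = {x \<in> sidx. sweight wm x = n}"
    by (auto simp: sw_def)
  ultimately show ?thesis by simp
qed

lemma finite_weight: "finite {x \<in> sidx. sweight wm x = n}"
proof -
  have f: "finite_fibres sidx (sw (\<lambda>i. (wm i, 0)))"
    by (rule wgf_sidx) (simp_all add: wm_simps)
  have "sweight (\<lambda>i. 0) x = 0" if "x \<in> sidx" for x
    using that unfolding sidx_def sweight_def less_12 by (auto simp: sstep_def)
  then have "{x \<in> sidx. sweight wm x = n} = {x \<in> sidx. sw (\<lambda>i. (wm i, 0)) x = (n, 0)}"
    by (auto simp: sw_def)
  then show ?thesis using finite_fibresD[OF f] by simp
qed

section \<open>Linear independence of the standard monomials\<close>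

text \<open>The spanning elements are homogeneous, so taking a component just discards those of
  other weights.\<close>

lemma span_wpart:
  fixes M :: "'i \<Rightarrow> poly4" and e :: "'i \<Rightarrow> nat"
  assumes "f \<in> Sv.span (M ` X)" and M: "\<And>x. x \<in> X \<Longrightarrow> wpart \<omega> (e x) (M x) = M x"
  shows "wpart \<omega> d f \<in> Sv.span (M ` {x \<in> X. e x = d})"
  using assms(1)
proof (induction rule: Sv.span_induct_alt)
  case base
  show ?case by (simp add: Sv.span_zero)
next
  case (step c y z)
  obtain x where x: "x \<in> X" "y = M x" using step by auto
  have "wpart \<omega> d y = wpart \<omega> d (wpart \<omega> (e x) (M x))" by (simp only: x(2) M[OF x(1)])
  also have "\<dots> = (if d = e x then M x else 0)" by (subst wpart_wpart) (simp only: M[OF x(1)])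
  finally have "wpart \<omega> d y = (if d = e x then M x else 0)" .
  then have "wpart \<omega> d y \<in> Sv.span (M ` {x \<in> X. e x = d})"
    using x(1) by (auto intro: Sv.span_base Sv.span_zero)
  then show ?case unfolding wpart_add wpart_Const_mult by (intro Sv.span_add Sv.span_scale step)
qed

text \<open>The weights are the degrees of the forms \<open>sx\<close>, \<open>QX\<close>,
  \<open>RX\<close> for which the three variables stand.\<close>

definition pdeg :: "mon4 \<Rightarrow> nat" where
  "pdeg m = 2 * Poly_Mapping.lookup m 1 + 6 * Poly_Mapping.lookup m 2 + 10 * Poly_Mapping.lookup m 3"

interpretation pdeg: grading pdeg
  by standard (simp add: pdeg_def lookup_add)

lemma wpart_pdeg_Var: "wpart pdeg 2 PP = PP" "wpart pdeg 6 QQ = QQ" "wpart pdeg 10 RR = RR"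
  by (simp_all add: Var_def wpart_single pdeg_def lookup_single)

lemma wpart_pdeg_monomial: "wpart pdeg (i * 2 + j * 6 + l * 10) (PP ^ i * QQ ^ j * RR ^ l) = PP ^ i * QQ ^ j * RR ^ l"
  by (intro pdeg.wpart_pure_mult pdeg.wpart_pure_power wpart_pdeg_Var)

lemma wpart_pdeg_lead:
  assumes "i < 12"
  shows "wpart pdeg (wm i) (lead i) = lead i"
proof -
  let ?p = "\<lambda>k f. wpart pdeg k f = f"
  have mult: "?p k (f * g)" if "?p a f" "?p b g" "a + b = k" for a b k f g
    using pdeg.wpart_pure_mult[OF that(1,2)] that(3) by simp
  have pow: "?p k (f ^ n)" if "?p a f" "n * a = k" for a k f n
    using pdeg.wpart_pure_power[OF that(1), of n] that(2) by simp
  have diff: "?p k (f - g)" if "?p k f" "?p k g" for k f g using that by (simp add: wpart_diff)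
  have num: "?p k (numeral n * f)" if "?p k f" for k n f using that by (simp add: wpart_numeral_mult)
  have P: "?p 2 PP" "?p 4 (PP ^ 2)" "?p 6 (PP ^ 3)" and Q: "?p 6 QQ" "?p 12 (QQ ^ 2)" "?p 18 (QQ ^ 3)" and R: "?p 10 RR"
    by (rule wpart_pdeg_Var pow[OF wpart_pdeg_Var(1)] pow[OF wpart_pdeg_Var(2)]; simp)+
  have "lead 0 = 1" by (simp add: lead_def Let_def)
  then have "?p (wm 0) (lead 0)" by (simp add: wm_simps pdeg.wpart_1)
  moreover have "?p (wm 1) (lead 1)" "?p (wm 2) (lead 2)" "?p (wm 3) (lead 3)" "?p (wm 4) (lead 4)" "?p (wm 6) (lead 6)"
    unfolding lead_simps wm_simps by (rule P Q R)+
  moreover have "?p (wm 5) (lead 5)" unfolding lead_simps wm_simps by (rule mult[OF P(1) Q(1)]) simp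
  moreover have "?p (wm 7) (lead 7)" unfolding lead_simps wm_simps by (rule mult[OF P(2) Q(1)]) simp
  moreover have PR: "?p 12 (PP * RR)" by (rule mult[OF P(1) R]) simp
  moreover have "?p (wm 8) (lead 8)" unfolding lead_simps wm_simps by (rule diff[OF Q(2) PR])
  moreover have "?p 14 (2 * PP ^ 2 * RR)" by (rule mult[OF num[OF P(2)] R]) simp
  moreover have "?p 14 (PP * QQ ^ 2)" by (rule mult[OF P(1) Q(2)]) simp
  moreover have "?p (wm 9) (lead 9)" unfolding lead_simps wm_simps by (rule diff) fact+
  moreover have "?p 16 (3 * PP ^ 2 * QQ ^ 2)" by (rule mult[OF num[OF P(2)] Q(2)]) simp
  moreover have "?p 16 (4 * PP ^ 3 * RR)" by (rule mult[OF num[OF P(3)] R]) simp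
  moreover have "?p (wm 10) (lead 10)" unfolding lead_simps wm_simps by (rule diff) fact+
  moreover have "?p 18 (3 * PP * QQ * RR)" by (rule mult[OF mult[OF num[OF P(1)] Q(1) refl] R]) simp
  moreover have "?p (wm 11) (lead 11)" unfolding lead_simps wm_simps by (rule diff[OF num[OF Q(3)]]) fact
  ultimately show ?thesis using assms unfolding less_12 by blast
qed

definition pmon :: "((unit \<times> nat) \<times> nat) \<times> nat \<Rightarrow> poly4" where
  "pmon = (\<lambda>(((_, i), j), l). PP ^ i * QQ ^ j * RR ^ l)"

definition pexp :: "((unit \<times> nat) \<times> nat) \<times> nat \<Rightarrow> mon4" where
  "pexp = (\<lambda>(((_, i), j), l). Poly_Mapping.single 1 i + Poly_Mapping.single 2 j + Poly_Mapping.single 3 l)"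

lemma pmon_eq: "pmon y = Poly_Mapping.single (pexp y) 1"
  by (cases y) (auto simp: pmon_def pexp_def Var_power mult_single)

lemma inj_pexp: "inj pexp"
proof (rule injI)
  fix x y assume "pexp x = pexp y"
  then have "Poly_Mapping.lookup (pexp x) k = Poly_Mapping.lookup (pexp y) k" for k by simp
  from this[of 1] this[of 2] this[of 3] show "x = y"
    by (cases x; cases y) (auto simp: pexp_def lookup_add lookup_single)
qed

lemma independent_pmon:
  assumes "finite J"
  shows "Sv.independent (pmon ` J)" "inj_on pmon J"
proof -
  have l: "Poly_Mapping.lookup (pmon y) (pexp z) = (if y = z then 1 else 0)" for y z
    using injD[OF inj_pexp, of y z] by (auto simp: pmon_eq lookup_single when_def)
  then show inj: "inj_on pmon J" by (metis inj_onI zero_neq_one)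
  show "Sv.independent (pmon ` J)"
  proof (rule Sv.independent_if_scalars_zero)
    fix f v assume 0: "(\<Sum>x\<in>pmon ` J. Const (f x) * x) = 0" and "v \<in> pmon ` J"
    then obtain z where z: "z \<in> J" "v = pmon z" by blast
    have "0 = Poly_Mapping.lookup (\<Sum>x\<in>pmon ` J. Const (f x) * x) (pexp z)" by (simp only: 0 lookup_zero)
    also have "\<dots> = (\<Sum>y\<in>J. if y = z then f (pmon z) else 0)"
      unfolding sum.reindex[OF inj] lookup_sum o_def lookup_Const_mult by (rule sum.cong) (auto simp: l)
    also have "\<dots> = f v" using z assms by simp
    finally show "f v = 0" by simp
  qed (use assms in simp)
qed

text \<open>In weight n the span of the standard monomials contains as many independent monomials in
  P, Q, R as there are standard indices; a spanning family of this size is injective and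
  independent.\<close>

lemma smon_lead_independent:
  shows "inj_on (smon lead) {x \<in> sidx. sweight wm x = n}"
    "Sv.independent (smon lead ` {x \<in> sidx. sweight wm x = n})"
proof -
  let ?I = "{x \<in> sidx. sweight wm x = n}"
  let ?J = "{y \<in> pidx. pw (2, 0) (6, 0) (10, 0) y = (n, 0)}"
  have finI: "finite ?I" by (rule finite_weight)
  have "finite_fibres pidx (pw (2, 0) (6, 0) (10, 0))" by (rule wgf_pidx) simp_all
  then have finJ: "finite ?J" by (simp add: finite_fibres_def)
  have sub: "pmon ` ?J \<subseteq> Sv.span (smon lead ` ?I)"
  proof
    fix f assume "f \<in> pmon ` ?J"
    then obtain i j l where f: "f = PP ^ i * QQ ^ j * RR ^ l" "i * 2 + j * 6 + l * 10 = n"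
      by (auto simp: pmon_def pw_def shiftw_def)
    have "wpart pdeg n f \<in> Sv.span (smon lead ` ?I)"
    proof (rule span_wpart)
      show "f \<in> Sv.span (smon lead ` sidx)" using monomial_in_svec unfolding f(1) svec_def .
      show "wpart pdeg (sweight wm x) (smon lead x) = smon lead x" if "x \<in> sidx" for x
        using wpart_pdeg_lead that by (rule pdeg.smon_weight)
    qed
    then show "f \<in> Sv.span (smon lead ` ?I)"
      using wpart_pdeg_monomial[of i j l] unfolding f(2) f(1)[symmetric] by simp
  qed
  obtain B where B: "B \<subseteq> smon lead ` ?I" "Sv.independent B" "smon lead ` ?I \<subseteq> Sv.span B"
    using Sv.maximal_independent_subset by blast
  have finB: "finite B" using B(1) finI by (meson finite_imageI finite_subset)
  have "pmon ` ?J \<subseteq> Sv.span B" using sub Sv.span_minimal[OF B(3) Sv.subspace_span] by (rule order_trans)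
  then have "card (pmon ` ?J) \<le> card B"
    using Sv.independent_span_bound[OF finB independent_pmon(1)[OF finJ]] by blast
  moreover have "card (pmon ` ?J) = card ?I"
    using card_image[OF independent_pmon(2)[OF finJ]] card_weight[of n] by simp
  moreover have "card B \<le> card (smon lead ` ?I)" using B(1) finI by (intro card_mono) auto
  moreover have "card (smon lead ` ?I) \<le> card ?I" using finI by (rule card_image_le)
  ultimately have c: "card B = card (smon lead ` ?I)" "card (smon lead ` ?I) = card ?I" by linarith+
  show "inj_on (smon lead) ?I" using finI c(2) by (rule eq_card_imp_inj_on)
  have "B = smon lead ` ?I" using B(1) finI c(1) by (intro card_subset_eq) auto
  then show "Sv.independent (smon lead ` ?I)" using B(2) by simp
qed

lemma smon_lead_relation:
  assumes X: "X \<subseteq> {x \<in> sidx. sweight wm x = n}" and 0: "(\<Sum>x\<in>X. Const (c x) * smon lead x) = 0" and x: "x \<in> X"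
  shows "c x = 0"
proof -
  have inj: "inj_on (smon lead) X" using smon_lead_independent(1) X by (rule inj_on_subset)
  let ?u = "\<lambda>v. c (the_inv_into X (smon lead) v)"
  have "(\<Sum>v\<in>smon lead ` X. Const (?u v) * v) = 0"
    unfolding sum.reindex[OF inj] o_def using 0 by (simp add: the_inv_into_f_f[OF inj])
  then have "?u (smon lead x) = 0"
    using Sv.independentD[OF smon_lead_independent(2)[of n], of "smon lead ` X" ?u "smon lead x"]
      finite_subset[OF X finite_weight] X x by blast
  then show ?thesis by (simp add: the_inv_into_f_f[OF inj x])
qed

section \<open>Leading forms of the generators\<close>

text \<open>
  In these normalizations the leading forms of the generators of bidegrees \<open>(12, 2)\<close>, \<open>(24, 6)\<close>
  and \<open>(36, 10)\<close> are scalar multiples of \<open>sx\<close>, \<open>QX\<close> and \<open>RX\<close> times powers of \<open>w\<close>, and those of all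
  other generators are polynomials in them with rational coefficients.
\<close>

definition QX :: poly4 where "QX = Const (- 3 / 2) * (sx ^ 3 + 5 * px)"
definition RX :: poly4 where "RX = Const (27 / 20) * (sx ^ 5 + 25 * (sx ^ 2 * px) - 25 * tx)"

lemma QX_RX_scaled: "2 * QX = - 3 * (sx ^ 3 + 5 * px)" "20 * RX = 27 * (sx ^ 5 + 25 * (sx ^ 2 * px) - 25 * tx)"
proof -
  have "Const 2 * Const (- 3 / 2) = Const (- 3)" "Const 20 * Const (27 / 20) = Const 27"
    unfolding Const_mult[symmetric] by simp_all
  then have "2 * Const (- 3 / 2) = - 3" "20 * Const (27 / 20) = 27"
    by (simp_all only: Const_numeral Const_uminus)
  then show "2 * QX = - 3 * (sx ^ 3 + 5 * px)" "20 * RX = 27 * (sx ^ 5 + 25 * (sx ^ 2 * px) - 25 * tx)"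
    by (simp_all only: QX_def RX_def mult.assoc[symmetric])
qed

text \<open>For nonzero g, a is the order of f at the base point; the power of w is kept apart from
  g so that the initial forms can be compared as forms in x, y, z.\<close>

definition lf :: "nat \<Rightarrow> nat \<Rightarrow> poly4 \<Rightarrow> poly4 \<Rightarrow> bool" where
  "lf a k g f \<longleftrightarrow> vanishes xdeg a f \<and> wpart xdeg a f = g * Var 4 ^ k"

lemma lf_mult: "lf a k g f \<Longrightarrow> lf b l h f' \<Longrightarrow> lf (a + b) (k + l) (g * h) (f * f')"
proof -
  assume *: "lf a k g f" "lf b l h f'"
  then have "wpart xdeg (a + b) (f * f') = (g * Var 4 ^ k) * (h * Var 4 ^ l)"
    by (simp only: lf_def xdeg.wpart_mult_lowest)
  also have "\<dots> = g * h * Var 4 ^ (k + l)" by (simp only: power_add mult_ac)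
  finally show ?thesis using * by (simp add: lf_def xdeg.vanishes_mult)
qed

lemma lf_numeral: "lf a k g f \<Longrightarrow> lf a k (numeral n * g) (numeral n * f)"
  unfolding lf_def vanishes_def by (auto simp only: wpart_numeral_mult mult_zero_right mult.assoc)

lemma lf_diff: "lf a k g f \<Longrightarrow> lf a k h f' \<Longrightarrow> lf a k (g - h) (f - f')"
  unfolding lf_def by (simp add: vanishes_diff wpart_diff left_diff_distrib)

lemma lf_uminus: "lf a k g f \<Longrightarrow> lf a k (- g) (- f)"
  unfolding lf_def vanishes_def by (simp add: wpart_uminus)

lemma lf_higher:
  assumes "lf a k g f" "lf b l h f'" "a < b"
  shows "lf a k g (f + f')" "lf a k g (f - f')"
proof -
  have "vanishes xdeg a f'" "wpart xdeg a f' = 0"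
    using assms(2,3) vanishes_le[of xdeg b f' a] by (auto simp: lf_def vanishes_def)
  then show "lf a k g (f + f')" "lf a k g (f - f')"
    using assms(1) by (simp_all add: lf_def vanishes_add vanishes_diff wpart_add wpart_diff)
qed

lemma lf_cong: "lf a k g f \<Longrightarrow> a = a' \<Longrightarrow> k = k' \<Longrightarrow> g = g' \<Longrightarrow> f = f' \<Longrightarrow> lf a' k' g' f'"
  by simp

lemma Var_nonzero: "Var i \<noteq> 0"
proof
  assume "Var i = 0"
  then have "partial i (Var i) = partial i 0" by (rule arg_cong)
  then show False by (simp add: partial_Var)
qed

lemma lf_cancel_numeral: "lf a k (numeral n * g) (numeral n * f) \<Longrightarrow> lf a k g f"
proof -
  have z: "numeral n \<noteq> (0 :: poly4)" by simp
  show "lf a k (numeral n * g) (numeral n * f) \<Longrightarrow> lf a k g f"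
    unfolding lf_def vanishes_def
    by (auto simp only: wpart_numeral_mult mult.assoc mult_eq_0_iff mult_cancel_left z simp_thms)
qed

lemma lf_f2: "lf 0 2 1 f2"
  using co_f2(1) by (simp add: lf_def co_def)

text \<open>The initial form of \<open>f2\<close> is w^2, of order 0, so division by
  \<open>f2\<close> lowers only the exponent of w.\<close>

lemma lf_cancel_f2:
  assumes "lf a (k + 2) g (f2 * f)"
  shows "lf a k g f"
proof -
  have 0: "wpart xdeg 0 f2 = Var 4 ^ 2" using lf_f2 by (simp add: lf_def)
  have v: "wpart xdeg j f = 0" if "j < a" for j
    using that
  proof (induction j rule: less_induct)
    case (less j)
    then have "vanishes xdeg j f" by (simp add: vanishes_def)
    then have "wpart xdeg (0 + j) (f2 * f) = Var 4 ^ 2 * wpart xdeg j f"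
      using xdeg.wpart_mult_lowest[of 0 f2 j f] by (simp add: 0)
    moreover have "wpart xdeg (0 + j) (f2 * f) = 0" using assms less.prems by (simp add: lf_def vanishes_def)
    ultimately show ?case by (simp add: Var_nonzero)
  qed
  then have va: "vanishes xdeg a f" by (simp add: vanishes_def)
  then have "wpart xdeg (0 + a) (f2 * f) = Var 4 ^ 2 * wpart xdeg a f"
    using xdeg.wpart_mult_lowest[of 0 f2 a f] by (simp add: 0)
  moreover have "wpart xdeg a (f2 * f) = g * (Var 4 ^ k * Var 4 ^ 2)"
    using assms by (simp only: lf_def power_add)
  ultimately have "Var 4 ^ 2 * wpart xdeg a f = g * (Var 4 ^ k * Var 4 ^ 2)" by (simp only: add_0_left)
  also have "\<dots> = Var 4 ^ 2 * (g * Var 4 ^ k)" by (simp only: mult_ac)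
  finally have "wpart xdeg a f = g * Var 4 ^ k"
    by (simp only: mult_cancel_left power_eq_0_iff Var_nonzero simp_thms)
  then show ?thesis using va by (simp add: lf_def)
qed

lemma lf_even:
  assumes "evenx f" "\<And>n. n < a \<Longrightarrow> co n f = 0" "co a f = g * dd ^ k" "b = 2 * a" "l = 2 * k"
  shows "lf b l g f"
proof -
  have "vanishes xdeg (2 * a) f"
    unfolding vanishes_def
  proof (intro allI impI)
    fix j assume j: "j < 2 * a"
    show "wpart xdeg j f = 0"
    proof (cases "even j")
      case True
      then obtain n where n: "j = 2 * n" by (elim evenE)
      then have "co n f = 0" using j assms(2) by simp
      then show ?thesis by (simp add: co_def n)
    qed (use assms(1) in \<open>simp add: evenx_def\<close>)
  qed
  then show ?thesis using assms(3-5) by (simp add: lf_def co_def power_mult)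
qed

lemma lf_f12: "lf 2 10 sx f12"
proof (rule lf_even[OF evenx_f12])
  show "co n f12 = 0" if "n < 1" for n using that by (simp add: co_f12)
  show "co 1 f12 = sx * dd ^ 5" by (simp only: co_f12 mult_1_left)
qed simp_all

lemma lf_f20: "lf 4 16 (sx ^ 2) f20"
proof (rule lf_even[OF evenx_f20])
  show "co n f20 = 0" if "n < 2" for n
  proof -
    have "n \<in> {0, 1}" using that by auto
    then show ?thesis by (elim insertE emptyE) (simp_all only: co_f20)
  qed
  show "co 2 f20 = sx ^ 2 * dd ^ 8" by (simp only: co_f20 mult_1_left)
qed simp_all

lemma lf_f30: "lf 6 24 (sx ^ 3) f30"
proof (rule lf_cancel_numeral[of _ _ "num.Bit0 (num.Bit1 (num.Bit0 num.One))"], rule lf_even)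
  show "evenx (10 * f30)" by (intro evenx_linear evenx_f30)
  show "co n (10 * f30) = 0" if "n < 3" for n
  proof -
    have "n \<in> {0, 1, 2}" using that by auto
    then show ?thesis by (elim insertE emptyE) (simp_all only: co_10f30)
  qed
  show "co 3 (10 * f30) = 10 * sx ^ 3 * dd ^ 12" by (simp only: co_10f30)
qed simp_all

text \<open>\<open>g24\<close> and \<open>g36\<close> are the generators 3 and 6, bracketed like the
  products expanded above. The coefficients 1, -1 cancel the common initial form sx^2 w^20, and 1,
  -3, 2 cancel everything of orders 6 and 8.\<close>

definition g24 :: poly4 where "g24 = f12 * f12 - (f2 * f2) * f20"
definition g36 :: poly4 where "g36 = f12 * (f12 * f12) - 3 * ((f2 * f2) * (f12 * f20)) + 2 * ((f2 * (f2 * f2)) * f30)"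

lemma lf_g24: "lf 6 18 (2 * QX) g24"
  unfolding g24_def
proof (rule lf_even)
  show "evenx (f12 * f12 - (f2 * f2) * f20)" by (intro evenx_linear evenx_mult evenx_f2 evenx_f12 evenx_f20)
  show "co n (f12 * f12 - (f2 * f2) * f20) = 0" if "n < 3" for n
  proof -
    have "n \<in> {0, 1, 2}" using that by auto
    then show ?thesis by (elim insertE emptyE) (simp_all only: co_linear co_sq co_f2_2_f20 diff_self)
  qed
  show "co 3 (f12 * f12 - (f2 * f2) * f20) = 2 * QX * dd ^ 9"
    unfolding co_linear co_sq co_f2_2_f20 QX_RX_scaled by Groebner_Basis.algebra
qed simp_all

lemma lf_g36: "lf 10 26 (4 * RX) g36"
proof (rule lf_cancel_numeral[of _ _ "num.Bit0 (num.Bit1 (num.Bit0 num.One))"])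
  have e: "10 * g36 = 10 * (f12 * (f12 * f12)) - 30 * ((f2 * f2) * (f12 * f20)) + 2 * ((f2 * (f2 * f2)) * (10 * f30))"
    unfolding g36_def by Groebner_Basis.algebra
  have s: "10 * (4 * RX) = 2 * (20 * RX)" by Groebner_Basis.algebra
  show "lf 10 26 (10 * (4 * RX)) (10 * g36)"
    unfolding e s
  proof (rule lf_even)
    let ?f = "10 * (f12 * (f12 * f12)) - 30 * ((f2 * f2) * (f12 * f20)) + 2 * ((f2 * (f2 * f2)) * (10 * f30))"
    show "evenx ?f" by (intro evenx_linear evenx_mult evenx_f2 evenx_f12 evenx_f20 evenx_f30)
    show "co n ?f = 0" if "n < 5" for n
    proof -
      have "n \<in> {0, 1, 2, 3, 4}" using that by auto
      moreover have "co 0 ?f = 0" "co 1 ?f = 0" "co 2 ?f = 0" "co 3 ?f = 0" "co 4 ?f = 0"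
        unfolding co_linear co_cube co_f2_2_pr co_f2_3_f30 by Groebner_Basis.algebra+
      ultimately show ?thesis by blast
    qed
    show "co 5 ?f = 2 * (20 * RX) * dd ^ 13"
      unfolding co_linear co_cube co_f2_2_pr co_f2_3_f30 QX_RX_scaled by Groebner_Basis.algebra
  qed simp_all
qed

lemma lf_cancel_f2_power: "lf a (k + 2 * n) g (f2 ^ n * f) \<Longrightarrow> lf a k g f"
proof (induction n arbitrary: k f)
  case (Suc n)
  have "lf a ((k + 2) + 2 * n) g (f2 ^ n * (f2 * f))"
    using Suc.prems by (rule lf_cong) (simp, simp, simp, simp only: power_Suc mult_ac)
  then have "lf a (k + 2) g (f2 * f)" by (rule Suc.IH)
  then show ?case by (rule lf_cancel_f2)
qed simp

lemma lf_sub: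
  assumes "lf a l h F" "F = numeral n * (f2 ^ e * f)" "h = numeral n * g" "l = k + 2 * e"
  shows "lf a k g f"
proof -
  have "lf a l (numeral n * g) (numeral n * (f2 ^ e * f))" using assms(1) by (simp only: assms(2,3))
  then have "lf a (k + 2 * e) g (f2 ^ e * f)" unfolding assms(4) by (rule lf_cancel_numeral)
  then show ?thesis by (rule lf_cancel_f2_power)
qed

text \<open>
  Up to powers of \<open>f2\<close>, each of the remaining generators is a polynomial in \<open>f12\<close>, \<open>g24\<close>, \<open>g36\<close>
  whose leading form does not cancel.
\<close>

lemma lf_products:
  "lf 8 28 (sx * (2 * QX)) (f12 * g24)" "lf 12 36 (sx * (4 * RX)) (f12 * g36)" "lf 12 36 (2 * QX * (2 * QX)) (g24 * g24)"
  "lf 16 44 (2 * QX * (4 * RX)) (g24 * g36)" "lf 20 52 (4 * RX * (4 * RX)) (g36 * g36)"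
  using lf_mult[OF lf_f12 lf_g24] lf_mult[OF lf_f12 lf_g36] lf_mult[OF lf_g24 lf_g24] lf_mult[OF lf_g24 lf_g36]
    lf_mult[OF lf_g36 lf_g36] by (simp_all only: arith_simps)

lemma lf_products':
  "lf 10 38 (sx * (sx * (2 * QX))) (f12 * (f12 * g24))" "lf 14 46 (sx * (2 * QX) * (2 * QX)) (f12 * g24 * g24)"
  "lf 14 46 (sx * (sx * (4 * RX))) (f12 * (f12 * g36))" "lf 16 56 (sx * (2 * QX) * (sx * (2 * QX))) (f12 * g24 * (f12 * g24))"
  "lf 18 54 (2 * QX * (2 * QX * (2 * QX))) (g24 * (g24 * g24))" "lf 18 54 (sx * (2 * QX) * (4 * RX)) (f12 * g24 * g36)"
  using lf_mult[OF lf_f12 lf_products(1)] lf_mult[OF lf_products(1) lf_g24] lf_mult[OF lf_f12 lf_products(2)]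
    lf_mult[OF lf_products(1) lf_products(1)] lf_mult[OF lf_g24 lf_products(3)] lf_mult[OF lf_products(1) lf_g36]
  by (simp_all only: arith_simps)

lemma lf_AAAr: "lf 16 56 (sx * (sx * (sx * (4 * RX)))) (f12 * (f12 * (f12 * g36)))"
  using lf_mult[OF lf_f12 lf_products'(3)] by (simp only: arith_simps)

text \<open>The polynomial in \<open>f12\<close>, \<open>g24\<close>, \<open>g36\<close> results
  from \<open>f2 ^ 2 * f20 = f12 ^ 2 - g24\<close> and
  \<open>2 * f2 ^ 3 * f30 = g36 + 2 * f12 ^ 3 - 3 * f12 * g24\<close>; e is the power of
  \<open>f2\<close> that clears denominators, and n a numerical factor. Here the product of
  \<open>f12\<close> and \<open>g24\<close> has order 8 and \<open>g36\<close> has order 10, so the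
  product decides. The remaining generators are treated alike.\<close>

lemma lf_gen5: "lf 8 24 (1 * (sx * QX)) (f12 * f20 - f2 * f30)"
proof (rule lf_sub[where n = "num.Bit0 num.One" and e = 2])
  show "lf 8 28 (sx * (2 * QX)) (f12 * g24 - g36)"
    by (intro lf_higher(2)[OF lf_products(1) lf_g36]) simp
  show "f12 * g24 - g36 = numeral (num.Bit0 num.One) * (f2 ^ 2 * (f12 * f20 - f2 * f30))"
    unfolding g24_def g36_def by Groebner_Basis.algebra
  show "sx * (2 * QX) = numeral (num.Bit0 num.One) * (1 * (sx * QX))"
    by Groebner_Basis.algebra
qed simp

lemma lf_gen7: "lf 10 32 (- 1 * (sx ^ 2 * QX)) (f2 * f20 ^ 2 - f12 * f30)"
proof (rule lf_sub[where n = "num.Bit0 num.One" and e = 3])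
  show "lf 10 38 (- (sx * (sx * (2 * QX)))) (- (f12 * (f12 * g24)) + 2 * (g24 * g24) - f12 * g36)"
    by (intro lf_higher(2)[OF lf_higher(1)[OF lf_uminus[OF lf_products'(1)] lf_numeral[OF lf_products(3)]] lf_products(2)]) simp_all
  show "- (f12 * (f12 * g24)) + 2 * (g24 * g24) - f12 * g36 = numeral (num.Bit0 num.One) * (f2 ^ 3 * (f2 * f20 ^ 2 - f12 * f30))"
    unfolding g24_def g36_def by Groebner_Basis.algebra
  show "- (sx * (sx * (2 * QX))) = numeral (num.Bit0 num.One) * (- 1 * (sx ^ 2 * QX))"
    by Groebner_Basis.algebra
qed simp

lemma lf_gen8: "lf 12 32 (4 * ((QX ^ 2 - sx * RX))) (f12 ^ 2 * f20 + f2 ^ 2 * f20 ^ 2 - 2 * f2 * f12 * f30)"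
proof (rule lf_sub[where n = "num.One" and e = 2])
  show "lf 12 36 (2 * QX * (2 * QX) - sx * (4 * RX)) (g24 * g24 - f12 * g36)"
    by (rule lf_diff[OF lf_products(3) lf_products(2)])
  show "g24 * g24 - f12 * g36 = numeral (num.One) * (f2 ^ 2 * (f12 ^ 2 * f20 + f2 ^ 2 * f20 ^ 2 - 2 * f2 * f12 * f30))"
    unfolding g24_def g36_def by Groebner_Basis.algebra
  show "2 * QX * (2 * QX) - sx * (4 * RX) = numeral (num.One) * (4 * ((QX ^ 2 - sx * RX)))"
    by Groebner_Basis.algebra
qed simp

lemma lf_gen9: "lf 14 40 (2 * ((sx * QX ^ 2 - 2 * sx ^ 2 * RX))) (2 * f2 * f12 * f20 ^ 2 - f12 ^ 2 * f30 - f2 ^ 2 * f20 * f30)"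
proof (rule lf_sub[where n = "num.Bit0 num.One" and e = 3])
  show "lf 14 46 (sx * (2 * QX) * (2 * QX) - 2 * (sx * (sx * (4 * RX)))) (f12 * g24 * g24 - 2 * (f12 * (f12 * g36)) + g24 * g36)"
    by (intro lf_higher(1)[OF lf_diff[OF lf_products'(2) lf_numeral[OF lf_products'(3)]] lf_products(4)]) simp
  show "f12 * g24 * g24 - 2 * (f12 * (f12 * g36)) + g24 * g36 = numeral (num.Bit0 num.One) * (f2 ^ 3 * (2 * f2 * f12 * f20 ^ 2 - f12 ^ 2 * f30 - f2 ^ 2 * f20 * f30))"
    unfolding g24_def g36_def by Groebner_Basis.algebra
  show "sx * (2 * QX) * (2 * QX) - 2 * (sx * (sx * (4 * RX))) = numeral (num.Bit0 num.One) * (2 * ((sx * QX ^ 2 - 2 * sx ^ 2 * RX)))"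
    by Groebner_Basis.algebra
qed simp

lemma lf_gen10: "lf 16 44 (1 * ((3 * sx ^ 2 * QX ^ 2 - 4 * sx ^ 3 * RX))) (f20 ^ 3 - f30 ^ 2)"
proof (rule lf_sub[where n = "num.Bit0 (num.Bit0 num.One)" and e = 6])
  show "lf 16 56 (3 * (sx * (2 * QX) * (sx * (2 * QX))) - 4 * (sx * (sx * (sx * (4 * RX))))) (3 * (f12 * g24 * (f12 * g24)) - 4 * (f12 * (f12 * (f12 * g36))) - 4 * (g24 * (g24 * g24)) + 6 * (f12 * g24 * g36) - g36 * g36)"
    by (intro lf_higher(2)[OF lf_higher(1)[OF lf_higher(2)[OF lf_diff[OF lf_numeral[OF lf_products'(4)] lf_numeral[OF lf_AAAr]] lf_numeral[OF lf_products'(5)]] lf_numeral[OF lf_products'(6)]] lf_products(5)]) simp_all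
  show "3 * (f12 * g24 * (f12 * g24)) - 4 * (f12 * (f12 * (f12 * g36))) - 4 * (g24 * (g24 * g24)) + 6 * (f12 * g24 * g36) - g36 * g36 = numeral (num.Bit0 (num.Bit0 num.One)) * (f2 ^ 6 * (f20 ^ 3 - f30 ^ 2))"
    unfolding g24_def g36_def by Groebner_Basis.algebra
  show "3 * (sx * (2 * QX) * (sx * (2 * QX))) - 4 * (sx * (sx * (sx * (4 * RX)))) = numeral (num.Bit0 (num.Bit0 num.One)) * (1 * ((3 * sx ^ 2 * QX ^ 2 - 4 * sx ^ 3 * RX)))"
    by Groebner_Basis.algebra
qed simp

lemma lf_gen11: "lf 18 48 (4 * ((2 * QX ^ 3 - 3 * sx * QX * RX))) (3 * f2 * f12 ^ 2 * f20 ^ 2 - f2 ^ 3 * f20 ^ 3 - f12 ^ 3 * f30 - 3 * f2 ^ 2 * f12 * f20 * f30 + 2 * f2 ^ 3 * f30 ^ 2)"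
proof (rule lf_sub[where n = "num.Bit0 num.One" and e = 3])
  show "lf 18 54 (2 * (2 * QX * (2 * QX * (2 * QX))) - 3 * (sx * (2 * QX) * (4 * RX))) (2 * (g24 * (g24 * g24)) - 3 * (f12 * g24 * g36) + g36 * g36)"
    by (intro lf_higher(1)[OF lf_diff[OF lf_numeral[OF lf_products'(5)] lf_numeral[OF lf_products'(6)]] lf_products(5)]) simp
  show "2 * (g24 * (g24 * g24)) - 3 * (f12 * g24 * g36) + g36 * g36 = numeral (num.Bit0 num.One) * (f2 ^ 3 * (3 * f2 * f12 ^ 2 * f20 ^ 2 - f2 ^ 3 * f20 ^ 3 - f12 ^ 3 * f30 - 3 * f2 ^ 2 * f12 * f20 * f30 + 2 * f2 ^ 3 * f30 ^ 2))"
    unfolding g24_def g36_def by Groebner_Basis.algebra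
  show "2 * (2 * QX * (2 * QX * (2 * QX))) - 3 * (sx * (2 * QX) * (4 * RX)) = numeral (num.Bit0 num.One) * (4 * ((2 * QX ^ 3 - 3 * sx * QX * RX)))"
    by Groebner_Basis.algebra
qed simp

lemma lf_gen0: "lf 0 2 (1 * 1) f2" and lf_gen1: "lf 2 10 (1 * sx) f12" and lf_gen2: "lf 4 16 (1 * sx ^ 2) f20"
  and lf_gen4: "lf 6 24 (1 * sx ^ 3) f30"
  unfolding mult_1_left by (rule lf_f2 lf_f12 lf_f20 lf_f30)+

lemma lf_gen3: "lf 6 18 (2 * QX) (f12 ^ 2 - f2 ^ 2 * f20)"
  by (rule lf_cong[OF lf_g24]) (unfold g24_def, simp_all only: power2_eq_square)

lemma lf_gen6: "lf 10 26 (4 * RX) (f12 ^ 3 - 3 * f2 ^ 2 * f12 * f20 + 2 * f2 ^ 3 * f30)"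
  by (rule lf_cong[OF lf_g36 refl refl refl]) (unfold g36_def, Groebner_Basis.algebra)

text \<open>Turns the formal P, Q, R of \<open>lead\<close> into the actual forms in x, y, z and
  leaves w alone.\<close>

definition lead_sub :: "4 \<Rightarrow> poly4" where
  "lead_sub i = (if i = 1 then sx else if i = 2 then QX else if i = 3 then RX else Var 4)"

lemma lead_sub_simps: "lead_sub 1 = sx" "lead_sub 2 = QX" "lead_sub 3 = RX" "lead_sub 4 = Var 4"
  by (simp_all add: lead_sub_def)

definition lead_scal :: "nat \<Rightarrow> complex" where
  "lead_scal i = [1, 1, 1, 2, 1, 1, 4, - 1, 4, 2, 1, 4] ! i"

lemma lf_gens:
  assumes "i < 12"
  shows "lf (wm i) (wd i - wm i) (Const (lead_scal i) * subst lead_sub (lead i)) (gens i)" "lead_scal i \<noteq> 0"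
proof -
  have l0: "lead 0 = 1" by (simp add: lead_def Let_def)
  note s = l0 lead_simps subst_1 subst_mult subst_diff subst_power subst_Var subst_numeral lead_sub_simps
  have c: "Const (lead_scal 0) = 1" "Const (lead_scal 1) = 1" "Const (lead_scal 2) = 1" "Const (lead_scal 3) = 2"
    "Const (lead_scal 4) = 1" "Const (lead_scal 5) = 1" "Const (lead_scal 6) = 4" "Const (lead_scal 7) = - 1"
    "Const (lead_scal 8) = 4" "Const (lead_scal 9) = 2" "Const (lead_scal 10) = 1" "Const (lead_scal 11) = 4"
    by (simp_all add: lead_scal_def Const_uminus)
  have k: "wd 0 - wm 0 = 2" "wd 1 - wm 1 = 10" "wd 2 - wm 2 = 16" "wd 3 - wm 3 = 18" "wd 4 - wm 4 = 24" "wd 5 - wm 5 = 24"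
    "wd 6 - wm 6 = 26" "wd 7 - wm 7 = 32" "wd 8 - wm 8 = 32" "wd 9 - wm 9 = 40" "wd 10 - wm 10 = 44" "wd 11 - wm 11 = 48"
    by (simp_all add: wd_simps wm_simps)
  have g: "gens 0 = f2" "gens 1 = f12" "gens 2 = f20" "gens 3 = f12 ^ 2 - f2 ^ 2 * f20" "gens 4 = f30" "gens 5 = f12 * f20 - f2 * f30" "gens 6 = f12 ^ 3 - 3 * f2 ^ 2 * f12 * f20 + 2 * f2 ^ 3 * f30" "gens 7 = f2 * f20 ^ 2 - f12 * f30" "gens 8 = f12 ^ 2 * f20 + f2 ^ 2 * f20 ^ 2 - 2 * f2 * f12 * f30" "gens 9 = 2 * f2 * f12 * f20 ^ 2 - f12 ^ 2 * f30 - f2 ^ 2 * f20 * f30" "gens 10 = f20 ^ 3 - f30 ^ 2" "gens 11 = 3 * f2 * f12 ^ 2 * f20 ^ 2 - f2 ^ 3 * f20 ^ 3 - f12 ^ 3 * f30 - 3 * f2 ^ 2 * f12 * f20 * f30 + 2 * f2 ^ 3 * f30 ^ 2"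
    by (simp_all add: gens_def R_gens_def)
  let ?P = "\<lambda>i. lf (wm i) (wd i - wm i) (Const (lead_scal i) * subst lead_sub (lead i)) (gens i)"
  have p0: "?P 0" unfolding s c k g unfolding wm_simps by (rule lf_gen0)
  have p1: "?P 1" unfolding s c k g unfolding wm_simps by (rule lf_gen1)
  have p2: "?P 2" unfolding s c k g unfolding wm_simps by (rule lf_gen2)
  have p3: "?P 3" unfolding s c k g unfolding wm_simps by (rule lf_gen3)
  have p4: "?P 4" unfolding s c k g unfolding wm_simps by (rule lf_gen4)
  have p5: "?P 5" unfolding s c k g unfolding wm_simps by (rule lf_gen5)
  have p6: "?P 6" unfolding s c k g unfolding wm_simps by (rule lf_gen6)
  have p7: "?P 7" unfolding s c k g unfolding wm_simps by (rule lf_gen7)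
  have p8: "?P 8" unfolding s c k g unfolding wm_simps by (rule lf_gen8)
  have p9: "?P 9" unfolding s c k g unfolding wm_simps by (rule lf_gen9)
  have p10: "?P 10" unfolding s c k g unfolding wm_simps by (rule lf_gen10)
  have p11: "?P 11" unfolding s c k g unfolding wm_simps by (rule lf_gen11)
  show "?P i" using assms unfolding less_12
    by (elim insertE emptyE) (simp_all only: p0 p1 p2 p3 p4 p5 p6 p7 p8 p9 p10 p11)
  show "lead_scal i \<noteq> 0" using assms unfolding less_12
    by (elim insertE emptyE) (simp_all add: lead_scal_def)
qed

section \<open>The Jacobian determinants\<close>

definition low :: "nat \<Rightarrow> poly4 \<Rightarrow> poly4 \<Rightarrow> bool" where
  "low k f g \<longleftrightarrow> vanishes xdeg k f \<and> wpart xdeg k f = g"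

lemma low_mult: "low k f F \<Longrightarrow> low l g G \<Longrightarrow> low (k + l) (f * g) (F * G)"
  and low_add: "low k f F \<Longrightarrow> low k g G' \<Longrightarrow> low k (f + g) (F + G')"
  and low_diff: "low k f F \<Longrightarrow> low k g G' \<Longrightarrow> low k (f - g) (F - G')"
  unfolding low_def by (auto simp: xdeg.vanishes_mult xdeg.wpart_mult_lowest vanishes_add vanishes_diff wpart_add wpart_diff)

lemma low_det3:
  assumes "low p a1 A1" "low p a2 A2" "low p a3 A3" "low q b1 B1" "low q b2 B2" "low q b3 B3"
    "low r c1 C1" "low r c2 C2" "low r c3 C3"
  shows "low (p + (q + r)) (det3 a1 a2 a3 b1 b2 b3 c1 c2 c3) (det3 A1 A2 A3 B1 B2 B3 C1 C2 C3)"
  unfolding det3_def by (intro low_add low_diff low_mult assms)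

lemma vanishes_det3:
  assumes "vanishes xdeg p a1" "vanishes xdeg p a2" "vanishes xdeg p a3" "vanishes xdeg q b1" "vanishes xdeg q b2" "vanishes xdeg q b3"
    "vanishes xdeg r c1" "vanishes xdeg r c2" "vanishes xdeg r c3"
  shows "vanishes xdeg (p + (q + r)) (det3 a1 a2 a3 b1 b2 b3 c1 c2 c3)"
  unfolding det3_def by (intro vanishes_add vanishes_diff xdeg.vanishes_mult assms)

lemma low_grad:
  assumes "lf (Suc k) l F f"
  shows "i \<noteq> 4 \<Longrightarrow> low k (grad f i) (partial i F * Var 4 ^ l)" "vanishes xdeg k (grad f i)"
proof -
  have p: "wpart xdeg j (partial i f) = 0" if "j < k" for j
    using assms that by (auto simp: wpart_xdeg_partial lf_def vanishes_def)
  then show "vanishes xdeg k (grad f i)" by (simp add: vanishes_def grad_def)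
  assume i: "i \<noteq> 4"
  then have "partial i (Var 4 ^ l) = 0" by (simp add: partial_power partial_Var)
  then have "wpart xdeg k (partial i f) = partial i F * Var 4 ^ l"
    using assms i by (simp add: wpart_xdeg_partial lf_def partial_mult)
  then show "low k (grad f i) (partial i F * Var 4 ^ l)"
    using p by (simp add: low_def vanishes_def grad_def)
qed

abbreviation jac3 :: "poly4 \<Rightarrow> poly4 \<Rightarrow> poly4 \<Rightarrow> poly4" where
  "jac3 F G H \<equiv> det3 (partial 1 F) (partial 2 F) (partial 3 F) (partial 1 G) (partial 2 G) (partial 3 G)
     (partial 1 H) (partial 2 H) (partial 3 H)"

text \<open>After removal of the factor 8xyz the determinant is a polynomial in the squares of the
  variables; at (1, 0, 0) it takes the value 1 - 2\<phi> = - sqrt 5.\<close>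

lemma jac3_invariants: "jac3 sx px tx \<noteq> 0"
proof -
  let ?P = "\<lambda>A B C. inv6' gold A B C" and ?T = "\<lambda>A B C. inv10' gold A B C"
  let ?D = "det3 1 1 1 (?P xx yx zx) (?P yx zx xx) (?P zx xx yx) (?T xx yx zx) (?T yx zx xx) (?T zx xx yx)"
  have c: "det3 (2 * x) (2 * y) (2 * z) (p1 * (2 * x)) (p2 * (2 * y)) (p3 * (2 * z)) (t1 * (2 * x)) (t2 * (2 * y)) (t3 * (2 * z)) =
      8 * x * y * z * det3 1 1 1 p1 p2 p3 t1 t2 t3" for x y z p1 p2 p3 t1 t2 t3 :: poly4
    unfolding det3_def by Groebner_Basis.algebra
  have e: "jac3 sx px tx = 8 * Var 1 * Var 2 * Var 3 * ?D"
    unfolding partial_sx partial_px partial_tx by (rule c)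
  let ?s = "subst (\<lambda>i. if i = 1 then 1 else 0)"
  have v: "?s (Var 1) = 1" "?s (Var 2) = 0" "?s (Var 3) = 0" "?s gold = gold"
    by (simp_all only: subst_Var four_neq if_True if_False refl gold_def subst_Const)
  have "?s ?D = 1 - 2 * gold"
    unfolding det3_def inv6'_def inv10'_def subst_hom subst_1 subst_numeral v by (simp; (Groebner_Basis.algebra)?)
  moreover have "1 - 2 * gold \<noteq> 0"
  proof
    assume "1 - 2 * gold = 0"
    then have "(5 :: poly4) = 0" using gold_square by Groebner_Basis.algebra
    then show False by simp
  qed
  ultimately have "?D \<noteq> 0" by (metis subst_0)
  then show ?thesis unfolding e by (simp add: Var_nonzero)
qed

lemma partial_QX: "partial i QX = Const (- 3 / 2) * (3 * sx ^ 2 * partial i sx + 5 * partial i px)"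
  unfolding QX_def partial_Const_mult partial_add[of i "sx ^ 3"] partial_mult[of i 5] partial_power[of i sx] by simp

lemma partial_RX: "partial i RX = Const (27 / 20) * ((5 * sx ^ 4 + 50 * sx * px) * partial i sx + 25 * sx ^ 2 * partial i px - 25 * partial i tx)"
proof -
    have n: "of_nat 5 = (5 :: poly4)" "of_nat 2 = (2 :: poly4)" "(5 :: nat) - 1 = 4" "(2 :: nat) - 1 = 1" by simp_all
    show ?thesis
      unfolding RX_def partial_Const_mult partial_diff partial_add[of i "sx ^ 5"] partial_mult[of i 25]
        partial_mult[of i "sx ^ 2"] partial_power[of i sx] n partial_numeral by Groebner_Basis.algebra
qed

text \<open>\<open>QX\<close> and \<open>RX\<close> arise from \<open>px\<close> and
  \<open>tx\<close> by a triangular change of generators with constant nonzero diagonal, which only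
  rescales the Jacobian determinant.\<close>

lemma jac3_lead: "jac3 sx QX RX \<noteq> 0"
proof -
  have c: "det3 s1 s2 s3 (c * (x * s1 + 5 * p1)) (c * (x * s2 + 5 * p2)) (c * (x * s3 + 5 * p3))
      (e * (y * s1 + z * p1 - 25 * t1)) (e * (y * s2 + z * p2 - 25 * t2)) (e * (y * s3 + z * p3 - 25 * t3)) =
      - (c * e * 125) * det3 s1 s2 s3 p1 p2 p3 t1 t2 t3" for s1 s2 s3 p1 p2 p3 t1 t2 t3 c e x y z :: poly4
    unfolding det3_def by Groebner_Basis.algebra
  have "jac3 sx QX RX = - (Const (- 3 / 2) * Const (27 / 20) * 125) * jac3 sx px tx"
    unfolding partial_QX partial_RX by (rule c)
  then show ?thesis using jac3_invariants by simp
qed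

text \<open>The initial forms of \<open>f12\<close>, \<open>f20\<close>, \<open>f30\<close> are
  dependent and hide the lowest part of the determinant. Row operations replace \<open>f20\<close>
  and \<open>f30\<close> by \<open>g24\<close> and \<open>g36\<close>; then the part of order 15 = 1
  + 5 + 9 is \<open>jac3 sx QX RX\<close> up to a scalar and a power of w.\<close>

lemma jacobian_nonzero: "det4 (grad f2) (grad f12) (grad f20) (grad f30) \<noteq> 0"
proof
  assume 0: "det4 (grad f2) (grad f12) (grad f20) (grad f30) = 0"
  have q: "grad g24 = (\<lambda>i. - (2 * f2 * f20) * grad f2 i + 2 * f12 * grad f12 i + - (f2 * f2) * grad f20 i)"
    unfolding grad_def g24_def by (intro ext) (simp only: partial_diff partial_mult, Groebner_Basis.algebra)
  have r: "grad g36 = (\<lambda>i. (6 * f2 * f2 * f30 - 6 * f2 * f12 * f20) * grad f2 i + (3 * f12 * f12 - 3 * f2 * f2 * f20) * grad f12 i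
      + - (3 * f2 * f2 * f12) * grad f20 i + 2 * f2 * f2 * f2 * grad f30 i)"
    unfolding grad_def g36_def
    by (intro ext) (simp only: partial_diff partial_add partial_mult partial_numeral, Groebner_Basis.algebra)
  have c: "det4 a b (\<lambda>i. x * a i + y * b i + z * c i) (\<lambda>i. x' * a i + y' * b i + z' * c i + w' * d i) = z * w' * det4 a b c d"
    for a b c d :: "4 \<Rightarrow> poly4" and x y z x' y' z' w'
    unfolding det4_def det3_def by Groebner_Basis.algebra
  let ?J = "det4 (grad f2) (grad f12) (grad g24) (grad g36)"
  have J0: "?J = 0" unfolding q r c 0 by simp
  have f2: "vanishes xdeg 1 (grad f2 i)" if "i \<noteq> 4" for i
    using co_f2(1) f2_parts(1) that
    by (auto simp: vanishes_def grad_def f2_def partial_add partial_Var power2_eq_square partial_mult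
        wpart_add wpart_numeral_mult wpart_xdeg_Var distrib_left[symmetric] mult_2[symmetric])
  have f24: "grad f2 4 = 2 * Var 4"
    by (simp add: grad_def f2_def partial_add partial_sq)
  have l: "lf (Suc 1) 10 sx f12" "lf (Suc 5) 18 (2 * QX) g24" "lf (Suc 9) 26 (4 * RX) g36"
    using lf_f12 lf_g24 lf_g36 by (simp_all only: Suc_1 Suc_numeral semiring_norm)
  note v = low_grad(2)[OF l(1)] low_grad(2)[OF l(2)] low_grad(2)[OF l(3)]
  note n4 = four_neq(3) four_neq(6) four_neq(9)
  let ?E = "\<lambda>i j k. det3 (grad f12 i) (grad f12 j) (grad f12 k) (grad g24 i) (grad g24 j) (grad g24 k)
      (grad g36 i) (grad g36 j) (grad g36 k)"
  \<comment> \<open>In the other three terms of the expansion the first factor has order at least 1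
    as well, so they start in order 16.\<close>
  have "vanishes xdeg (1 + (1 + (5 + 9))) (grad f2 m * ?E i j k)" if "m \<noteq> 4" for m i j k
    by (intro xdeg.vanishes_mult vanishes_det3 v f2 that)
  then have z: "wpart xdeg 15 (grad f2 m * ?E i j k) = 0" if "m \<noteq> 4" for m i j k
    using that by (simp add: vanishes_def)
  let ?L = "det3 (partial 1 sx * Var 4 ^ 10) (partial 2 sx * Var 4 ^ 10) (partial 3 sx * Var 4 ^ 10)
     (partial 1 (2 * QX) * Var 4 ^ 18) (partial 2 (2 * QX) * Var 4 ^ 18) (partial 3 (2 * QX) * Var 4 ^ 18)
     (partial 1 (4 * RX) * Var 4 ^ 26) (partial 2 (4 * RX) * Var 4 ^ 26) (partial 3 (4 * RX) * Var 4 ^ 26)"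
  have "low 0 (2 * Var 4) (2 * Var 4)"
    by (simp add: low_def wpart_numeral_mult wpart_xdeg_Var)
  moreover have "low (1 + (5 + 9)) (?E 1 2 3) ?L"
    by (intro low_det3 low_grad(1)[OF l(1)] low_grad(1)[OF l(2)] low_grad(1)[OF l(3)] n4)
  ultimately have "low (0 + (1 + (5 + 9))) (2 * Var 4 * ?E 1 2 3) (2 * Var 4 * ?L)" by (rule low_mult)
  then have "wpart xdeg 15 (2 * Var 4 * ?E 1 2 3) = 2 * Var 4 * ?L" by (simp add: low_def)
  then have "wpart xdeg 15 ?J = - (2 * Var 4 * ?L)"
    unfolding det4_def wpart_diff wpart_add z[OF n4(1)] z[OF n4(2)] z[OF n4(3)] f24 by simp
  then have "2 * Var 4 * ?L = 0" unfolding J0 by simp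
  then have L0: "?L = 0" by (simp add: Var_nonzero)
  have "?L = 8 * Var 4 ^ 54 * jac3 sx QX RX"
    unfolding partial_mult[of _ 2] partial_mult[of _ 4] partial_numeral det3_def by Groebner_Basis.algebra
  then show False using L0 jac3_lead by (simp add: Var_nonzero)
qed

section \<open>The Jacobian criterion for algebraic independence\<close>

definition bounded_degree :: "nat \<Rightarrow> poly4 \<Rightarrow> bool" where
  "bounded_degree n f \<longleftrightarrow> (\<exists>g. f = (\<Sum>k\<le>n. g k) \<and> (\<forall>k. homogeneous k (g k)))"

lemma bounded_degree_exists: "\<exists>n. bounded_degree n f"
proof -
  obtain N where "\<forall>m\<in>Poly_Mapping.keys f. mdeg m \<le> N" using wpart_bounded by blast
  then have "f = (\<Sum>k\<le>N. wpart mdeg k f)" by (simp add: sum_wpart)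
  then show ?thesis unfolding bounded_degree_def using homogeneous_wpart_mdeg by blast
qed

lemma bounded_degree_partial: "bounded_degree (Suc n) f \<Longrightarrow> bounded_degree n (partial i f)"
proof -
  assume "bounded_degree (Suc n) f"
  then obtain g where g: "f = (\<Sum>k\<le>Suc n. g k)" "\<And>k. homogeneous k (g k)" by (auto simp: bounded_degree_def)
  have "partial i (g 0) = 0" using g(2)[of 0] by (auto simp: homogeneous_0_iff)
  then have "partial i f = (\<Sum>k\<le>n. partial i (g (Suc k)))"
    unfolding g(1) partial_sum by (subst sum.atMost_Suc_shift) simp
  then show ?thesis unfolding bounded_degree_def
    by (intro exI[of _ "\<lambda>k. partial i (g (Suc k))"]) (simp add: homogeneous_partial g(2))
qed

text \<open>For a relation f the chain rule makes the gradients dependent with coefficients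
  \<open>subst h (partial i f)\<close>. By Cramer's rule these vanish, so the partial derivatives of
  f are relations of smaller degree, hence 0, and f is constant.\<close>

lemma jacobian_independent:
  assumes J: "det4 (grad (h 1)) (grad (h 2)) (grad (h 3)) (grad (h 4)) \<noteq> 0" and "subst h f = 0"
  shows "f = 0"
proof -
  obtain n where "bounded_degree n f" using bounded_degree_exists by blast
  then show ?thesis using assms(2)
  proof (induction n arbitrary: f)
    case 0
    then show ?case by (auto simp: bounded_degree_def homogeneous_0_iff subst_Const)
        (metis Const_0 homogeneous_0_iff subst_Const)
  next
    case (Suc n)
    let ?x = "\<lambda>i. subst h (partial i f)"
    have "(\<Sum>i\<in>UNIV. ?x i * grad (h i) j) = 0" for j
      using partial_subst[of j h f] Suc.prems(2) by (simp add: grad_def)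
    then have v: "?x 1 * grad (h 1) j + ?x 2 * grad (h 2) j + ?x 3 * grad (h 3) j + ?x 4 * grad (h 4) j = 0" for j
      by (simp only: sum_4)
    let ?V = "\<lambda>j. ?x 1 * grad (h 1) j + ?x 2 * grad (h 2) j + ?x 3 * grad (h 3) j + ?x 4 * grad (h 4) j"
    have c: "x1 * det4 a b c d = det4 (\<lambda>j. x1 * a j + x2 * b j + x3 * c j + x4 * d j) b c d"
      "x2 * det4 a b c d = det4 a (\<lambda>j. x1 * a j + x2 * b j + x3 * c j + x4 * d j) c d"
      "x3 * det4 a b c d = det4 a b (\<lambda>j. x1 * a j + x2 * b j + x3 * c j + x4 * d j) d"
      "x4 * det4 a b c d = det4 a b c (\<lambda>j. x1 * a j + x2 * b j + x3 * c j + x4 * d j)"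
      for a b c d :: "4 \<Rightarrow> poly4" and x1 x2 x3 x4
      unfolding det4_def det3_def by Groebner_Basis.algebra+
    have z: "det4 (\<lambda>j. 0) b c d = 0" "det4 a (\<lambda>j. 0) c d = 0" "det4 a b (\<lambda>j. 0) d = 0" "det4 a b c (\<lambda>j. 0) = 0"
      for a b c d :: "4 \<Rightarrow> poly4"
      unfolding det4_def det3_def by simp_all
    let ?J = "det4 (grad (h 1)) (grad (h 2)) (grad (h 3)) (grad (h 4))"
    have V0: "?V = (\<lambda>j. 0)" by (rule ext) (rule v)
    have "?x 1 * ?J = 0"
    proof -
      have "?x 1 * ?J = det4 ?V (grad (h 2)) (grad (h 3)) (grad (h 4))" by (rule c(1))
      then show ?thesis unfolding V0 z .
    qed
    moreover have "?x 2 * ?J = 0"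
    proof -
      have "?x 2 * ?J = det4 (grad (h 1)) ?V (grad (h 3)) (grad (h 4))" by (rule c(2))
      then show ?thesis unfolding V0 z .
    qed
    moreover have "?x 3 * ?J = 0"
    proof -
      have "?x 3 * ?J = det4 (grad (h 1)) (grad (h 2)) ?V (grad (h 4))" by (rule c(3))
      then show ?thesis unfolding V0 z .
    qed
    moreover have "?x 4 * ?J = 0"
    proof -
      have "?x 4 * ?J = det4 (grad (h 1)) (grad (h 2)) (grad (h 3)) ?V" by (rule c(4))
      then show ?thesis unfolding V0 z .
    qed
    ultimately have "\<forall>i. ?x i = 0" using J unfolding forall_4 by simp
    then have "partial i f = 0" for i
      using Suc.IH[OF bounded_degree_partial[OF Suc.prems(1)]] by blast
    then obtain c where "f = Const c" using poly_const_if_partial_0 by blast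
    then show ?case using Suc.prems(2) by (simp add: subst_Const)
  qed
qed

lemma lead_sub_injective:
  assumes "subst lead_sub f = 0"
  shows "f = 0"
proof (rule jacobian_independent[OF _ assms])
  have 4: "partial 4 QX = 0" "partial 4 RX = 0"
    by (simp_all only: partial_QX partial_RX partial_sx partial_px partial_tx mult_zero_right add_0_left diff_zero)
  have c: "det4 a b c d = det3 (a 1) (a 2) (a 3) (b 1) (b 2) (b 3) (c 1) (c 2) (c 3)"
    if "a 4 = 0" "b 4 = 0" "c 4 = 0" "d 1 = 0" "d 2 = 0" "d 3 = 0" "d 4 = 1" for a b c d :: "4 \<Rightarrow> poly4"
    unfolding det4_def det3_def that by Groebner_Basis.algebra
  have "det4 (grad sx) (grad QX) (grad RX) (grad (Var 4)) = jac3 sx QX RX"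
    by (subst c) (simp_all only: grad_def partial_sx 4 partial_Var four_neq if_True if_False refl)
  then show "det4 (grad (lead_sub 1)) (grad (lead_sub 2)) (grad (lead_sub 3)) (grad (lead_sub 4)) \<noteq> 0"
    unfolding lead_sub_simps using jac3_lead by simp
qed

section \<open>A basis of the invariants adapted to the filtration\<close>

lemma smon_power: "x \<in> sidx \<Longrightarrow> smon (\<lambda>i. t ^ k i) x = t ^ sweight k x" for t :: "'a::comm_monoid_mult"
  unfolding sidx_def less_12 by (auto simp: smon_def sweight_def shead_def sstep_def power_add power_mult mult.commute[of _ "k _"])

lemma sweight_add: "x \<in> sidx \<Longrightarrow> sweight (\<lambda>i. u i + v i) x = sweight u x + sweight v x"
  unfolding sidx_def less_12 by (auto simp: sweight_def sstep_def algebra_simps)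

lemma sweight_mono:
  assumes "x \<in> sidx" "\<And>i. i < 12 \<Longrightarrow> u i \<le> v i"
  shows "sweight u x \<le> sweight v x"
proof -
  obtain \<beta> i j m where x: "x = (((\<beta>, i), j), m)" by (metis surj_pair)
  have "i * u 8 + j * u 10 + (h + m * sstep u \<beta>) \<le> i * v 8 + j * v 10 + (h' + m * sstep v \<beta>)" if "h \<le> h'" for h h'
    using that assms(2)[of 8] assms(2)[of 10] assms(2)[of 2] assms(2)[of 6]
    by (intro add_mono mult_le_mono) (auto simp: sstep_def)
  moreover have "[0, u 4, u 5, u 4 + u 5, u 6, u 1, u 3, u 11, u 1 + u 11, u 3 + u 11, u 7, u 9] ! \<beta>
      \<le> [0, v 4, v 5, v 4 + v 5, v 6, v 1, v 3, v 11, v 1 + v 11, v 3 + v 11, v 7, v 9] ! \<beta>"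
    using assms(1) assms(2)[of 4] assms(2)[of 5] assms(2)[of 6] assms(2)[of 1] assms(2)[of 3] assms(2)[of 11]
      assms(2)[of 7] assms(2)[of 9] unfolding x sidx_def less_12 by auto
  ultimately show ?thesis by (simp add: x sweight_def)
qed

lemma sweight_cong: "x \<in> sidx \<Longrightarrow> (\<And>i. i < 12 \<Longrightarrow> u i = v i) \<Longrightarrow> sweight u x = sweight v x"
  using sweight_mono[of x u v] sweight_mono[of x v u] by (simp add: order_antisym)

lemma sweight_mult: "sweight (\<lambda>i. k * u i) x = k * sweight u x" if "x \<in> sidx"
  using that unfolding sidx_def less_12 by (auto simp: sweight_def sstep_def algebra_simps)

text \<open>Standard monomials contain no factor \<open>f2\<close>; its powers are adjoined here.
  Each raises the degree by 2 and leaves the order alone, as in \<open>edeg\<close> and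
  \<open>eord\<close>.\<close>

definition ebas :: "(((nat \<times> nat) \<times> nat) \<times> nat) \<times> nat \<Rightarrow> poly4" where
  "ebas = (\<lambda>(x, l). f2 ^ l * smon gens x)"

definition edeg :: "(((nat \<times> nat) \<times> nat) \<times> nat) \<times> nat \<Rightarrow> nat" where
  "edeg = (\<lambda>(x, l). sweight wd x + l * 2)"

definition eord :: "(((nat \<times> nat) \<times> nat) \<times> nat) \<times> nat \<Rightarrow> nat" where
  "eord = (\<lambda>(x, l). sweight wm x)"

definition eidx :: "nat \<Rightarrow> ((((nat \<times> nat) \<times> nat) \<times> nat) \<times> nat) set" where
  "eidx d = {y \<in> sidx \<times> UNIV. edeg y = d}"

lemma gens_simps: "gens 0 = f2" "gens 1 = f12" "gens 2 = f20" "gens 3 = f12 ^ 2 - f2 ^ 2 * f20" "gens 4 = f30"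
  "gens 5 = f12 * f20 - f2 * f30" "gens 6 = f12 ^ 3 - 3 * f2 ^ 2 * f12 * f20 + 2 * f2 ^ 3 * f30"
  "gens 7 = f2 * f20 ^ 2 - f12 * f30" "gens 8 = f12 ^ 2 * f20 + f2 ^ 2 * f20 ^ 2 - 2 * f2 * f12 * f30"
  "gens 9 = 2 * f2 * f12 * f20 ^ 2 - f12 ^ 2 * f30 - f2 ^ 2 * f20 * f30" "gens 10 = f20 ^ 3 - f30 ^ 2"
  "gens 11 = 3 * f2 * f12 ^ 2 * f20 ^ 2 - f2 ^ 3 * f20 ^ 3 - f12 ^ 3 * f30 - 3 * f2 ^ 2 * f12 * f20 * f30 + 2 * f2 ^ 3 * f30 ^ 2"
  by (simp_all add: gens_def R_gens_def)

lemma gens_T_inv: "i < 12 \<Longrightarrow> gens i \<in> T_inv"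
  unfolding less_12
  by (elim insertE emptyE) (simp_all only: gens_simps T_inv_closed f2_T_inv f12_T_inv f20_T_inv f30_T_inv)

lemma homogeneous_orbit_sum12: "homogeneous 12 orbit_sum12"
  unfolding orbit_sum12_def using homogeneous_power[OF homogeneous_Var, of 12]
  by (intro homogeneous_sum homogeneous_act) simp

lemma hom_mult: "homogeneous a f \<Longrightarrow> homogeneous b g \<Longrightarrow> a + b = d \<Longrightarrow> homogeneous d (f * g)"
  using homogeneous_mult by blast

lemma hom_power: "homogeneous a f \<Longrightarrow> n * a = d \<Longrightarrow> homogeneous d (f ^ n)"
  using homogeneous_power by blast

lemma hom_numeral: "homogeneous d f \<Longrightarrow> homogeneous d (numeral n * f)"
  using homogeneous_Const_mult[of d f "numeral n"] by simp

lemma hom_lap: "homogeneous e f \<Longrightarrow> d + 2 = e \<Longrightarrow> homogeneous d (laplacian f)"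
  using homogeneous_laplacian[of d f] by auto

lemma homogeneous_basic: "homogeneous 2 f2" "homogeneous 12 f12" "homogeneous 20 f20" "homogeneous 30 f30"
proof -
  show 2: "homogeneous 2 f2"
    unfolding f2_def by (intro homogeneous_add hom_power[OF homogeneous_Var]) simp_all
  have "homogeneous 12 g12" unfolding g12_def by (intro homogeneous_Const_mult homogeneous_orbit_sum12)
  then show 12: "homogeneous 12 f12"
    unfolding f12_def by (intro homogeneous_Const_mult homogeneous_diff hom_power[OF 2]) simp_all
  have "homogeneous 20 g20"
    unfolding g20_def
    by (intro homogeneous_Const_mult hom_lap[of 22] hom_lap[of 24] hom_power[OF 12]) simp_all
  moreover have "homogeneous 20 (f2 ^ 10)" "homogeneous 20 (f2 ^ 4 * f12)"
    by (rule hom_power[OF 2] hom_mult[OF hom_power[OF 2 refl] 12]; simp)+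
  ultimately show 20: "homogeneous 20 f20"
    unfolding f20_def mult_minus_left mult.assoc[of 224]
    by (intro homogeneous_Const_mult homogeneous_add homogeneous_diff homogeneous_uminus hom_numeral)
  have "homogeneous 30 g30"
    unfolding g30_def by (intro homogeneous_Const_mult hom_lap[of 32] hom_mult[OF 12 20]) simp_all
  moreover have "homogeneous 30 (f2 ^ 5 * f20)" "homogeneous 30 (f2 ^ 3 * f12 ^ 2)"
    by (rule hom_mult[OF hom_power[OF 2 refl] 20] hom_mult[OF hom_power[OF 2 refl] hom_power[OF 12 refl]]; simp)+
  ultimately show "homogeneous 30 f30"
    unfolding f30_def mult_minus_left mult.assoc[of 15] mult.assoc[of 6]
    by (intro homogeneous_Const_mult homogeneous_add homogeneous_diff homogeneous_uminus hom_numeral)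
qed

lemma homogeneous_gens:
  assumes "i < 12"
  shows "homogeneous (wd i) (gens i)"
proof -
  note b = homogeneous_basic
  have m: "homogeneous (2 * a + 12 * b + 20 * c + 30 * e) (f2 ^ a * (f12 ^ b * (f20 ^ c * f30 ^ e)))" for a b c e
    by (rule hom_mult[OF hom_power[OF b(1) refl] hom_mult[OF hom_power[OF b(2) refl]
      hom_mult[OF hom_power[OF b(3) refl] hom_power[OF b(4) refl] refl] refl]]) simp
  have m': "homogeneous d f" if "f = f2 ^ a * (f12 ^ b * (f20 ^ c * f30 ^ e))" "2 * a + 12 * b + 20 * c + 30 * e = d" for a b c e d f
    using m[of a b c e] that by simp
  have mm: "homogeneous 24 (f12 ^ 2)" "homogeneous 24 (f2 ^ 2 * f20)" "homogeneous 32 (f12 * f20)" "homogeneous 32 (f2 * f30)"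
    "homogeneous 36 (f12 ^ 3)" "homogeneous 36 (f2 ^ 2 * f12 * f20)" "homogeneous 36 (f2 ^ 3 * f30)"
    "homogeneous 42 (f2 * f20 ^ 2)" "homogeneous 42 (f12 * f30)" "homogeneous 44 (f12 ^ 2 * f20)" "homogeneous 44 (f2 ^ 2 * f20 ^ 2)"
    "homogeneous 44 (f2 * f12 * f30)" "homogeneous 54 (f2 * f12 * f20 ^ 2)" "homogeneous 54 (f12 ^ 2 * f30)"
    "homogeneous 54 (f2 ^ 2 * f20 * f30)" "homogeneous 60 (f20 ^ 3)" "homogeneous 60 (f30 ^ 2)"
    "homogeneous 66 (f2 * f12 ^ 2 * f20 ^ 2)" "homogeneous 66 (f2 ^ 3 * f20 ^ 3)" "homogeneous 66 (f12 ^ 3 * f30)"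
    "homogeneous 66 (f2 ^ 2 * f12 * f20 * f30)" "homogeneous 66 (f2 ^ 3 * f30 ^ 2)"
    by (rule m'[of _ 0 2 0 0] m'[of _ 2 0 1 0] m'[of _ 0 1 1 0] m'[of _ 1 0 0 1] m'[of _ 0 3 0 0] m'[of _ 2 1 1 0]
      m'[of _ 3 0 0 1] m'[of _ 1 0 2 0] m'[of _ 0 1 0 1] m'[of _ 0 2 1 0] m'[of _ 2 0 2 0] m'[of _ 1 1 0 1] m'[of _ 1 1 2 0]
      m'[of _ 0 2 0 1] m'[of _ 2 0 1 1] m'[of _ 0 0 3 0] m'[of _ 0 0 0 2] m'[of _ 1 2 2 0] m'[of _ 3 0 3 0] m'[of _ 0 3 0 1]
      m'[of _ 2 1 1 1] m'[of _ 3 0 0 2]; (simp; fail))+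
  show ?thesis
    using assms unfolding less_12
    by (elim insertE emptyE; simp only: gens_simps wd_simps mult.assoc[of "numeral _" "_ ^ _" _] mult.assoc[of "numeral _" f2 _] mult.assoc[of "numeral _" "_ * _" _])
      (intro homogeneous_add homogeneous_diff hom_numeral mm b)+
qed

lemma ebas_properties:
  assumes "y \<in> eidx d"
  shows "homogeneous d (ebas y)" "ebas y \<in> T_inv"
proof -
  obtain x l where y: "y = (x, l)" by (cases y)
  have x: "x \<in> sidx" and d: "sweight wd x + l * 2 = d" using assms by (auto simp: eidx_def edeg_def y)
  have "wpart mdeg (sweight wd x) (smon gens x) = smon gens x"
    using homogeneous_gens by (intro mdeg.smon_weight x) (simp add: homogeneous_iff)
  then show "homogeneous d (ebas y)"
    using d[unfolded add.commute[of "sweight wd x"]] unfolding y ebas_def prod.case homogeneous_iff[symmetric]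
    by (intro hom_mult[OF hom_power[OF homogeneous_basic(1) refl]]) simp_all
  have "smon gens x \<in> T_inv"
    using x by (rule smon_closed) (auto intro: T_inv_closed gens_T_inv)
  then show "ebas y \<in> T_inv" unfolding y ebas_def prod.case by (intro T_inv_closed f2_T_inv)
qed

lemma ebas_T_deg: "y \<in> eidx d \<Longrightarrow> ebas y \<in> T_deg d"
  by (simp add: T_deg_def ebas_properties)

lemma ebas_lead:
  assumes "y \<in> eidx d"
  shows "\<exists>c. c \<noteq> 0 \<and> lf (eord y) (d - eord y) (Const c * subst lead_sub (smon lead (fst y))) (ebas y)" "eord y \<le> d"
proof -
  obtain x l where y: "y = (x, l)" by (cases y)
  have x: "x \<in> sidx" and d: "sweight wd x + l * 2 = d" using assms by (auto simp: eidx_def edeg_def y)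
  let ?k = "\<lambda>i. wd i - wm i"
  let ?g = "\<lambda>i. Const (lead_scal i) * subst lead_sub (lead i) * Var 4 ^ ?k i"
  have le: "wm i \<le> wd i" if "i < 12" for i
    using that unfolding less_12 by (elim insertE emptyE) (simp_all add: wd_simps wm_simps)
  have "sweight ?k x + sweight wm x = sweight (\<lambda>i. ?k i + wm i) x" using x by (simp only: sweight_add)
  also have "\<dots> = sweight wd x" using x le by (intro sweight_cong) auto
  finally have k: "sweight ?k x + sweight wm x = sweight wd x" .
  then show le': "eord y \<le> d" using d by (simp add: y eord_def)
  have "smon ?g x = smon (\<lambda>i. Const (lead_scal i)) x * smon (\<lambda>i. subst lead_sub (lead i)) x * smon (\<lambda>i. Var 4 ^ ?k i) x"
    using x by (simp only: smon_mult)
  also have "smon (\<lambda>i. Const (lead_scal i)) x = Const (smon lead_scal x)"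
    using x by (intro smon_hom[symmetric]) (simp_all add: Const_mult)
  also have "smon (\<lambda>i. subst lead_sub (lead i)) x = subst lead_sub (smon lead x)"
    using x by (intro smon_hom[symmetric]) (simp_all add: subst_mult)
  also have "smon (\<lambda>i. Var 4 ^ ?k i) x = Var 4 ^ sweight ?k x" by (rule smon_power[OF x])
  finally have g: "smon ?g x = Const (smon lead_scal x) * subst lead_sub (smon lead x) * Var 4 ^ sweight ?k x" .
  have "vanishes xdeg (sweight wm x) (smon gens x) \<and> wpart xdeg (sweight wm x) (smon gens x) = smon ?g x"
    using x lf_gens(1) by (intro xdeg.smon_lowest) (auto simp: lf_def)
  then have 1: "lf (sweight wm x) (sweight ?k x) (Const (smon lead_scal x) * subst lead_sub (smon lead x)) (smon gens x)"
    by (simp only: lf_def g simp_thms)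
  have 2: "lf 0 (l * 2) 1 (f2 ^ l)"
  proof (induction l)
    case (Suc l)
    then show ?case using lf_mult[OF lf_f2 Suc] by (simp only: mult_Suc power_Suc add_0_left mult_1_left)
  qed (simp add: lf_def xdeg.wpart_1)
  have "lf (eord y) (d - eord y) (Const (smon lead_scal x) * subst lead_sub (smon lead x)) (ebas y)"
    by (rule lf_cong[OF lf_mult[OF 2 1]]) (use k d in \<open>simp_all add: y eord_def ebas_def\<close>)
  moreover have "smon lead_scal x \<noteq> 0"
    using x by (rule smon_closed) (auto simp: lf_gens(2))
  ultimately show "\<exists>c. c \<noteq> 0 \<and> lf (eord y) (d - eord y) (Const c * subst lead_sub (smon lead (fst y))) (ebas y)"
    by (auto simp: y)
qed

lemma finite_fibres_eidx: "finite_fibres (sidx \<times> UNIV) (shiftw (sw (\<lambda>i. (wd i, 0))) (2, 0))"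
  by (intro finite_fibres_shift wgf_sidx) (simp_all add: wd_simps)

lemma sweight_0: "x \<in> sidx \<Longrightarrow> sweight (\<lambda>i. 0) x = 0"
  unfolding sidx_def sweight_def less_12 by (auto simp: sstep_def)

lemma eidx_eq: "eidx d = {y \<in> sidx \<times> UNIV. shiftw (sw (\<lambda>i. (wd i, 0))) (2, 0) y = (d, 0)}"
  by (auto simp: eidx_def edeg_def shiftw_def sw_def sweight_0)

lemma finite_eidx: "finite (eidx d)"
  unfolding eidx_eq by (rule finite_fibresD[OF finite_fibres_eidx])

text \<open>This makes the basis adapted to the filtration. Once coefficients of smaller order are
  known to be 0, the part of order w comes from the elements of order w alone; their initial forms
  are the images of independent polynomials under the injective \<open>lead_sub\<close>.\<close>

lemma ebas_coefficients:
  assumes "Y \<subseteq> eidx d" and v: "vanishes xdeg k (\<Sum>y\<in>Y. Const (c y) * ebas y)" and y: "y \<in> Y" "eord y < k"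
  shows "c y = 0"
proof -
  have finY: "finite Y" using assms(1) finite_eidx by (rule finite_subset)
  have "\<forall>y\<in>Y. eord y = w \<longrightarrow> w < k \<longrightarrow> c y = 0" for w
  proof (induction w rule: less_induct)
    case (less w)
    show ?case
    proof (intro ballI impI)
      fix z assume z: "z \<in> Y" "eord z = w" "w < k"
      have "\<forall>y\<in>Y. \<exists>c. c \<noteq> 0 \<and> lf (eord y) (d - eord y) (Const c * subst lead_sub (smon lead (fst y))) (ebas y)"
        using ebas_lead(1) assms(1) by blast
      then obtain a where a: "\<And>y. y \<in> Y \<Longrightarrow> a y \<noteq> 0"
        "\<And>y. y \<in> Y \<Longrightarrow> lf (eord y) (d - eord y) (Const (a y) * subst lead_sub (smon lead (fst y))) (ebas y)"
        by metis
      let ?Z = "{y \<in> Y. eord y = w}"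
      have "wpart xdeg w (Const (c y) * ebas y) =
          (if eord y = w then Const (c y * a y) * subst lead_sub (smon lead (fst y)) * Var 4 ^ (d - w) else 0)" if "y \<in> Y" for y
      proof (cases "eord y" w rule: linorder_cases)
        case less': less
        then have "c y = 0" using less.IH[of "eord y"] z(3) that by auto
        then show ?thesis using less' by simp
      next
        case equal
        then show ?thesis using a(2)[OF that]
          by (simp only: lf_def wpart_Const_mult Const_mult mult.assoc if_True simp_thms)
      next
        case greater
        then show ?thesis using a(2)[OF that] by (simp add: lf_def vanishes_def wpart_Const_mult)
      qed
      then have "wpart xdeg w (\<Sum>y\<in>Y. Const (c y) * ebas y) =
          (\<Sum>y\<in>Y. if eord y = w then Const (c y * a y) * subst lead_sub (smon lead (fst y)) * Var 4 ^ (d - w) else 0)"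
        unfolding wpart_sum by (rule sum.cong[OF refl])
      also have "\<dots> = (\<Sum>y\<in>?Z. Const (c y * a y) * subst lead_sub (smon lead (fst y)) * Var 4 ^ (d - w))"
        using finY by (simp add: sum.inter_filter)
      also have "\<dots> = subst lead_sub (\<Sum>y\<in>?Z. Const (c y * a y) * smon lead (fst y)) * Var 4 ^ (d - w)"
        by (simp only: subst_sum subst_mult subst_Const sum_distrib_right)
      finally have "subst lead_sub (\<Sum>y\<in>?Z. Const (c y * a y) * smon lead (fst y)) * Var 4 ^ (d - w) = 0"
        using v z(3) by (simp add: vanishes_def)
      then have "subst lead_sub (\<Sum>y\<in>?Z. Const (c y * a y) * smon lead (fst y)) = 0"
        by (simp only: mult_eq_0_iff power_eq_0_iff Var_nonzero simp_thms)
      then have 0: "(\<Sum>y\<in>?Z. Const (c y * a y) * smon lead (fst y)) = 0" by (rule lead_sub_injective)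
      \<comment> \<open>In the fixed degree d the exponent of \<open>f2\<close> is determined by the
        standard monomial.\<close>
      have inj: "inj_on fst ?Z"
      proof (rule inj_onI)
        fix y y' assume "y \<in> ?Z" "y' \<in> ?Z" "fst y = fst y'"
        moreover from this have "edeg y = d" "edeg y' = d" using assms(1) by (auto simp: eidx_def)
        ultimately show "y = y'" by (cases y; cases y') (simp add: edeg_def)
      qed
      have sub: "fst ` ?Z \<subseteq> {x \<in> sidx. sweight wm x = w}"
        using assms(1) by (auto simp: eidx_def eord_def)
      let ?b = "\<lambda>x. let y = the_inv_into ?Z fst x in c y * a y"
      have "(\<Sum>x\<in>fst ` ?Z. Const (?b x) * smon lead x) = 0"
        unfolding sum.reindex[OF inj] o_def using 0 by (simp only: the_inv_into_f_f[OF inj] Let_def cong: sum.cong)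
      then have "?b (fst z) = 0"
        by (rule smon_lead_relation[OF sub]) (use z in auto)
      moreover have "the_inv_into ?Z fst (fst z) = z" using z by (intro the_inv_into_f_f[OF inj]) auto
      ultimately show "c z = 0" using a(1)[OF z(1)] by (simp only: Let_def mult_eq_0_iff simp_thms)
    qed
  qed
  then show ?thesis using y by blast
qed

lemma ebas_independent:
  shows "inj_on ebas (eidx d)" "Sv.independent (ebas ` eidx d)"
proof -
  \<comment> \<open>The zero sum vanishes to every order, in particular to one beyond the order of
    y.\<close>
  have z: "c y = 0" if "(\<Sum>y\<in>eidx d. Const (c y) * ebas y) = 0" "y \<in> eidx d" for c y
    using ebas_coefficients[of "eidx d" d "Suc (eord y)" c y] that by simp
  show inj: "inj_on ebas (eidx d)"
  proof (rule inj_onI, rule ccontr)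
    fix y y' assume y: "y \<in> eidx d" "y' \<in> eidx d" "ebas y = ebas y'" "y \<noteq> y'"
    let ?c = "\<lambda>z. (if z = y then 1 else 0) - (if z = y' then 1 else 0) :: complex"
    have "Const (?c z) * ebas z = (if z = y then ebas y else 0) - (if z = y' then ebas y' else 0)" for z
      by (simp add: Const_diff)
    then have "(\<Sum>z\<in>eidx d. Const (?c z) * ebas z) = 0"
      using y finite_eidx by (simp add: sum_subtractf)
    from z[OF this y(1)] show False using y(4) by simp
  qed
  show "Sv.independent (ebas ` eidx d)"
  proof (rule Sv.independent_if_scalars_zero)
    fix f v assume 0: "(\<Sum>x\<in>ebas ` eidx d. Const (f x) * x) = 0" and v: "v \<in> ebas ` eidx d"
    from 0 have "(\<Sum>y\<in>eidx d. Const (f (ebas y)) * ebas y) = 0"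
      unfolding sum.reindex[OF inj] o_def .
    from z[OF this] v show "f v = 0" by auto
  qed (simp add: finite_eidx)
qed

section \<open>Comparison with the monomials in the four basic invariants\<close>

definition tidx :: "((((unit \<times> nat) \<times> nat) \<times> nat) \<times> nat) set" where
  "tidx = pidx \<times> UNIV"

definition tw :: "(((unit \<times> nat) \<times> nat) \<times> nat) \<times> nat \<Rightarrow> nat \<times> nat" where
  "tw = shiftw (pw (2, 0) (12, 0) (20, 0)) (30, 0)"

definition tmon :: "(((unit \<times> nat) \<times> nat) \<times> nat) \<times> nat \<Rightarrow> poly4" where
  "tmon = (\<lambda>((((_, a), b), c), e). f2 ^ a * f12 ^ b * f20 ^ c * f30 ^ e)"

text \<open>Counted by degree, the standard monomials times powers of \<open>f2\<close> have the
  series 1 / ((1 - t^2) (1 - t^12) (1 - t^20) (1 - t^30)), that of a polynomial ring on the basic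
  invariants.\<close>

lemma card_eidx: "card (eidx d) = card {t \<in> tidx. tw t = (d, 0)}" and finite_tidx: "finite {t \<in> tidx. tw t = (d, 0)}"
proof -
  let ?v = "\<lambda>i. (wd i, 0 :: nat)"
  let ?X = "fps_X :: rat fps fps"
  have v: "?v 2 \<noteq> (0, 0)" "?v 6 \<noteq> (0, 0)" "?v 8 \<noteq> (0, 0)" "?v 10 \<noteq> (0, 0)" by (simp_all add: wd_simps)
  have a: "(2, 0) \<noteq> (0 :: nat, 0 :: nat)" "(12, 0) \<noteq> (0 :: nat, 0 :: nat)" "(20, 0) \<noteq> (0 :: nat, 0 :: nat)"
    "(30, 0) \<noteq> (0 :: nat, 0 :: nat)" by simp_all
  note s = wgf_sidx(2)[of ?v, OF v, unfolded wd_simps bmon_X]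
  note s' = wgf_shift[OF wgf_sidx(1)[of ?v, OF v] a(1), unfolded bmon_X]
  note p = wgf_pidx(2)[OF a(1-3), unfolded bmon_X]
  note p' = wgf_shift[OF wgf_pidx(1)[OF a(1-3)] a(4), unfolded bmon_X, folded tidx_def tw_def]
  show "finite {t \<in> tidx. tw t = (d, 0)}"
    unfolding tidx_def tw_def by (rule finite_fibresD[OF finite_fibres_shift[OF wgf_pidx(1)[OF a(1-3)] a(4)]])
  let ?G = "wgf (sidx \<times> UNIV) (shiftw (sw ?v) (2, 0))" and ?H = "wgf tidx tw"
  let ?D = "(1 - ?X ^ 44) * (1 - ?X ^ 60) * (1 - ?X ^ 20) * (1 - ?X ^ 36)"
  let ?E = "(1 - ?X ^ 12) * (1 - ?X ^ 20) * (1 - ?X ^ 30)"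
  let ?N = "(1 + ?X ^ 30 + ?X ^ 32 + ?X ^ 30 * ?X ^ 32) * (1 - ?X ^ 36)
      + (?X ^ 36 + ?X ^ 12 + ?X ^ 24 + ?X ^ 66 + ?X ^ 12 * ?X ^ 66 + ?X ^ 24 * ?X ^ 66) * (1 - ?X ^ 20)
      + (?X ^ 42 + ?X ^ 54) * ((1 - ?X ^ 20) * (1 - ?X ^ 36))"
  have "?G * (?D * ?E * (1 - ?X ^ 2)) = (?G * (1 - ?X ^ 2)) * ?D * ?E" by (simp only: mult_ac)
  also have "\<dots> = ?N * ?E" unfolding s' s ..
  also have "\<dots> = ?D" by Groebner_Basis.algebra
  also have "\<dots> = ?H * (1 - ?X ^ 30) * ((1 - ?X ^ 2) * (1 - ?X ^ 12) * (1 - ?X ^ 20)) * ?D"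
    unfolding p' p by (rule mult_1_left[symmetric])
  also have "\<dots> = ?H * (?D * ?E * (1 - ?X ^ 2))" by (simp only: mult_ac)
  finally have "?G * (?D * ?E * (1 - ?X ^ 2)) = ?H * (?D * ?E * (1 - ?X ^ 2))" .
  moreover have "?D * ?E * (1 - ?X ^ 2) \<noteq> 0" by (simp add: one_minus_X_power del: right_minus_eq)
  ultimately have "?G = ?H" using mult_right_cancel[of "?D * ?E * (1 - ?X ^ 2)"] by blast
  then show "card (eidx d) = card {t \<in> tidx. tw t = (d, 0)}"
    unfolding eidx_eq by (rule card_eq_if_wgf_eq)
qed

lemma T_deg_span_tmon:
  assumes "f \<in> T_deg d"
  shows "f \<in> Sv.span (tmon ` {t \<in> tidx. tw t = (d, 0)})"
proof -
  have inv: "f \<in> T_inv" and hom: "homogeneous d f" using assms by (auto simp: T_deg_def)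
  let ?S = "Sv.span (tmon ` tidx)"
  have base: "tmon ((((u, a), b), c), e) \<in> ?S" for u a b c e
    by (rule Sv.span_base) (auto simp: tidx_def pidx_def)
  have mult: "f * g \<in> ?S" if "f \<in> ?S" "g \<in> ?S" for f g
    using that(1)
  proof (induction rule: Sv.span_induct_alt)
    case base
    show ?case by (simp add: Sv.span_zero)
  next
    case (step k x z)
    have "x * g \<in> ?S" using that(2)
    proof (induction rule: Sv.span_induct_alt)
      case base
      show ?case by (simp add: Sv.span_zero)
    next
      case (step k' x' z')
      obtain a b c e where 1: "x = tmon (((((), a), b), c), e)" using \<open>x \<in> tmon ` tidx\<close> by auto
      obtain a' b' c' e' where 2: "x' = tmon (((((), a'), b'), c'), e')" using \<open>x' \<in> tmon ` tidx\<close> by auto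
      have "x * x' = tmon (((((), a + a'), b + b'), c + c'), e + e')"
        unfolding 1 2 tmon_def prod.case power_add by (simp only: mult_ac)
      then have "x * x' \<in> ?S" using assms(1) \<open>\<And>u a b c e. tmon ((((u, a), b), c), e) \<in> ?S\<close> by simp
      moreover have "x * (Const k' * x' + z') = Const k' * (x * x') + x * z'"
        by (simp only: distrib_left mult.left_commute)
      ultimately show ?case using step by (simp only: Sv.span_add Sv.span_scale)
    qed
    moreover have "(Const k * x + z) * g = Const k * (x * g) + z * g" by (simp only: distrib_right mult.assoc)
    ultimately show ?case using step by (simp only: Sv.span_add Sv.span_scale)
  qed
  have "f \<in> ?S"
  proof (rule invariants_generated[where A = "\<lambda>f. f \<in> ?S", OF f2_T_inv f12_T_inv f20_T_inv f30_T_inv])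
    show "homogeneous (Suc 1) f2" "homogeneous (Suc 11) f12" "homogeneous (Suc 19) f20" "homogeneous (Suc 29) f30"
      using homogeneous_basic by (simp_all only: Suc_1 Suc_numeral semiring_norm)
    show "det4 (grad f2) (grad f12) (grad f20) (grad f30) \<noteq> 0" by (rule jacobian_nonzero)
    have "1 \<in> ?S" using base[of "()" 0 0 0 0] by (simp add: tmon_def)
    then show "Const c \<in> ?S" for c using Sv.span_scale[of 1 _ c] by simp
    show "f2 \<in> ?S" "f12 \<in> ?S" "f20 \<in> ?S" "f30 \<in> ?S"
      using base[of "()" 1 0 0 0] base[of "()" 0 1 0 0] base[of "()" 0 0 1 0] base[of "()" 0 0 0 1] by (simp_all add: tmon_def)
  qed (use inv hom in \<open>simp_all add: Sv.span_add mult\<close>)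
  then have "wpart mdeg d f \<in> Sv.span (tmon ` {t \<in> tidx. fst (tw t) = d})"
  proof (rule span_wpart)
    fix t assume "t \<in> tidx"
    obtain u a b c e where t: "t = ((((u, a), b), c), e)" by (metis surj_pair)
    have "homogeneous (fst (tw t)) (tmon t)"
      unfolding t tmon_def tw_def pw_def shiftw_def
      by (simp, intro hom_mult[OF hom_mult[OF hom_mult[OF hom_power[OF homogeneous_basic(1) refl]
        hom_power[OF homogeneous_basic(2) refl] refl] hom_power[OF homogeneous_basic(3) refl] refl] hom_power[OF homogeneous_basic(4) refl]]) simp
    then show "wpart mdeg (fst (tw t)) (tmon t) = tmon t" by (simp add: homogeneous_iff)
  qed
  moreover have "{t \<in> tidx. fst (tw t) = d} = {t \<in> tidx. tw t = (d, 0)}"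
    by (auto simp: tw_def pw_def shiftw_def)
  ultimately show ?thesis using hom by (simp add: homogeneous_iff)
qed

text \<open>The independent elements \<open>ebas y\<close> are as many as the monomials in the basic
  invariants, whose span contains \<open>T_deg d\<close>; one more independent element would exceed
  that number.\<close>

lemma T_deg_expand:
  assumes "f \<in> T_deg d"
  shows "\<exists>c. f = (\<Sum>y\<in>eidx d. Const (c y) * ebas y)"
proof -
  let ?B = "ebas ` eidx d" and ?M = "tmon ` {t \<in> tidx. tw t = (d, 0)}"
  have "f \<in> Sv.span ?B"
  proof (rule ccontr)
    assume f: "f \<notin> Sv.span ?B"
    then have i: "Sv.independent (insert f ?B)" using ebas_independent(2) by (rule Sv.independent_insertI)
    have sub: "insert f ?B \<subseteq> Sv.span ?M"
      using T_deg_span_tmon[OF assms] T_deg_span_tmon[OF ebas_T_deg] by blast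
    have "finite ?M" using finite_tidx by simp
    from Sv.independent_span_bound[OF this i sub] have "card (insert f ?B) \<le> card ?M" ..
    moreover have nf: "f \<notin> ?B" using f by (rule contrapos_nn) (rule Sv.span_base)
    have "card (insert f ?B) = Suc (card (eidx d))"
      unfolding card_insert_disjoint[OF finite_imageI[OF finite_eidx] nf] card_image[OF ebas_independent(1)] ..
    moreover have "card ?M \<le> card (eidx d)" unfolding card_eidx using finite_tidx by (rule card_image_le)
    ultimately show False by linarith
  qed
  then obtain u where "f = (\<Sum>v\<in>?B. Const (u v) * v)"
    using Sv.span_finite[of ?B] finite_eidx by auto
  then have "f = (\<Sum>y\<in>eidx d. Const (u (ebas y)) * ebas y)"
    unfolding sum.reindex[OF ebas_independent(1)] o_def .
  then show ?thesis by (rule exI[of _ "\<lambda>y. u (ebas y)"])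
qed

section \<open>The associated graded algebra\<close>

lemma filt_iff: "f \<in> filt k \<longleftrightarrow> f \<in> T_inv \<and> vanishes xdeg k f"
  by (simp add: filt_def ideal_power_I_pt_iff)

lemma T_deg_filt_iff: "f \<in> T_deg d \<inter> ideal_power I_pt k \<longleftrightarrow> homogeneous d f \<and> f \<in> filt k"
  by (auto simp: T_deg_def filt_iff ideal_power_I_pt_iff)

lemma ebas_filt: "y \<in> eidx d \<Longrightarrow> ebas y \<in> filt (eord y)"
  using ebas_properties[of y d] ebas_lead(1)[of y d] by (auto simp: filt_iff lf_def)

interpretation Fl: poly_filtration filt
  by (rule poly_filtration_filt)

text \<open>A family concentrated in one summand, as a power series with polynomial coefficients.
  \<open>Fl.cls\<close> maps such series to families of cosets, so that calculations in R become
  calculations with polynomials.\<close>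

definition fsing :: "nat \<Rightarrow> poly4 \<Rightarrow> poly4 fps" where
  "fsing m f = Abs_fps (\<lambda>k. if k = m then f else 0)"

lemma gr_class_eq_cls: "gr_class filt m f = Fl.cls (fsing m f)"
proof
  fix k
  have "0 +o filt (Suc k) = filt (Suc k)" using Fl.coset_eq_zero_iff[of 0 "Suc k"] Fl.zero by simp
  then show "gr_class filt m f k = Fl.cls (fsing m f) k" by (simp add: gr_class_def Fl.cls_def fsing_def)
qed

lemma fsing_good: "f \<in> filt m \<Longrightarrow> fsing m f \<in> Fl.good"
  using Fl.zero by (auto simp: Fl.good_def fsing_def elim!: rev_finite_subset[of "{m}"])

lemma fsing_add: "fsing m f + fsing m g = fsing m (f + g)" and fsing_0: "fsing m 0 = 0"
  and fsing_scale: "fps_const c * fsing m f = fsing m (c * f)"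
  by (simp_all add: fsing_def fps_eq_iff)

lemma gr_class_in_carrier: "f \<in> filt m \<Longrightarrow> gr_class filt m f \<in> carrier R_alg"
  unfolding gr_class_eq_cls R_alg_def Fl.carrier_eq using fsing_good by blast

lemma R_cring: "cring R_alg"
  using algebra.axioms(2)[OF algebra_R_alg] .

lemma R_ring: "ring R_alg"
  using R_cring by (simp add: cring_def)

lemma C_cring: "cring complex_ring"
  using module.axioms(1)[OF algebra.axioms(1)[OF algebra_R_alg]] .

lemma R_scalars_eq: "R_scalars = {Fl.cls (fps_const (Const c)) | c. True}"
  unfolding R_scalars_def R_alg_def Fl.one_cls Fl.smult_cls by (simp add: complex_ring_def)

lemma scalar_good: "fps_const (Const c) \<in> Fl.good"
  using Fl.good_scale[OF Fl.good_one, of c] by simp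

text \<open>Provides the uniqueness of dimensions in \<open>R_piece_dim_eq\<close>: the scalars are
  the image of the field \<complex> in a ring with 1 distinct from 0, as 1 does not vanish at the
  base point.\<close>

lemma subfield_R_scalars: "subfield R_scalars R_alg"
proof -
  let ?h = "\<lambda>c. Fl.cls (fps_const (Const c))"
  have "field complex_ring"
    by (rule cring.cring_fieldI2[OF C_cring]) (auto simp: complex_ring_def intro: exI[of _ "inverse _"] right_inverse)
  moreover have "?h \<in> ring_hom complex_ring R_alg"
  proof (rule ring_hom_memI)
    show "?h x \<in> carrier R_alg" for x
      unfolding R_alg_def Fl.carrier_eq using scalar_good by blast
    show "?h (x \<otimes>\<^bsub>complex_ring\<^esub> y) = ?h x \<otimes>\<^bsub>R_alg\<^esub> ?h y" for x y
      unfolding R_alg_def Fl.mult_cls[OF scalar_good scalar_good] by (simp add: complex_ring_def Const_mult)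
    show "?h (x \<oplus>\<^bsub>complex_ring\<^esub> y) = ?h x \<oplus>\<^bsub>R_alg\<^esub> ?h y" for x y
      unfolding R_alg_def Fl.add_cls by (simp add: complex_ring_def Const_add)
    show "?h \<one>\<^bsub>complex_ring\<^esub> = \<one>\<^bsub>R_alg\<^esub>"
      unfolding R_alg_def Fl.one_cls by (simp add: complex_ring_def)
  qed
  ultimately have hom: "ring_hom_ring complex_ring R_alg ?h" and C: "subfield (carrier complex_ring) complex_ring"
    using R_ring C_cring by (auto intro: ring_hom_ringI2 field.carrier_is_subfield simp: cring_def)
  have "\<one>\<^bsub>R_alg\<^esub> \<noteq> \<zero>\<^bsub>R_alg\<^esub>"
  proof
    assume "\<one>\<^bsub>R_alg\<^esub> = \<zero>\<^bsub>R_alg\<^esub>"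
    then have "Fl.cls 1 0 = Fl.cls 0 0" unfolding R_alg_def Fl.one_cls Fl.zero_cls by simp
    then have "(1 :: poly4) \<in> filt 1" by (simp add: Fl.cls_def Fl.coset_eq_iff Fl.coset_eq_zero_iff)
    then have "wpart xdeg 0 1 = 0" by (simp add: filt_iff vanishes_def)
    then show False by (simp add: xdeg.wpart_1)
  qed
  then have "subfield (?h ` carrier complex_ring) R_alg" by (rule ring_hom_ring.img_is_subfield(2)[OF hom C])
  moreover have "?h ` carrier complex_ring = R_scalars" unfolding R_scalars_eq by (auto simp: complex_ring_def)
  ultimately show ?thesis by simp
qed

section \<open>Dimensions of the bigraded pieces, and the Hilbert series\<close>

definition epiece :: "nat \<Rightarrow> nat \<Rightarrow> ((((nat \<times> nat) \<times> nat) \<times> nat) \<times> nat) set" where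
  "epiece d m = {y \<in> eidx d. eord y = m}"

definition class_span :: "nat \<Rightarrow> ((((nat \<times> nat) \<times> nat) \<times> nat) \<times> nat) set \<Rightarrow> (nat \<Rightarrow> poly4 set) set" where
  "class_span m Y = {gr_class filt m (\<Sum>y\<in>Y. Const (c y) * ebas y) | c. True}"

text \<open>Dimension is built up by line extensions, so basis elements are added one at a time. A
  new class lies outside the previous span: otherwise a combination with coefficient 1 at an element
  of order m would vanish to order m + 1, against \<open>ebas_coefficients\<close>.\<close>

lemma dimension_class_span:
  assumes "Y \<subseteq> epiece d m"
  shows "ring.dimension R_alg (card Y) R_scalars (class_span m Y)"
proof -
  have "finite Y" using assms finite_eidx by (auto simp: epiece_def intro: finite_subset)
  then show ?thesis using assms
  proof (induction Y rule: finite_induct)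
    case empty
    have "class_span m {} = {\<zero>\<^bsub>R_alg\<^esub>}"
      by (simp add: class_span_def gr_class_eq_cls fsing_0 R_alg_def Fl.zero_cls)
    then show ?case using ring.zero_dim[OF R_ring] by simp
  next
    case (insert y Y)
    have y: "y \<in> eidx d" "ebas y \<in> filt m" using insert.prems ebas_filt[of y d] by (auto simp: epiece_def)
    let ?v = "gr_class filt m (ebas y)"
    have v: "?v \<notin> class_span m Y"
    proof
      assume "?v \<in> class_span m Y"
      then obtain c where "ebas y - (\<Sum>y\<in>Y. Const (c y) * ebas y) \<in> filt (Suc m)"
        by (auto simp: class_span_def Fl.gr_class_eq_iff)
      moreover have "(\<Sum>z\<in>insert y Y. Const (if z = y then 1 else - c z) * ebas z) =
          ebas y - (\<Sum>y\<in>Y. Const (c y) * ebas y)"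
      proof -
        have "(\<Sum>z\<in>Y. Const (if z = y then 1 else - c z) * ebas z) = (\<Sum>z\<in>Y. - (Const (c z) * ebas z))"
          using insert.hyps(2) by (intro sum.cong) (auto simp: Const_uminus)
        then show ?thesis using insert.hyps by (simp add: sum_negf)
      qed
      ultimately have van: "vanishes xdeg (Suc m) (\<Sum>z\<in>insert y Y. Const (if z = y then 1 else - c z) * ebas z)"
        by (simp only: filt_iff)
      have sub: "insert y Y \<subseteq> eidx d" using insert.prems by (auto simp: epiece_def)
      have "(if y = y then 1 else - c y) = (0 :: complex)"
        by (rule ebas_coefficients[OF sub van]) (use insert.prems in \<open>auto simp: epiece_def\<close>)
      then show False by simp
    qed
    have step: "Fl.cls (fps_const (Const k)) \<otimes>\<^bsub>R_alg\<^esub> ?v \<oplus>\<^bsub>R_alg\<^esub> gr_class filt m f = gr_class filt m (Const k * ebas y + f)" for k f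
      unfolding gr_class_eq_cls R_alg_def Fl.mult_cls[OF scalar_good fsing_good[OF y(2)]] Fl.add_cls fsing_scale fsing_add ..
    have "class_span m (insert y Y) = ring.line_extension R_alg R_scalars ?v (class_span m Y)"
    proof (intro equalityI subsetI)
      fix u assume "u \<in> class_span m (insert y Y)"
      then obtain c where "u = gr_class filt m (Const (c y) * ebas y + (\<Sum>y\<in>Y. Const (c y) * ebas y))"
        using insert.hyps by (auto simp: class_span_def)
      then have "u = Fl.cls (fps_const (Const (c y))) \<otimes>\<^bsub>R_alg\<^esub> ?v \<oplus>\<^bsub>R_alg\<^esub>
          gr_class filt m (\<Sum>y\<in>Y. Const (c y) * ebas y)"
        by (simp only: step)
      moreover have "gr_class filt m (\<Sum>y\<in>Y. Const (c y) * ebas y) \<in> class_span m Y"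
        unfolding class_span_def by blast
      moreover have "Fl.cls (fps_const (Const (c y))) \<in> R_scalars" unfolding R_scalars_eq by blast
      ultimately show "u \<in> ring.line_extension R_alg R_scalars ?v (class_span m Y)"
        unfolding ring.line_extension_mem_iff[OF R_ring] by blast
    next
      fix u assume "u \<in> ring.line_extension R_alg R_scalars ?v (class_span m Y)"
      then obtain s v where sv: "s \<in> R_scalars" "v \<in> class_span m Y" "u = s \<otimes>\<^bsub>R_alg\<^esub> ?v \<oplus>\<^bsub>R_alg\<^esub> v"
        unfolding ring.line_extension_mem_iff[OF R_ring] by blast
      obtain k where k: "s = Fl.cls (fps_const (Const k))" using sv(1) unfolding R_scalars_eq by blast
      obtain c where "v = gr_class filt m (\<Sum>y\<in>Y. Const (c y) * ebas y)" using sv(2) unfolding class_span_def by blast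
      then have "u = gr_class filt m (Const k * ebas y + (\<Sum>y\<in>Y. Const (c y) * ebas y))"
        by (simp only: sv(3) k step)
      moreover have "Const k * ebas y + (\<Sum>y\<in>Y. Const (c y) * ebas y) = (\<Sum>z\<in>insert y Y. Const ((c(y := k)) z) * ebas z)"
      proof -
        have "(\<Sum>z\<in>Y. Const ((c(y := k)) z) * ebas z) = (\<Sum>y\<in>Y. Const (c y) * ebas y)"
          using insert.hyps(2) by (intro sum.cong) auto
        then show ?thesis using insert.hyps by simp
      qed
      ultimately have "u = gr_class filt m (\<Sum>z\<in>insert y Y. Const ((c(y := k)) z) * ebas z)" by (simp only:)
      then show "u \<in> class_span m (insert y Y)"
        unfolding class_span_def by (intro CollectI exI[of _ "c(y := k)"] conjI TrueI)
    qed
    moreover have "ring.dimension R_alg (card Y) R_scalars (class_span m Y)" using insert by blast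
    ultimately show ?case
      using ring.Suc_dim[OF R_ring gr_class_in_carrier[OF y(2)] v] insert.hyps by simp
  qed
qed

lemma T_deg_expand_filt:
  assumes "homogeneous d f" "f \<in> filt m"
  shows "\<exists>c. f = (\<Sum>y\<in>eidx d. Const (c y) * ebas y) \<and> (\<forall>y\<in>eidx d. eord y < m \<longrightarrow> c y = 0)"
proof -
  have "f \<in> T_deg d" using assms by (simp add: T_deg_def filt_iff)
  then obtain c where c: "f = (\<Sum>y\<in>eidx d. Const (c y) * ebas y)" using T_deg_expand by blast
  moreover have "c y = 0" if "y \<in> eidx d" "eord y < m" for y
    using assms(2) ebas_coefficients[OF subset_refl, of m c d y] that by (simp add: c filt_iff)
  ultimately show ?thesis by blast
qed

text \<open>Basis elements of order below m have coefficient 0, and those of order above m lie in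
  the next step of the filtration; so only order m is left in the class.\<close>

lemma gr_class_expand:
  assumes "homogeneous d f" "f \<in> filt m"
  shows "\<exists>c. gr_class filt m f = gr_class filt m (\<Sum>y\<in>epiece d m. Const (c y) * ebas y)"
proof -
  obtain c where c: "f = (\<Sum>y\<in>eidx d. Const (c y) * ebas y)" "\<forall>y\<in>eidx d. eord y < m \<longrightarrow> c y = 0"
    using T_deg_expand_filt[OF assms] by blast
  have split: "(\<Sum>y\<in>eidx d. Const (c y) * ebas y) =
      (\<Sum>y\<in>eidx d - epiece d m. Const (c y) * ebas y) + (\<Sum>y\<in>epiece d m. Const (c y) * ebas y)"
    using finite_eidx by (intro sum.subset_diff) (auto simp: epiece_def)
  have "(\<Sum>y\<in>eidx d - epiece d m. Const (c y) * ebas y) \<in> filt (Suc m)"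
  proof (rule Fl.sum)
    fix y assume y: "y \<in> eidx d - epiece d m"
    show "Const (c y) * ebas y \<in> filt (Suc m)"
    proof (cases "eord y < m")
      case True
      then have "c y = 0" using c(2) y by blast
      then show ?thesis using Fl.zero by simp
    next
      case False
      then have "Suc m \<le> eord y" using y by (auto simp: epiece_def)
      then show ?thesis using ebas_filt[of y d] y Fl.antimono Fl.scale by blast
    qed
  qed
  then have "gr_class filt m f = gr_class filt m (\<Sum>y\<in>epiece d m. Const (c y) * ebas y)"
    by (simp add: Fl.gr_class_eq_iff c(1) split)
  then show ?thesis by blast
qed

lemma R_piece_eq: "R_piece d m = class_span m (epiece d m)"
proof (intro equalityI subsetI)
  fix u assume "u \<in> R_piece d m"
  then obtain f where "u = gr_class filt m f" "homogeneous d f" "f \<in> filt m"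
    unfolding R_piece_def using T_deg_filt_iff by blast
  then show "u \<in> class_span m (epiece d m)" using gr_class_expand unfolding class_span_def by blast
next
  fix u assume "u \<in> class_span m (epiece d m)"
  then obtain c where u: "u = gr_class filt m (\<Sum>y\<in>epiece d m. Const (c y) * ebas y)" by (auto simp: class_span_def)
  have "homogeneous d (\<Sum>y\<in>epiece d m. Const (c y) * ebas y)"
    by (intro homogeneous_sum homogeneous_Const_mult ebas_properties) (simp add: epiece_def)
  moreover have "(\<Sum>y\<in>epiece d m. Const (c y) * ebas y) \<in> filt m"
    using ebas_filt by (intro Fl.sum Fl.scale) (auto simp: epiece_def)
  ultimately show "u \<in> R_piece d m" unfolding u R_piece_def using T_deg_filt_iff by blast
qed

lemma R_piece_has_dim_card: "R_piece_has_dim d m (card (epiece d m))"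
  unfolding R_piece_has_dim_def R_piece_eq by (rule dimension_class_span[OF subset_refl])

lemma R_piece_dim_eq: "R_piece_dim d m = card (epiece d m)"
  unfolding R_piece_dim_def
  using R_piece_has_dim_card ring.dimension_is_inj[OF R_ring subfield_R_scalars]
  by (intro the_equality) (auto simp: R_piece_has_dim_def)

text \<open>The classes of the basis elements of bidegree (d, m) form a basis of the piece, so the
  series counts standard monomials times powers of \<open>f2\<close> by both gradings; putting the
  three kinds of families over a common denominator gives \<open>HS_num\<close>.\<close>

theorem HS_eq: "HS = HS_num hs_u hs_v / HS_denom hs_u hs_v"
proof -
  let ?v = "\<lambda>i. (wd i, wm i)"
  let ?w = "shiftw (sw ?v) (2, 0)"
  have "epiece d m = {y \<in> sidx \<times> UNIV. ?w y = (d, m)}" for d m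
    by (auto simp: epiece_def eidx_def edeg_def eord_def shiftw_def sw_def)
  then have HS: "HS = wgf (sidx \<times> UNIV) ?w"
    by (simp add: HS_def wgf_def R_piece_dim_eq)
  have v: "?v 2 \<noteq> (0, 0)" "?v 6 \<noteq> (0, 0)" "?v 8 \<noteq> (0, 0)" "?v 10 \<noteq> (0, 0)" by (simp_all add: wd_simps)
  have b: "bmon (a, b) = hs_u ^ a * hs_v ^ b" for a b
    by (simp add: bmon_def hs_u_def hs_v_def fps_const_power)
  have c: "(2, 0) \<noteq> (0 :: nat, 0 :: nat)" by simp
  note s = wgf_sidx(2)[of ?v, OF v, unfolded wd_simps wm_simps b]
  note s' = wgf_shift[OF wgf_sidx(1)[of ?v, OF v] c, unfolded b]
  have "HS * HS_denom hs_u hs_v = (HS * (1 - hs_u ^ 2 * hs_v ^ 0)) *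
      ((1 - hs_u ^ 44 * hs_v ^ 12) * (1 - hs_u ^ 60 * hs_v ^ 16) * (1 - hs_u ^ 20 * hs_v ^ 4) * (1 - hs_u ^ 36 * hs_v ^ 10))"
    unfolding HS_denom_def by (simp only: power_0 mult_1_right mult_1_left mult_ac)
  also have "\<dots> = HS_num hs_u hs_v"
    unfolding HS s' s HS_num_def by Groebner_Basis.algebra
  finally have N: "HS * HS_denom hs_u hs_v = HS_num hs_u hs_v" .
  have "HS_denom hs_u hs_v \<noteq> 0"
  proof
    assume "HS_denom hs_u hs_v = 0"
    then have "(1 :: rat fps fps) = 0" using HS_denom_unit[of 1] by simp
    then show False by simp
  qed
  moreover have "(HS_num hs_u hs_v / HS_denom hs_u hs_v) * HS_denom hs_u hs_v = HS * HS_denom hs_u hs_v"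
    by (simp only: HS_denom_unit N)
  ultimately show ?thesis using mult_right_cancel by metis
qed

section \<open>Generation by the twelve classes\<close>

lemma gens_filt: "i < 12 \<Longrightarrow> gens i \<in> filt (wm i)"
  using lf_gens(1)[of i] gens_T_inv[of i] by (auto simp: filt_iff lf_def)

lemma R_gens_set: "set R_gens = (\<lambda>i. (wd i, wm i, gens i)) ` {..<12}"
proof -
  have "length R_gens = 12" by (simp add: R_gens_def)
  then have "set R_gens = (!) R_gens ` {..<12}" by (auto simp: set_conv_nth image_iff)
  then show ?thesis by (simp add: wd_def wm_def gens_def)
qed

lemma R_gens_in_pieces: "\<forall>(d, m, f) \<in> set R_gens. f \<in> T_deg d \<inter> ideal_power I_pt m"
  unfolding R_gens_set T_deg_filt_iff using homogeneous_gens gens_filt by auto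

abbreviation gen_classes :: "(nat \<Rightarrow> poly4 set) set" where
  "gen_classes \<equiv> {gr_class filt m f | d m f. (d, m, f) \<in> set R_gens}"

lemma gen_classes_eq: "gen_classes = (\<lambda>i. gr_class filt (wm i) (gens i)) ` {..<12}"
  unfolding R_gens_set by (auto simp: image_iff)

lemma fsing_eq: "fsing m f = fps_X ^ m * fps_const f"
  by (simp add: fsing_def fps_eq_iff fps_X_power_mult_nth)

text \<open>The predicate \<open>?P\<close> lifts membership in H to representing series, where
  products are products of polynomials. It spreads from the generators to standard monomials and
  basis elements, and from these to all families by \<open>gr_class_expand\<close>.\<close>

lemma generates:
  assumes H: "subring H R_alg" "\<forall>c\<in>carrier complex_ring. \<forall>h\<in>H. c \<odot>\<^bsub>R_alg\<^esub> h \<in> H" "gen_classes \<subseteq> H"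
  shows "carrier R_alg \<subseteq> H"
proof -
  note zero = subringE(2)[OF H(1)] and one = subringE(3)[OF H(1)] and mult = subringE(6)[OF H(1)] and add = subringE(7)[OF H(1)]
  let ?P = "\<lambda>F. F \<in> Fl.good \<and> Fl.cls F \<in> H"
  have Pm: "?P (F * G)" if "?P F" "?P G" for F G
    using that mult[of "Fl.cls F" "Fl.cls G"] Fl.good_mult[of F G] Fl.mult_cls[of F G] by (simp add: R_alg_def)
  have P1: "?P 1" using one Fl.good_one by (simp add: R_alg_def Fl.one_cls)
  have Pa: "?P (F + G)" if "?P F" "?P G" for F G
    using that add[of "Fl.cls F" "Fl.cls G"] Fl.good_add[of F G] by (simp add: R_alg_def Fl.add_cls)
  have P0: "?P 0" using zero Fl.good_zero by (simp add: R_alg_def Fl.zero_cls)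
  have Pc: "?P (fps_const (Const c) * F)" if "?P F" for c F
    using that H(2) Fl.good_scale[of F c] by (simp add: R_alg_def Fl.smult_cls[symmetric] complex_ring_def)
  have Pg: "?P (fsing (wm i) (gens i))" if "i < 12" for i
  proof -
    have "gr_class filt (wm i) (gens i) \<in> gen_classes" unfolding gen_classes_eq using that by blast
    then have "gr_class filt (wm i) (gens i) \<in> H" using H(3) by blast
    then show ?thesis using fsing_good[OF gens_filt[OF that]] by (simp only: gr_class_eq_cls simp_thms)
  qed
  have Ps: "?P (fsing (sweight wm x) (smon gens x))" if x: "x \<in> sidx" for x
  proof -
    have "smon (\<lambda>i. fsing (wm i) (gens i)) x = smon (\<lambda>i. fps_X ^ wm i) x * smon (\<lambda>i. fps_const (gens i)) x"
      unfolding fsing_eq using x by (rule smon_mult)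
    also have "\<dots> = fps_X ^ sweight wm x * fps_const (smon gens x)"
      using smon_power[OF x, of "fps_X :: poly4 fps" wm] smon_hom[of fps_const x gens] x by simp
    finally have "smon (\<lambda>i. fsing (wm i) (gens i)) x = fsing (sweight wm x) (smon gens x)" by (simp only: fsing_eq)
    moreover have "?P (smon (\<lambda>i. fsing (wm i) (gens i)) x)"
      using x P1 Pm Pg by (rule smon_closed)
    ultimately show ?thesis by simp
  qed
  have Pf: "?P (fsing 0 (f2 ^ l))" for l
  proof (induction l)
    case 0
    have "fsing 0 1 = 1" by (simp add: fsing_eq)
    then show ?case using P1 by simp
  next
    case (Suc l)
    have "fsing 0 (f2 ^ Suc l) = fsing 0 (gens 0) * fsing 0 (f2 ^ l)" by (simp add: fsing_eq gens_simps)
    then show ?case using Pm[OF _ Suc] Pg[of 0] by (simp add: wm_simps)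
  qed
  have Pe: "?P (fsing (eord y) (ebas y))" if y: "y \<in> eidx d" for y d
  proof -
    obtain x l where xl: "y = (x, l)" by (cases y)
    have "fsing (eord y) (ebas y) = fsing 0 (f2 ^ l) * fsing (sweight wm x) (smon gens x)"
      by (simp add: fsing_eq xl eord_def ebas_def mult_ac flip: fps_const_mult)
    then show ?thesis using Pm[OF Pf Ps] y by (simp add: xl eidx_def)
  qed
  have Psum: "?P (\<Sum>i\<in>J. F i)" if "\<And>i. i \<in> J \<Longrightarrow> ?P (F i)" for F and J :: "'i set"
    using that by (induction J rule: infinite_finite_induct) (auto simp: P0 intro!: Pa)
  have Ph: "gr_class filt m f \<in> H" if hf: "homogeneous d f" "f \<in> filt m" for d m f
  proof -
    obtain c where c: "gr_class filt m f = gr_class filt m (\<Sum>y\<in>epiece d m. Const (c y) * ebas y)"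
      using gr_class_expand[OF hf] by blast
    have e: "fsing m (\<Sum>y\<in>Y. Const (c y) * ebas y) = (\<Sum>y\<in>Y. fps_const (Const (c y)) * fsing m (ebas y))" for Y
      by (induction Y rule: infinite_finite_induct) (simp_all add: fsing_0 fsing_scale flip: fsing_add)
    have p: "?P (\<Sum>y\<in>epiece d m. fps_const (Const (c y)) * fsing m (ebas y))"
    proof (rule Psum)
      fix y assume "y \<in> epiece d m"
      then show "?P (fps_const (Const (c y)) * fsing m (ebas y))"
        using Pc[OF Pe[of y d]] by (simp add: epiece_def)
    qed
    show ?thesis unfolding c unfolding gr_class_eq_cls e using p by blast
  qed
  \<comment> \<open>Elements of the filtration need not be homogeneous, but their homogeneous
    components are again invariant and of no smaller order.\<close>
  have Pk: "?P (fsing k f)" if f: "f \<in> filt k" for k f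
  proof -
    obtain N where "\<forall>m\<in>Poly_Mapping.keys f. mdeg m \<le> N" using wpart_bounded by blast
    then have s: "f = (\<Sum>j\<le>N. wpart mdeg j f)" by (simp add: sum_wpart)
    have 1: "fsing k (\<Sum>j\<in>J. g j) = (\<Sum>j\<in>J. fsing k (g j))" for J and g :: "nat \<Rightarrow> poly4"
      by (induction J rule: infinite_finite_induct) (simp_all add: fsing_0 flip: fsing_add)
    have "?P (fsing k (wpart mdeg j f))" for j
    proof -
      have "wpart mdeg j f \<in> T_inv" using f by (simp add: filt_iff T_inv_def flip: wpart_mdeg_act)
      moreover have "vanishes xdeg k (wpart mdeg j f)"
        using f unfolding filt_iff vanishes_iff_keys
        by (auto simp: in_keys_iff lookup_wpart split: if_splits)
      ultimately have "wpart mdeg j f \<in> filt k" by (simp add: filt_iff)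
      from Ph[OF homogeneous_wpart_mdeg this] fsing_good[OF this] show ?thesis
        by (simp only: gr_class_eq_cls simp_thms)
    qed
    then have "?P (\<Sum>j\<le>N. fsing k (wpart mdeg j f))" by (rule Psum)
    then show ?thesis using 1[of "\<lambda>j. wpart mdeg j f" "{..N}"] s by simp
  qed
  show ?thesis
  proof
    fix u assume "u \<in> carrier R_alg"
    then obtain F where F: "F \<in> Fl.good" "u = Fl.cls F" by (auto simp: R_alg_def Fl.carrier_eq)
    let ?K = "{k. fps_nth F k \<noteq> 0}"
    have fin: "finite ?K" and A: "fps_nth F k \<in> filt k" for k using F(1) by (auto simp: Fl.good_def)
    have "F = (\<Sum>k\<in>?K. fsing k (fps_nth F k))"
    proof (rule fps_ext)
      fix n
      have "fps_nth (\<Sum>k\<in>?K. fsing k (fps_nth F k)) n = (\<Sum>k\<in>?K. if k = n then fps_nth F n else 0)"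
        unfolding fps_sum_nth by (rule sum.cong) (auto simp: fsing_def)
      then show "fps_nth F n = fps_nth (\<Sum>k\<in>?K. fsing k (fps_nth F k)) n" using fin by simp
    qed
    moreover have "?P (\<Sum>k\<in>?K. fsing k (fps_nth F k))" by (rule Psum) (rule Pk[OF A])
    ultimately show "u \<in> H" using F(2) by simp
  qed
qed

lemma gen_classes_generate: "generated_subalgebra complex_ring R_alg gen_classes = carrier R_alg"
  unfolding generated_subalgebra_def
proof (intro equalityI Inter_greatest)
  have "subring (carrier R_alg) R_alg" using ring.carrier_is_subring[OF R_ring] .
  moreover have "\<forall>c\<in>carrier complex_ring. \<forall>h\<in>carrier R_alg. c \<odot>\<^bsub>R_alg\<^esub> h \<in> carrier R_alg"
    using module.smult_closed[OF algebra.axioms(1)[OF algebra_R_alg]] by blast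
  moreover have "gen_classes \<subseteq> carrier R_alg"
    unfolding gen_classes_eq using gens_filt gr_class_in_carrier by auto
  ultimately show "\<Inter> {H. subring H R_alg \<and> (\<forall>c\<in>carrier complex_ring. \<forall>h\<in>H. c \<odot>\<^bsub>R_alg\<^esub> h \<in> H) \<and> gen_classes \<subseteq> H} \<subseteq> carrier R_alg"
    by (intro Inter_lower) simp
next
  fix H assume "H \<in> {H. subring H R_alg \<and> (\<forall>c\<in>carrier complex_ring. \<forall>h\<in>H. c \<odot>\<^bsub>R_alg\<^esub> h \<in> H) \<and> gen_classes \<subseteq> H}"
  then show "carrier R_alg \<subseteq> H" by (intro generates) auto
qed

lemma R_finitely_generated: "finitely_generated_algebra complex_ring R_alg"
  unfolding finitely_generated_algebra_def
proof (intro conjI exI[of _ gen_classes])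
  show "finite gen_classes" unfolding gen_classes_eq by simp
  show "gen_classes \<subseteq> carrier R_alg"
    unfolding gen_classes_eq using gens_filt gr_class_in_carrier by auto
qed (rule algebra_R_alg gen_classes_generate)+

section \<open>The Waldschmidt constant\<close>

text \<open>The inequality 18 m \<le> 5 d is the slope bound 36/10. It holds for each generator and
  adds up over monomials; a nonzero f in the filtration step m involves some basis element of order
  at least m, which has the degree of f.\<close>

lemma slope_bound:
  assumes "f \<in> filt m" "homogeneous d f" "f \<noteq> 0"
  shows "18 * m \<le> 5 * d"
proof -
  obtain c where c: "f = (\<Sum>y\<in>eidx d. Const (c y) * ebas y)" "\<forall>y\<in>eidx d. eord y < m \<longrightarrow> c y = 0"
    using T_deg_expand_filt[OF assms(2,1)] by blast
  have "\<exists>y\<in>eidx d. m \<le> eord y"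
  proof (rule ccontr)
    assume "\<not> ?thesis"
    then have "\<forall>y\<in>eidx d. c y = 0" using c(2) by auto
    then have "f = 0" unfolding c(1) by simp
    then show False using assms(3) by simp
  qed
  then obtain x l where y: "(x, l) \<in> eidx d" "m \<le> sweight wm x" by (auto simp: eord_def)
  then have x: "x \<in> sidx" and d: "sweight wd x + l * 2 = d" by (auto simp: eidx_def edeg_def)
  have "sweight (\<lambda>i. 18 * wm i) x \<le> sweight (\<lambda>i. 5 * wd i) x"
  proof (rule sweight_mono[OF x])
    fix i :: nat assume "i < 12"
    then show "18 * wm i \<le> 5 * wd i"
      unfolding less_12 by (elim insertE emptyE) (simp_all add: wd_simps wm_simps)
  qed
  then show ?thesis using d y(2) x by (simp add: sweight_mult)
qed

section \<open>Points of the orbit and their ideals\<close>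

definition cvec :: "real ^ 4 \<Rightarrow> complex ^ 4" where
  "cvec r = (\<chi> i. complex_of_real (r $ i))"

lemma Const_prod: "Const (prod f J) = (\<Prod>j\<in>J. Const (f j))"
  by (induction J rule: infinite_finite_induct) (simp_all add: Const_mult)

lemma eval_at_subst: "Const (eval_at f a) = subst (\<lambda>i. Const (a $ i)) f"
  by (simp add: eval_at_def subst_def Const_sum Const_mult Const_prod Const_power)

lemma ideal_power_hom_image:
  assumes "\<And>f g. \<phi> (f * g) = \<phi> f * \<phi> g" "\<And>f g. \<phi> (f + g) = \<phi> f + \<phi> g" "\<phi> 0 = 0" "\<phi> 1 = 1"
    and J: "\<And>f. f \<in> J \<Longrightarrow> \<phi> f \<in> J'" and f: "f \<in> ideal_power J m"
  shows "\<phi> f \<in> ideal_power J' m"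
proof -
  have p: "\<phi> a \<in> J' ^ m" if "a \<in> J ^ m" for a
    using that
  proof (induction m arbitrary: a)
    case (Suc m)
    then obtain b c where "a = b * c" "b \<in> J" "c \<in> J ^ m" by (auto simp: set_times_def)
    then show ?case using Suc.IH[of c] J[of b] assms(1) by (auto simp: set_times_def)
  qed (simp add: assms(4))
  show ?thesis using f unfolding ideal_power_def ideal_gen_def
  proof (induction rule: S_mod.span_induct_alt)
    case base
    show ?case by (simp add: assms(3) S_mod.span_zero)
  next
    case (step c x y)
    then show ?case unfolding assms(1,2) by (intro S_mod.span_add S_mod.span_scale[OF S_mod.span_base[OF p]])
  qed
qed

lemma ideal_gen_hom_image:
  assumes "\<And>f g. \<phi> (f * g) = \<phi> f * \<phi> g" "\<And>f g. \<phi> (f + g) = \<phi> f + \<phi> g" "\<phi> 0 = 0"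
    and X: "\<And>f. f \<in> X \<Longrightarrow> \<phi> f \<in> X'" and f: "f \<in> ideal_gen X"
  shows "\<phi> f \<in> ideal_gen X'"
  using f unfolding ideal_gen_def
proof (induction rule: S_mod.span_induct_alt)
  case base
  show ?case by (simp add: assms(3) S_mod.span_zero)
next
  case (step c x y)
  then show ?case unfolding assms(1,2) by (intro S_mod.span_add S_mod.span_scale[OF S_mod.span_base[OF X]])
qed

text \<open>An orthogonal map preserves the pairing of linear forms with vectors; the scalar z lets
  the vector run through the whole line in \<complex>^4 that is the projective point.\<close>

lemma eval_at_act:
  assumes g: "g \<in> W_H4"
  shows "eval_at (act g f) (\<chi> i. z * cvec (g r) $ i) = eval_at f (\<chi> i. z * cvec r $ i)"
proof -
  have "(\<Sum>j\<in>UNIV. g (axis i 1) $ j * g r $ j) = r $ i" for i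
  proof -
    have "(\<Sum>j\<in>UNIV. g (axis i 1) $ j * g r $ j) = g (axis i 1) \<bullet> g r" by (simp add: inner_vec_def)
    also have "\<dots> = axis i 1 \<bullet> r" by (rule W_inner[OF g])
    finally show ?thesis by (simp add: inner_axis')
  qed
  then have "(\<Sum>j\<in>UNIV. Const (complex_of_real (g (axis i 1) $ j)) * Const (z * complex_of_real (g r $ j))) = Const (z * complex_of_real (r $ i))" for i
  proof -
    have "(\<Sum>j\<in>UNIV. Const (complex_of_real (g (axis i 1) $ j)) * Const (z * complex_of_real (g r $ j))) =
        Const (z * complex_of_real (\<Sum>j\<in>UNIV. g (axis i 1) $ j * g r $ j))"
      by (simp add: Const_sum sum_distrib_left mult_ac flip: Const_mult)
    then show ?thesis by (simp only: \<open>\<And>i. (\<Sum>j\<in>UNIV. g (axis i 1) $ j * g r $ j) = r $ i\<close>)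
  qed
  then have "Const (eval_at (act g f) (\<chi> i. z * cvec (g r) $ i)) = Const (eval_at f (\<chi> i. z * cvec r $ i))"
    unfolding eval_at_subst act_def subst_subst
    by (simp add: cvec_def subst_sum subst_mult subst_Const)
  then show ?thesis by (simp add: Const_eq_iff)
qed

lemma act_point_ideal:
  assumes g: "g \<in> W_H4" and f: "f \<in> ideal_power (point_ideal (proj_point (cvec r))) m"
  shows "act g f \<in> ideal_power (point_ideal (proj_point (cvec (g r)))) m"
proof -
  have pp: "a \<in> proj_point (cvec r) \<longleftrightarrow> (\<exists>z. a = (\<chi> i. z * cvec r $ i))" for a r
    unfolding proj_point_def vec.span_singleton by (auto simp: vec_eq_iff)
  have "act g f \<in> point_ideal (proj_point (cvec (g r)))" if "f \<in> point_ideal (proj_point (cvec r))" for f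
    using that unfolding point_ideal_def
  proof (rule ideal_gen_hom_image[rotated 4])
    fix f assume "f \<in> {f. (\<exists>d. homogeneous d f) \<and> (\<forall>a\<in>proj_point (cvec r). eval_at f a = 0)}"
    then obtain d where d: "homogeneous d f" and fv: "\<forall>a\<in>proj_point (cvec r). eval_at f a = 0" by auto
    have "eval_at (act g f) a = 0" if "a \<in> proj_point (cvec (g r))" for a
    proof -
      from iffD1[OF pp that] obtain z where a: "a = (\<chi> i. z * cvec (g r) $ i)" ..
      have "(\<chi> i. z * cvec r $ i) \<in> proj_point (cvec r)" by (rule iffD2[OF pp]) (rule exI, rule refl)
      with fv show ?thesis unfolding a eval_at_act[OF g] by (rule bspec)
    qed
    moreover have "\<exists>d. homogeneous d (act g f)" using homogeneous_act[OF d] by (rule exI)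
    ultimately show "act g f \<in> {f. (\<exists>d. homogeneous d f) \<and> (\<forall>a\<in>proj_point (cvec (g r)). eval_at f a = 0)}"
      by (intro CollectI conjI ballI)
  qed (simp_all add: act_hom)
  then show ?thesis using f by (intro ideal_power_hom_image[of "act g"]) (simp_all add: act_hom)
qed

text \<open>A form of degree d vanishes at the base point exactly when it has no term w^d, the only
  monomial of degree d free of x, y, z.\<close>

lemma point_ideal_base: "point_ideal (proj_point (cvec (axis 4 1))) = I_pt"
proof -
  have pp: "a \<in> proj_point (cvec (axis 4 1)) \<longleftrightarrow> (\<exists>z. a = (\<chi> i. if i = 4 then z else 0))" for a
    unfolding proj_point_def vec.span_singleton by (auto simp: vec_eq_iff cvec_def axis_def)
  have van: "f \<in> I_pt \<longleftrightarrow> vanishes xdeg 1 f" for f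
  proof
    assume "vanishes xdeg 1 f"
    then have "f \<in> ideal_power I_pt 1" by (simp add: ideal_power_I_pt_iff)
    then show "f \<in> I_pt" unfolding ideal_power_def ideal_gen_def I_pt_def by (simp only: power_one_right S_mod.span_span)
  qed (rule I_pt_vanishes)
  have ev: "eval_at f (\<chi> i. if i = 4 then z else 0) = eval_at (wpart xdeg 0 f) (\<chi> i. if i = 4 then z else 0)" for f z
  proof -
    let ?s = "subst (\<lambda>i. Const ((\<chi> i. if i = 4 then z else 0) $ i))"
    have "?s f = ?s (wpart xdeg 0 f)"
    proof (induction f rule: poly_single_induct)
      case (single m c)
      show ?case
      proof (cases "xdeg m = 0")
        case False
        then have "Poly_Mapping.lookup m 1 \<noteq> 0 \<or> Poly_Mapping.lookup m 2 \<noteq> 0 \<or> Poly_Mapping.lookup m 3 \<noteq> 0"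
          by (auto simp: xdeg_def)
        then obtain i where "i \<noteq> 4" "Poly_Mapping.lookup m i \<noteq> 0" using four_neq by blast
        then have "(\<Prod>i\<in>UNIV. Const ((\<chi> i. if i = 4 then z else 0) $ i) ^ Poly_Mapping.lookup m i) = 0"
          by (intro prod_zero) (auto intro!: bexI[of _ i])
        then show ?thesis using False by (simp add: subst_single wpart_single subst_0)
      qed (simp add: wpart_single)
    qed (simp add: subst_add wpart_add)
    then have "Const (eval_at f (\<chi> i. if i = 4 then z else 0)) = Const (eval_at (wpart xdeg 0 f) (\<chi> i. if i = 4 then z else 0))"
      unfolding eval_at_subst .
    then show ?thesis by (simp only: Const_eq_iff)
  qed
  show ?thesis
  proof (intro equalityI)
    have "{f. (\<exists>d. homogeneous d f) \<and> (\<forall>a\<in>proj_point (cvec (axis 4 1)). eval_at f a = 0)} \<subseteq> I_pt"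
    proof
      fix f assume f: "f \<in> {f. (\<exists>d. homogeneous d f) \<and> (\<forall>a\<in>proj_point (cvec (axis 4 1)). eval_at f a = 0)}"
      then obtain d where d: "homogeneous d f" by auto
      have "wpart xdeg 0 f = Const (Poly_Mapping.lookup f (Poly_Mapping.single 4 d)) * Var 4 ^ d"
      proof (rule poly_mapping_eqI)
        fix m
        have "m = Poly_Mapping.single 4 d" if "xdeg m = 0" "Poly_Mapping.lookup f m \<noteq> 0"
        proof -
          have "mdeg m = d" using d that(2) by (simp add: homogeneous_def in_keys_iff)
          moreover have "Poly_Mapping.lookup m i = 0" if "i \<noteq> 4" for i
            using \<open>xdeg m = 0\<close> that exhaust_4[of i] by (auto simp: xdeg_def)
          ultimately show ?thesis
            by (intro mon4_eqI) (auto simp: mdeg_def sum_4 lookup_single when_def)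
        qed
        moreover have "xdeg (Poly_Mapping.single 4 d) = 0" by (simp add: xdeg_single)
        ultimately show "Poly_Mapping.lookup (wpart xdeg 0 f) m =
            Poly_Mapping.lookup (Const (Poly_Mapping.lookup f (Poly_Mapping.single 4 d)) * Var 4 ^ d) m"
          unfolding lookup_wpart lookup_Const_mult Var_power lookup_single by (auto simp: when_def)
      qed
      moreover have mem: "(\<chi> i. if i = 4 then 1 else 0) \<in> proj_point (cvec (axis 4 1))"
        by (rule iffD2[OF pp]) (rule exI, rule refl)
      have "eval_at (wpart xdeg 0 f) (\<chi> i. if i = 4 then 1 else 0) = 0"
        unfolding ev[symmetric] using f mem by blast
      then have "subst (\<lambda>i. Const ((\<chi> i. if i = 4 then 1 else 0) $ i)) (wpart xdeg 0 f) = 0"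
        unfolding eval_at_subst[symmetric] by simp
      ultimately have "wpart xdeg 0 f = 0" by (simp add: subst_mult subst_Const subst_power)
      then show "f \<in> I_pt" unfolding van by (simp add: vanishes_def)
    qed
    then show "point_ideal (proj_point (cvec (axis 4 1))) \<subseteq> I_pt"
      unfolding point_ideal_def ideal_gen_def I_pt_def by (intro S_mod.span_minimal) (auto simp: S_mod.subspace_span)
    have "eval_at (Var i) a = 0" if i: "i \<noteq> 4" and ain: "a \<in> proj_point (cvec (axis 4 1))" for i a
    proof -
      from iffD1[OF pp ain] obtain z where a: "a = (\<chi> i. if i = 4 then z else 0)" ..
      have w: "wpart xdeg 0 (Var i) = 0" using i by (simp add: wpart_xdeg_Var)
      have z: "eval_at 0 b = 0" for b by (simp add: eval_at_def)
      show ?thesis using ev[of "Var i" z] unfolding a w z .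
    qed
    then show "I_pt \<subseteq> point_ideal (proj_point (cvec (axis 4 1)))"
      unfolding I_pt_def point_ideal_def ideal_gen_def using homogeneous_Var
      by (intro S_mod.span_mono) (auto intro!: exI[of _ 1])
  qed
qed

lemma root_orbit: "r \<in> H4 \<Longrightarrow> \<exists>g\<in>W_H4. g (axis 4 1) = r"
proof -
  assume "r \<in> H4"
  then obtain g where g: "g \<in> W_H4" "g (axis 1 1) = r" using reachable by blast
  obtain h where h: "h \<in> W_H4" "h (axis 1 1) = axis 4 1" using reachable axis_in_H4 by blast
  obtain k where k: "k \<in> W_H4" "\<forall>v. k (h v) = v" using W_inverse[OF h(1)] by blast
  have "(\<lambda>v. g (k v)) \<in> W_H4" by (rule comp_in_W[OF g(1) k(1)])
  moreover have "k (axis 4 1) = axis 1 1" using k(2) h(2) by metis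
  ultimately show ?thesis using g(2) by (metis (no_types, lifting))
qed

lemma H4_proj_eq: "H4_proj = (\<lambda>r. proj_point (cvec r)) ` H4"
  by (simp add: H4_proj_def cvec_def)

text \<open>An invariant has the same multiplicity at all points of an orbit, so order m at the base
  point suffices.\<close>

lemma filt_symbolic: "filt m \<subseteq> symbolic_power H4_proj m"
  unfolding symbolic_power_def H4_proj_eq
proof (intro subsetI INT_I)
  fix f P assume f: "f \<in> filt m" and "P \<in> (\<lambda>r. proj_point (cvec r)) ` H4"
  then obtain r where r: "r \<in> H4" "P = proj_point (cvec r)" by blast
  obtain g where g: "g \<in> W_H4" "g (axis 4 1) = r" using root_orbit[OF r(1)] by blast
  have "f \<in> ideal_power (point_ideal (proj_point (cvec (axis 4 1)))) m"
    using f by (simp add: filt_def point_ideal_base)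
  from act_point_ideal[OF g(1) this] show "f \<in> ideal_power (point_ideal P) m"
    using f g by (simp add: r(2) filt_def T_inv_def)
qed

lemma act_injective: "g \<in> W_H4 \<Longrightarrow> act g f = 0 \<Longrightarrow> f = 0"
proof -
  assume g: "g \<in> W_H4" and 0: "act g f = 0"
  obtain h where h: "h \<in> W_H4" "\<forall>v. h (g v) = v" using W_inverse[OF g] by blast
  have "act h (act g f) = act (\<lambda>v. h (g v)) f" by (rule act_comp[OF W_linear[OF h(1)]])
  also have "(\<lambda>v. h (g v)) = (\<lambda>v. v)" using h(2) by simp
  finally show ?thesis using 0 by (simp add: act_id act_hom)
qed

text \<open>The norm of a form with multiplicity \<open>m\<close> at every point of the orbit is an invariant to which \<open>slope_bound\<close> applies.\<close>

lemma symbolic_bound: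
  assumes "f \<in> symbolic_power H4_proj m" "homogeneous d f" "f \<noteq> 0"
  shows "18 * m \<le> 5 * d"
proof -
  \<comment> \<open>f has multiplicity at least m at every point of the orbit, hence each of its
    transforms has it at the base point.\<close>
  have van: "vanishes xdeg m (act g f)" if g: "g \<in> W_H4" for g
  proof -
    obtain h where h: "h \<in> W_H4" "\<forall>v. g (h v) = v" using W_inverse[OF g] by blast
    have "h (axis 4 1) \<in> H4" by (rule W_preserves_H4[OF h(1) axis_in_H4])
    then have "f \<in> ideal_power (point_ideal (proj_point (cvec (h (axis 4 1))))) m"
      using assms(1) by (auto simp: symbolic_power_def H4_proj_eq)
    from act_point_ideal[OF g this] show ?thesis
      using h(2) by (simp add: point_ideal_base ideal_power_I_pt_iff)
  qed
  let ?N = "\<Prod>g\<in>W_H4. act g f" and ?n = "card W_H4"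
  have "homogeneous (card G * d) (\<Prod>g\<in>G. act g f) \<and> vanishes xdeg (card G * m) (\<Prod>g\<in>G. act g f)"
    if "finite G" "G \<subseteq> W_H4" for G
    using that
  proof (induction G rule: finite_induct)
    case (insert g G)
    then show ?case
      using homogeneous_mult[OF homogeneous_act[OF assms(2), of g]] xdeg.vanishes_mult[OF van[of g]] by simp
  qed (use homogeneous_Const[of 1] in simp)
  then have N: "homogeneous (?n * d) ?N" "vanishes xdeg (?n * m) ?N" using finite_W by auto
  have "act h ?N = ?N" if h: "h \<in> W_H4" for h
  proof -
    obtain k where k: "k \<in> W_H4" "\<forall>v. h (k v) = v" "\<forall>v. k (h v) = v" using W_inverse[OF h] by blast
    have "bij_betw (\<lambda>g v. h (g v)) W_H4 W_H4"
      using comp_in_W[OF h] comp_in_W[OF k(1)]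
      by (intro bij_betw_byWitness[of _ "\<lambda>g v. k (g v)"]) (auto simp: k)
    then have "(\<Prod>g\<in>W_H4. act (\<lambda>v. h (g v)) f) = ?N" by (rule prod.reindex_bij_betw)
    then show ?thesis by (simp add: act_prod act_comp W_linear h)
  qed
  then have "?N \<in> filt (?n * m)" using N(2) by (simp add: filt_iff T_inv_def)
  moreover have "?N \<noteq> 0" using finite_W act_injective assms(3) by (auto simp: prod_zero_iff)
  ultimately have "18 * (?n * m) \<le> 5 * (?n * d)" using N(1) slope_bound by blast
  then have "?n * (18 * m) \<le> ?n * (5 * d)" by (simp only: mult.left_commute)
  then show ?thesis using card_W by simp
qed

lemma g36_filt: "gens 6 \<in> filt 10" "homogeneous 36 (gens 6)" "gens 6 \<noteq> 0"
proof -
  show f: "gens 6 \<in> filt 10" "homogeneous 36 (gens 6)"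
    using gens_filt[of 6] homogeneous_gens[of 6] by (simp_all add: wm_simps wd_simps)
  have y: "(((((4, 0), 0), 0), 0) :: (((nat \<times> nat) \<times> nat) \<times> nat) \<times> nat) \<in> eidx 36"
    by (simp add: eidx_def sidx_def edeg_def sweight_def wd_simps)
  have e: "ebas ((((4, 0), 0), 0), 0) = gens 6" by (simp add: ebas_def smon_def shead_def)
  show "gens 6 \<noteq> 0"
  proof
    assume "gens 6 = 0"
    then have "0 \<in> ebas ` eidx 36" using y e by (metis imageI)
    then show False using ebas_independent(2)[of 36] Sv.dependent_zero by blast
  qed
qed

text \<open>Guarantees that the minimum in \<open>initial_degree\<close> is attained by an actual
  form; the crude witness is a power of the generator of bidegree (36, 10).\<close>

lemma symbolic_power_nonzero: "\<exists>d. \<exists>f\<in>symbolic_power H4_proj m. f \<noteq> 0 \<and> homogeneous d f"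
proof -
  have "gens 6 ^ m \<in> filt m"
  proof (induction m)
    case 0
    show ?case using Fl.one by simp
  next
    case (Suc m)
    have "gens 6 \<in> filt 1" using g36_filt(1) Fl.antimono[of 1 10] by auto
    from Fl.mult[OF this Suc] show ?case by simp
  qed
  moreover have "homogeneous (m * 36) (gens 6 ^ m)" by (rule homogeneous_power[OF g36_filt(2)])
  moreover have "gens 6 ^ m \<noteq> 0" using g36_filt(3) by simp
  ultimately show ?thesis using filt_symbolic by blast
qed

theorem waldschmidt_H4: "waldschmidt H4_proj = 36 / 10"
  unfolding waldschmidt_def
proof (rule antisym)
  let ?q = "\<lambda>m. real (initial_degree (symbolic_power H4_proj m)) / real m"
  have lower: "36 / 10 \<le> ?q m" if "m \<in> {1..}" for m
  proof -
    have "\<exists>f\<in>symbolic_power H4_proj m. f \<noteq> 0 \<and> homogeneous (initial_degree (symbolic_power H4_proj m)) f"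
      unfolding initial_degree_def using symbolic_power_nonzero[of m] by (rule LeastI_ex)
    then have "18 * m \<le> 5 * initial_degree (symbolic_power H4_proj m)" using symbolic_bound by blast
    then have "18 * real m \<le> 5 * real (initial_degree (symbolic_power H4_proj m))"
      by (metis (mono_tags) of_nat_le_iff of_nat_mult of_nat_numeral)
    then show ?thesis using that by (simp add: field_simps)
  qed
  then show "36 / 10 \<le> (INF m\<in>{1..}. ?q m)" by (intro cINF_greatest) auto
  have "bdd_below (?q ` {1..})" by (rule bdd_belowI[of _ 0]) auto
  \<comment> \<open>The infimum is reached at m = 10, by the generator of bidegree (36, 10)
    itself.\<close>
  then have "(INF m\<in>{1..}. ?q m) \<le> ?q 10" by (rule cINF_lower) simp
  also have "initial_degree (symbolic_power H4_proj 10) \<le> 36"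
    unfolding initial_degree_def using g36_filt filt_symbolic[of 10] by (intro Least_le) blast
  then have "?q 10 \<le> 36 / 10" by simp
  finally show "(INF m\<in>{1..}. ?q m) \<le> 36 / 10" .
qed

theorem theorem1p4:
  "(finitely_generated_algebra complex_ring R_alg \<and>
    (\<forall>(d, m, f) \<in> set R_gens. f \<in> T_deg d \<inter> ideal_power I_pt m) \<and>
    generated_subalgebra complex_ring R_alg {gr_class filt m f | d m f. (d, m, f) \<in> set R_gens}
      = carrier R_alg) \<and>
   ((\<forall>(d, m, f) \<in> set R_gens. (d, m) \<noteq> (36, 10) \<longrightarrow> slope 36 10 < slope d m) \<and>
    waldschmidt H4_proj = 36 / 10) \<and>
   ((\<forall>d m. \<exists>n. R_piece_has_dim d m n) \<and>
    HS = HS_num hs_u hs_v / HS_denom hs_u hs_v)"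
proof (intro conjI allI)
  show "\<forall>(d, m, f) \<in> set R_gens. (d, m) \<noteq> (36, 10) \<longrightarrow> slope 36 10 < slope d m"
    by (simp add: R_gens_def slope_def)
  show "\<exists>n. R_piece_has_dim d m n" for d m using R_piece_has_dim_card by blast
qed (rule R_finitely_generated R_gens_in_pieces gen_classes_generate waldschmidt_H4 HS_eq)+

end
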